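(* Let $k$ be an algebraically closed field (of arbitrary characteristic) and $X/k$ a smooth projective geometrically irreducible curve. Let $I$ be a finite set, $\mathcal L$ a line bundle on $X$, and $(\mathcal L_i)_{i\in I}$ coherent subsheaves of $\mathcal L$. Consider the integral $k$-algebra $\prod_{n\ge0}\mathrm H^0(X,\mathcal L^{\otimes n})$ and let $\mathcal K$ be its field of fractions. For every $i\in I$ let $V_i\subset\mathcal K$ be a $k$-subspace which is either $k\oplus\mathrm H^0(X,\mathcal L_i)$ or $\mathrm H^0(X,\mathcal L_i)$. Then the product morphism $$m:\prod_{i\in I}\mathbb P(V_i)\to\mathbb P(\mathcal K)$$ satisfies $$\dim\Sigma^r(m)\le r\quad\text{for all } r\ge0.$$
   Context: For a $k$-vector space $V$, $\mathbb P(V)$ is the (ind-)scheme of lines $L\subset V$; if $V$ is infinite-dimensional it is the inductive limit of $\mathbb P(U)$ over finite-dimensional subspaces $U\subset V$. The morphism $m$ sends $(L_i)_i$ to the line $\prod_iL_i\subset\mathcal K$; it factors through $\mathbb P(W)$ with $W\subset\mathcal K$ the finite-dimensional $k$-span of all products $\prod_iv_i$, $v_i\in V_i$. Here $k=\mathrm{H}^0(X,\mathcal O_X)$ is placed in degree $n=0$ and $\mathrm H^0(X,\mathcal L_i)\subset\mathrm H^0(X,\mathcal L)$ in degree $n=1$ of $\prod_{n\ge0}\mathrm H^0(X,\mathcal L^{\otimes n})$. For a morphism $\phi:\mathcal X\to\mathcal Y$ whose source is a smooth variety (and whose target is a smooth variety, or an ind-scheme of the form $\mathbb P(V)$ with $V$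 an infinite-dimensional $k$-vector space, i.e. the inductive limit of $\mathbb P(U)$ over finite-dimensional subspaces $U\subset V$), with tangent maps $(\mathrm d\phi)_*:\mathrm T_x\mathcal X\to\mathrm T_{\phi(x)}\mathcal Y$, the Thom–Boardman strata are $\Sigma^r(\phi):=\{x\in\mathcal X:\dim(\mathrm d\phi)_*\mathrm T_x\mathcal X=r\}$. The empty set satisfies every upper bound on dimension. *)

theory Defs
  imports "HOL-Analysis.Analysis" "HOL-Library.Function_Algebras"
    "HOL-Computational_Algebra.Polynomial"
begin

section \<open>Topological dimension\<close>

definition irreducible_closed :: "'p topology \<Rightarrow> 'p set \<Rightarrow> bool" where
  "irreducible_closed T Z \<longleftrightarrow> closedin T Z \<and> Z \<noteq> {} \<and>
     (\<forall>A B. closedin T A \<and> closedin T B \<and> Z \<subseteq> A \<union> B \<longrightarrow> Z \<subseteq> A \<or> Z \<subseteq> B)"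

text \<open>Krull dimension, valued in \<open>ereal\<close> so that the empty space has dimension \<open>-\<infinity>\<close>.\<close>

definition krull_dim :: "'p topology \<Rightarrow> ereal" where
  "krull_dim T = Sup {ereal (real n) | n. \<exists>Z :: nat \<Rightarrow> 'p set.
     (\<forall>i\<le>n. irreducible_closed T (Z i)) \<and> (\<forall>i<n. Z i \<subset> Z (Suc i))}"


section \<open>Spaces with functions, tangent spaces, Thom--Boardman strata\<close>

text \<open>Varieties over an algebraically closed field \<open>'k\<close> are taken in the classical sense: the set of
  closed points with its Zariski topology and its sheaf of regular \<open>'k\<close>-valued functions. Membership
  in \<open>reg S U\<close> only restricts the values of a function on \<open>U\<close>.\<close>

record ('p, 'k) kspace =
  zar :: "'p topology"
  reg :: "'p set \<Rightarrow> ('p \<Rightarrow> 'k) set"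

text \<open>Representatives of the elements of the local ring at \<open>x\<close>.\<close>

definition germs :: "('p, 'k) kspace \<Rightarrow> 'p \<Rightarrow> ('p \<Rightarrow> 'k) set" where
  "germs S x = {f. \<exists>U. openin (zar S) U \<and> x \<in> U \<and> f \<in> reg S U}"

definition germ_eq :: "('p, 'k) kspace \<Rightarrow> 'p \<Rightarrow> ('p \<Rightarrow> 'k) \<Rightarrow> ('p \<Rightarrow> 'k) \<Rightarrow> bool" where
  "germ_eq S x f g \<longleftrightarrow> (\<exists>U. openin (zar S) U \<and> x \<in> U \<and> (\<forall>y\<in>U. f y = g y))"

text \<open>The tangent space at \<open>x\<close>: \<open>'k\<close>-linear derivations of the local ring at \<open>x\<close> into the residue
  field \<open>'k\<close>; they are extended by 0 to functions that are not regular near \<open>x\<close>.\<close>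

definition tangent_space :: "('p, 'k::field) kspace \<Rightarrow> 'p \<Rightarrow> (('p \<Rightarrow> 'k) \<Rightarrow> 'k) set" where
  "tangent_space S x = {D.
     (\<forall>f\<in>germs S x. \<forall>g\<in>germs S x. germ_eq S x f g \<longrightarrow> D f = D g) \<and>
     (\<forall>f\<in>germs S x. \<forall>g\<in>germs S x. D (\<lambda>y. f y + g y) = D f + D g) \<and>
     (\<forall>f\<in>germs S x. \<forall>c. D (\<lambda>y. c * f y) = c * D f) \<and>
     (\<forall>f\<in>germs S x. \<forall>g\<in>germs S x. D (\<lambda>y. f y * g y) = f x * D g + g x * D f) \<and>
     (\<forall>f. f \<notin> germs S x \<longrightarrow> D f = 0)}"

definition tangent_map ::
    "('q, 'k::field) kspace \<Rightarrow> ('p \<Rightarrow> 'q) \<Rightarrow> 'p \<Rightarrow> (('p \<Rightarrow> 'k) \<Rightarrow> 'k) \<Rightarrow> (('q \<Rightarrow> 'k) \<Rightarrow> 'k)" where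
  "tangent_map T \<phi> x D = (\<lambda>g. if g \<in> germs T (\<phi> x) then D (g \<circ> \<phi>) else 0)"

abbreviation tangent_dim :: "(('p \<Rightarrow> 'k::field) \<Rightarrow> 'k) set \<Rightarrow> nat" where
  "tangent_dim \<equiv> vector_space.dim (\<lambda>c D f. c * D f)"

definition thom_boardman ::
    "('p, 'k::field) kspace \<Rightarrow> ('q, 'k) kspace \<Rightarrow> ('p \<Rightarrow> 'q) \<Rightarrow> nat \<Rightarrow> 'p set" where
  "thom_boardman S T \<phi> r =
     {x \<in> topspace (zar S). tangent_dim (tangent_map T \<phi> x ` tangent_space S x) = r}"


section \<open>Projective spaces and their products\<close>

text \<open>The \<open>'k\<close>-algebra of functions generated by \<open>G\<close>. Algebraically closed fields are infinite, so
  polynomial functions amount to polynomials.\<close>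

inductive_set polyfun :: "('v \<Rightarrow> 'k::field) set \<Rightarrow> ('v \<Rightarrow> 'k) set" for G where
  const: "(\<lambda>_. c) \<in> polyfun G"
| gen: "f \<in> G \<Longrightarrow> f \<in> polyfun G"
| add: "f \<in> polyfun G \<Longrightarrow> g \<in> polyfun G \<Longrightarrow> (\<lambda>v. f v + g v) \<in> polyfun G"
| mult: "f \<in> polyfun G \<Longrightarrow> g \<in> polyfun G \<Longrightarrow> (\<lambda>v. f v * g v) \<in> polyfun G"

text \<open>A set \<open>X\<close> of points \<open>x\<close> with sets \<open>rep x\<close> of homogeneous coordinates becomes a space with
  functions once the forms \<open>H d\<close> of each (multi)degree \<open>d\<close> are given: the sets \<open>f \<noteq> 0\<close>
  generate the topology, and regular functions are locally quotients of forms of equal degree.\<close>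

definition cone_zariski :: "('p \<Rightarrow> 'v set) \<Rightarrow> ('d \<Rightarrow> ('v \<Rightarrow> 'k::field) set) \<Rightarrow> 'p set \<Rightarrow> 'p topology" where
  "cone_zariski rep H X =
     topology_generated_by {{x \<in> X. \<forall>v\<in>rep x. f v \<noteq> 0} | f. \<exists>d. f \<in> H d}"

definition cone_regular ::
    "('p \<Rightarrow> 'v set) \<Rightarrow> ('d \<Rightarrow> ('v \<Rightarrow> 'k::field) set) \<Rightarrow> 'p set \<Rightarrow> 'p set \<Rightarrow> ('p \<Rightarrow> 'k) set" where
  "cone_regular rep H X U = {h. \<forall>x\<in>U. \<exists>N d f g.
     openin (cone_zariski rep H X) N \<and> x \<in> N \<and> N \<subseteq> U \<and> f \<in> H d \<and> g \<in> H d \<and>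
     (\<forall>y\<in>N. \<forall>v\<in>rep y. g v \<noteq> 0 \<and> h y = f v / g v)}"

definition cone_space ::
    "('p \<Rightarrow> 'v set) \<Rightarrow> ('d \<Rightarrow> ('v \<Rightarrow> 'k::field) set) \<Rightarrow> 'p set \<Rightarrow> ('p, 'k) kspace" where
  "cone_space rep H X = \<lparr>zar = cone_zariski rep H X, reg = cone_regular rep H X\<rparr>"

definition lines :: "('k::field \<Rightarrow> 'v::ab_group_add \<Rightarrow> 'v) \<Rightarrow> 'v set \<Rightarrow> 'v set set" where
  "lines sc V = {module.span sc {v} | v. v \<in> V \<and> v \<noteq> 0}"

text \<open>Forms live on the whole ambient space; since linear functionals on a subspace extend to the
  ambient space, no forms on the subspace are lost.\<close>

definition forms :: "('k::field \<Rightarrow> 'v::ab_group_add \<Rightarrow> 'v) \<Rightarrow> nat \<Rightarrow> ('v \<Rightarrow> 'k) set" where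
  "forms sc d = {f \<in> polyfun {l. Vector_Spaces.linear sc (*) l}.
     \<forall>c v. f (sc c v) = c ^ d * f v}"

definition multiforms ::
    "('k::field \<Rightarrow> 'v::ab_group_add \<Rightarrow> 'v) \<Rightarrow> 'i set \<Rightarrow> ('i \<Rightarrow> nat) \<Rightarrow> (('i \<Rightarrow> 'v) \<Rightarrow> 'k) set" where
  "multiforms sc I d =
     {f \<in> polyfun {\<lambda>v. l (v i) | i l. i \<in> I \<and> Vector_Spaces.linear sc (*) l}.
        \<forall>c v. f (\<lambda>i. sc (c i) (v i)) = (\<Prod>i\<in>I. c i ^ d i) * f v}"

text \<open>A subset of a projective space with its induced structure.\<close>

definition proj_sub :: "('k::field \<Rightarrow> 'v::ab_group_add \<Rightarrow> 'v) \<Rightarrow> 'v set set \<Rightarrow> ('v set, 'k) kspace" where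
  "proj_sub sc X = cone_space (\<lambda>L. L - {0}) (forms sc) X"

definition proj_prod ::
    "('k::field \<Rightarrow> 'v::ab_group_add \<Rightarrow> 'v) \<Rightarrow> 'i set \<Rightarrow> ('i \<Rightarrow> 'v set) \<Rightarrow> ('i \<Rightarrow> 'v set, 'k) kspace" where
  "proj_prod sc I V =
     cone_space (\<lambda>x. \<Pi>\<^sub>E i\<in>I. x i - {0}) (multiforms sc I) (\<Pi>\<^sub>E i\<in>I. lines sc (V i))"

text \<open>The projective space of a possibly infinite-dimensional \<open>V\<close>, as the inductive limit of the
  projective spaces of the finite-dimensional subspaces of \<open>V\<close>.\<close>

definition fd_subspace :: "('k::field \<Rightarrow> 'v::ab_group_add \<Rightarrow> 'v) \<Rightarrow> 'v set \<Rightarrow> 'v set \<Rightarrow> bool" where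
  "fd_subspace sc V U \<longleftrightarrow> U \<subseteq> V \<and> (\<exists>B. finite B \<and> U = module.span sc B)"

definition ind_proj :: "('k::field \<Rightarrow> 'v::ab_group_add \<Rightarrow> 'v) \<Rightarrow> 'v set \<Rightarrow> ('v set, 'k) kspace" where
  "ind_proj sc V = \<lparr>
     zar = topology (\<lambda>N. N \<subseteq> lines sc V \<and> (\<forall>U. fd_subspace sc V U \<longrightarrow>
       openin (zar (proj_sub sc (lines sc U))) (N \<inter> lines sc U))),
     reg = (\<lambda>N. {h. \<forall>U. fd_subspace sc V U \<longrightarrow>
       h \<in> reg (proj_sub sc (lines sc U)) (N \<inter> lines sc U)})\<rparr>"

lemma openin_ind_proj:
  "openin (zar (ind_proj sc V)) N \<longleftrightarrow> N \<subseteq> lines sc V \<and> (\<forall>U. fd_subspace sc V U \<longrightarrow>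
     openin (zar (proj_sub sc (lines sc U))) (N \<inter> lines sc U))"
proof -
  have "istopology (\<lambda>N. N \<subseteq> lines sc V \<and> (\<forall>U. fd_subspace sc V U \<longrightarrow>
     openin (zar (proj_sub sc (lines sc U))) (N \<inter> lines sc U)))"
    unfolding istopology_def
  proof (intro conjI allI impI)
    fix A B U
    assume A: "A \<subseteq> lines sc V \<and> (\<forall>U. fd_subspace sc V U \<longrightarrow>
        openin (zar (proj_sub sc (lines sc U))) (A \<inter> lines sc U))"
      and B: "B \<subseteq> lines sc V \<and> (\<forall>U. fd_subspace sc V U \<longrightarrow>
        openin (zar (proj_sub sc (lines sc U))) (B \<inter> lines sc U))"
    then show "A \<inter> B \<subseteq> lines sc V" by blast
    assume U: "fd_subspace sc V U"
    have "A \<inter> B \<inter> lines sc U = (A \<inter> lines sc U) \<inter> (B \<inter> lines sc U)" by blast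
    with A B U show "openin (zar (proj_sub sc (lines sc U))) (A \<inter> B \<inter> lines sc U)"
      by (metis openin_Int)
  next
    fix \<K> U
    assume K: "\<forall>K\<in>\<K>. K \<subseteq> lines sc V \<and> (\<forall>U. fd_subspace sc V U \<longrightarrow>
        openin (zar (proj_sub sc (lines sc U))) (K \<inter> lines sc U))"
    then show "\<Union>\<K> \<subseteq> lines sc V" by blast
    assume U: "fd_subspace sc V U"
    have "\<Union>\<K> \<inter> lines sc U = (\<Union>K\<in>\<K>. K \<inter> lines sc U)" by blast
    with K U show "openin (zar (proj_sub sc (lines sc U))) (\<Union>\<K> \<inter> lines sc U)"
      by (metis (mono_tags, lifting) openin_Union imageE)
  qed
  then show ?thesis by (simp add: ind_proj_def topology_inverse')
qed


section \<open>Smooth projective curves\<close>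

definition proj_n :: "nat \<Rightarrow> (nat \<Rightarrow> 'k::field) set set" where
  "proj_n n = lines (\<lambda>c v i. c * v i) {v. \<forall>i>n. v i = 0}"

abbreviation proj_variety :: "(nat \<Rightarrow> 'k::field) set set \<Rightarrow> ((nat \<Rightarrow> 'k) set, 'k) kspace" where
  "proj_variety X \<equiv> proj_sub (\<lambda>c v i. c * v i) X"

text \<open>Over an algebraically closed field, irreducible is the same as geometrically irreducible.
  Smoothness: the tangent space at each point has the dimension of \<open>X\<close>.\<close>

definition smooth_projective_curve :: "nat \<Rightarrow> (nat \<Rightarrow> 'k::alg_closed_field) set set \<Rightarrow> bool" where
  "smooth_projective_curve n X \<longleftrightarrow>
     irreducible_closed (zar (proj_variety (proj_n n))) X \<and>
     krull_dim (zar (proj_variety X)) = 1 \<and>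
     (\<forall>x\<in>X. tangent_dim (tangent_space (proj_variety X) x) = 1)"


section \<open>Line bundles and coherent subsheaves\<close>

text \<open>Sections of the structure sheaf over \<open>V\<close>, extended by 0 outside \<open>V\<close>. All sheaves of modules
  below have families (indexed by \<open>'j\<close>) of such functions as sections.\<close>

definition osec :: "('p, 'k::field) kspace \<Rightarrow> 'p set \<Rightarrow> ('p \<Rightarrow> 'k) set" where
  "osec S V = {f \<in> reg S V. \<forall>x. x \<notin> V \<longrightarrow> f x = 0}"

definition restr :: "'p set \<Rightarrow> ('j \<Rightarrow> 'p \<Rightarrow> 'k::field) \<Rightarrow> ('j \<Rightarrow> 'p \<Rightarrow> 'k)" where
  "restr V s = (\<lambda>j x. if x \<in> V then s j x else 0)"

definition smul :: "('p \<Rightarrow> 'k::field) \<Rightarrow> ('j \<Rightarrow> 'p \<Rightarrow> 'k) \<Rightarrow> ('j \<Rightarrow> 'p \<Rightarrow> 'k)" where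
  "smul f s = (\<lambda>j x. f x * s j x)"

text \<open>A line bundle given by transition functions \<open>g a b\<close> with respect to an open cover \<open>U\<close>; some
  of the \<open>U a\<close> may be empty. The section \<open>s\<close> has the component \<open>s a\<close> in the trivialization over
  \<open>U a\<close>. The transition functions of the \<open>m\<close>-th tensor power are the \<open>m\<close>-th powers, and the
  product of sections of two tensor powers is the pointwise one.\<close>

definition line_bundle ::
    "('p, 'k::field) kspace \<Rightarrow> ('a \<Rightarrow> 'p set) \<Rightarrow> ('a \<Rightarrow> 'a \<Rightarrow> 'p \<Rightarrow> 'k) \<Rightarrow> bool" where
  "line_bundle S U g \<longleftrightarrow>
     (\<forall>a. openin (zar S) (U a)) \<and> (\<Union>a. U a) = topspace (zar S) \<and>
     (\<forall>a b. g a b \<in> reg S (U a \<inter> U b)) \<and>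
     (\<forall>a. \<forall>x\<in>U a. g a a x = 1) \<and>
     (\<forall>a b c. \<forall>x\<in>U a \<inter> U b \<inter> U c. g a b x * g b c x = g a c x)"

definition tensor_power ::
    "('p, 'k::field) kspace \<Rightarrow> ('a \<Rightarrow> 'p set) \<Rightarrow> ('a \<Rightarrow> 'a \<Rightarrow> 'p \<Rightarrow> 'k) \<Rightarrow> nat \<Rightarrow>
     'p set \<Rightarrow> ('a \<Rightarrow> 'p \<Rightarrow> 'k) set" where
  "tensor_power S U g m V = {s. (\<forall>a. s a \<in> osec S (V \<inter> U a)) \<and>
     (\<forall>a b. \<forall>x\<in>V \<inter> U a \<inter> U b. s a x = g a b x ^ m * s b x)}"

abbreviation line_sheaf ::
    "('p, 'k::field) kspace \<Rightarrow> ('a \<Rightarrow> 'p set) \<Rightarrow> ('a \<Rightarrow> 'a \<Rightarrow> 'p \<Rightarrow> 'k) \<Rightarrow>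
     'p set \<Rightarrow> ('a \<Rightarrow> 'p \<Rightarrow> 'k) set" where
  "line_sheaf S U g \<equiv> tensor_power S U g 1"

definition subsheaf_of_modules ::
    "('p, 'k::field) kspace \<Rightarrow> ('p set \<Rightarrow> ('j \<Rightarrow> 'p \<Rightarrow> 'k) set) \<Rightarrow>
     ('p set \<Rightarrow> ('j \<Rightarrow> 'p \<Rightarrow> 'k) set) \<Rightarrow> bool" where
  "subsheaf_of_modules S M L \<longleftrightarrow> (\<forall>V. openin (zar S) V \<longrightarrow>
     M V \<subseteq> L V \<and> 0 \<in> M V \<and>
     (\<forall>s\<in>M V. \<forall>t\<in>M V. s + t \<in> M V) \<and>
     (\<forall>f\<in>osec S V. \<forall>s\<in>M V. smul f s \<in> M V) \<and>
     (\<forall>V'. openin (zar S) V' \<and> V' \<subseteq> V \<longrightarrow> (\<forall>s\<in>M V. restr V' s \<in> M V')) \<and>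
     (\<forall>s\<in>L V. (\<forall>x\<in>V. \<exists>V'. openin (zar S) V' \<and> x \<in> V' \<and> V' \<subseteq> V \<and> restr V' s \<in> M V') \<longrightarrow> s \<in> M V))"

text \<open>The sections \<open>t 0, \<dots>, t (p - 1)\<close> of \<open>M\<close> over \<open>V\<close> generate \<open>M\<close> on \<open>V\<close>.\<close>

definition generate_on ::
    "('p, 'k::field) kspace \<Rightarrow> ('p set \<Rightarrow> ('j \<Rightarrow> 'p \<Rightarrow> 'k) set) \<Rightarrow> 'p set \<Rightarrow>
     nat \<Rightarrow> (nat \<Rightarrow> 'j \<Rightarrow> 'p \<Rightarrow> 'k) \<Rightarrow> bool" where
  "generate_on S M V p t \<longleftrightarrow> (\<forall>j<p. t j \<in> M V) \<and>
     (\<forall>W s. openin (zar S) W \<and> W \<subseteq> V \<and> s \<in> M W \<longrightarrow>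
       (\<forall>y\<in>W. \<exists>N f. openin (zar S) N \<and> y \<in> N \<and> N \<subseteq> W \<and> (\<forall>j<p. f j \<in> osec S N) \<and>
          restr N s = (\<Sum>j<p. smul (f j) (restr N (t j)))))"

definition finite_type_on ::
    "('p, 'k::field) kspace \<Rightarrow> ('p set \<Rightarrow> ('j \<Rightarrow> 'p \<Rightarrow> 'k) set) \<Rightarrow> 'p set \<Rightarrow> bool" where
  "finite_type_on S M V \<longleftrightarrow>
     (\<forall>x\<in>V. \<exists>N p t. openin (zar S) N \<and> x \<in> N \<and> N \<subseteq> V \<and> generate_on S M N p t)"

text \<open>Kernel of the morphism from the \<open>p\<close>-th power of the structure sheaf given by \<open>t\<close>.\<close>

definition relation_sheaf ::
    "('p, 'k::field) kspace \<Rightarrow> nat \<Rightarrow> (nat \<Rightarrow> 'j \<Rightarrow> 'p \<Rightarrow> 'k) \<Rightarrow> 'p set \<Rightarrow> (nat \<Rightarrow> 'p \<Rightarrow> 'k) set" where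
  "relation_sheaf S p t V = {f. (\<forall>j<p. f j \<in> osec S V) \<and> (\<forall>j\<ge>p. f j = 0) \<and>
     (\<Sum>j<p. smul (f j) (restr V (t j))) = 0}"

definition coherent :: "('p, 'k::field) kspace \<Rightarrow> ('p set \<Rightarrow> ('j \<Rightarrow> 'p \<Rightarrow> 'k) set) \<Rightarrow> bool" where
  "coherent S M \<longleftrightarrow> finite_type_on S M (topspace (zar S)) \<and>
     (\<forall>V p t. openin (zar S) V \<and> (\<forall>j<p. t j \<in> M V) \<longrightarrow> finite_type_on S (relation_sheaf S p t) V)"

abbreviation global_sections ::
    "('p, 'k::field) kspace \<Rightarrow> ('p set \<Rightarrow> ('j \<Rightarrow> 'p \<Rightarrow> 'k) set) \<Rightarrow> ('j \<Rightarrow> 'p \<Rightarrow> 'k) set" where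
  "global_sections S M \<equiv> M (topspace (zar S))"


section \<open>The algebra of sections of all tensor powers and its field of fractions\<close>

definition section_algebra ::
    "('p, 'k::field) kspace \<Rightarrow> ('a \<Rightarrow> 'p set) \<Rightarrow> ('a \<Rightarrow> 'a \<Rightarrow> 'p \<Rightarrow> 'k) \<Rightarrow>
     (nat \<Rightarrow> 'a \<Rightarrow> 'p \<Rightarrow> 'k) set" where
  "section_algebra S U g = {F. \<forall>m. F m \<in> global_sections S (tensor_power S U g m)}"

definition section_mult ::
    "(nat \<Rightarrow> 'a \<Rightarrow> 'p \<Rightarrow> 'k::field) \<Rightarrow> (nat \<Rightarrow> 'a \<Rightarrow> 'p \<Rightarrow> 'k) \<Rightarrow> (nat \<Rightarrow> 'a \<Rightarrow> 'p \<Rightarrow> 'k)" where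
  "section_mult F G = (\<lambda>m a x. \<Sum>i\<le>m. F i a x * G (m - i) a x)"

definition in_degree :: "nat \<Rightarrow> ('a \<Rightarrow> 'p \<Rightarrow> 'k::field) \<Rightarrow> (nat \<Rightarrow> 'a \<Rightarrow> 'p \<Rightarrow> 'k)" where
  "in_degree n s = (\<lambda>m. if m = n then s else 0)"

definition const_section :: "('a \<Rightarrow> 'p set) \<Rightarrow> 'k::field \<Rightarrow> ('a \<Rightarrow> 'p \<Rightarrow> 'k)" where
  "const_section U c = (\<lambda>a x. if x \<in> U a then c else 0)"

text \<open>The field \<open>'K\<close> together with the ring homomorphism \<open>\<iota>\<close> is a field of fractions of the
  algebra of sections.\<close>

definition is_fraction_field ::
    "('p, 'k::field) kspace \<Rightarrow> ('a \<Rightarrow> 'p set) \<Rightarrow> ('a \<Rightarrow> 'a \<Rightarrow> 'p \<Rightarrow> 'k) \<Rightarrow>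
     ((nat \<Rightarrow> 'a \<Rightarrow> 'p \<Rightarrow> 'k) \<Rightarrow> 'K::field) \<Rightarrow> bool" where
  "is_fraction_field S U g \<iota> \<longleftrightarrow> (let A = section_algebra S U g in
     (\<forall>F\<in>A. \<forall>G\<in>A. \<iota> (F + G) = \<iota> F + \<iota> G \<and> \<iota> (section_mult F G) = \<iota> F * \<iota> G) \<and>
     \<iota> (in_degree 0 (const_section U 1)) = 1 \<and>
     inj_on \<iota> A \<and>
     (\<forall>z. \<exists>F\<in>A. \<exists>G\<in>A. \<iota> G \<noteq> 0 \<and> z = \<iota> F / \<iota> G))"

definition K_scale ::
    "('a \<Rightarrow> 'p set) \<Rightarrow> ((nat \<Rightarrow> 'a \<Rightarrow> 'p \<Rightarrow> 'k::field) \<Rightarrow> 'K::field) \<Rightarrow> 'k \<Rightarrow> 'K \<Rightarrow> 'K" where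
  "K_scale U \<iota> c z = \<iota> (in_degree 0 (const_section U c)) * z"

text \<open>The line spanned by the products of elements of the lines \<open>x i\<close>; for empty \<open>I\<close> it is the
  line of constants.\<close>

definition product_map :: "('k::field \<Rightarrow> 'K::field \<Rightarrow> 'K) \<Rightarrow> 'i set \<Rightarrow> ('i \<Rightarrow> 'K set) \<Rightarrow> 'K set" where
  "product_map sc I x = module.span sc {\<Prod>i\<in>I. v i | v. v \<in> (\<Pi>\<^sub>E i\<in>I. x i)}"

end

theory Submission
  imports Defs
begin

text \<open>If \<open>Z\<^sub>0 \<subset> \<dots> \<subset> Z\<^sub>t\<close> is a chain of irreducible closed subsets of \<open>\<Sigma>\<^sup>r\<close> with
  \<open>t = r + 1\<close>, there are forms of one multidegree \<open>(e, \<dots>, e)\<close>, namely one for each step of the chain,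
  whose restrictions to \<open>Z\<^sub>t\<close> are algebraically independent. It therefore suffices to find \<open>t\<close> forms of
  this multidegree over which all of them are integral, that is, \<open>t\<close> forms without common zero on the
  closure of \<open>Z\<^sub>t\<close>. Every place of \<open>\<K>\<close> that is finite on all \<open>V\<^sub>i\<close> has residue functionals \<open>\<lambda>\<^sub>i\<close> on
  the \<open>V\<^sub>i\<close>, and \<open>\<Prod>\<^sub>i \<lambda>\<^sub>i(v\<^sub>i)\<^sup>e\<close> is such a form. For \<open>t\<close> successively generic places, a common zero \<open>v\<close>
  means that at each of these places some \<open>\<lambda>\<^sub>i(v\<^sub>i)\<close> vanishes; the elements \<open>u \<Prod>\<^bsub>j \<noteq> i\<^esub> v\<^sub>j\<close> of the image of the
  differential of \<open>m\<close>, with suitable \<open>u \<in> V\<^sub>i\<close>, then have quotients by \<open>\<Prod>\<^sub>j v\<^sub>j\<close> with independent polar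
  parts, so that the rank of the differential at \<open>v\<close> is at least \<open>t\<close>. As the rank is lower
  semicontinuous and equals \<open>r\<close> on \<open>Z\<^sub>t\<close>, this is impossible. Generic places exist since sections of
  \<open>\<L>\<close> can be evaluated at a point of \<open>X\<close> and the grading variable specialized.\<close>

section \<open>Places\<close>

text \<open>The strata are defined by the tangent space of the whole product, so the rank of the
  differential is bounded below at single points and no map is restricted to a stratum. Generic
  smoothness never enters, hence the characteristic does not matter. Algebraic independence is
  contradicted by counting: t + 1 independent forms have of the order of D^t monomials of degree D,
  while integrality over t forms leaves dimension O(D^(t-1)). Places occur in two rings: in
  \<open>'K\<close>, where their residues are the functionals, and in the ring of all functions on a
  set of points, where they replace valuations of a function field and yield limits of points. The
  second ring has zero divisors, so places are defined without division, and functions are compared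
  up to those vanishing on a nonempty open set. Polar parts are controlled by taking, at each place,
  the factor whose v_i has the deepest zero, and a direction u with nonzero residue. Residue
  functionals are written in finite bases of the V_i; this is why spaces of sections on the curve
  have to be shown finite-dimensional.\<close>

locale algebra_over =
  fixes \<kappa> :: "'k::alg_closed_field \<Rightarrow> 'r::comm_ring_1"
  assumes kadd: "\<kappa> (a + b) = \<kappa> a + \<kappa> b"
    and kmult: "\<kappa> (a * b) = \<kappa> a * \<kappa> b"
    and kone: "\<kappa> 1 = 1"
begin

lemma kzero [simp]: "\<kappa> 0 = 0"
  using kadd[of 0 0] by simp

lemma kuminus: "\<kappa> (- a) = - \<kappa> a"
  using kadd[of a "- a"] by (simp add: eq_neg_iff_add_eq_0 add.commute)

lemma kdiff: "\<kappa> (a - b) = \<kappa> a - \<kappa> b"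
  using kadd[of a "- b"] by (simp add: kuminus)

text \<open>\<open>M\<close> plays the maximal ideal of the subalgebra k + M. As it is closed under
  scalars and misses 1, the residue field is k itself and no extension of it has to be
  considered.\<close>

definition nonunital :: "'r set \<Rightarrow> bool" where
  "nonunital M \<longleftrightarrow> 0 \<in> M \<and> (\<forall>a\<in>M. \<forall>b\<in>M. a + b \<in> M \<and> a * b \<in> M) \<and>
     (\<forall>c. \<forall>a\<in>M. \<kappa> c * a \<in> M) \<and> 1 \<notin> M"

text \<open>A subalgebra without unit that is maximal among those behaves like the maximal ideal of a
  valuation ring with residue field \<open>'k\<close>, the ring being \<open>vring M\<close>, even if \<open>'r\<close> is not a field.\<close>

definition place :: "'r set \<Rightarrow> bool" where
  "place M \<longleftrightarrow> nonunital M \<and> (\<forall>M'. nonunital M' \<and> M \<subseteq> M' \<longrightarrow> M' = M)"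

definition vring :: "'r set \<Rightarrow> 'r set" where
  "vring M = {\<kappa> c + m | c m. m \<in> M}"

lemma exists_place:
  assumes "nonunital M0"
  shows "\<exists>M. place M \<and> M0 \<subseteq> M"
proof -
  let ?A = "{M. nonunital M \<and> M0 \<subseteq> M}"
  have "\<exists>M\<in>?A. \<forall>X\<in>?A. M \<subseteq> X \<longrightarrow> X = M"
  proof (rule subset_Zorn_nonempty)
    show "?A \<noteq> {}" using assms by blast
    fix C assume C: "C \<noteq> {}" "subset.chain ?A C"
    have ch: "\<And>A B. A \<in> C \<Longrightarrow> B \<in> C \<Longrightarrow> A \<subseteq> B \<or> B \<subseteq> A"
      using C(2) unfolding subset.chain_def by blast
    have N: "\<And>A. A \<in> C \<Longrightarrow> nonunital A \<and> M0 \<subseteq> A"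
      using C(2) unfolding subset.chain_def by blast
    have pair: "\<exists>A\<in>C. a \<in> A \<and> b \<in> A" if "a \<in> \<Union>C" "b \<in> \<Union>C" for a b
      using that ch by blast
    have "nonunital (\<Union>C)"
      unfolding nonunital_def
    proof (intro conjI ballI allI)
      show "0 \<in> \<Union>C" using C(1) N unfolding nonunital_def by blast
      show "1 \<notin> \<Union>C" using N unfolding nonunital_def by blast
      fix c a assume "a \<in> \<Union>C" then show "\<kappa> c * a \<in> \<Union>C" using N unfolding nonunital_def by blast
    next
      fix a b assume "a \<in> \<Union>C" "b \<in> \<Union>C"
      then obtain A where "A \<in> C" "a \<in> A" "b \<in> A" using pair by blast
      then show "a + b \<in> \<Union>C" "a * b \<in> \<Union>C" using N unfolding nonunital_def by blast+
    qed
    then show "\<Union>C \<in> ?A" using N C(1) by blast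
  qed
  then obtain M where "M \<in> ?A" and m: "\<forall>X\<in>?A. M \<subseteq> X \<longrightarrow> X = M" ..
  then have M: "nonunital M" "M0 \<subseteq> M" by auto
  have "X = M" if "nonunital X" "M \<subseteq> X" for X using m that M(2) by simp
  then show ?thesis unfolding place_def using M by blast
qed

end

locale place_of = algebra_over \<kappa> for \<kappa> :: "'k::alg_closed_field \<Rightarrow> 'r::comm_ring_1" +
  fixes M assumes pl: "place M"
begin

abbreviation "A \<equiv> vring M"

lemma M0 [simp]: "0 \<in> M"
  and Madd: "a \<in> M \<Longrightarrow> b \<in> M \<Longrightarrow> a + b \<in> M"
  and Mmult: "a \<in> M \<Longrightarrow> b \<in> M \<Longrightarrow> a * b \<in> M"
  and Mk: "a \<in> M \<Longrightarrow> \<kappa> c * a \<in> M"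
  and M1 [simp]: "1 \<notin> M"
  using pl unfolding place_def nonunital_def by blast+

lemma Mneg: "a \<in> M \<Longrightarrow> - a \<in> M"
  using Mk[of a "- 1"] by (simp add: kuminus kone)

lemma Mdiff: "a \<in> M \<Longrightarrow> b \<in> M \<Longrightarrow> a - b \<in> M"
  using Madd[of a "- b"] Mneg by simp

lemma Msum: "(\<And>i. i \<in> S \<Longrightarrow> f i \<in> M) \<Longrightarrow> sum f S \<in> M"
  by (induction S rule: infinite_finite_induct) (auto intro: Madd)

lemma Mk_iff: "\<kappa> c \<in> M \<longleftrightarrow> c = 0"
proof
  assume "\<kappa> c \<in> M"
  show "c = 0"
  proof (rule ccontr)
    assume "c \<noteq> 0"
    then have "\<kappa> (inverse c) * \<kappa> c = 1" by (simp flip: kmult add: kone)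
    with Mk[OF \<open>\<kappa> c \<in> M\<close>, of "inverse c"] show False by simp
  qed
qed simp

lemma maximal: "nonunital M' \<Longrightarrow> M \<subseteq> M' \<Longrightarrow> M' = M"
  using pl unfolding place_def by blast

lemma AI: assumes "r - \<kappa> c \<in> M" shows "r \<in> A"
proof -
  have "r = \<kappa> c + (r - \<kappa> c)" by simp
  then show ?thesis using assms unfolding vring_def by blast
qed

lemma AE: assumes "r \<in> A" shows "\<exists>c. r - \<kappa> c \<in> M"
proof -
  obtain c m where "r = \<kappa> c + m" "m \<in> M" using assms unfolding vring_def by blast
  then have "r - \<kappa> c \<in> M" by simp
  then show ?thesis ..
qed

lemma AM_mult: assumes "a \<in> A" "m \<in> M" shows "a * m \<in> M"
proof -
  obtain c where c: "a - \<kappa> c \<in> M" using AE assms by blast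
  have "a * m = \<kappa> c * m + (a - \<kappa> c) * m" by (simp add: algebra_simps)
  then show ?thesis using Madd[OF Mk[OF assms(2)] Mmult[OF c assms(2)]] by simp
qed

lemma res_mult: assumes "a - \<kappa> c \<in> M" "b - \<kappa> d \<in> M" shows "a * b - \<kappa> (c * d) \<in> M"
proof -
  have "a * b - \<kappa> (c * d) = a * (b - \<kappa> d) + \<kappa> d * (a - \<kappa> c)" by (simp add: algebra_simps kmult)
  moreover have "a \<in> A" using assms(1) by (rule AI)
  ultimately show ?thesis using Madd[OF AM_mult[OF _ assms(2)] Mk[OF assms(1)]] by simp
qed

lemma res_add: assumes "a - \<kappa> c \<in> M" "b - \<kappa> d \<in> M" shows "a + b - \<kappa> (c + d) \<in> M"
proof -
  have "a + b - \<kappa> (c + d) = (a - \<kappa> c) + (b - \<kappa> d)" by (simp only: kadd add_diff_add)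
  then show ?thesis using Madd[OF assms] by (simp only:)
qed

lemma res_unique: "a - \<kappa> c \<in> M \<Longrightarrow> a - \<kappa> d \<in> M \<Longrightarrow> c = d"
  using Mdiff[of "a - \<kappa> c" "a - \<kappa> d"] Mk_iff[of "d - c"] by (simp add: kdiff)

lemma A_mult: assumes "a \<in> A" "b \<in> A" shows "a * b \<in> A"
proof -
  obtain c d where cd: "a - \<kappa> c \<in> M" "b - \<kappa> d \<in> M" using assms[THEN AE] by blast
  show ?thesis by (rule AI[OF res_mult[OF cd]])
qed

lemma A_add: assumes "a \<in> A" "b \<in> A" shows "a + b \<in> A"
proof -
  obtain c d where cd: "a - \<kappa> c \<in> M" "b - \<kappa> d \<in> M" using assms[THEN AE] by blast
  show ?thesis by (rule AI[OF res_add[OF cd]])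
qed

lemma A_k: "\<kappa> c \<in> A" using AI[of "\<kappa> c" c] by simp

lemma M_A: "m \<in> M \<Longrightarrow> m \<in> A" using AI[of m 0] by simp

text \<open>Localizing M at the elements 1 - m gives again a subalgebra without unit, which
  maximality forces to be M. So 1 - m acts as a unit even if it is not invertible in
  \<open>'r\<close>.\<close>

lemma local_M: assumes "m \<in> M" "(1 - m) * r \<in> M" shows "r \<in> M"
proof -
  let ?M = "{r. \<exists>m\<in>M. (1 - m) * r \<in> M}"
  have "nonunital ?M"
    unfolding nonunital_def
  proof (intro conjI ballI allI)
    show "0 \<in> ?M" using M0 by (auto intro!: exI[of _ 0])
    show "1 \<notin> ?M"
    proof
      assume "1 \<in> ?M" then obtain m where "m \<in> M" "1 - m \<in> M" by auto
      then show False using Madd[of m "1 - m"] by simp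
    qed
    fix c a assume "a \<in> ?M"
    then obtain m where "m \<in> M" "(1 - m) * a \<in> M" by auto
    then show "\<kappa> c * a \<in> ?M" using Mk[of "(1 - m) * a" c] by (auto simp: mult.left_commute)
  next
    fix a b assume "a \<in> ?M" "b \<in> ?M"
    then obtain m n where m: "m \<in> M" "(1 - m) * a \<in> M" and n: "n \<in> M" "(1 - n) * b \<in> M" by auto
    let ?l = "m + n - m * n"
    have l: "?l \<in> M" using m n Madd Mdiff Mmult by simp
    have 1: "1 - ?l = (1 - n) * (1 - m)" by (simp add: algebra_simps)
    have na: "(1 - n) \<in> A" "(1 - m) \<in> A" using AI[of "1 - n" 1] AI[of "1 - m" 1] m n Mneg by (simp_all add: kone)
    have a: "(1 - ?l) * a \<in> M" unfolding 1 using AM_mult[OF na(1) m(2)] by (simp add: algebra_simps)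
    have b: "(1 - ?l) * b \<in> M" unfolding 1 using AM_mult[OF na(2) n(2)] by (simp add: algebra_simps)
    show "a + b \<in> ?M" using l Madd[OF a b] by (auto simp: distrib_left)
    have "(1 - ?l) * (a * b) = ((1 - m) * a) * ((1 - n) * b)" unfolding 1 by (simp add: algebra_simps)
    then show "a * b \<in> ?M" using l Mmult[OF m(2) n(2)] by (metis (mono_tags, lifting) mem_Collect_eq)
  qed
  moreover have "M \<subseteq> ?M" using M0 by (auto intro!: bexI[of _ 0])
  ultimately show ?thesis using maximal assms by blast
qed

lemma local_A: assumes "m \<in> M" "(1 - m) * r \<in> A" shows "r \<in> A"
proof -
  obtain c where c: "(1 - m) * r - \<kappa> c \<in> M" using AE assms by blast
  have "(1 - m) * (r - \<kappa> c) = ((1 - m) * r - \<kappa> c) + \<kappa> c * m" by (simp add: algebra_simps)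
  then have "(1 - m) * (r - \<kappa> c) \<in> M" using Madd[OF c Mk[OF assms(1)]] by simp
  then show ?thesis by (rule AI[OF local_M[OF assms(1)]])
qed

text \<open>Divided by its nonzero residue, a takes the form 1 - m with m in M, and
  \<open>local_A\<close> applies.\<close>

lemma A_unit: assumes "a - \<kappa> c \<in> M" "c \<noteq> 0" "a * r \<in> A" shows "r \<in> A"
proof -
  have cc: "\<kappa> (inverse c) * \<kappa> c = 1" using assms(2) by (simp flip: kmult add: kone)
  let ?m = "- (\<kappa> (inverse c) * (a - \<kappa> c))"
  have m: "?m \<in> M" using Mk Mneg assms(1) by blast
  have "1 - ?m = \<kappa> (inverse c) * a" using cc by (simp add: algebra_simps)
  then have "(1 - ?m) * r = \<kappa> (inverse c) * (a * r)" by (simp add: algebra_simps)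
  then have "(1 - ?m) * r \<in> A" using A_mult[OF A_k assms(3)] by simp
  then show ?thesis by (rule local_A[OF m])
qed

section \<open>The valuation property of places\<close>

definition Mpoly :: "'r \<Rightarrow> 'r set" where
  "Mpoly r = {poly p r | p. \<forall>i. coeff p i \<in> M}"

text \<open>\<open>Mpoly r\<close> is the extension of M to an ideal of A[r]. If it still misses 1,
  maximality collapses it to M, so that multiplication by r preserves M.\<close>

lemma Mpoly_ext:
  assumes "1 \<notin> Mpoly r" shows "Mpoly r = M"
proof (rule maximal)
  show "nonunital (Mpoly r)"
    unfolding nonunital_def
  proof (intro conjI ballI allI assms)
    show "0 \<in> Mpoly r" unfolding Mpoly_def by (auto intro!: exI[of _ 0])
    fix c a assume "a \<in> Mpoly r"
    then obtain p where "a = poly p r" "\<forall>i. coeff p i \<in> M" unfolding Mpoly_def by blast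
    then show "\<kappa> c * a \<in> Mpoly r" unfolding Mpoly_def by (auto intro!: exI[of _ "smult (\<kappa> c) p"] Mk)
  next
    fix a b assume "a \<in> Mpoly r" "b \<in> Mpoly r"
    then obtain p q where "a = poly p r" "\<forall>i. coeff p i \<in> M" "b = poly q r" "\<forall>i. coeff q i \<in> M"
      unfolding Mpoly_def by blast
    then have "a + b = poly (p + q) r" "\<forall>i. coeff (p + q) i \<in> M"
      "a * b = poly (p * q) r" "\<forall>i. coeff (p * q) i \<in> M"
      by (auto intro!: Madd Msum Mmult simp: coeff_mult)
    then show "a + b \<in> Mpoly r" "a * b \<in> Mpoly r" unfolding Mpoly_def by blast+
  qed
  show "M \<subseteq> Mpoly r"
  proof
    fix m assume "m \<in> M"
    then show "m \<in> Mpoly r" unfolding Mpoly_def by (auto intro!: exI[of _ "[:m:]"] simp: coeff_pCons split: nat.split)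
  qed
qed

abbreviation "kpoly \<equiv> (map_poly \<kappa> :: 'k poly \<Rightarrow> 'r poly)"

lemma coeff_kpoly [simp]: "coeff (kpoly p) i = \<kappa> (coeff p i)"
  by (simp add: coeff_map_poly)

lemma ksum: "\<kappa> (sum f S) = (\<Sum>i\<in>S. \<kappa> (f i))"
  by (induction S rule: infinite_finite_induct) (auto simp: kadd)

lemma kpoly_add: "kpoly (p + q) = kpoly p + kpoly q" by (rule poly_eqI) (simp add: kadd)
lemma kpoly_mult: "kpoly (p * q) = kpoly p * kpoly q" by (rule poly_eqI) (simp add: coeff_mult ksum kmult)
lemma kpoly_pCons: "kpoly (pCons a p) = pCons (\<kappa> a) (kpoly p)"
  by (rule poly_eqI) (simp add: coeff_pCons split: nat.split)
lemma kpoly_diff: "kpoly (p - q) = kpoly p - kpoly q" by (rule poly_eqI) (simp add: kdiff)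

text \<open>A one-variable Nullstellensatz: k[r] acts on M, and if r had no residue in k, every r -
  c would be invertible modulo this action. As k is algebraically closed, every nonzero polynomial
  in r would then be invertible too, which a relation of r over M excludes.\<close>

lemma not_unit_A:
  assumes "1 \<notin> Mpoly r" shows "r \<in> A"
proof (rule ccontr)
  assume "r \<notin> A"
  have Mr: "m * r \<in> M" if "m \<in> M" for m
  proof -
    have "m * r = poly [:0, m:] r" by (simp add: algebra_simps)
    moreover have "\<forall>i. coeff [:0, m:] i \<in> M" using that by (auto simp: coeff_pCons split: nat.split)
    ultimately have "m * r \<in> Mpoly r" unfolding Mpoly_def by blast
    then show ?thesis using Mpoly_ext[OF assms] by simp
  qed
  have Mrp: "m * poly (kpoly p) r \<in> M" if "m \<in> M" for m p
    using that
  proof (induction p arbitrary: m)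
    case (pCons a p)
    have "m * poly (kpoly (pCons a p)) r = \<kappa> a * m + (m * r) * poly (kpoly p) r"
      by (simp add: kpoly_pCons algebra_simps)
    then show ?case using Madd[OF Mk[OF pCons.prems] pCons.IH[OF Mr[OF pCons.prems]]] by simp
  qed simp
  \<comment> \<open>Otherwise M + (r - c) k[r] would still be without unit, hence equal to M, and c
    would be a residue of r.\<close>
  have one: "\<exists>m p. m \<in> M \<and> 1 = m + (r - \<kappa> c) * poly (kpoly p) r" for c
  proof (rule ccontr)
    assume no: "\<nexists>m p. m \<in> M \<and> 1 = m + (r - \<kappa> c) * poly (kpoly p) r"
    let ?M = "{m + (r - \<kappa> c) * poly (kpoly p) r | m p. m \<in> M}"
    have "nonunital ?M"
      unfolding nonunital_def
    proof (intro conjI ballI allI)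
      show "0 \<in> ?M" by (auto intro!: exI[of _ 0])
      show "1 \<notin> ?M" using no by blast
      fix d a assume "a \<in> ?M"
      then obtain m p where "m \<in> M" "a = m + (r - \<kappa> c) * poly (kpoly p) r" by blast
      then have "\<kappa> d * a = \<kappa> d * m + (r - \<kappa> c) * poly (kpoly ([:d:] * p)) r"
        unfolding kpoly_mult kpoly_pCons by (simp add: distrib_left mult.left_commute)
      then show "\<kappa> d * a \<in> ?M" using Mk[OF \<open>m \<in> M\<close>] by blast
    next
      fix a b assume "a \<in> ?M" "b \<in> ?M"
      then obtain m p n q where m: "m \<in> M" "a = m + (r - \<kappa> c) * poly (kpoly p) r"
        and n: "n \<in> M" "b = n + (r - \<kappa> c) * poly (kpoly q) r" by blast
      have "a + b = (m + n) + (r - \<kappa> c) * poly (kpoly (p + q)) r"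
        unfolding m(2) n(2) kpoly_add poly_add by (simp only: distrib_left ac_simps)
      then show "a + b \<in> ?M" using Madd m n by blast
      have 1: "(r - \<kappa> c) * poly (kpoly p) r = poly (kpoly ([:-c, 1:] * p)) r" for p
        by (simp only: kpoly_mult kpoly_pCons) (simp add: kone kuminus algebra_simps)
      have 2: "poly (kpoly p) r * ((r - \<kappa> c) * poly (kpoly q) r) = poly (kpoly (p * ([:-c, 1:] * q))) r"
        by (simp only: 1 kpoly_mult[of p] poly_mult)
      have "a * b = (m * n + m * ((r - \<kappa> c) * poly (kpoly q) r) + n * ((r - \<kappa> c) * poly (kpoly p) r))
           + (r - \<kappa> c) * (poly (kpoly p) r * ((r - \<kappa> c) * poly (kpoly q) r))"
        unfolding m(2) n(2) by (simp only: distrib_left distrib_right ac_simps)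
      then have "a * b = (m * n + m * poly (kpoly ([:-c, 1:] * q)) r + n * poly (kpoly ([:-c, 1:] * p)) r)
           + (r - \<kappa> c) * poly (kpoly (p * ([:-c, 1:] * q))) r"
        by (simp only: 2) (simp only: 1)
      moreover have "m * n + m * poly (kpoly ([:-c, 1:] * q)) r + n * poly (kpoly ([:-c, 1:] * p)) r \<in> M"
        by (intro Madd Mrp Mmult m n)
      ultimately show "a * b \<in> ?M" by blast
    qed
    moreover have "M \<subseteq> ?M"
    proof
      fix m assume "m \<in> M"
      moreover have "m = m + (r - \<kappa> c) * poly (kpoly 0) r" by simp
      ultimately show "m \<in> ?M" by blast
    qed
    ultimately have "?M = M" using maximal by blast
    moreover have "r - \<kappa> c = 0 + (r - \<kappa> c) * poly (kpoly 1) r" by (simp add: kone map_poly_1')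
    then have "r - \<kappa> c \<in> ?M" using M0 by blast
    ultimately have "r - \<kappa> c \<in> M" by simp
    then show False using AI \<open>r \<notin> A\<close> by blast
  qed
  \<comment> \<open>The case c = 0 yields a polynomial over k with constant term 1 whose value at r
    lies in M.\<close>
  obtain m p where mp: "m \<in> M" "1 = m + (r - \<kappa> 0) * poly (kpoly p) r" using one[of 0] by blast
  let ?P = "1 - [:0, 1:] * p"
  have "coeff ?P 0 = 1" by simp
  then have nz: "?P \<noteq> 0" by (metis coeff_0 zero_neq_one)
  have "poly (kpoly ?P) r = 1 - r * poly (kpoly p) r"
    by (simp only: kpoly_diff kpoly_mult kpoly_pCons) (simp add: kone map_poly_1')
  also have "\<dots> = m" using mp(2) by (metis add_diff_cancel_right' diff_zero kzero)
  finally have PM: "poly (kpoly ?P) r \<in> M" using mp by simp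
  \<comment> \<open>A root c of P is split off, and \<open>one\<close> for this c allows the factor
    r - c to be cancelled. At the end a nonzero constant would lie in M.\<close>
  have "P \<noteq> 0 \<Longrightarrow> poly (kpoly P) r \<in> M \<Longrightarrow> False" for P
  proof (induction "degree P" arbitrary: P)
    case 0
    then obtain c where "P = [:c:]" using degree_0_id by metis
    with 0 show False using Mk_iff by (simp add: kpoly_pCons)
  next
    case (Suc n)
    obtain c where "poly P c = 0" using alg_closed_imp_poly_has_root[of P] Suc by auto
    then obtain P' where P': "P = [:-c, 1:] * P'" using poly_eq_0_iff_dvd by blast
    have "P' \<noteq> 0" using P' Suc.prems by auto
    then have "degree P = Suc (degree P')" unfolding P' by (subst degree_mult_eq) auto
    then have d: "degree P' = n" "P' \<noteq> 0" using Suc.hyps \<open>P' \<noteq> 0\<close> by auto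
    have r1: "poly (kpoly P) r = (r - \<kappa> c) * poly (kpoly P') r"
      unfolding P' by (simp only: kpoly_mult kpoly_pCons) (simp add: kone kuminus algebra_simps)
    obtain m p where mp: "m \<in> M" "1 = m + (r - \<kappa> c) * poly (kpoly p) r" using one by blast
    have "poly (kpoly P') r = (m + (r - \<kappa> c) * poly (kpoly p) r) * poly (kpoly P') r"
      using mp by simp
    also have "\<dots> = m * poly (kpoly P') r + poly (kpoly P) r * poly (kpoly p) r"
      unfolding r1 by (simp only: distrib_left distrib_right ac_simps)
    finally have E: "poly (kpoly P') r = m * poly (kpoly P') r + poly (kpoly P) r * poly (kpoly p) r" .
    have "poly (kpoly P') r \<in> M" by (subst E) (intro Madd Mrp mp Suc.prems)
    then show False using Suc.hyps(1)[of P'] d by simp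
  qed
  then show False using nz PM by blast
qed

text \<open>The shortening step of the classical proof that a maximal local subring is a valuation
  ring: the relation for g, the inverse of f, expresses the top power of f through lower
  ones.\<close>

lemma Mpoly_reduce:
  assumes fg: "f * g = 1"
    and p: "1 = poly p f" "\<forall>i. coeff p i \<in> M" and q: "1 = poly q g" "\<forall>i. coeff q i \<in> M"
    and le: "degree q \<le> degree p"
  shows "\<exists>p'. 1 = poly p' f \<and> (\<forall>i. coeff p' i \<in> M) \<and> (degree p' < degree p)"
proof -
  let ?p = "degree p" let ?q = "degree q"
  have p0: "?p > 0"
  proof (rule ccontr)
    assume "\<not> ?p > 0" then have "?p = 0" by simp
    then obtain c where "p = [:c:]" by (metis degree_0_id)
    then show False using p M1 by (auto simp: coeff_pCons dest: spec[of _ 0])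
  qed
  let ?c = "coeff q" let ?m = "?c 0"
  \<comment> \<open>Multiplying 1 = q(g) by the top power of f turns each power of g into a power of
    f with smaller exponent; the hypothesis on the degrees keeps these exponents
    nonnegative.\<close>
  define s where "s = (\<Sum>j=1..?q. monom (?c j) (?p - j))"
  have "poly q g = (\<Sum>j\<le>?q. ?c j * g ^ j)" by (simp add: poly_altdef)
  also have "\<dots> = ?m + (\<Sum>j=1..?q. ?c j * g ^ j)"
    using sum.atLeast1_atMost_eq[of "\<lambda>j. ?c j * g ^ j" ?q] unfolding sum.atMost_shift by simp
  finally have 1: "1 - ?m = (\<Sum>j=1..?q. ?c j * g ^ j)" using q by (simp add: algebra_simps)
  have fgp: "f ^ ?p * g ^ j = f ^ (?p - j)" if "j \<le> ?p" for j
  proof -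
    have "f ^ ?p = f ^ (?p - j) * f ^ j" using that by (simp flip: power_add)
    then have "f ^ ?p * g ^ j = f ^ (?p - j) * (f * g) ^ j" by (simp add: power_mult_distrib algebra_simps)
    then show ?thesis using fg by simp
  qed
  have s: "(1 - ?m) * f ^ ?p = poly s f"
    unfolding 1 s_def sum_distrib_right poly_sum poly_monom
    by (rule sum.cong) (use le fgp in \<open>auto simp: mult.assoc mult.commute[of "g ^ _"]\<close>)
  have sM: "coeff s i \<in> M" for i unfolding s_def coeff_sum using q(2) by (auto intro!: Msum)
  have sd: "degree s \<le> ?p - 1" unfolding s_def
    by (rule degree_sum_le) (auto intro!: order_trans[OF degree_monom_le])
  define t where "t = p - monom (coeff p ?p) ?p"
  have tM: "coeff t i \<in> M" for i using p(2) by (auto simp: t_def Mdiff)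
  have td: "degree t \<le> ?p - 1"
    unfolding t_def by (rule degree_le) (use p0 in \<open>auto simp: coeff_eq_0\<close>)
  have pt: "poly p f = poly t f + coeff p ?p * f ^ ?p" by (simp add: t_def poly_monom)
  \<comment> \<open>Since 1 - \<open>coeff q 0\<close> need not be invertible, 1 = p(f) is
    multiplied by it before the top power is replaced, and \<open>coeff q 0\<close> is added back to
    restore the left-hand side 1.\<close>
  define u where "u = [:?m:] + [:1 - ?m:] * t + [:coeff p ?p:] * s"
  have "(1 - ?m) = (1 - ?m) * poly t f + coeff p ?p * ((1 - ?m) * f ^ ?p)"
    using p(1) pt by (metis distrib_left mult.left_commute mult.right_neutral)
  then have "1 = poly u f" unfolding s u_def by (simp add: algebra_simps)
  moreover have "coeff u i \<in> M" for i
  proof -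
    have "coeff u i = coeff [:?m:] i + (coeff t i - ?m * coeff t i) + coeff p ?p * coeff s i"
      by (simp add: u_def algebra_simps)
    moreover have "coeff [:?m:] i \<in> M" using q(2) by (auto simp: coeff_pCons split: nat.split)
    ultimately show ?thesis using Madd Mdiff Mmult tM sM q(2) p(2) by presburger
  qed
  moreover have "degree u \<le> ?p - 1" unfolding u_def
    by (intro degree_add_le) (use td sd in \<open>auto intro: order_trans[OF degree_smult_le]\<close>)
  ultimately show ?thesis using p0 by (intro exI[of _ u]) auto
qed

text \<open>Outside A both elements would satisfy relations with coefficients in M. Of two relations
  of least degree, the one of larger degree could be shortened by the other.\<close>

lemma valuation_A:
  assumes fg: "f * g = 1" shows "f \<in> A \<or> g \<in> A"
proof (rule ccontr)
  assume no: "\<not> (f \<in> A \<or> g \<in> A)"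
  have gf: "g * f = 1" using fg by (simp add: mult.commute)
  define D where "D f n \<longleftrightarrow> (\<exists>p. 1 = poly p f \<and> (\<forall>i. coeff p i \<in> M) \<and> degree p = n)" for f :: 'r and n
  have "\<exists>n. D f n" "\<exists>n. D g n" using no not_unit_A unfolding D_def Mpoly_def by blast+
  then obtain a b where a: "D f a" "\<And>n. D f n \<Longrightarrow> a \<le> n" and b: "D g b" "\<And>n. D g n \<Longrightarrow> b \<le> n"
    by (metis LeastI Least_le)
  show False
  proof (cases "b \<le> a")
    case True
    with a b Mpoly_reduce[OF fg] show False unfolding D_def by (metis not_le)
  next
    case False
    with a b Mpoly_reduce[OF gf] show False unfolding D_def by (metis nle_le not_le)
  qed
qed

text \<open>As \<open>v t0\<close> is the inverse of \<open>u t0\<close>, the element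
  \<open>u t0\<close> has least valuation; it exists because \<open>valuation_A\<close> makes the
  order of valuations total.\<close>

lemma ex_min_valuation:
  assumes "finite T" "T \<noteq> {}" "\<And>t. t \<in> T \<Longrightarrow> u t * v t = 1"
  shows "\<exists>t0\<in>T. \<forall>t\<in>T. u t * v t0 \<in> A"
  using assms
proof (induction T rule: finite_ne_induct)
  case (singleton x) then show ?case using A_k[of 1] by (simp add: kone)
next
  case (insert x F)
  then obtain t0 where t0: "t0 \<in> F" "\<And>t. t \<in> F \<Longrightarrow> u t * v t0 \<in> A" by auto
  have ux: "u x * v x = 1" "u t0 * v t0 = 1" using insert.prems t0(1) by auto
  have "(u x * v t0) * (u t0 * v x) = (u x * v x) * (u t0 * v t0)" by (simp add: algebra_simps)
  then have "u x * v t0 \<in> A \<or> u t0 * v x \<in> A" using valuation_A[of "u x * v t0" "u t0 * v x"] ux by simp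
  then show ?case
  proof
    assume "u x * v t0 \<in> A" then show ?thesis using t0 by blast
  next
    assume a: "u t0 * v x \<in> A"
    have "u t * v x \<in> A" if "t \<in> F" for t
    proof -
      have "(u t * v t0) * (u t0 * v x) = u t * v x * (u t0 * v t0)" by (simp add: algebra_simps)
      then show ?thesis using A_mult[OF t0(2)[OF that] a] ux(2) by simp
    qed
    moreover have "u x * v x \<in> A" using ux A_k[of 1] by (simp add: kone)
    ultimately show ?thesis by blast
  qed
qed

end

section \<open>Multihomogeneous forms and limits of points along places\<close>

abbreviation cfun :: "'k \<Rightarrow> 'p \<Rightarrow> 'k" where "cfun c \<equiv> (\<lambda>_. c)"

lemma algebra_over_fun: "algebra_over (cfun :: 'k::alg_closed_field \<Rightarrow> 'p \<Rightarrow> 'k)"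
  by unfold_locales (auto simp: fun_eq_iff)

lemma fun_sum_apply: "sum f A x = (\<Sum>a\<in>A. f a x)"
  by (induction A rule: infinite_finite_induct) auto

context vector_space
begin

lemma vsp_self: "vector_space_pair scale ((*) :: 'a \<Rightarrow> 'a \<Rightarrow> 'a)"
  by (unfold_locales) (auto simp: algebra_simps)

lemma ex_dual_basis:
  assumes "independent B"
  shows "\<exists>l. (\<forall>b. Vector_Spaces.linear scale (*) (l b)) \<and> (\<forall>b\<in>B. \<forall>b'\<in>B. l b b' = (if b' = b then 1 else 0))"
proof -
  interpret p: vector_space_pair scale "(*) :: 'a \<Rightarrow> 'a \<Rightarrow> 'a" by (rule vsp_self)
  have "\<exists>g. Vector_Spaces.linear scale (*) g \<and> (\<forall>x\<in>B. g x = (if x = b then 1 else 0))" for b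
    using p.linear_independent_extend[OF assms, of "\<lambda>x. if x = b then 1 else 0"] by auto
  then show ?thesis by metis
qed

lemma span_dual_expand:
  assumes "finite B" "x \<in> span B"
    and lin: "\<forall>b. Vector_Spaces.linear scale (*) (l b)"
    and dual: "\<forall>b\<in>B. \<forall>b'\<in>B. l b b' = (if b' = b then 1 else (0::'a))"
  shows "x = (\<Sum>b\<in>B. scale (l b x) b)"
proof -
  interpret p: vector_space_pair scale "(*) :: 'a \<Rightarrow> 'a \<Rightarrow> 'a" by (rule vsp_self)
  obtain u where u: "x = (\<Sum>b\<in>B. scale (u b) b)" using assms(1,2) span_finite by auto
  have "l b x = u b" if "b \<in> B" for b
  proof -
    have "l b x = (\<Sum>b'\<in>B. u b' * l b b')"
      unfolding u using lin by (simp add: p.linear_sum p.linear_scale)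
    also have "\<dots> = (\<Sum>b'\<in>B. if b' = b then u b' else 0)"
      using dual that by (intro sum.cong) auto
    finally show ?thesis using that assms(1) by simp
  qed
  then show ?thesis using u by simp
qed

lemma linear_functional_simps:
  assumes "Vector_Spaces.linear scale (*) l"
  shows "l (a + b) = l a + l b" "l (scale c a) = c * l a" "l 0 = 0" "l (- a) = - l a"
    "l (a - b) = l a - l b" "l (sum f S) = (\<Sum>i\<in>S. l (f i))"
proof -
  interpret p: vector_space_pair scale "(*) :: 'a \<Rightarrow> 'a \<Rightarrow> 'a" by (rule vsp_self)
  show "l (a + b) = l a + l b" "l (scale c a) = c * l a" "l 0 = 0" "l (- a) = - l a"
    "l (a - b) = l a - l b" "l (sum f S) = (\<Sum>i\<in>S. l (f i))"
    using assms by (simp_all add: p.linear_add p.linear_scale p.linear_0 p.linear_neg p.linear_diff p.linear_sum)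
qed

lemma ex_functional_nonzero:
  assumes "v \<noteq> 0" shows "\<exists>l. Vector_Spaces.linear scale (*) l \<and> l v = (1::'a)"
proof -
  have "independent {v}" using assms by (simp add: dependent_single)
  from ex_dual_basis[OF this] show ?thesis by auto
qed

end

context
  fixes sc :: "'k::field \<Rightarrow> 'v::ab_group_add \<Rightarrow> 'v" and I :: "'i set"
begin

lemma multiforms_zero: "(\<lambda>v. 0) \<in> multiforms sc I d"
  by (auto simp: multiforms_def intro: polyfun.intros)

lemma multiforms_const: "(\<lambda>v. c) \<in> multiforms sc I (\<lambda>_. 0)"
  by (auto simp: multiforms_def intro: polyfun.intros)

lemma multiforms_add:
  "f \<in> multiforms sc I d \<Longrightarrow> g \<in> multiforms sc I d \<Longrightarrow> (\<lambda>v. f v + g v) \<in> multiforms sc I d"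
  by (auto simp: multiforms_def algebra_simps intro: polyfun.intros)

lemma multiforms_scale: "f \<in> multiforms sc I d \<Longrightarrow> (\<lambda>v. c * f v) \<in> multiforms sc I d"
  by (auto simp: multiforms_def algebra_simps intro: polyfun.mult[OF polyfun.const])

lemma multiforms_diff:
  "f \<in> multiforms sc I d \<Longrightarrow> g \<in> multiforms sc I d \<Longrightarrow> (\<lambda>v. f v - g v) \<in> multiforms sc I d"
  using multiforms_add[OF _ multiforms_scale[of g d "-1"]] by simp

lemma multiforms_sum:
  "(\<And>j. j \<in> J \<Longrightarrow> f j \<in> multiforms sc I d) \<Longrightarrow> (\<lambda>v. \<Sum>j\<in>J. f j v) \<in> multiforms sc I d"
  by (induction J rule: infinite_finite_induct) (auto intro: multiforms_add multiforms_zero)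

lemma multiforms_mult:
  assumes "f \<in> multiforms sc I d" "g \<in> multiforms sc I d'"
  shows "(\<lambda>v. f v * g v) \<in> multiforms sc I (\<lambda>i. d i + d' i)"
  using assms by (auto simp: multiforms_def power_add prod.distrib algebra_simps intro: polyfun.intros)

lemma multiforms_power:
  assumes "f \<in> multiforms sc I d"
  shows "(\<lambda>v. f v ^ n) \<in> multiforms sc I (\<lambda>i. n * d i)"
proof (induction n)
  case 0 show ?case using multiforms_const[of 1] by simp
next
  case (Suc n) show ?case using multiforms_mult[OF assms Suc] by simp
qed

lemma multiforms_prod:
  assumes "\<And>j. j \<in> J \<Longrightarrow> f j \<in> multiforms sc I (d j)"
  shows "(\<lambda>v. \<Prod>j\<in>J. f j v) \<in> multiforms sc I (\<lambda>i. \<Sum>j\<in>J. d j i)"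
  using assms
proof (induction J rule: infinite_finite_induct)
  case (insert x F)
  then show ?case using multiforms_mult[of "f x" "d x" "\<lambda>v. \<Prod>j\<in>F. f j v"] by simp
qed (use multiforms_const[of 1] in simp_all)

lemma multiforms_linear:
  assumes "i \<in> I" "finite I" and l: "Vector_Spaces.linear sc (*) l"
  shows "(\<lambda>v. l (v i)) \<in> multiforms sc I (\<lambda>j. if j = i then 1 else 0)"
proof -
  have "l (sc c v) = c * l v" for c v
    using l by (simp add: Vector_Spaces.linear_iff)
  moreover have "(\<Prod>j\<in>I. c j ^ (if j = i then 1 else 0)) = c i" for c :: "'i \<Rightarrow> 'k"
  proof -
    have "(\<Prod>j\<in>I. c j ^ (if j = i then 1 else 0)) = (\<Prod>j\<in>I. if j = i then c j else 1)"
      by (intro prod.cong) auto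
    then show ?thesis using assms(1,2) by simp
  qed
  ultimately show ?thesis using assms by (auto simp: multiforms_def intro!: polyfun.gen)
qed

lemma multiforms_cong:
  assumes "\<And>i. i \<in> I \<Longrightarrow> d i = d' i" shows "multiforms sc I d = multiforms sc I d'"
  unfolding multiforms_def using assms by simp

lemma multiforms_hom:
  "f \<in> multiforms sc I d \<Longrightarrow> f (\<lambda>i. sc (c i) (v i)) = (\<Prod>i\<in>I. c i ^ d i) * f v"
  by (auto simp: multiforms_def)

end

text \<open>An irreducible set of points of a product of projective spaces, each with chosen
  homogeneous coordinates \<open>w y\<close>; \<open>irr\<close> says that nonempty basic open sets
  meet. The points are indexed by a whole type, so that functions on them form a ring type.\<close>

locale multi_points = vector_space sc
  for sc :: "'k::alg_closed_field \<Rightarrow> 'v::ab_group_add \<Rightarrow> 'v" +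
  fixes I :: "'i set" and V :: "'i \<Rightarrow> 'v set" and w :: "'p \<Rightarrow> 'i \<Rightarrow> 'v"
  assumes finI: "finite I"
    and fdV: "i \<in> I \<Longrightarrow> \<exists>B. finite B \<and> V i = span B"
    and wV: "i \<in> I \<Longrightarrow> w y i \<in> V i"
    and w0: "i \<in> I \<Longrightarrow> w y i \<noteq> 0"
    and irr: "f \<in> multiforms sc I d \<Longrightarrow> g \<in> multiforms sc I d' \<Longrightarrow>
      f (w y) \<noteq> 0 \<Longrightarrow> g (w y') \<noteq> 0 \<Longrightarrow> \<exists>z. f (w z) \<noteq> 0 \<and> g (w z) \<noteq> 0"
begin

text \<open>Functions that vanish on a nonempty open set. Places of the algebra of all functions that
  contain \<open>N0\<close> take the role of valuations of the function field.\<close>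

definition N0 :: "('p \<Rightarrow> 'k) set" where
  "N0 = {h. \<exists>d f y. f \<in> multiforms sc I d \<and> f (w y) \<noteq> 0 \<and> (\<forall>y. f (w y) \<noteq> 0 \<longrightarrow> h y = 0)}"

text \<open>Coordinates of a point of the Zariski closure of the given points in the
  product.\<close>

definition adherent :: "('i \<Rightarrow> 'v) \<Rightarrow> bool" where
  "adherent x \<longleftrightarrow> (\<forall>i\<in>I. x i \<in> V i \<and> x i \<noteq> 0) \<and>
     (\<forall>d. \<forall>f\<in>multiforms sc I d. (\<forall>y. f (w y) = 0) \<longrightarrow> f x = 0)"

lemma N0I: "f \<in> multiforms sc I d \<Longrightarrow> f (w y) \<noteq> 0 \<Longrightarrow> (\<And>y. f (w y) \<noteq> 0 \<Longrightarrow> h y = 0) \<Longrightarrow> h \<in> N0"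
  unfolding N0_def by blast

lemma N0_zero [simp]: "0 \<in> N0"
  by (rule N0I[OF multiforms_const[of 1]]) auto

lemma N0_mult: "h \<in> N0 \<Longrightarrow> u * h \<in> N0"
  unfolding N0_def by fastforce

lemma N0_add: assumes "h \<in> N0" "h' \<in> N0" shows "h + h' \<in> N0"
proof -
  obtain d f y where f: "f \<in> multiforms sc I d" "f (w y) \<noteq> 0" "\<And>y. f (w y) \<noteq> 0 \<Longrightarrow> h y = 0"
    using assms(1) unfolding N0_def by blast
  obtain d' g y' where g: "g \<in> multiforms sc I d'" "g (w y') \<noteq> 0" "\<And>y. g (w y) \<noteq> 0 \<Longrightarrow> h' y = 0"
    using assms(2) unfolding N0_def by blast
  obtain z where "f (w z) \<noteq> 0" "g (w z) \<noteq> 0" using irr[OF f(1) g(1) f(2) g(2)] by blast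
  then show ?thesis by (intro N0I[OF multiforms_mult[OF f(1) g(1)], of z]) (auto simp: f g)
qed

lemma N0_neg: "h \<in> N0 \<Longrightarrow> - h \<in> N0"
  using N0_mult[of h "- 1"] by simp

lemma N0_diff: "h \<in> N0 \<Longrightarrow> h' \<in> N0 \<Longrightarrow> h - h' \<in> N0"
  using N0_add[of h "- h'"] N0_neg by simp

lemma N0_sum: "(\<And>j. j \<in> J \<Longrightarrow> f j \<in> N0) \<Longrightarrow> sum f J \<in> N0"
  by (induction J rule: infinite_finite_induct) (auto intro: N0_add)

lemma N0_one: "1 \<notin> N0"
  unfolding N0_def by auto

text \<open>This makes identities between forms exact although functions are only known up to
  \<open>N0\<close>: by \<open>irr\<close> the set where f does not vanish would meet the open set
  where it does.\<close>

lemma N0_form: assumes "f \<in> multiforms sc I d" "f \<circ> w \<in> N0" shows "f (w y) = 0"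
proof (rule ccontr)
  assume a: "f (w y) \<noteq> 0"
  obtain d' g y' where g: "g \<in> multiforms sc I d'" "g (w y') \<noteq> 0" "\<And>y. g (w y) \<noteq> 0 \<Longrightarrow> (f \<circ> w) y = 0"
    using assms(2) unfolding N0_def by blast
  obtain z where "f (w z) \<noteq> 0" "g (w z) \<noteq> 0" using irr[OF assms(1) g(1) a g(2)] by blast
  then show False using g(3) by simp
qed

lemma N0_cancel:
  assumes f: "f \<in> multiforms sc I d" "f (w y) \<noteq> 0" and h: "(f \<circ> w) * h \<in> N0"
  shows "h \<in> N0"
proof -
  obtain d' g y' where g: "g \<in> multiforms sc I d'" "g (w y') \<noteq> 0"
      "\<And>y. g (w y) \<noteq> 0 \<Longrightarrow> ((f \<circ> w) * h) y = 0"
    using h unfolding N0_def by blast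
  obtain z where "f (w z) \<noteq> 0" "g (w z) \<noteq> 0" using irr[OF f(1) g(1) f(2) g(2)] by blast
  then show ?thesis
    by (intro N0I[OF multiforms_mult[OF f(1) g(1)], of z]) (use g(3) in auto)
qed

text \<open>In the ring of all functions a nonzero form need not be invertible. Replacing its zero
  values by 1 makes it so, at the cost of an element of \<open>N0\<close>.\<close>

definition unitize :: "('p \<Rightarrow> 'k) \<Rightarrow> 'p \<Rightarrow> 'k" where
  "unitize h y = (if h y = 0 then 1 else h y)"

lemma unitize_nz: "unitize h y \<noteq> 0"
  by (simp add: unitize_def)

lemma unitize_form: "f \<in> multiforms sc I d \<Longrightarrow> f (w y) \<noteq> 0 \<Longrightarrow> unitize (f \<circ> w) - (f \<circ> w) \<in> N0"
  by (rule N0I) (auto simp: unitize_def)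

sublocale fa: algebra_over "cfun :: 'k \<Rightarrow> 'p \<Rightarrow> 'k"
  by (rule algebra_over_fun)

text \<open>The valuative criterion of properness for a projective space: division by the coordinate
  of least valuation makes all coordinates finite at the place and one of them 1, so that the vector
  of residues is not zero.\<close>

lemma limit_one:
  assumes pl: "fa.place M" "N0 \<subseteq> M" and i: "i \<in> I"
  shows "\<exists>\<tau> x. (\<forall>y. \<tau> y \<noteq> 0) \<and> x \<in> V i \<and> x \<noteq> 0 \<and>
     (\<forall>l. Vector_Spaces.linear sc (*) l \<longrightarrow> (\<lambda>y. l (sc (\<tau> y) (w y i))) - cfun (l x) \<in> M)"
proof -
  interpret pl: place_of "cfun :: 'k \<Rightarrow> 'p \<Rightarrow> 'k" M
    by unfold_locales (rule pl(1))
  obtain B0 where B0: "finite B0" "V i = span B0" using fdV i by blast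
  obtain B where "B \<subseteq> B0" "independent B" "span B = span B0"
    using maximal_independent_subset[of B0] span_mono span_span subset_antisym
    by (metis span_minimal subspace_span)
  then have B: "finite B" "independent B" "V i = span B" using B0 finite_subset by auto
  obtain l where lin: "\<forall>b. Vector_Spaces.linear sc (*) (l b)"
    and dual: "\<forall>b\<in>B. \<forall>b'\<in>B. l b b' = (if b' = b then 1 else (0::'k))"
    using ex_dual_basis[OF B(2)] by blast
  have wexp: "w y i = (\<Sum>b\<in>B. sc (l b (w y i)) b)" for y
    using span_dual_expand[OF B(1) _ lin dual] wV[OF i] B(3) by blast
  \<comment> \<open>Only coordinates that are not identically zero agree with their
    \<open>unitize\<close> up to \<open>N0\<close>; the others have residue 0 anyway.\<close>
  define T where "T = {b\<in>B. \<exists>y. l b (w y i) \<noteq> 0}"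
  define L where "L b = (\<lambda>v. l b (v i))" for b
  have L: "L b \<in> multiforms sc I (\<lambda>j. if j = i then 1 else 0)" for b
    unfolding L_def using multiforms_linear[OF i finI] lin by blast
  define u where "u b = unitize (L b \<circ> w)" for b
  define v where "v b = (\<lambda>y. inverse (u b y))" for b
  have uv: "u b * v b = 1" for b
    by (auto simp: fun_eq_iff u_def v_def unitize_nz)
  have T: "finite T" "T \<noteq> {}"
  proof -
    show "finite T" using B(1) by (simp add: T_def)
    fix y
    show "T \<noteq> {}"
    proof
      assume "T = {}"
      then have "\<And>b. b \<in> B \<Longrightarrow> l b (w y i) = 0" unfolding T_def by blast
      then have "w y i = 0" by (subst wexp) simp
      then show False using w0[OF i] by simp
    qed
  qed
  obtain b0 where b0: "b0 \<in> T" "\<And>b. b \<in> T \<Longrightarrow> u b * v b0 \<in> pl.A"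
    using pl.ex_min_valuation[OF T, of u v, OF uv] by auto
  define \<tau> where "\<tau> = v b0"
  have \<tau>0: "\<tau> y \<noteq> 0" for y by (simp add: \<tau>_def v_def u_def unitize_nz)
  have "\<exists>c. \<tau> * (L b \<circ> w) - cfun c \<in> M" if "b \<in> B" for b
  proof (cases "b \<in> T")
    case True
    obtain c where c: "u b * v b0 - cfun c \<in> M" using pl.AE[OF b0(2)[OF True]] by blast
    obtain y where "L b (w y) \<noteq> 0" using True unfolding T_def L_def by blast
    from unitize_form[OF L this] have "\<tau> * (u b - (L b \<circ> w)) \<in> M" using N0_mult subsetD[OF pl(2)] unfolding u_def by blast
    from pl.Mdiff[OF c this] have "\<tau> * (L b \<circ> w) - cfun c \<in> M"
      by (simp add: \<tau>_def algebra_simps)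
    then show ?thesis ..
  next
    case False
    then have "\<tau> * (L b \<circ> w) - cfun 0 = 0" using that unfolding T_def L_def by (auto simp: fun_eq_iff)
    then have "\<tau> * (L b \<circ> w) - cfun 0 \<in> M" by (simp only: pl.M0)
    then show ?thesis ..
  qed
  then obtain xc where xc: "\<And>b. b \<in> B \<Longrightarrow> \<tau> * (L b \<circ> w) - cfun (xc b) \<in> M" by metis
  define x where "x = (\<Sum>b\<in>B. sc (xc b) b)"
  have b0B: "b0 \<in> B" using b0(1) by (simp add: T_def)
  have "xc b0 = 1"
  proof (rule pl.res_unique[OF xc[OF b0B]])
    obtain y where "L b0 (w y) \<noteq> 0" using b0(1) unfolding T_def L_def by blast
    from unitize_form[OF L this] have "\<tau> * (u b0 - (L b0 \<circ> w)) \<in> M" using N0_mult subsetD[OF pl(2)] unfolding u_def by blast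
    from pl.Mneg[OF this] show "\<tau> * (L b0 \<circ> w) - cfun 1 \<in> M"
      using uv[of b0] by (simp add: \<tau>_def algebra_simps one_fun_def)
  qed
  moreover have "l b0 x = xc b0"
  proof -
    have "l b0 x = (\<Sum>b\<in>B. xc b * l b0 b)"
      unfolding x_def using lin by (simp add: linear_functional_simps)
    also have "\<dots> = (\<Sum>b\<in>B. if b = b0 then xc b else 0)"
      using dual b0B by (intro sum.cong) auto
    finally show ?thesis using b0B B(1) by simp
  qed
  ultimately have x0: "x \<noteq> 0" using lin linear_functional_simps(3)[of "l b0"] by auto
  have xV: "x \<in> V i" unfolding x_def B(3) by (intro span_sum span_scale span_base)
  have "(\<lambda>y. f (sc (\<tau> y) (w y i))) - cfun (f x) \<in> M" if f: "Vector_Spaces.linear sc (*) f" for f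
  proof -
    have "f (sc (\<tau> y) (w y i)) = (\<Sum>b\<in>B. (\<tau> y * l b (w y i)) * f b)" for y
      by (subst wexp) (simp add: linear_functional_simps[OF f] sum_distrib_left mult.assoc)
    moreover have "f x = (\<Sum>b\<in>B. xc b * f b)"
      by (simp add: x_def linear_functional_simps[OF f])
    ultimately have "(\<lambda>y. f (sc (\<tau> y) (w y i))) - cfun (f x) =
        (\<Sum>b\<in>B. cfun (f b) * (\<tau> * (L b \<circ> w) - cfun (xc b)))"
      by (auto simp: fun_eq_iff L_def sum_subtractf algebra_simps fun_sum_apply)
    also have "\<dots> \<in> M" by (intro pl.Msum pl.Mk xc)
    finally show ?thesis .
  qed
  then show ?thesis using \<tau>0 x0 xV by blast
qed

text \<open>Residues are compatible with sums and products, so the factorwise limits are limits for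
  every polynomial. A form that is zero at all points therefore has residue 0, its value at the
  limit, and the limit is adherent.\<close>

lemma limit:
  assumes pl: "fa.place M" "N0 \<subseteq> M"
  shows "\<exists>\<tau> x. (\<forall>i\<in>I. \<forall>y. \<tau> i y \<noteq> 0) \<and> adherent x \<and>
     (\<forall>f\<in>polyfun {\<lambda>v. l (v i) | i l. i \<in> I \<and> Vector_Spaces.linear sc (*) l}.
        (\<lambda>y. f (\<lambda>i. sc (\<tau> i y) (w y i))) - cfun (f x) \<in> M)"
proof -
  interpret pl: place_of "cfun :: 'k \<Rightarrow> 'p \<Rightarrow> 'k" M
    by unfold_locales (rule pl(1))
  obtain \<tau> x where tx: "\<And>i. i \<in> I \<Longrightarrow> (\<forall>y. \<tau> i y \<noteq> 0) \<and> x i \<in> V i \<and> x i \<noteq> 0 \<and>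
     (\<forall>l. Vector_Spaces.linear sc (*) l \<longrightarrow> (\<lambda>y. l (sc (\<tau> i y) (w y i))) - cfun (l (x i)) \<in> M)"
  proof -
    have "\<forall>i. \<exists>p. i \<in> I \<longrightarrow> (\<forall>y. fst p y \<noteq> 0) \<and> snd p \<in> V i \<and> snd p \<noteq> 0 \<and>
     (\<forall>l. Vector_Spaces.linear sc (*) l \<longrightarrow> (\<lambda>y. l (sc (fst p y) (w y i))) - cfun (l (snd p)) \<in> M)"
      using limit_one[OF pl] by auto
    from choice[OF this] obtain p where "\<forall>i. i \<in> I \<longrightarrow> (\<forall>y. fst (p i) y \<noteq> 0) \<and> snd (p i) \<in> V i \<and> snd (p i) \<noteq> 0 \<and>
     (\<forall>l. Vector_Spaces.linear sc (*) l \<longrightarrow> (\<lambda>y. l (sc (fst (p i) y) (w y i))) - cfun (l (snd (p i))) \<in> M)" ..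
    then show thesis by (intro that[of "\<lambda>i. fst (p i)" "\<lambda>i. snd (p i)"]) auto
  qed
  have tx1: "\<forall>y. \<tau> i y \<noteq> 0" "x i \<in> V i" "x i \<noteq> 0" if "i \<in> I" for i
    using tx[OF that] by blast+
  have tx2: "(\<lambda>y. l (sc (\<tau> i y) (w y i))) - cfun (l (x i)) \<in> M"
    if "i \<in> I" "Vector_Spaces.linear sc (*) l" for i l
    using tx[OF that(1)] that(2) by blast
  have P: "(\<lambda>y. f (\<lambda>i. sc (\<tau> i y) (w y i))) - cfun (f x) \<in> M"
    if "f \<in> polyfun {\<lambda>v. l (v i) | i l. i \<in> I \<and> Vector_Spaces.linear sc (*) l}" for f
    using that
  proof induction
    case (const c) then show ?case by (simp only: diff_self pl.M0)
  next
    case (gen f)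
    then obtain i l where "i \<in> I" "Vector_Spaces.linear sc (*) l" "f = (\<lambda>v. l (v i))" by blast
    then show ?case using tx2[of i l] by (simp only:)
  next
    case (add f g) from pl.res_add[OF this(3,4)] show ?case by (simp only: plus_fun_def)
  next
    case (mult f g) from pl.res_mult[OF this(3,4)] show ?case by (simp only: times_fun_def)
  qed
  have "adherent x"
    unfolding adherent_def
  proof (intro conjI allI ballI impI)
    fix i assume "i \<in> I" then show "x i \<in> V i" "x i \<noteq> 0" by (simp_all only: tx1 not_False_eq_True)
  next
    fix d f assume f: "f \<in> multiforms sc I d" "\<forall>y. f (w y) = 0"
    then have "(\<lambda>y. f (\<lambda>i. sc (\<tau> i y) (w y i))) = 0" by (auto simp: fun_eq_iff multiforms_hom[OF f(1)])
    moreover have "f \<in> polyfun {\<lambda>v. l (v i) | i l. i \<in> I \<and> Vector_Spaces.linear sc (*) l}"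
      using f(1) by (simp add: multiforms_def)
    ultimately have "0 - cfun (f x) \<in> M" using P[of f] by (simp only:)
    then have "cfun (f x) \<in> M" using pl.Mneg[of "0 - cfun (f x)"] by (simp only: diff_0 minus_minus)
    then show "f x = 0" by (simp add: pl.Mk_iff)
  qed
  moreover have "\<forall>i\<in>I. \<forall>y. \<tau> i y \<noteq> 0" using tx1(1) by blast
  ultimately show ?thesis using P by blast
qed

end

section \<open>Integrality and growth of graded algebras\<close>

definition fscale :: "'k::field \<Rightarrow> ('p \<Rightarrow> 'k) \<Rightarrow> 'p \<Rightarrow> 'k" where
  "fscale c f = (\<lambda>y. c * f y)"

lemma fscale_eq: "fscale c f = cfun c * f"
  by (simp add: fscale_def fun_eq_iff)

global_interpretation fsp: vector_space fscale
  by unfold_locales (auto simp: fun_eq_iff fscale_def algebra_simps)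

lemma fspan_cmult: "a \<in> fsp.span S \<Longrightarrow> cfun c * a \<in> fsp.span S"
  using fsp.span_scale[of a S c] by (simp only: fscale_eq)

lemma fspan_mult_left:
  fixes r :: "'p \<Rightarrow> 'k::field"
  assumes "a \<in> fsp.span S" "\<And>s. s \<in> S \<Longrightarrow> r * s \<in> fsp.span S'"
  shows "r * a \<in> fsp.span S'"
  using assms(1)
proof (induction rule: fsp.span_induct_alt)
  case base show ?case by (simp only: mult_zero_right fsp.span_zero)
next
  case (step c x y)
  have e: "r * (fscale c x + y) = cfun c * (r * x) + r * y"
    by (simp add: fscale_eq algebra_simps)
  show ?case unfolding e
    by (intro fsp.span_add fspan_cmult assms(2) step)
qed

lemma fspan_mult:
  fixes a :: "'p \<Rightarrow> 'k::field"
  assumes "a \<in> fsp.span S" "b \<in> fsp.span S'" "\<And>s s'. s \<in> S \<Longrightarrow> s' \<in> S' \<Longrightarrow> s * s' \<in> fsp.span S''"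
  shows "a * b \<in> fsp.span S''"
proof (rule fspan_mult_left[OF assms(2)])
  fix s' assume "s' \<in> S'"
  then have "s' * a \<in> fsp.span S''" by (intro fspan_mult_left[OF assms(1)]) (metis assms(3) mult.commute)
  then show "a * s' \<in> fsp.span S''" by (simp add: mult.commute)
qed

text \<open>Monomials of degree \<open>m\<close> in the \<open>F l\<close> and \<open>G\<close> that involve some \<open>F l\<close>: \<open>G ^ m\<close> lies in their
  span iff \<open>G\<close> satisfies a homogeneous monic equation over the algebra generated by the \<open>F l\<close>.\<close>

definition int_monos :: "'l set \<Rightarrow> ('l \<Rightarrow> 'p \<Rightarrow> 'k::field) \<Rightarrow> ('p \<Rightarrow> 'k) \<Rightarrow> nat \<Rightarrow> ('p \<Rightarrow> 'k) set" where
  "int_monos T F G m = {(\<Prod>l\<in>T. F l ^ \<alpha> l) * G ^ i | \<alpha> i. (\<exists>l\<in>T. \<alpha> l \<ge> 1) \<and> sum \<alpha> T + i = m}"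

lemma int_monos_mult:
  assumes "s \<in> int_monos T F G m" "s' \<in> int_monos T F G m'"
  shows "s * s' \<in> int_monos T F G (m + m')"
proof -
  obtain \<alpha> i where a: "s = (\<Prod>l\<in>T. F l ^ \<alpha> l) * G ^ i" "\<exists>l\<in>T. \<alpha> l \<ge> 1" "sum \<alpha> T + i = m"
    using assms(1) unfolding int_monos_def by blast
  obtain \<beta> j where b: "s' = (\<Prod>l\<in>T. F l ^ \<beta> l) * G ^ j" "\<exists>l\<in>T. \<beta> l \<ge> 1" "sum \<beta> T + j = m'"
    using assms(2) unfolding int_monos_def by blast
  have "s * s' = (\<Prod>l\<in>T. F l ^ (\<alpha> l + \<beta> l)) * G ^ (i + j)"
    unfolding a b by (simp add: power_add prod.distrib algebra_simps)
  moreover have "\<exists>l\<in>T. \<alpha> l + \<beta> l \<ge> 1" using a(2) trans_le_add1 by blast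
  moreover have "(\<Sum>l\<in>T. \<alpha> l + \<beta> l) + (i + j) = m + m'" using a b by (simp add: sum.distrib)
  ultimately show ?thesis unfolding int_monos_def
    by (intro CollectI exI[of _ "\<lambda>l. \<alpha> l + \<beta> l"] exI[of _ "i + j"]) blast
qed

lemma int_monos_shift:
  assumes "s \<in> int_monos T F G m" shows "G ^ j * s \<in> int_monos T F G (m + j)"
proof -
  obtain \<alpha> i where a: "s = (\<Prod>l\<in>T. F l ^ \<alpha> l) * G ^ i" "\<exists>l\<in>T. \<alpha> l \<ge> 1" "sum \<alpha> T + i = m"
    using assms(1) unfolding int_monos_def by blast
  have "G ^ j * s = (\<Prod>l\<in>T. F l ^ \<alpha> l) * G ^ (i + j)" unfolding a by (simp add: power_add algebra_simps)
  moreover have "sum \<alpha> T + (i + j) = m + j" using a by simp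
  ultimately show ?thesis using a(2) unfolding int_monos_def by blast
qed

lemma int_monos_gen:
  assumes "finite T" "l \<in> T" shows "F l * G ^ i \<in> int_monos T F G (Suc i)"
proof -
  have "(\<Prod>l'\<in>T. F l' ^ (if l' = l then 1 else 0)) = (\<Prod>l'\<in>T. if l' = l then F l' else 1)"
    by (rule prod.cong) auto
  then have "F l * G ^ i = (\<Prod>l'\<in>T. F l' ^ (if l' = l then 1 else 0)) * G ^ i"
    using assms by simp
  moreover have "(\<Sum>l'\<in>T. if l' = l then 1 else 0) + i = Suc i" using assms by simp
  moreover have "\<exists>l'\<in>T. (if l' = l then 1 else 0) \<ge> (1::nat)" using assms by auto
  ultimately show ?thesis unfolding int_monos_def
    by (intro CollectI exI[of _ "\<lambda>l'. if l' = l then 1 else 0"] exI[of _ i]) blast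
qed

context multi_points
begin

text \<open>The graded pieces of the coordinate ring for the Segre embedding: of all multidegrees
  only (d, ..., d) is kept.\<close>

definition gr :: "nat \<Rightarrow> ('p \<Rightarrow> 'k) set" where
  "gr d = {A \<circ> w | A. A \<in> multiforms sc I (\<lambda>_. d)}"

lemma subspace_gr: "fsp.subspace (gr d)"
proof -
  have "0 = (\<lambda>_. 0) \<circ> w" by (simp add: fun_eq_iff)
  then have "0 \<in> gr d" unfolding gr_def using multiforms_zero[of sc I "\<lambda>_. d"] by blast
  moreover have "f + g \<in> gr d" if fg: "f \<in> gr d" "g \<in> gr d" for f g
  proof -
    obtain A B where AB: "A \<in> multiforms sc I (\<lambda>_. d)" "B \<in> multiforms sc I (\<lambda>_. d)" "f = A \<circ> w" "g = B \<circ> w"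
      using fg unfolding gr_def by blast
    have "f + g = (\<lambda>v. A v + B v) \<circ> w" using AB by (simp add: fun_eq_iff)
    then show ?thesis unfolding gr_def using multiforms_add[OF AB(1,2)] by blast
  qed
  moreover have "fscale c f \<in> gr d" if f: "f \<in> gr d" for f c
  proof -
    obtain A where A: "A \<in> multiforms sc I (\<lambda>_. d)" "f = A \<circ> w"
      using f unfolding gr_def by blast
    have "fscale c f = (\<lambda>v. c * A v) \<circ> w" using A by (simp add: fun_eq_iff fscale_def)
    then show ?thesis unfolding gr_def using multiforms_scale[OF A(1), of c] by blast
  qed
  ultimately show ?thesis unfolding fsp.subspace_def by blast
qed

lemma gr_N0: assumes "f \<in> gr d" "f \<in> N0" shows "f = 0"
proof -
  obtain A where A: "A \<in> multiforms sc I (\<lambda>_. d)" "f = A \<circ> w" using assms(1) unfolding gr_def by blast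
  have "A (w y) = 0" for y using N0_form[OF A(1)] assms(2) A(2) by simp
  then show ?thesis using A(2) by (simp add: fun_eq_iff)
qed

lemma gr_mult: "f \<in> gr d \<Longrightarrow> g \<in> gr d' \<Longrightarrow> f * g \<in> gr (d + d')"
proof -
  assume fg: "f \<in> gr d" "g \<in> gr d'"
  then obtain A B where AB: "A \<in> multiforms sc I (\<lambda>_. d)" "B \<in> multiforms sc I (\<lambda>_. d')"
      and fg': "f = A \<circ> w" "g = B \<circ> w"
    unfolding gr_def by blast
  have "f * g = (\<lambda>v. A v * B v) \<circ> w" unfolding fg' by (simp add: fun_eq_iff)
  then show ?thesis unfolding gr_def using multiforms_mult[OF AB] by blast
qed

lemma gr_one: "1 \<in> gr 0"
  unfolding gr_def using multiforms_const[of 1 sc I] by (intro CollectI exI[of _ "\<lambda>_. 1"]) (simp add: fun_eq_iff)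

lemma gr_power: "f \<in> gr d \<Longrightarrow> f ^ n \<in> gr (n * d)"
proof (induction n)
  case (Suc n) show ?case using gr_mult[OF Suc(2) Suc(1)[OF Suc(2)]] by (simp only: power_Suc mult_Suc)
qed (simp only: power_0 mult_0 gr_one)

lemma gr_prod: "(\<And>j. j \<in> J \<Longrightarrow> f j \<in> gr (d j)) \<Longrightarrow> prod f J \<in> gr (sum d J)"
proof (induction J rule: infinite_finite_induct)
  case (insert x F)
  then have "f x * prod f F \<in> gr (d x + sum d F)" by (intro gr_mult) auto
  then show ?case using insert(1,2) by (simp only: prod.insert sum.insert not_False_eq_True)
qed (simp_all only: prod.infinite sum.infinite prod.empty sum.empty gr_one not_False_eq_True)

lemma span_int_monos_gr:
  assumes "\<And>l. l \<in> T \<Longrightarrow> F l \<in> gr e" "G \<in> gr e"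
  shows "fsp.span (int_monos T F G m) \<subseteq> gr (m * e)"
proof (rule fsp.span_minimal[OF _ subspace_gr], rule subsetI)
  fix s assume "s \<in> int_monos T F G m"
  then obtain \<alpha> i where a: "s = (\<Prod>l\<in>T. F l ^ \<alpha> l) * G ^ i" "sum \<alpha> T + i = m"
    unfolding int_monos_def by blast
  have "s \<in> gr ((\<Sum>l\<in>T. \<alpha> l * e) + i * e)" unfolding a
    by (intro gr_mult gr_prod gr_power assms)
  then show "s \<in> gr (m * e)" using a(2) by (simp flip: sum_distrib_right add_mult_distrib)
qed

text \<open>If G were not integral, the polynomials without constant term in the fractions F_l / G
  would generate a subalgebra without unit, hence be contained in a place. All F_l / G vanish there,
  so the limit of the points along this place is a common zero of the F_l in the closure.\<close>

lemma integral_over: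
  assumes T: "finite T" "\<And>l. l \<in> T \<Longrightarrow> F l \<in> multiforms sc I (\<lambda>_. e)"
    and G: "G \<in> multiforms sc I (\<lambda>_. e)" "G (w y0) \<noteq> 0"
    and no: "\<And>x. adherent x \<Longrightarrow> \<exists>l\<in>T. F l x \<noteq> 0"
  shows "\<exists>m. (G \<circ> w) ^ m \<in> fsp.span (int_monos T (\<lambda>l. F l \<circ> w) (G \<circ> w) m)"
proof (rule ccontr)
  assume nint: "\<nexists>m. (G \<circ> w) ^ m \<in> fsp.span (int_monos T (\<lambda>l. F l \<circ> w) (G \<circ> w) m)"
  define g where "g = G \<circ> w"
  define f where "f l = F l \<circ> w" for l
  let ?S = "\<lambda>m. fsp.span (int_monos T f g m)"
  have ggr: "g \<in> gr e" unfolding g_def gr_def using G(1) by blast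
  have fgr: "f l \<in> gr e" if "l \<in> T" for l
    unfolding f_def gr_def using T(2)[OF that] by blast
  have shift: "g ^ j * a \<in> ?S (m + j)" if "a \<in> ?S m" for a m j
    by (rule fspan_mult_left[OF that]) (intro fsp.span_base int_monos_shift)
  have smult: "a * b \<in> ?S (m + m')" if "a \<in> ?S m" "b \<in> ?S m'" for a b m m'
    by (rule fspan_mult[OF that]) (intro fsp.span_base int_monos_mult)
  \<comment> \<open>Fractions with denominator a power of g and numerator in the ideal generated by
    the \<open>f l\<close>, up to \<open>N0\<close>. Multiplying by g^m states this without dividing
    by g.\<close>
  define M0 where "M0 = {q. \<exists>m. \<exists>n\<in>N0. g ^ m * (q - n) \<in> ?S m}"
  have M0I: "q \<in> M0" if "n \<in> N0" "g ^ m * (q - n) \<in> ?S m" for q m n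
    using that unfolding M0_def by blast
  have "fa.nonunital M0"
    unfolding fa.nonunital_def
  proof (intro conjI ballI allI)
    show "0 \<in> M0" by (rule M0I[OF N0_zero, of 0]) (simp add: fsp.span_zero)
    show "1 \<notin> M0"
    \<comment> \<open>The assumption 1 in \<open>M0\<close> gives the integral equation for g only
      up to \<open>N0\<close>. The error is a form, so it vanishes and the equation holds
      exactly.\<close>
    proof
      assume "1 \<in> M0"
      then obtain m n where n: "n \<in> N0" "g ^ m * (1 - n) \<in> ?S m" unfolding M0_def by blast
      have "g ^ m - g ^ m * (1 - n) = g ^ m * n" by (simp add: algebra_simps)
      moreover have "g ^ m * (1 - n) \<in> gr (m * e)"
        using n(2) by (rule subsetD[OF span_int_monos_gr[of T f e g m, OF fgr ggr], rotated -1])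
      then have "g ^ m - g ^ m * (1 - n) \<in> gr (m * e)"
        by (rule fsp.subspace_diff[OF subspace_gr gr_power[OF ggr]])
      ultimately have "g ^ m * n \<in> gr (m * e)" by (simp only:)
      then have "g ^ m * n = 0" using N0_mult[OF n(1)] by (rule gr_N0)
      then have "g ^ m * (1 - n) = g ^ m" by (simp add: algebra_simps)
      then have "g ^ m \<in> ?S m" using n(2) by (simp only:)
      then show False using nint unfolding g_def f_def by blast
    qed
    fix c a assume "a \<in> M0"
    then obtain m n where n: "n \<in> N0" "g ^ m * (a - n) \<in> ?S m" unfolding M0_def by blast
    have "g ^ m * (cfun c * a - cfun c * n) = cfun c * (g ^ m * (a - n))" by (simp add: algebra_simps)
    then have "g ^ m * (cfun c * a - cfun c * n) \<in> ?S m" using fspan_cmult[OF n(2), of c] by (simp only:)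
    then show "cfun c * a \<in> M0" by (rule M0I[OF N0_mult[OF n(1)]])
  next
    fix a b assume "a \<in> M0" "b \<in> M0"
    then obtain m n m' n' where n: "n \<in> N0" "g ^ m * (a - n) \<in> ?S m"
      and n': "n' \<in> N0" "g ^ m' * (b - n') \<in> ?S m'" unfolding M0_def by blast
    have "g ^ (m + m') * ((a + b) - (n + n')) = g ^ m' * (g ^ m * (a - n)) + g ^ m * (g ^ m' * (b - n'))"
      by (simp add: algebra_simps power_add)
    also have "\<dots> \<in> ?S (m + m')"
      using fsp.span_add[OF shift[OF n(2), of m'] shift[OF n'(2), of m, unfolded add.commute[of m' m]]] by simp
    finally show "a + b \<in> M0" by (rule M0I[OF N0_add[OF n(1) n'(1)]])
    have "g ^ (m + m') * (a * b - (n * b + a * n' - n * n')) = (g ^ m * (a - n)) * (g ^ m' * (b - n'))"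
      by (simp add: algebra_simps power_add)
    also have "\<dots> \<in> ?S (m + m')" by (rule smult[OF n(2) n'(2)])
    finally have 1: "g ^ (m + m') * (a * b - (n * b + a * n' - n * n')) \<in> ?S (m + m')" .
    have "n * b + a * n' - n * n' \<in> N0"
      using N0_diff[OF N0_add[OF N0_mult[OF n(1), of b] N0_mult[OF n'(1), of a]] N0_mult[OF n'(1), of n]]
      by (simp add: mult.commute)
    then show "a * b \<in> M0" using 1 by (rule M0I)
  qed
  from fa.exists_place[OF this] obtain M where M: "fa.place M" "M0 \<subseteq> M" by blast
  interpret pl: place_of "cfun :: 'k \<Rightarrow> 'p \<Rightarrow> 'k" M
    by unfold_locales (rule M(1))
  have N0M: "N0 \<subseteq> M"
  proof
    fix n assume "n \<in> N0"
    then have "n \<in> M0" by (rule M0I[of n 0]) (simp add: fsp.span_zero)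
    then show "n \<in> M" using M by blast
  qed
  obtain \<tau> x where x: "\<forall>i\<in>I. \<forall>y. \<tau> i y \<noteq> 0" "adherent x"
    and lim: "\<forall>f\<in>polyfun {\<lambda>v. l (v i) | i l. i \<in> I \<and> Vector_Spaces.linear sc (*) l}.
        (\<lambda>y. f (\<lambda>i. sc (\<tau> i y) (w y i))) - cfun (f x) \<in> M"
    using limit[OF M(1) N0M] by blast
  define P where "P = (\<lambda>y. \<Prod>i\<in>I. \<tau> i y ^ e)"
  have lim': "P * (H \<circ> w) - cfun (H x) \<in> M" if "H \<in> multiforms sc I (\<lambda>_. e)" for H
  proof -
    have "(\<lambda>y. H (\<lambda>i. sc (\<tau> i y) (w y i))) = P * (H \<circ> w)"
      by (auto simp: fun_eq_iff P_def multiforms_hom[OF that])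
    moreover have "H \<in> polyfun {\<lambda>v. l (v i) | i l. i \<in> I \<and> Vector_Spaces.linear sc (*) l}"
      using that by (simp add: multiforms_def)
    ultimately show ?thesis using bspec[OF lim, of H] by (simp only:)
  qed
  have "F l x = 0" if l: "l \<in> T" for l
  proof -
    define h where "h = (\<lambda>y. f l y / unitize g y)"
    \<comment> \<open>With exponent 1 the identity would fail where g is zero and
      \<open>unitize g\<close> is 1; with exponent 2 both sides are zero there.\<close>
    have "g ^ 2 * (h - 0) = f l * g ^ 1"
      by (auto simp: fun_eq_iff h_def unitize_def power2_eq_square)
    also have "f l * g ^ 1 \<in> ?S 2"
      using fsp.span_base[OF int_monos_gen[OF T(1) l, of f g 1]] by (simp only: numeral_2_eq_2 One_nat_def)
    finally have "h \<in> M0" by (rule M0I[OF N0_zero])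
    then have hM: "h \<in> M" using M by blast
    have "f l = unitize g * h" by (auto simp: fun_eq_iff h_def unitize_nz)
    \<comment> \<open>The first summand lies in \<open>N0\<close>. In the second, P g has a residue
      at the place and h lies in M.\<close>
    then have 1: "P * f l = (P * h) * (unitize g - g) + (P * g) * h"
      by (simp add: algebra_simps)
    have 2: "(P * h) * (unitize g - g) \<in> M"
      using N0_mult[OF unitize_form[OF G]] N0M unfolding g_def by blast
    have 3: "(P * g) * h \<in> M"
      using pl.AM_mult[OF pl.AI[OF lim'[OF G(1)]] hM] unfolding g_def .
    have "P * f l \<in> M" unfolding 1 by (rule pl.Madd[OF 2 3])
    from pl.Mdiff[OF this lim'[OF T(2)[OF l], folded f_def]]
    have "cfun (F l x) \<in> M" by (simp only: diff_diff_eq2 add_diff_cancel_left')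
    then show ?thesis by (simp only: pl.Mk_iff)
  qed
  then show False using no[OF x(2)] by blast
qed

end

definition monomial :: "'l set \<Rightarrow> ('l \<Rightarrow> 'p \<Rightarrow> 'k::field) \<Rightarrow> 'j set \<Rightarrow> ('j \<Rightarrow> 'p \<Rightarrow> 'k) \<Rightarrow>
    ('l \<Rightarrow> nat) \<Rightarrow> ('j \<Rightarrow> nat) \<Rightarrow> 'p \<Rightarrow> 'k" where
  "monomial T F J G \<alpha> \<gamma> = (\<Prod>l\<in>T. F l ^ \<alpha> l) * (\<Prod>j\<in>J. G j ^ \<gamma> j)"

text \<open>Each term of the equation for a power of G_j contains some F_l, so substituting it
  strictly lowers the total degree in the G's while preserving the full degree.\<close>

lemma monomial_reduce:
  assumes J: "finite J" and fT: "finite T" and int: "\<And>j. j \<in> J \<Longrightarrow> G j ^ mm j \<in> fsp.span (int_monos T F (G j) (mm j))"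
  shows "monomial T F J G \<alpha> \<gamma> \<in> fsp.span {monomial T F J G \<alpha>' \<gamma>' | \<alpha>' \<gamma>'.
     (\<forall>j\<in>J. \<gamma>' j < mm j) \<and> sum \<alpha>' T + sum \<gamma>' J = sum \<alpha> T + sum \<gamma> J}"
proof (induction "sum \<gamma> J" arbitrary: \<alpha> \<gamma> rule: less_induct)
  case less
  let ?S = "\<lambda>D. {monomial T F J G \<alpha>' \<gamma>' | \<alpha>' \<gamma>'. (\<forall>j\<in>J. \<gamma>' j < mm j) \<and> sum \<alpha>' T + sum \<gamma>' J = D}"
  show ?case
  proof (cases "\<forall>j\<in>J. \<gamma> j < mm j")
    case True then show ?thesis by (intro fsp.span_base) blast
  next
    case False
    then obtain j where j: "j \<in> J" "mm j \<le> \<gamma> j" by (meson not_le)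
    define R where "R = (\<Prod>l\<in>T. F l ^ \<alpha> l) * (G j ^ (\<gamma> j - mm j) * (\<Prod>j'\<in>J - {j}. G j' ^ \<gamma> j'))"
    have "(\<Prod>j'\<in>J. G j' ^ \<gamma> j') = G j ^ \<gamma> j * (\<Prod>j'\<in>J - {j}. G j' ^ \<gamma> j')"
      by (rule prod.remove[OF J j(1)])
    moreover have "G j ^ \<gamma> j = G j ^ (\<gamma> j - mm j) * G j ^ mm j" using j by (simp flip: power_add)
    ultimately have eq: "monomial T F J G \<alpha> \<gamma> = R * G j ^ mm j"
      unfolding monomial_def R_def by (simp add: algebra_simps)
    show ?thesis unfolding eq
    proof (rule fspan_mult_left[OF int[OF j(1)]])
      fix s assume "s \<in> int_monos T F (G j) (mm j)"
      then obtain \<beta> i where s: "s = (\<Prod>l\<in>T. F l ^ \<beta> l) * G j ^ i" "\<exists>l\<in>T. \<beta> l \<ge> 1" "sum \<beta> T + i = mm j"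
        unfolding int_monos_def by blast
      define \<gamma>' where "\<gamma>' = \<gamma>(j := \<gamma> j - mm j + i)"
      have b: "sum \<beta> T \<ge> 1" 
      proof -
        obtain l where l: "l \<in> T" "\<beta> l \<ge> 1" using s(2) by blast
        have "\<beta> l \<le> sum \<beta> T" by (rule member_le_sum[OF l(1) _ fT]) simp
        then show ?thesis using l(2) by (rule order_trans[rotated])
      qed
      have pr: "(\<Prod>j'\<in>J. G j' ^ \<gamma>' j') = G j ^ (\<gamma> j - mm j + i) * (\<Prod>j'\<in>J - {j}. G j' ^ \<gamma> j')"
        unfolding prod.remove[OF J j(1)] by (auto simp: \<gamma>'_def intro!: prod.cong)
      have e: "R * s = monomial T F J G (\<lambda>l. \<alpha> l + \<beta> l) \<gamma>'"
        unfolding monomial_def R_def s(1) pr by (simp add: power_add prod.distrib algebra_simps)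
      have sg: "sum \<gamma> J = \<gamma> j + sum \<gamma> (J - {j})" "sum \<gamma>' J = \<gamma> j - mm j + i + sum \<gamma> (J - {j})"
        unfolding sum.remove[OF J j(1)] by (auto simp: \<gamma>'_def intro!: sum.cong)
      show "R * s \<in> fsp.span (?S (sum \<alpha> T + sum \<gamma> J))"
      proof -
        have "i < mm j" using b s(3) by linarith
        then have "sum \<gamma>' J < sum \<gamma> J" using sg j by linarith
        note lt = less[OF this, of "\<lambda>l. \<alpha> l + \<beta> l"]
        have D: "(\<Sum>l\<in>T. \<alpha> l + \<beta> l) + sum \<gamma>' J = sum \<alpha> T + sum \<gamma> J"
          unfolding sum.distrib using sg s(3) j by linarith
        show ?thesis using lt unfolding e D .
      qed
    qed
  qed
qed

lemma (in vector_space) ex_relation: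
  assumes A: "finite A" and S: "finite S" "card S < card A" and v: "\<And>a. a \<in> A \<Longrightarrow> v a \<in> span S"
  shows "\<exists>c. (\<exists>a\<in>A. c a \<noteq> 0) \<and> (\<Sum>a\<in>A. scale (c a) (v a)) = 0"
proof (cases "inj_on v A")
  case True
  have "dependent (v ` A)"
    using independent_span_bound[OF S(1), of "v ` A"] v card_image[OF True] S(2) by force
  then obtain u where u: "\<exists>x\<in>v ` A. u x \<noteq> 0" "(\<Sum>x\<in>v ` A. scale (u x) x) = 0"
    using dependent_finite[of "v ` A"] A by auto
  have "(\<Sum>a\<in>A. scale (u (v a)) (v a)) = 0" using u(2) by (simp add: sum.reindex[OF True])
  then show ?thesis using u(1) by (intro exI[of _ "\<lambda>a. u (v a)"]) auto
next
  case False
  then obtain a b where ab: "a \<in> A" "b \<in> A" "a \<noteq> b" "v a = v b" unfolding inj_on_def by blast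
  define c :: "_ \<Rightarrow> 'a" where "c x = (if x = a then 1 else if x = b then - 1 else 0)" for x
  have "(\<Sum>x\<in>A. scale (c x) (v x)) = (\<Sum>x\<in>{a, b}. scale (c x) (v x))"
    by (rule sum.mono_neutral_right) (use A ab in \<open>auto simp: c_def\<close>)
  also have "\<dots> = 0" using ab by (simp add: c_def)
  finally have "(\<Sum>x\<in>A. scale (c x) (v x)) = 0" .
  moreover have "c a \<noteq> 0" by (simp add: c_def)
  ultimately show ?thesis using ab(1) by blast
qed

text \<open>After reduction the exponents of the G's are bounded independently of D. The exponents
  of the F's are at most D, and the total degree determines one of them, whence the exponent |T| -
  1.\<close>

lemma monomial_bound:
  assumes T: "finite T" "T \<noteq> {}" and J: "finite J"
    and int: "\<And>j. j \<in> J \<Longrightarrow> \<exists>m. G j ^ m \<in> fsp.span (int_monos T F (G j) m)"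
  shows "\<exists>C. \<forall>D. \<exists>S. finite S \<and> card S \<le> C * (D + 1) ^ (card T - 1) \<and>
     (\<forall>\<alpha> \<gamma>. sum \<alpha> T + sum \<gamma> J = D \<longrightarrow> monomial T F J G \<alpha> \<gamma> \<in> fsp.span S)"
proof -
  have "\<forall>j. \<exists>m. j \<in> J \<longrightarrow> G j ^ m \<in> fsp.span (int_monos T F (G j) m)" using int by blast
  from choice[OF this] obtain mm where mm: "\<And>j. j \<in> J \<Longrightarrow> G j ^ mm j \<in> fsp.span (int_monos T F (G j) (mm j))"
    by blast
  obtain t0 where t0: "t0 \<in> T" using T(2) by blast
  let ?S = "\<lambda>D. {monomial T F J G \<alpha>' \<gamma>' | \<alpha>' \<gamma>'. (\<forall>j\<in>J. \<gamma>' j < mm j) \<and> sum \<alpha>' T + sum \<gamma>' J = D}"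
  define C where "C = (\<Prod>j\<in>J. mm j)"
  have "finite (?S D) \<and> card (?S D) \<le> C * (D + 1) ^ (card T - 1)" for D
  proof -
    let ?P = "(\<Pi>\<^sub>E j\<in>J. {..<mm j}) \<times> (\<Pi>\<^sub>E l\<in>T - {t0}. {..D})"
    \<comment> \<open>The exponent at \<open>t0\<close> is recovered as what remains of the total
      degree.\<close>
    define h where "h = (\<lambda>(\<gamma>, \<alpha>). monomial T F J G
       (\<lambda>l. if l = t0 then D - sum \<gamma> J - sum \<alpha> (T - {t0}) else \<alpha> l) \<gamma>)"
    have sub: "?S D \<subseteq> h ` ?P"
    proof
      fix s assume "s \<in> ?S D"
      then obtain \<alpha> \<gamma> where s: "s = monomial T F J G \<alpha> \<gamma>" "\<forall>j\<in>J. \<gamma> j < mm j" "sum \<alpha> T + sum \<gamma> J = D" by blast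
      have sa: "sum \<alpha> T = \<alpha> t0 + sum \<alpha> (T - {t0})" by (rule sum.remove[OF T(1) t0])
      have le: "\<alpha> l \<le> D" if "l \<in> T" for l
      proof -
        have "\<alpha> l \<le> sum \<alpha> T" by (rule member_le_sum[OF that _ T(1)]) simp
        then show ?thesis using s(3) by linarith
      qed
      have g: "sum (restrict \<gamma> J) J = sum \<gamma> J" "sum (restrict \<alpha> (T - {t0})) (T - {t0}) = sum \<alpha> (T - {t0})"
        by (auto intro!: sum.cong)
      have "h (restrict \<gamma> J, restrict \<alpha> (T - {t0})) = s"
        unfolding h_def s(1) monomial_def case_prod_conv g using s(3) sa
        by (intro arg_cong2[where f = "(*)"] prod.cong refl) auto
      moreover have "(restrict \<gamma> J, restrict \<alpha> (T - {t0})) \<in> ?P" using s(2) le by auto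
      ultimately show "s \<in> h ` ?P" by (metis imageI)
    qed
    have fin: "finite ?P" using T J by (intro finite_cartesian_product finite_PiE) auto
    have "card (?S D) \<le> card ?P" using sub fin by (meson card_image_le card_mono finite_imageI order_trans)
    also have "card ?P = C * (D + 1) ^ (card T - 1)"
      using T J t0 by (simp add: card_cartesian_product card_PiE C_def)
    finally show ?thesis using finite_subset[OF sub] fin by blast
  qed
  moreover have "monomial T F J G \<alpha> \<gamma> \<in> fsp.span (?S D)" if "sum \<alpha> T + sum \<gamma> J = D" for \<alpha> \<gamma> D
    using monomial_reduce[OF J T(1) mm, where \<alpha> = \<alpha> and \<gamma> = \<gamma>] unfolding that .
  ultimately show ?thesis by blast
qed

definition exps :: "nat \<Rightarrow> nat \<Rightarrow> (nat \<Rightarrow> nat) set" where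
  "exps n D = {\<beta>. (\<forall>j>n. \<beta> j = 0) \<and> sum \<beta> {..n} = D}"

lemma finite_exps: "finite (exps n D)"
proof (rule finite_subset)
  show "exps n D \<subseteq> {\<beta>. \<forall>x. (x \<in> {..n} \<longrightarrow> \<beta> x \<in> {..D}) \<and> (x \<notin> {..n} \<longrightarrow> \<beta> x = 0)}"
  proof (intro subsetI CollectI allI conjI impI)
    fix \<beta> x assume b: "\<beta> \<in> exps n D"
    show "\<beta> x = 0" if "x \<notin> {..n}" using b that by (simp add: exps_def)
    show "\<beta> x \<in> {..D}" if "x \<in> {..n}"
      using member_le_sum[of x "{..n}" \<beta>] that b by (simp add: exps_def)
  qed
  show "finite {\<beta>. \<forall>x. (x \<in> {..n} \<longrightarrow> \<beta> x \<in> {..D}) \<and> (x \<notin> {..n} \<longrightarrow> \<beta> x = (0::nat))}"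
    by (rule finite_set_of_finite_funs) auto
qed

text \<open>The first n exponents range freely over 0, ..., q, and the last one fills the degree up
  to n q.\<close>

lemma card_exps: "(q + 1) ^ n \<le> card (exps n (n * q))"
proof -
  let ?A = "\<Pi>\<^sub>E j\<in>{..<n}. {..q}"
  define h where "h \<beta> = (\<lambda>j. if j < n then \<beta> j else if j = n then n * q - sum \<beta> {..<n} else (0::nat))" for \<beta>
  have inj: "inj_on h ?A"
  proof (rule inj_onI)
    fix a b assume a: "a \<in> ?A" and b: "b \<in> ?A" and e: "h a = h b"
    show "a = b"
    proof (rule PiE_ext[OF a b])
      fix j assume "j \<in> {..<n}"
      then show "a j = b j" using fun_cong[OF e, of j] by (simp add: h_def)
    qed
  qed
  have "h \<beta> \<in> exps n (n * q)" if "\<beta> \<in> ?A" for \<beta>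
  proof -
    have "sum \<beta> {..<n} \<le> (\<Sum>j<n. q)" using that by (intro sum_mono) auto
    then have le: "sum \<beta> {..<n} \<le> n * q" by simp
    have "sum (h \<beta>) {..n} = h \<beta> n + sum (h \<beta>) {..<n}"
      by (simp add: lessThan_Suc_atMost[symmetric])
    also have "sum (h \<beta>) {..<n} = sum \<beta> {..<n}" by (rule sum.cong) (auto simp: h_def)
    finally show ?thesis using le by (simp add: exps_def h_def)
  qed
  then have "card (h ` ?A) \<le> card (exps n (n * q))" by (intro card_mono finite_exps) auto
  moreover have "card (h ` ?A) = (q + 1) ^ n" by (simp add: card_image[OF inj] card_PiE)
  ultimately show ?thesis by simp
qed

text \<open>Degree D carries of the order of D^n monomials in the n + 1 functions G_j, which span
  only O(D^(n-1)) dimensions when all G_j are integral over n functions.\<close>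

lemma growth_contradiction:
  fixes G :: "nat \<Rightarrow> 'p \<Rightarrow> 'k::field"
  assumes T: "finite T" "card T = n" "n \<ge> 1"
    and int: "\<And>j. j \<le> n \<Longrightarrow> \<exists>m. G j ^ m \<in> fsp.span (int_monos T F (G j) m)"
    and indep: "\<And>D c. (\<forall>y. (\<Sum>\<beta>\<in>exps n D. c \<beta> * (\<Prod>j\<le>n. G j y ^ \<beta> j)) = 0) \<Longrightarrow> \<forall>\<beta>\<in>exps n D. c \<beta> = 0"
  shows False
proof -
  have T0: "T \<noteq> {}" using T by auto
  obtain C where C: "\<And>D. \<exists>S. finite S \<and> card S \<le> C * (D + 1) ^ (card T - 1) \<and>
     (\<forall>\<alpha> \<gamma>. sum \<alpha> T + sum \<gamma> {..n} = D \<longrightarrow> monomial T F {..n} G \<alpha> \<gamma> \<in> fsp.span S)"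
    using monomial_bound[OF T(1) T0, of "{..n}" G F] int by auto
  \<comment> \<open>Chosen so that C (n q + 1)^(n-1) is at most q (q + 1)^(n-1), which is less than
    (q + 1)^n.\<close>
  define q where "q = C * n ^ (n - 1)"
  define D where "D = n * q"
  obtain S where S: "finite S" "card S \<le> C * (D + 1) ^ (n - 1)"
    "\<And>\<alpha> \<gamma>. sum \<alpha> T + sum \<gamma> {..n} = D \<Longrightarrow> monomial T F {..n} G \<alpha> \<gamma> \<in> fsp.span S"
    using C[of D] T(2) by auto
  have "D + 1 \<le> n * (q + 1)" using T(3) by (simp add: D_def)
  then have "(D + 1) ^ (n - 1) \<le> (n * (q + 1)) ^ (n - 1)" by (rule power_mono) simp
  then have "card S \<le> C * (n * (q + 1)) ^ (n - 1)" using S(2) by (meson le_trans mult_le_mono2)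
  also have "\<dots> = q * (q + 1) ^ (n - 1)" by (simp only: q_def power_mult_distrib mult.assoc)
  also have "\<dots> < (q + 1) ^ n" using T(3) by (cases n) auto
  also have "\<dots> \<le> card (exps n D)" unfolding D_def by (rule card_exps)
  finally have lt: "card S < card (exps n D)" .
  have "(\<Prod>j\<le>n. G j ^ \<beta> j) \<in> fsp.span S" if "\<beta> \<in> exps n D" for \<beta>
    using S(3)[of "\<lambda>_. 0" \<beta>] that by (simp add: monomial_def exps_def)
  then have "\<exists>c. (\<exists>\<beta>\<in>exps n D. c \<beta> \<noteq> 0) \<and> (\<Sum>\<beta>\<in>exps n D. fscale (c \<beta>) (\<Prod>j\<le>n. G j ^ \<beta> j)) = 0"
    by (rule fsp.ex_relation[OF finite_exps S(1) lt])
  then obtain c where c: "\<exists>\<beta>\<in>exps n D. c \<beta> \<noteq> 0" "(\<Sum>\<beta>\<in>exps n D. fscale (c \<beta>) (\<Prod>j\<le>n. G j ^ \<beta> j)) = 0"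
    by (elim exE conjE)
  have pa: "(\<Prod>j\<in>A. G j ^ \<beta> j) y = (\<Prod>j\<in>A. G j y ^ \<beta> j)" for A \<beta> y
  proof -
    have "(G j ^ k) y = G j y ^ k" for j k by (induction k) auto
    then show ?thesis by (induction A rule: infinite_finite_induct) auto
  qed
  have "(\<Sum>\<beta>\<in>exps n D. c \<beta> * (\<Prod>j\<le>n. G j y ^ \<beta> j)) = 0" for y
    using fun_cong[OF c(2), of y] unfolding fun_sum_apply fscale_def pa zero_fun_def .
  then have "\<forall>\<beta>\<in>exps n D. c \<beta> = 0" by (intro indep allI)
  then show False using c(1) by blast
qed

text \<open>A relation on Y_k restricts to Y_(k-1), where all monomials containing G_k vanish, so
  induction on k kills the others. What remains is divisible by G_k, which can be cancelled on the
  irreducible Y_k, and induction on the degree finishes.\<close>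

lemma chain_monomials_independent:
  fixes Y :: "nat \<Rightarrow> ('i \<Rightarrow> 'v::ab_group_add) set" and sc :: "'k::field \<Rightarrow> 'v \<Rightarrow> 'v"
  assumes irr: "\<And>k f g d d'. k \<le> n \<Longrightarrow> f \<in> multiforms sc I d \<Longrightarrow> g \<in> multiforms sc I d' \<Longrightarrow>
      \<exists>y\<in>Y k. f y \<noteq> 0 \<Longrightarrow> \<exists>y\<in>Y k. g y \<noteq> 0 \<Longrightarrow> \<exists>y\<in>Y k. f y \<noteq> 0 \<and> g y \<noteq> 0"
    and mono: "\<And>k. k < n \<Longrightarrow> Y k \<subseteq> Y (Suc k)"
    and G: "\<And>j. j \<le> n \<Longrightarrow> G j \<in> multiforms sc I (\<lambda>_. e)"
    and G0: "\<And>j. j \<le> n \<Longrightarrow> \<exists>y\<in>Y j. G j y \<noteq> 0"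
    and G1: "\<And>j y. j < n \<Longrightarrow> y \<in> Y j \<Longrightarrow> G (Suc j) y = 0"
  shows "k \<le> n \<Longrightarrow> (\<forall>y\<in>Y k. (\<Sum>\<beta>\<in>exps k D. c \<beta> * (\<Prod>j\<le>k. G j y ^ \<beta> j)) = 0) \<Longrightarrow> \<forall>\<beta>\<in>exps k D. c \<beta> = 0"
proof (induction k arbitrary: D c)
  case 0
  obtain y where y: "y \<in> Y 0" "G 0 y \<noteq> 0" using G0[of 0] by blast
  have e: "exps 0 D = {\<lambda>j. if j = 0 then D else 0}" by (auto simp: exps_def fun_eq_iff)
  show ?case using 0(2) y unfolding e by force
next
  case (Suc k)
  note IHk = Suc.IH and kn' = Suc.prems(1)
  show ?case using Suc.prems(2)
  proof (induction D arbitrary: c)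
    case 0
    have "\<beta> = (\<lambda>_. 0)" if "\<beta> \<in> exps (Suc k) 0" for \<beta>
    proof
      fix j show "\<beta> j = 0" using that sum_eq_0_iff[of "{..Suc k}" \<beta>]
        by (cases "j \<le> Suc k") (auto simp: exps_def simp del: sum.atMost_Suc)
    qed
    moreover have "(\<lambda>_. 0) \<in> exps (Suc k) 0" by (simp add: exps_def)
    ultimately have e: "exps (Suc k) 0 = {\<lambda>_. 0}" by blast
    obtain y where "y \<in> Y (Suc k)" using G0[OF kn'] by blast
    then show ?case using 0 unfolding e by auto
  next
    case (Suc D)
    let ?k = "Suc k"
    let ?m = "\<lambda>\<beta> y. \<Prod>j\<le>?k. G j y ^ \<beta> j"
    define up where "up \<beta> = \<beta>(?k := Suc (\<beta> ?k))" for \<beta> :: "nat \<Rightarrow> nat"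
    \<comment> \<open>Monomials free of the last form, and the last form times a monomial of degree
      D.\<close>
    have dec: "exps ?k (Suc D) = exps k (Suc D) \<union> up ` exps ?k D"
    proof (intro equalityI subsetI)
      fix \<beta> assume b: "\<beta> \<in> exps ?k (Suc D)"
      show "\<beta> \<in> exps k (Suc D) \<union> up ` exps ?k D"
      proof (cases "\<beta> ?k")
        case 0
        have "\<beta> j = 0" if "j > k" for j using b 0 that by (cases "j = ?k") (auto simp: exps_def)
        then show ?thesis using b 0 by (auto simp: exps_def)
      next
        case (Suc b')
        have "\<beta> = up (\<beta>(?k := b'))" using Suc by (auto simp: up_def fun_eq_iff)
        moreover have "\<beta>(?k := b') \<in> exps ?k D"
          using b Suc by (auto simp: exps_def)
        ultimately show ?thesis by blast
      qed
    next
      fix \<beta> assume "\<beta> \<in> exps k (Suc D) \<union> up ` exps ?k D"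
      then show "\<beta> \<in> exps ?k (Suc D)" by (auto simp: exps_def up_def)
    qed
    have disj: "exps k (Suc D) \<inter> up ` exps ?k D = {}" by (auto simp: exps_def up_def)
    have inj: "inj_on up (exps ?k D)"
    proof (rule inj_onI)
      fix a b assume e: "up a = up b"
      show "a = b"
      proof
        fix x show "a x = b x" using fun_cong[OF e, of x] by (cases "x = ?k") (auto simp: up_def)
      qed
    qed
    have mk: "?m \<beta> y = (\<Prod>j\<le>k. G j y ^ \<beta> j)" if "\<beta> \<in> exps k (Suc D)" for \<beta> y
      using that by (simp add: exps_def)
    have mup: "?m (up \<beta>) y = G ?k y * ?m \<beta> y" for \<beta> y
    proof -
      have "(\<Prod>j\<le>k. G j y ^ up \<beta> j) = (\<Prod>j\<le>k. G j y ^ \<beta> j)" by (rule prod.cong) (auto simp: up_def)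
      then show ?thesis by (simp add: up_def)
    qed
    have split: "(\<Sum>\<beta>\<in>exps ?k (Suc D). c \<beta> * ?m \<beta> y) =
        (\<Sum>\<beta>\<in>exps k (Suc D). c \<beta> * (\<Prod>j\<le>k. G j y ^ \<beta> j)) + G ?k y * (\<Sum>\<beta>\<in>exps ?k D. c (up \<beta>) * ?m \<beta> y)" for y
    proof -
      have "(\<Sum>\<beta>\<in>exps ?k (Suc D). c \<beta> * ?m \<beta> y) =
        (\<Sum>\<beta>\<in>exps k (Suc D). c \<beta> * ?m \<beta> y) + (\<Sum>\<beta>\<in>up ` exps ?k D. c \<beta> * ?m \<beta> y)"
        unfolding dec by (rule sum.union_disjoint) (auto simp: finite_exps disj)
      moreover have "(\<Sum>\<beta>\<in>up ` exps ?k D. c \<beta> * ?m \<beta> y) = G ?k y * (\<Sum>\<beta>\<in>exps ?k D. c (up \<beta>) * ?m \<beta> y)"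
        unfolding sum.reindex[OF inj] sum_distrib_left comp_def mup
        by (rule sum.cong) (auto simp: algebra_simps)
      moreover have "(\<Sum>\<beta>\<in>exps k (Suc D). c \<beta> * ?m \<beta> y) = (\<Sum>\<beta>\<in>exps k (Suc D). c \<beta> * (\<Prod>j\<le>k. G j y ^ \<beta> j))"
        by (rule sum.cong[OF refl]) (simp only: mk)
      ultimately show ?thesis by simp
    qed
    have kn: "k < n" using kn' by simp
    have "(\<Sum>\<beta>\<in>exps k (Suc D). c \<beta> * (\<Prod>j\<le>k. G j y ^ \<beta> j)) = 0" if "y \<in> Y k" for y
    proof -
      have "y \<in> Y ?k" using that mono[OF kn] by blast
      then have "(\<Sum>\<beta>\<in>exps ?k (Suc D). c \<beta> * ?m \<beta> y) = 0" using Suc.prems by blast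
      then show ?thesis unfolding split[of y] G1[OF kn that] by simp
    qed
    then have c0: "\<forall>\<beta>\<in>exps k (Suc D). c \<beta> = 0"
      by (intro IHk less_imp_le[OF kn] ballI)
    have pz: "G ?k y * (\<Sum>\<beta>\<in>exps ?k D. c (up \<beta>) * ?m \<beta> y) = 0" if "y \<in> Y ?k" for y
    proof -
      have "(\<Sum>\<beta>\<in>exps ?k (Suc D). c \<beta> * ?m \<beta> y) = 0" using Suc.prems that by blast
      then show ?thesis unfolding split[of y] using c0 by simp
    qed
    \<comment> \<open>The cofactor of the last form must be recognized as a multihomogeneous form
      itself, because irreducibility is available for such forms only.\<close>
    have mf: "(\<lambda>y. \<Sum>\<beta>\<in>exps ?k D. c (up \<beta>) * ?m \<beta> y) \<in> multiforms sc I (\<lambda>_. D * e)"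
    proof (intro multiforms_sum multiforms_scale)
      fix \<beta> assume b: "\<beta> \<in> exps ?k D"
      have "?m \<beta> \<in> multiforms sc I (\<lambda>i. \<Sum>j\<le>?k. \<beta> j * e)"
        by (intro multiforms_prod multiforms_power G) (use kn' in auto)
      moreover have "(\<Sum>j\<le>?k. \<beta> j * e) = D * e"
        using b by (simp only: exps_def mem_Collect_eq sum_distrib_right[symmetric])
      ultimately show "?m \<beta> \<in> multiforms sc I (\<lambda>_. D * e)" by (simp only:)
    qed
    have "(\<Sum>\<beta>\<in>exps ?k D. c (up \<beta>) * ?m \<beta> y) = 0" if "y \<in> Y ?k" for y
    proof (rule ccontr)
      assume "(\<Sum>\<beta>\<in>exps ?k D. c (up \<beta>) * ?m \<beta> y) \<noteq> 0"
      then have "\<exists>y\<in>Y ?k. (\<Sum>\<beta>\<in>exps ?k D. c (up \<beta>) * ?m \<beta> y) \<noteq> 0" using that by (rule bexI)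
      from irr[OF kn' G[OF kn'] mf G0[OF kn'] this]
      obtain z where z: "z \<in> Y ?k" "G ?k z \<noteq> 0" "(\<Sum>\<beta>\<in>exps ?k D. c (up \<beta>) * ?m \<beta> z) \<noteq> 0"
        by (elim bexE conjE)
      show False using pz[OF z(1)] z(2,3) by (simp only: mult_eq_0_iff simp_thms)
    qed
    then have "\<forall>\<beta>\<in>exps ?k D. c (up \<beta>) = 0" by (intro Suc.IH ballI)
    then show ?case using c0 unfolding dec by blast
  qed
qed

section \<open>Hilbert's basis theorem\<close>

text \<open>The ideal of A generated by T for a subring A given as a set. Adding one term at a time
  replaces finite linear combinations by induction.\<close>

inductive_set idl :: "'r::comm_ring_1 set \<Rightarrow> 'r set \<Rightarrow> 'r set" for A T where
  zero: "0 \<in> idl A T"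
| step: "a \<in> A \<Longrightarrow> t \<in> T \<Longrightarrow> r \<in> idl A T \<Longrightarrow> a * t + r \<in> idl A T"

definition subring :: "'r::comm_ring_1 set \<Rightarrow> bool" where
  "subring A \<longleftrightarrow> 0 \<in> A \<and> 1 \<in> A \<and> (\<forall>a\<in>A. \<forall>b\<in>A. a + b \<in> A \<and> a * b \<in> A) \<and> (\<forall>a\<in>A. - a \<in> A)"

text \<open>The ascending chain condition for sequences of generators. This is directly the form
  contradicted by a strictly descending chain of closed sets with one separating form per
  step.\<close>

definition noeth :: "'r::comm_ring_1 set \<Rightarrow> bool" where
  "noeth A \<longleftrightarrow> (\<forall>f::nat \<Rightarrow> 'r. (\<forall>j. f j \<in> A) \<longrightarrow> (\<exists>m. f m \<in> idl A (f ` {..<m})))"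

lemma idl_add: "r \<in> idl A T \<Longrightarrow> s \<in> idl A T \<Longrightarrow> r + s \<in> idl A T"
  by (induction rule: idl.induct) (auto simp: add.assoc intro: idl.step)

lemma idl_mult: "r \<in> idl A T \<Longrightarrow> subring A \<Longrightarrow> a \<in> A \<Longrightarrow> a * r \<in> idl A T"
proof (induction rule: idl.induct)
  case zero then show ?case by (simp add: idl.zero)
next
  case (step b t r)
  have "a * (b * t + r) = (a * b) * t + a * r" by (simp add: algebra_simps)
  moreover have "a * b \<in> A" using step by (auto simp: subring_def)
  ultimately show ?case using step idl.step[of "a * b" A t T "a * r"] by simp
qed

lemma idl_neg: "r \<in> idl A T \<Longrightarrow> subring A \<Longrightarrow> - r \<in> idl A T"
  using idl_mult[of r A T "- 1"] by (simp add: subring_def)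

lemma idl_base: "t \<in> T \<Longrightarrow> subring A \<Longrightarrow> t \<in> idl A T"
  using idl.step[of 1 A t T 0] by (simp add: subring_def idl.zero)

lemma idl_mono: "T \<subseteq> T' \<Longrightarrow> r \<in> idl A T \<Longrightarrow> r \<in> idl A T'"
  by (rotate_tac 1, induction rule: idl.induct) (auto intro: idl.intros)

lemma idl_idl: "r \<in> idl A T \<Longrightarrow> subring A \<Longrightarrow> T \<subseteq> idl A T' \<Longrightarrow> r \<in> idl A T'"
proof (induction rule: idl.induct)
  case (step a t r)
  then show ?case by (intro idl_add idl_mult) auto
qed (rule idl.zero)

lemma idl_range_stage: "r \<in> idl A (range f) \<Longrightarrow> \<exists>m. r \<in> idl A (f ` {..<m::nat})"
proof (induction rule: idl.induct)
  case zero show ?case by (auto intro: idl.zero)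
next
  case (step a t r)
  then obtain m j where m: "r \<in> idl A (f ` {..<m})" "t = f j" by auto
  have 1: "r \<in> idl A (f ` {..<max m (Suc j)})" by (rule idl_mono[OF _ m(1)]) auto
  have 2: "t \<in> f ` {..<max m (Suc j)}" using m(2) by auto
  show ?case using idl.step[OF step(1) 2 1] ..
qed

definition polys_over :: "'r::comm_ring_1 set \<Rightarrow> 'r poly set" where
  "polys_over A = {p. \<forall>i. coeff p i \<in> A}"

lemma subring_sum: "subring A \<Longrightarrow> (\<And>i. i \<in> S \<Longrightarrow> f i \<in> A) \<Longrightarrow> sum f S \<in> A"
  by (induction S rule: infinite_finite_induct) (auto simp: subring_def)

lemma subring_polys_over:
  assumes A: "subring A" shows "subring (polys_over A)"
proof -
  have z: "0 \<in> A" "1 \<in> A" and c: "\<And>a b. a \<in> A \<Longrightarrow> b \<in> A \<Longrightarrow> a + b \<in> A" "\<And>a b. a \<in> A \<Longrightarrow> b \<in> A \<Longrightarrow> a * b \<in> A"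
     "\<And>a. a \<in> A \<Longrightarrow> - a \<in> A" using A by (auto simp: subring_def)
  show ?thesis
    unfolding subring_def polys_over_def
  proof (intro conjI ballI CollectI allI)
    fix i show "coeff 0 i \<in> A" "coeff 1 i \<in> A" using z by (simp_all add: coeff_1)
    fix p assume p: "p \<in> {p. \<forall>i. coeff p i \<in> A}"
    from p have pA: "coeff p i \<in> A" for i by blast
    show "coeff (- p) i \<in> A" unfolding coeff_minus by (rule c(3)[OF pA])
    fix q assume q: "q \<in> {p. \<forall>i. coeff p i \<in> A}"
    from q have qA: "coeff q i \<in> A" for i by blast
    show "coeff (p + q) i \<in> A" unfolding coeff_add by (rule c(1)[OF pA qA])
    show "coeff (p * q) i \<in> A" unfolding coeff_mult by (rule subring_sum[OF A]) (rule c(2)[OF pA qA])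
  qed
qed

text \<open>Hilbert's argument: choose elements of least degree outside the ideal of their
  predecessors. A relation among the leading coefficients produces an element outside that ideal of
  smaller degree.\<close>

lemma noeth_polys_over:
  fixes A :: "'r::comm_ring_1 set"
  assumes A: "subring A" "noeth A" shows "noeth (polys_over A)"
proof (rule ccontr)
  let ?P = "polys_over A"
  note P = subring_polys_over[OF A(1)]
  assume "\<not> noeth ?P"
  then have "\<exists>f::nat \<Rightarrow> 'r poly. (\<forall>j. f j \<in> ?P) \<and> (\<forall>m. f m \<notin> idl ?P (f ` {..<m}))"
    by (simp add: noeth_def)
  then obtain f :: "nat \<Rightarrow> 'r poly" where f': "\<forall>j. f j \<in> ?P" "\<forall>m. f m \<notin> idl ?P (f ` {..<m})"
    by (elim exE conjE)
  note f = f'[rule_format]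
  define J where "J = idl ?P (range f)"
  \<comment> \<open>\<open>Q g m r\<close>: r is a least-degree element of J outside the ideal of
    the first m members of g. Its dependence on these members only permits the recursive
    choice.\<close>
  define Q where "Q g m r \<longleftrightarrow> r \<in> J - idl ?P (g ` {..<m}) \<and> (\<forall>s\<in>J - idl ?P (g ` {..<m}). degree r \<le> degree s)"
    for g :: "nat \<Rightarrow> 'r poly" and m r
  have "\<exists>g. \<forall>m. Q g m (g m)"
  proof (rule dependent_wellorder_choice)
    fix r :: "'r poly" and g h :: "nat \<Rightarrow> 'r poly" and m assume "\<And>j. j < m \<Longrightarrow> g j = h j"
    then have "g ` {..<m} = h ` {..<m}" by auto
    then show "Q g m r = Q h m r" unfolding Q_def by simp
  next
    fix m and g :: "nat \<Rightarrow> 'r poly" assume g: "\<And>j. j < m \<Longrightarrow> Q g j (g j)"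
    \<comment> \<open>Finitely many members of g involve finitely many f's, so some
      \<open>f M\<close> remains outside their ideal and the choice never stops.\<close>
    have "\<exists>M. g ` {..<k} \<subseteq> idl ?P (f ` {..<M})" if "k \<le> m" for k
      using that
    proof (induction k)
      case (Suc k)
      then obtain M where M: "g ` {..<k} \<subseteq> idl ?P (f ` {..<M})" by auto
      have "g k \<in> J" using g[of k] Suc.prems by (simp add: Q_def)
      then obtain M' where M': "g k \<in> idl ?P (f ` {..<M'})" using idl_range_stage unfolding J_def by blast
      have "g ` {..<Suc k} \<subseteq> idl ?P (f ` {..<max M M'})"
      proof -
        have s: "f ` {..<M} \<subseteq> f ` {..<max M M'}" "f ` {..<M'} \<subseteq> f ` {..<max M M'}" by auto
        have "r \<in> idl ?P (f ` {..<max M M'})" if "r \<in> g ` {..<k}" for r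
          by (rule idl_mono[OF s(1) subsetD[OF M that]])
        then show ?thesis using idl_mono[OF s(2) M'] by (auto simp: lessThan_Suc)
      qed
      then show ?case by blast
    qed auto
    then obtain M where M: "g ` {..<m} \<subseteq> idl ?P (f ` {..<M})" by blast
    have "f M \<in> J - idl ?P (g ` {..<m})"
    proof
      show "f M \<in> J" unfolding J_def by (rule idl_base[OF rangeI P])
      show "f M \<notin> idl ?P (g ` {..<m})"
        using f(2)[of M] idl_idl[OF _ P M, of "f M"] by (rule contrapos_nn)
    qed
    then show "\<exists>r. Q g m r" unfolding Q_def
      using ex_has_least_nat[of "\<lambda>r. r \<in> J - idl ?P (g ` {..<m})" "f M" degree] by (simp only: Ball_def)
  qed
  then obtain g where g: "\<And>m. Q g m (g m)" by blast
  have gJ: "g m \<in> J" "g m \<notin> idl ?P (g ` {..<m})" for m using g[of m] by (auto simp: Q_def)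
  have JP: "r \<in> ?P" if "r \<in> J" for r
    using that unfolding J_def
  proof (induction rule: idl.induct)
    case (step a t r)
    then have "t \<in> ?P" using f(1) by blast
    with step show ?case using P by (simp add: subring_def)
  qed (use P in \<open>simp add: subring_def\<close>)
  define d where "d m = degree (g m)" for m
  have dmono: "d j \<le> d m" if "j \<le> m" for j m
  proof -
    have "g m \<in> J - idl ?P (g ` {..<j})"
    proof
      show "g m \<in> J" by (rule gJ(1))
      have "g ` {..<j} \<subseteq> g ` {..<m}" using that by auto
      then show "g m \<notin> idl ?P (g ` {..<j})" using gJ(2)[of m] idl_mono by blast
    qed
    then show ?thesis using g[of j] unfolding Q_def d_def by blast
  qed
  define a where "a m = coeff (g m) (d m)" for m
  have "a m \<in> A" for m using JP[OF gJ(1)] by (simp add: a_def polys_over_def)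
  then obtain m where m: "a m \<in> idl A (a ` {..<m})" using A(2) unfolding noeth_def by blast
  \<comment> \<open>The relation of leading coefficients is lifted by multiplying with monomials
    that raise all degrees to \<open>d m\<close>; this is possible because the degrees
    \<open>d j\<close> do not decrease.\<close>
  have "\<exists>q\<in>idl ?P (g ` {..<m}). degree q \<le> d m \<and> coeff q (d m) = r" if "r \<in> idl A (a ` {..<m})" for r
    using that
  proof (induction rule: idl.induct)
    case zero show ?case by (auto intro!: bexI[of _ 0] idl.zero)
  next
    case (step c t r)
    then obtain q where q: "q \<in> idl ?P (g ` {..<m})" "degree q \<le> d m" "coeff q (d m) = r" by blast
    obtain j where j: "j < m" "t = a j" using step(2) by auto
    have dj: "d j \<le> d m" using dmono j by simp
    let ?q = "monom c (d m - d j) * g j + q"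
    have "monom c (d m - d j) \<in> ?P" using step(1) A(1) by (auto simp: polys_over_def subring_def)
    then have "?q \<in> idl ?P (g ` {..<m})" using j q by (intro idl.step) auto
    moreover have "degree (monom c (d m - d j) * g j) \<le> d m"
      using degree_mult_le[of "monom c (d m - d j)" "g j"] degree_monom_le[of c "d m - d j"] dj
      unfolding d_def by linarith
    then have "degree ?q \<le> d m" using q(2) by (rule degree_add_le)
    moreover have "coeff ?q (d m) = c * t + r"
      using dj q(3) j by (simp add: coeff_monom_mult a_def)
    ultimately show ?case by blast
  qed
  from this[OF m] obtain q where q: "q \<in> idl ?P (g ` {..<m})" "degree q \<le> d m" "coeff q (d m) = a m" by blast
  have qJ: "q \<in> J"
    unfolding J_def by (rule idl_idl[OF q(1) P]) (use gJ(1) J_def in auto)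
  let ?r = "g m - q"
  have nid: "?r \<notin> idl ?P (g ` {..<m})" using idl_add[of ?r ?P "g ` {..<m}" q] q(1) gJ(2)[of m] by auto
  moreover have "?r \<in> J" using idl_add[OF gJ(1)[of m, unfolded J_def] idl_neg[OF qJ[unfolded J_def] P]] unfolding J_def by simp
  ultimately have ge: "d m \<le> degree ?r" using g[of m] unfolding Q_def d_def by blast
  have "coeff ?r (d m) = 0" using q(3) by (simp add: a_def)
  moreover have "degree ?r \<le> d m" using q(2) by (intro degree_diff_le) (auto simp: d_def)
  ultimately have "?r = 0" using ge by (metis le_antisym leading_coeff_0_iff)
  then show False using nid idl.zero[of ?P "g ` {..<m}"] by simp
qed

text \<open>The adjunction A[x] is an image of the polynomial ring, and the chain condition descends
  along evaluation.\<close>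

lemma noeth_adjoin:
  assumes A: "subring A" "noeth A"
  shows "noeth {poly p x | p. p \<in> polys_over A}"
  unfolding noeth_def
proof (intro allI impI)
  fix f :: "nat \<Rightarrow> 'a" assume "\<forall>j. f j \<in> {poly p x | p. p \<in> polys_over A}"
  then have "\<forall>j. \<exists>p. f j = poly p x \<and> p \<in> polys_over A" by blast
  then obtain p where p: "\<And>j. f j = poly (p j) x" "\<And>j. p j \<in> polys_over A" by metis
  obtain m where m: "p m \<in> idl (polys_over A) (p ` {..<m})"
    using noeth_polys_over[OF A] p(2) unfolding noeth_def by blast
  have "poly r x \<in> idl {poly p x | p. p \<in> polys_over A} (f ` {..<m})" if "r \<in> idl (polys_over A) (p ` {..<m})" for r
    using that
  proof (induction rule: idl.induct)
    case zero show ?case by (simp add: idl.zero)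
  next
    case (step a t r)
    then show ?case unfolding poly_add poly_mult by (intro idl.step) (auto simp: p(1))
  qed
  from this[OF m] show "\<exists>m. f m \<in> idl {poly p x | p. p \<in> polys_over A} (f ` {..<m})" unfolding p(1)[symmetric] by blast
qed

lemma subring_adjoin:
  assumes A: "subring A" shows "subring {poly p x | p. p \<in> polys_over A}"
proof -
  have P: "subring (polys_over A)" by (rule subring_polys_over[OF A])
  have *: "q \<in> polys_over A \<Longrightarrow> poly q x \<in> {poly p x | p. p \<in> polys_over A}" for q by blast
  show ?thesis unfolding subring_def
  proof (intro conjI ballI)
    show "0 \<in> {poly p x | p. p \<in> polys_over A}" using *[of 0] P by (simp only: subring_def poly_0)
    show "1 \<in> {poly p x | p. p \<in> polys_over A}" using *[of 1] P by (simp only: subring_def poly_1)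
    fix a assume "a \<in> {poly p x | p. p \<in> polys_over A}"
    then obtain p where p: "p \<in> polys_over A" "a = poly p x" by blast
    have "- p \<in> polys_over A" using P p by (simp add: subring_def)
    from *[OF this] show "- a \<in> {poly p x | p. p \<in> polys_over A}" unfolding p(2) poly_minus .
    fix b assume "b \<in> {poly p x | p. p \<in> polys_over A}"
    then obtain q where q: "q \<in> polys_over A" "b = poly q x" by blast
    have "p + q \<in> polys_over A" "p * q \<in> polys_over A" using P p q by (auto simp: subring_def)
    from this[THEN *] show "a + b \<in> {poly p x | p. p \<in> polys_over A}" "a * b \<in> {poly p x | p. p \<in> polys_over A}"
      unfolding p(2) q(2) poly_add poly_mult .
  qed
qed

text \<open>Functions are adjoined one at a time to the constants, which avoids polynomial rings in
  several variables.\<close>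

lemma ex_noeth_ring:
  fixes x :: "nat \<Rightarrow> 'p \<Rightarrow> 'k::field"
  shows "\<exists>A. subring A \<and> noeth A \<and> (\<forall>c. cfun c \<in> A) \<and> (\<forall>i<m. x i \<in> A)"
proof (induction m)
  case 0
  let ?A = "range (cfun :: 'k \<Rightarrow> 'p \<Rightarrow> 'k)"
  have cI: "\<And>f c. f = cfun c \<Longrightarrow> f \<in> ?A" by blast
  have S: "subring ?A"
    unfolding subring_def
  proof (intro conjI ballI)
    show "0 \<in> ?A" by (rule cI[of _ 0]) (simp add: fun_eq_iff)
    show "1 \<in> ?A" by (rule cI[of _ 1]) (simp add: fun_eq_iff)
    fix a :: "'p \<Rightarrow> 'k" assume "a \<in> ?A"
    then obtain c where c: "a = cfun c" by blast
    show "- a \<in> ?A" by (rule cI[of _ "- c"]) (simp add: c fun_eq_iff)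
    fix b :: "'p \<Rightarrow> 'k" assume "b \<in> ?A"
    then obtain d where d: "b = cfun d" by blast
    show "a + b \<in> ?A" by (rule cI[of _ "c + d"]) (simp add: c d fun_eq_iff)
    show "a * b \<in> ?A" by (rule cI[of _ "c * d"]) (simp add: c d fun_eq_iff)
  qed
  have "noeth ?A"
    unfolding noeth_def
  proof (intro allI impI)
    fix f :: "nat \<Rightarrow> 'p \<Rightarrow> 'k" assume f: "\<forall>j. f j \<in> ?A"
    show "\<exists>m. f m \<in> idl ?A (f ` {..<m})"
    proof (cases "f 0 = 0")
      case True then show ?thesis using idl.zero by metis
    next
      case False
      obtain c d where c: "f 0 = cfun c" "f 1 = cfun d" using f by (metis rangeE)
      have c0: "c \<noteq> 0" using False c by (auto simp: fun_eq_iff)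
      have e: "f 1 = cfun (d / c) * f 0 + 0" using c0 c by (simp add: fun_eq_iff)
      have "cfun (d / c) * f 0 + 0 \<in> idl ?A (f ` {..<1})"
        by (rule idl.step[OF rangeI _ idl.zero]) (rule imageI, simp)
      then show ?thesis by (intro exI[of _ 1]) (simp only: e)
    qed
  qed
  then show ?case using S by blast
next
  case (Suc m)
  then obtain A where A: "subring A" "noeth A" "\<And>c. cfun c \<in> A" "\<And>i. i < m \<Longrightarrow> x i \<in> A" by blast
  let ?B = "{poly p (x m) | p. p \<in> polys_over A}"
  have BI: "poly p (x m) \<in> ?B" if "p \<in> polys_over A" for p using that by blast
  have z: "0 \<in> A" "1 \<in> A" using A(1) by (auto simp: subring_def)
  have AB: "a \<in> ?B" if "a \<in> A" for a
  proof -
    have "[:a:] \<in> polys_over A" using that z by (auto simp: polys_over_def coeff_pCons split: nat.split)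
    from BI[OF this] show ?thesis by simp
  qed
  have "[:0, 1:] \<in> polys_over A" using z by (auto simp: polys_over_def coeff_pCons split: nat.split)
  from BI[OF this] have "x m \<in> ?B" by simp
  then have xB: "x i \<in> ?B" if "i < Suc m" for i
    using AB[OF A(4), of i] that by (cases "i = m") (simp_all only: less_Suc_eq simp_thms)
  show ?case
  proof (intro exI[of _ ?B] conjI allI impI)
    show "cfun c \<in> ?B" for c by (rule AB[OF A(3)])
    show "i < Suc m \<Longrightarrow> x i \<in> ?B" for i by (rule xB)
  qed (rule subring_adjoin[OF A(1)], rule noeth_adjoin[OF A(1,2)])
qed

section \<open>The Zariski topology on sets of points with homogeneous coordinates\<close>

definition nonvan :: "('p \<Rightarrow> 'v set) \<Rightarrow> 'p set \<Rightarrow> ('v \<Rightarrow> 'k::field) \<Rightarrow> 'p set" where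
  "nonvan rep X f = {x \<in> X. \<forall>v\<in>rep x. f v \<noteq> 0}"

lemma openin_nonvan: "f \<in> H d \<Longrightarrow> openin (cone_zariski rep H X) (nonvan rep X f)"
  unfolding cone_zariski_def openin_topology_generated_by_iff nonvan_def
  by (rule generate_topology_on.Basis) blast

text \<open>Intersections of the generating sets are again of this kind, by products of forms, so
  they are a basis and not merely a subbasis.\<close>

lemma openin_cone_zariski_iff:
  assumes mult: "\<And>d d' f g. f \<in> H d \<Longrightarrow> g \<in> H d' \<Longrightarrow> \<exists>d''. (\<lambda>v. f v * g v) \<in> H d''"
  shows "openin (cone_zariski rep H X) U \<longleftrightarrow>
     (\<forall>x\<in>U. \<exists>d. \<exists>f\<in>H d. x \<in> nonvan rep X f \<and> nonvan rep X f \<subseteq> U)"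
proof
  assume "openin (cone_zariski rep H X) U"
  then have "generate_topology_on {{x \<in> X. \<forall>v\<in>rep x. f v \<noteq> 0} | f. \<exists>d. f \<in> H d} U"
    unfolding cone_zariski_def openin_topology_generated_by_iff .
  then show "\<forall>x\<in>U. \<exists>d. \<exists>f\<in>H d. x \<in> nonvan rep X f \<and> nonvan rep X f \<subseteq> U"
  proof induction
    case (Int A B)
    show ?case
    proof
      fix x assume "x \<in> A \<inter> B"
      then obtain d f d' g where f: "f \<in> H d" "x \<in> nonvan rep X f" "nonvan rep X f \<subseteq> A"
        and g: "g \<in> H d'" "x \<in> nonvan rep X g" "nonvan rep X g \<subseteq> B" using Int.IH by blast
      obtain d'' where fg: "(\<lambda>v. f v * g v) \<in> H d''" using mult[OF f(1) g(1)] by blast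
      have "nonvan rep X (\<lambda>v. f v * g v) = nonvan rep X f \<inter> nonvan rep X g" by (auto simp: nonvan_def)
      then show "\<exists>d. \<exists>f\<in>H d. x \<in> nonvan rep X f \<and> nonvan rep X f \<subseteq> A \<inter> B"
        using fg f g by blast
    qed
  next
    case (UN K)
    show ?case
    proof
      fix x assume "x \<in> \<Union>K"
      then obtain A where "A \<in> K" "x \<in> A" by blast
      then show "\<exists>d. \<exists>f\<in>H d. x \<in> nonvan rep X f \<and> nonvan rep X f \<subseteq> \<Union>K" using UN.IH by blast
    qed
  next
    case (Basis s)
    then obtain f d where "s = nonvan rep X f" "f \<in> H d" unfolding nonvan_def by blast
    then show ?case by blast
  qed simp
next
  assume *: "\<forall>x\<in>U. \<exists>d. \<exists>f\<in>H d. x \<in> nonvan rep X f \<and> nonvan rep X f \<subseteq> U"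
  show "openin (cone_zariski rep H X) U"
    unfolding openin_subopen[of _ U]
  proof
    fix x assume "x \<in> U"
    from bspec[OF * this] obtain d f where f: "f \<in> H d" "x \<in> nonvan rep X f" "nonvan rep X f \<subseteq> U"
      by (elim exE bexE conjE)
    show "\<exists>T. openin (cone_zariski rep H X) T \<and> x \<in> T \<and> T \<subseteq> U"
      by (intro exI[of _ "nonvan rep X f"] conjI openin_nonvan[where H = H, OF f(1)] f)
  qed
qed

lemma topspace_cone_zariski:
  assumes "f \<in> H d" "\<And>v. f v \<noteq> 0" shows "topspace (cone_zariski rep H X) = X"
proof
  have "X = nonvan rep X f" using assms(2) by (auto simp: nonvan_def)
  then have "openin (cone_zariski rep H X) X" using openin_nonvan[where H = H and d = d and f = f, OF assms(1)] by metis
  then show "X \<subseteq> topspace (cone_zariski rep H X)" by (rule openin_subset)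
  show "topspace (cone_zariski rep H X) \<subseteq> X"
    unfolding cone_zariski_def topology_generated_by_topspace by blast
qed

context
  fixes sc :: "'k::field \<Rightarrow> 'v::ab_group_add \<Rightarrow> 'v"
begin

text \<open>A single projective space is the product over a one-element index set; this transfers
  everything shown for \<open>multi_points\<close>.\<close>

lemma forms_to_multiforms:
  assumes "f \<in> forms sc d"
  shows "(\<lambda>v. f (v ())) \<in> multiforms sc {()} (\<lambda>_. d)"
proof -
  have "(\<lambda>v. f (v ())) \<in> polyfun {\<lambda>v. l (v i) | i l. i \<in> {()} \<and> Vector_Spaces.linear sc (*) l}"
    if "f \<in> polyfun {l. Vector_Spaces.linear sc (*) l}" for f
    using that
  proof induction
    case (gen f) then show ?case by (intro polyfun.gen) auto
  qed (auto intro: polyfun.intros)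
  then show ?thesis using assms by (auto simp: forms_def multiforms_def)
qed

lemma multiforms_to_forms:
  assumes "F \<in> multiforms sc {()} d"
  shows "(\<lambda>u. F (\<lambda>_. u)) \<in> forms sc (d ())"
proof -
  have "(\<lambda>u. F (\<lambda>_. u)) \<in> polyfun {l. Vector_Spaces.linear sc (*) l}"
    if "F \<in> polyfun {\<lambda>v. l (v i) | i l. i \<in> {()} \<and> Vector_Spaces.linear sc (*) l}" for F
    using that
  proof induction
    case (gen f)
    then obtain l i where "f = (\<lambda>v. l (v i))" "Vector_Spaces.linear sc (*) l" by blast
    then show ?case by (intro polyfun.gen) simp
  qed (auto intro: polyfun.intros)
  moreover have "F (\<lambda>_. sc c u) = c ^ d () * F (\<lambda>_. u)" for c u
    using multiforms_hom[OF assms, of "\<lambda>_. c" "\<lambda>_. u"] by simp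
  ultimately show ?thesis using assms by (auto simp: forms_def multiforms_def)
qed

lemma forms_zero: "(\<lambda>v. 0) \<in> forms sc d"
  by (auto simp: forms_def intro: polyfun.intros)

lemma forms_const: "(\<lambda>v. c) \<in> forms sc 0"
  by (auto simp: forms_def intro: polyfun.intros)

lemma forms_mult: "f \<in> forms sc d \<Longrightarrow> g \<in> forms sc d' \<Longrightarrow> (\<lambda>v. f v * g v) \<in> forms sc (d + d')"
  by (auto simp: forms_def power_add algebra_simps intro: polyfun.intros)

lemma forms_add: "f \<in> forms sc d \<Longrightarrow> g \<in> forms sc d \<Longrightarrow> (\<lambda>v. f v + g v) \<in> forms sc d"
  by (auto simp: forms_def algebra_simps intro: polyfun.intros)

lemma forms_scale: "f \<in> forms sc d \<Longrightarrow> (\<lambda>v. c * f v) \<in> forms sc d"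
  by (auto simp: forms_def algebra_simps intro: polyfun.mult[OF polyfun.const])

lemma forms_diff: "f \<in> forms sc d \<Longrightarrow> g \<in> forms sc d \<Longrightarrow> (\<lambda>v. f v - g v) \<in> forms sc d"
  using forms_add[OF _ forms_scale[of g d "-1"]] by simp

lemma forms_power: assumes "f \<in> forms sc d" shows "(\<lambda>v. f v ^ n) \<in> forms sc (n * d)"
proof (induction n)
  case 0 show ?case using forms_const[of 1] by simp
next
  case (Suc n) show ?case using forms_mult[OF assms Suc] by simp
qed

lemma forms_prod:
  assumes "\<And>j. j \<in> J \<Longrightarrow> f j \<in> forms sc (d j)"
  shows "(\<lambda>v. \<Prod>j\<in>J. f j v) \<in> forms sc (sum d J)"
  using assms
proof (induction J rule: infinite_finite_induct)
  case (insert x F)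
  then show ?case using forms_mult[of "f x" "d x" "\<lambda>v. \<Prod>j\<in>F. f j v"] by simp
qed (use forms_const[of 1] in simp_all)

lemma forms_linear: "Vector_Spaces.linear sc (*) l \<Longrightarrow> l \<in> forms sc 1"
  by (auto simp: forms_def Vector_Spaces.linear_iff intro!: polyfun.gen)

lemma forms_hom: "f \<in> forms sc d \<Longrightarrow> f (sc c v) = c ^ d * f v"
  by (auto simp: forms_def)

end

context vector_space
begin

lemma lines_memD:
  assumes "L \<in> lines scale V" "v \<in> L" "v \<noteq> 0" "u \<in> L" "u \<noteq> 0"
  shows "\<exists>c. c \<noteq> 0 \<and> u = scale c v"
proof -
  obtain z where z: "L = span {z}" using assms(1) unfolding lines_def by blast
  obtain a b where ab: "v = scale a z" "u = scale b z" using assms z by (auto simp: span_singleton)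
  have "a \<noteq> 0" "b \<noteq> 0" using ab assms by auto
  then have "u = scale (b / a) v" using ab by simp
  then show ?thesis using \<open>a \<noteq> 0\<close> \<open>b \<noteq> 0\<close> by (intro exI[of _ "b / a"]) simp
qed

lemma lines_span_eq:
  assumes "L \<in> lines scale V" "v \<in> L" "v \<noteq> 0" shows "L = span {v}"
proof -
  obtain z where z: "L = span {z}" using assms(1) unfolding lines_def by blast
  obtain a where a: "v = scale a z" using assms z by (auto simp: span_singleton)
  then have "a \<noteq> 0" using assms by auto
  then have "z = scale (inverse a) v" using a by simp
  then have "z \<in> span {v}" by (simp add: span_scale span_base)
  then show ?thesis using assms(2) unfolding z by (simp add: span_eq)
qed

lemma lines_ex_nonzero:
  assumes "L \<in> lines scale V" shows "\<exists>v. v \<in> L \<and> v \<noteq> 0 \<and> v \<in> V"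
  using assms unfolding lines_def by (auto intro: span_base)

lemma lines_subspace_mem:
  assumes "L \<in> lines scale V" "subspace V" "v \<in> L" shows "v \<in> V"
proof -
  obtain z where "L = span {z}" "z \<in> V" using assms(1) unfolding lines_def by blast
  then show ?thesis using assms span_minimal[of "{z}" V] by blast
qed

lemma nonvan_forms_iff:
  assumes "f \<in> forms scale d" "L \<in> lines scale V" "v \<in> L" "v \<noteq> 0" "L \<in> X"
  shows "L \<in> nonvan (\<lambda>L. L - {0}) X f \<longleftrightarrow> f v \<noteq> 0"
proof
  assume "L \<in> nonvan (\<lambda>L. L - {0}) X f" then show "f v \<noteq> 0" using assms by (auto simp: nonvan_def)
next
  assume fv: "f v \<noteq> 0"
  have "f u \<noteq> 0" if "u \<in> L" "u \<noteq> 0" for u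
    using lines_memD[OF assms(2,3,4) that] forms_hom[OF assms(1)] fv by auto
  then show "L \<in> nonvan (\<lambda>L. L - {0}) X f" using assms(5) by (auto simp: nonvan_def)
qed

lemma openin_proj_sub_iff:
  "openin (zar (proj_sub scale X)) U \<longleftrightarrow>
     (\<forall>x\<in>U. \<exists>d. \<exists>f\<in>forms scale d. x \<in> nonvan (\<lambda>L. L - {0}) X f \<and> nonvan (\<lambda>L. L - {0}) X f \<subseteq> U)"
proof -
  have e: "zar (proj_sub scale X) = cone_zariski (\<lambda>L. L - {0}) (forms scale) X"
    by (simp add: proj_sub_def cone_space_def)
  show ?thesis unfolding e by (rule openin_cone_zariski_iff) (rule exI, rule forms_mult)
qed

lemma topspace_proj_sub: "topspace (zar (proj_sub scale X)) = X"
  unfolding proj_sub_def cone_space_def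
  using topspace_cone_zariski[where H = "forms scale", OF forms_const[of 1]] by simp

text \<open>The neighbourhood is shrunk to a set F nonzero, since irreducibility will be used for
  forms rather than for open sets.\<close>

lemma reg_proj_sub_local:
  assumes h: "h \<in> reg (proj_sub scale X) U" and x: "x \<in> U" and X: "X \<subseteq> lines scale W"
    and v: "v \<in> x" "v \<noteq> 0"
  shows "\<exists>d F A B e. F \<in> forms scale e \<and> A \<in> forms scale d \<and> B \<in> forms scale d \<and> F v \<noteq> 0 \<and> B v \<noteq> 0 \<and>
     (\<forall>y\<in>X. \<forall>u\<in>y. u \<noteq> 0 \<longrightarrow> F u \<noteq> 0 \<longrightarrow> y \<in> U \<and> B u \<noteq> 0 \<and> h y = A u / B u)"
proof -
  have "h \<in> cone_regular (\<lambda>L. L - {0}) (forms scale) X U"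
    using h by (simp add: proj_sub_def cone_space_def)
  then obtain N d f g where N: "openin (cone_zariski (\<lambda>L. L - {0}) (forms scale) X) N" "x \<in> N" "N \<subseteq> U"
    "f \<in> forms scale d" "g \<in> forms scale d" "\<forall>y\<in>N. \<forall>v\<in>y - {0}. g v \<noteq> 0 \<and> h y = f v / g v"
    using x unfolding cone_regular_def by blast
  have "openin (zar (proj_sub scale X)) N" using N(1) by (simp add: proj_sub_def cone_space_def)
  then obtain e F where F: "F \<in> forms scale e" "x \<in> nonvan (\<lambda>L. L - {0}) X F" "nonvan (\<lambda>L. L - {0}) X F \<subseteq> N"
    using N(2) unfolding openin_proj_sub_iff by blast
  have xX: "x \<in> X" using F(2) by (simp add: nonvan_def)
  have "F v \<noteq> 0" using nonvan_forms_iff[OF F(1) _ v xX] F(2) X xX by blast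
  moreover have "g v \<noteq> 0" using N(2,6) v by blast
  moreover have "y \<in> U \<and> g u \<noteq> 0 \<and> h y = f u / g u" if "y \<in> X" "u \<in> y" "u \<noteq> 0" "F u \<noteq> 0" for y u
  proof -
    have "y \<in> N" using nonvan_forms_iff[OF F(1) _ that(2,3,1)] that(1,4) X F(3) by blast
    then show ?thesis using N(3,6) that by blast
  qed
  ultimately show ?thesis using F(1) N(4,5) by blast
qed

end

section \<open>Curves\<close>

lemma fscale_alt: "(\<lambda>c v i. c * v i) = fscale"
  by (auto simp: fscale_def fun_eq_iff)

locale projective_curve =
  fixes n :: nat and X :: "(nat \<Rightarrow> 'k::alg_closed_field) set set"
  assumes Xirr: "irreducible_closed (zar (proj_sub fscale (proj_n n))) X"
    and kd: "krull_dim (zar (proj_sub fscale X)) = 1"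
begin

definition E :: "(nat \<Rightarrow> 'k) set" where "E = {v. \<forall>i>n. v i = 0}"

definition ev :: "nat \<Rightarrow> nat \<Rightarrow> 'k" where "ev i = (\<lambda>j. if j = i then 1 else 0)"

lemma E_expand: "v \<in> E \<Longrightarrow> v = (\<Sum>i\<le>n. fscale (v i) (ev i))"
proof
  fix j assume v: "v \<in> E"
  have "(\<Sum>i\<le>n. fscale (v i) (ev i)) j = (\<Sum>i\<le>n. if i = j then v i else 0)"
    unfolding fun_sum_apply by (rule sum.cong) (auto simp: fscale_def ev_def)
  then show "v j = (\<Sum>i\<le>n. fscale (v i) (ev i)) j" using v by (auto simp: E_def)
qed

lemma subspace_E: "fsp.subspace E"
  unfolding fsp.subspace_def by (auto simp: E_def fscale_def)

lemma E_span: "E = fsp.span (ev ` {..n})"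
proof
  show "E \<subseteq> fsp.span (ev ` {..n})"
  proof
    fix v assume "v \<in> E"
    then have "v = (\<Sum>i\<le>n. fscale (v i) (ev i))" by (rule E_expand)
    also have "\<dots> \<in> fsp.span (ev ` {..n})" by (intro fsp.span_sum fsp.span_scale fsp.span_base) auto
    finally show "v \<in> fsp.span (ev ` {..n})" .
  qed
  show "fsp.span (ev ` {..n}) \<subseteq> E"
    by (rule fsp.span_minimal[OF _ subspace_E]) (auto simp: E_def ev_def)
qed

lemma proj_n_eq: "proj_n n = lines fscale E"
  unfolding proj_n_def fscale_alt E_def ..

lemma X_sub: "X \<subseteq> lines fscale E"
  using Xirr closedin_subset unfolding irreducible_closed_def proj_n_eq
  by (metis fsp.topspace_proj_sub)

lemma X_ne: "X \<noteq> {}"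
  using Xirr unfolding irreducible_closed_def by blast

definition rp :: "(nat \<Rightarrow> 'k) set \<Rightarrow> nat \<Rightarrow> 'k" where "rp x = (SOME v. v \<in> x \<and> v \<noteq> 0)"

lemma rp:
  assumes "x \<in> X" shows "rp x \<in> x" "rp x \<noteq> 0" "rp x \<in> E"
proof -
  have L: "x \<in> lines fscale E" using X_sub assms by blast
  have "\<exists>v. v \<in> x \<and> v \<noteq> 0" using fsp.lines_ex_nonzero[OF L] by blast
  then have "rp x \<in> x \<and> rp x \<noteq> 0" unfolding rp_def by (rule someI_ex)
  then show "rp x \<in> x" "rp x \<noteq> 0" by auto
  then show "rp x \<in> E" using fsp.lines_subspace_mem[OF L subspace_E] by blast
qed

lemma nonvan_rp:
  assumes "f \<in> forms fscale d" "x \<in> X" "X \<subseteq> Y"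
  shows "x \<in> nonvan (\<lambda>L. L - {0}) Y f \<longleftrightarrow> f (rp x) \<noteq> 0"
  using fsp.nonvan_forms_iff[OF assms(1) _ rp(1,2)[OF assms(2)], of E Y] assms X_sub by blast

lemma irr_forms:
  assumes f: "f \<in> forms fscale d" "x \<in> X" "f (rp x) \<noteq> 0"
    and g: "g \<in> forms fscale d'" "x' \<in> X" "g (rp x') \<noteq> 0"
  shows "\<exists>z\<in>X. f (rp z) \<noteq> 0 \<and> g (rp z) \<noteq> 0"
proof (rule ccontr)
  assume no: "\<not> ?thesis"
  let ?T = "zar (proj_sub fscale (proj_n n))"
  let ?N = "nonvan (\<lambda>L. L - {0}) (proj_n n)"
  have XP: "X \<subseteq> proj_n n" using X_sub proj_n_eq by blast
  have op: "openin ?T (?N h)" if "h \<in> forms fscale e" for h e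
    unfolding proj_sub_def cone_space_def using openin_nonvan[where H = "forms fscale", OF that] by simp
  have cl: "closedin ?T (proj_n n - ?N h)" if "h \<in> forms fscale e" for h e
    using openin_closedin_eq[of ?T "?N h"] op[OF that] by (simp add: fsp.topspace_proj_sub)
  have nf: "z \<in> ?N f \<longleftrightarrow> f (rp z) \<noteq> 0" if "z \<in> X" for z by (rule nonvan_rp[OF f(1) that XP])
  have ng: "z \<in> ?N g \<longleftrightarrow> g (rp z) \<noteq> 0" if "z \<in> X" for z by (rule nonvan_rp[OF g(1) that XP])
  have "X \<subseteq> (proj_n n - ?N f) \<union> (proj_n n - ?N g)"
  proof
    fix z assume z: "z \<in> X"
    then show "z \<in> (proj_n n - ?N f) \<union> (proj_n n - ?N g)"
      using no nf[OF z] ng[OF z] XP by blast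
  qed
  moreover have "\<forall>A B. closedin ?T A \<and> closedin ?T B \<and> X \<subseteq> A \<union> B \<longrightarrow> X \<subseteq> A \<or> X \<subseteq> B"
    using Xirr unfolding irreducible_closed_def by simp
  ultimately have "X \<subseteq> proj_n n - ?N f \<or> X \<subseteq> proj_n n - ?N g"
    using cl[OF f(1)] cl[OF g(1)] by simp
  then show False using nf[OF f(2)] ng[OF g(2)] f(2,3) g(2,3) by blast
qed

abbreviation T :: "(nat \<Rightarrow> 'k) set topology" where "T \<equiv> zar (proj_sub fscale X)"

lemma topspace_T: "topspace T = X"
  by (rule fsp.topspace_proj_sub)

lemma openin_T_form:
  assumes "openin T U" "x \<in> U"
  shows "\<exists>d. \<exists>f\<in>forms fscale d. f (rp x) \<noteq> 0 \<and> (\<forall>y\<in>X. f (rp y) \<noteq> 0 \<longrightarrow> y \<in> U)"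
proof -
  obtain d f where f: "f \<in> forms fscale d" "x \<in> nonvan (\<lambda>L. L - {0}) X f" "nonvan (\<lambda>L. L - {0}) X f \<subseteq> U"
    using assms unfolding fsp.openin_proj_sub_iff by blast
  have "x \<in> X" using f(2) by (simp add: nonvan_def)
  then have "f (rp x) \<noteq> 0" using nonvan_rp[OF f(1) _ order_refl] f(2) by blast
  moreover have "y \<in> U" if "y \<in> X" "f (rp y) \<noteq> 0" for y using nonvan_rp[OF f(1) that(1) order_refl] f(3) that by blast
  ultimately show ?thesis using f(1) by blast
qed

lemma closedin_T_form:
  assumes "closedin T Y" "x \<in> X" "x \<notin> Y"
  shows "\<exists>d. \<exists>f\<in>forms fscale d. f (rp x) \<noteq> 0 \<and> (\<forall>y\<in>Y. f (rp y) = 0)"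
proof -
  have o: "openin T (X - Y)" using assms(1) topspace_T by (metis closedin_def)
  have YX: "Y \<subseteq> X" using closedin_subset[OF assms(1)] topspace_T by simp
  from openin_T_form[OF o, of x] assms(2,3) obtain d f where
    "f \<in> forms fscale d" "f (rp x) \<noteq> 0" "\<forall>y\<in>X. f (rp y) \<noteq> 0 \<longrightarrow> y \<in> X - Y" by blast
  then show ?thesis using YX by blast
qed

lemma openin_T_nonvan: "f \<in> forms fscale d \<Longrightarrow> openin T {y \<in> X. f (rp y) \<noteq> 0}"
proof -
  assume f: "f \<in> forms fscale d"
  have "nonvan (\<lambda>L. L - {0}) X f = {y \<in> X. f (rp y) \<noteq> 0}"
    using nonvan_rp[OF f _ order_refl] by (auto simp: nonvan_def)
  moreover have "openin T (nonvan (\<lambda>L. L - {0}) X f)"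
    unfolding proj_sub_def cone_space_def using openin_nonvan[where H = "forms fscale", OF f] by simp
  ultimately show ?thesis by simp
qed

lemma irreducible_X: "irreducible_closed T X"
  unfolding irreducible_closed_def
proof (intro conjI allI impI)
  show "closedin T X" using closedin_topspace[of T] topspace_T by simp
  show "X \<noteq> {}" by (rule X_ne)
  fix A B assume AB: "closedin T A \<and> closedin T B \<and> X \<subseteq> A \<union> B"
  show "X \<subseteq> A \<or> X \<subseteq> B"
  proof (rule ccontr)
    assume "\<not> (X \<subseteq> A \<or> X \<subseteq> B)"
    then obtain x x' where x: "x \<in> X" "x \<notin> A" "x' \<in> X" "x' \<notin> B" by blast
    obtain d f where f: "f \<in> forms fscale d" "f (rp x) \<noteq> 0" "\<forall>y\<in>A. f (rp y) = 0"
      using closedin_T_form[of A x] AB x by blast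
    obtain d' g where g: "g \<in> forms fscale d'" "g (rp x') \<noteq> 0" "\<forall>y\<in>B. g (rp y) = 0"
      using closedin_T_form[of B x'] AB x by blast
    show False using irr_forms[OF f(1) x(1) f(2) g(1) x(3) g(2)] AB f(3) g(3) by blast
  qed
qed

lemma closedin_point: assumes "q \<in> X" shows "closedin T {q}"
proof -
  have "openin T (X - {q})"
    unfolding openin_subopen[of _ "X - {q}"]
  proof
    fix x assume x: "x \<in> X - {q}"
    have xs: "x = fsp.span {rp x}" "q = fsp.span {rp q}"
      using fsp.lines_span_eq[OF _ rp(1,2)] X_sub x assms by blast+
    have "rp x \<notin> fsp.span {rp q}"
    proof
      assume "rp x \<in> fsp.span {rp q}"
      then have "rp x \<in> q" using xs(2) by simp
      then have "q = fsp.span {rp x}" using fsp.lines_span_eq[of q E "rp x"] rp x assms X_sub by blast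
      then show False using xs(1) x by simp
    qed
    then have ind: "fsp.independent {rp x, rp q}"
      using rp(2)[OF assms] by (auto simp: fsp.independent_insert)
    have ne: "rp x \<noteq> rp q" using \<open>rp x \<notin> fsp.span {rp q}\<close> fsp.span_base[of "rp q" "{rp q}"] by auto
    obtain l where l: "\<forall>b. Vector_Spaces.linear fscale (*) (l b)"
      "\<forall>b\<in>{rp x, rp q}. \<forall>b'\<in>{rp x, rp q}. l b b' = (if b' = b then 1 else (0::'k))"
      using fsp.ex_dual_basis[OF ind] by blast
    have "l (rp x) (rp x) = 1" "l (rp x) (rp q) = 0" using l(2) ne by auto
    then show "\<exists>U. openin T U \<and> x \<in> U \<and> U \<subseteq> X - {q}"
      using openin_T_nonvan[OF forms_linear[of fscale "l (rp x)"]] l(1) x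
      by (intro exI[of _ "{y \<in> X. l (rp x) (rp y) \<noteq> 0}"]) auto
  qed
  then show ?thesis using assms topspace_T by (simp add: closedin_def)
qed

text \<open>A form that vanishes on Y_(i+1) but not on Y_i is chosen for each i. By the chain
  condition one of them lies in the ideal of its predecessors, all of which vanish at the point
  where it should not.\<close>

lemma no_descending_chain:
  assumes Y: "\<And>i. closedin T (Y i)" "\<And>i. Y (Suc i) \<subset> Y i"
  shows False
proof -
  have YX: "Y i \<subseteq> X" for i using closedin_subset[OF Y(1)] topspace_T by simp
  have dec: "Y j \<subseteq> Y i" if "i \<le> j" for i j
    using lift_Suc_antimono_le[of Y i j] Y(2) that by blast
  have "\<exists>x d f. x \<in> Y i \<and> f \<in> forms fscale d \<and> f (rp x) \<noteq> 0 \<and> (\<forall>y\<in>Y (Suc i). f (rp y) = 0)" for i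
  proof -
    obtain x where x: "x \<in> Y i" "x \<notin> Y (Suc i)" using Y(2)[of i] by blast
    then have "x \<in> X" using YX by blast
    from closedin_T_form[OF Y(1) this x(2)] x(1) show ?thesis by blast
  qed
  then have "\<forall>i. \<exists>x d f. x \<in> Y i \<and> f \<in> forms fscale d \<and> f (rp x) \<noteq> 0 \<and> (\<forall>y\<in>Y (Suc i). f (rp y) = 0)" by blast
  from choice[OF this] obtain x where "\<forall>i. \<exists>d f. x i \<in> Y i \<and> f \<in> forms fscale d \<and> f (rp (x i)) \<noteq> 0 \<and> (\<forall>y\<in>Y (Suc i). f (rp y) = 0)" ..
  then have "\<forall>i. \<exists>f. x i \<in> Y i \<and> (\<exists>d. f \<in> forms fscale d) \<and> f (rp (x i)) \<noteq> 0 \<and> (\<forall>y\<in>Y (Suc i). f (rp y) = 0)" by blast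
  from choice[OF this] obtain f where f: "\<forall>i. x i \<in> Y i \<and> (\<exists>d. f i \<in> forms fscale d) \<and> f i (rp (x i)) \<noteq> 0 \<and> (\<forall>y\<in>Y (Suc i). f i (rp y) = 0)" ..
  \<comment> \<open>A linear functional on all sequences need not depend on finitely many
    coordinates. After truncation it is a combination of the first n + 1, and nothing changes on
    E.\<close>
  define tr :: "(nat \<Rightarrow> 'k) \<Rightarrow> nat \<Rightarrow> 'k" where "tr v = (\<lambda>i. if i \<le> n then v i else 0)" for v
  have trE: "tr v = v" if "v \<in> E" for v using that by (auto simp: tr_def E_def fun_eq_iff)
  have trX: "tr v \<in> E" for v by (auto simp: tr_def E_def)
  obtain A where A: "subring A" "noeth A" "\<And>c. cfun c \<in> A" "\<And>i. i < Suc n \<Longrightarrow> (\<lambda>v::nat \<Rightarrow> 'k. v i) \<in> A"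
    using ex_noeth_ring[of "Suc n" "\<lambda>i v. v i"] by blast
  have Aadd: "a + b \<in> A" "a * b \<in> A" if "a \<in> A" "b \<in> A" for a b using A(1) that by (simp_all add: subring_def)
  have P: "g \<circ> tr \<in> A" if "g \<in> polyfun {l. Vector_Spaces.linear fscale (*) l}" for g
    using that
  proof induction
    case (const c) then show ?case using A(3)[of c] by (simp add: comp_def)
  next
    case (gen l)
    then have l: "Vector_Spaces.linear fscale (*) l" by simp
    have "(l \<circ> tr) v = (\<Sum>i\<le>n. cfun (l (ev i)) * (\<lambda>v. v i)) v" for v
    proof -
      have "l (tr v) = (\<Sum>i\<le>n. tr v i * l (ev i))"
        by (subst E_expand[OF trX]) (simp add: fsp.linear_functional_simps[OF l])
      also have "\<dots> = (\<Sum>i\<le>n. v i * l (ev i))" by (rule sum.cong) (auto simp: tr_def)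
      finally show ?thesis by (simp add: fun_sum_apply mult.commute)
    qed
    then have e: "l \<circ> tr = (\<Sum>i\<le>n. cfun (l (ev i)) * (\<lambda>v. v i))" by (rule ext)
    show ?case unfolding e
    proof (rule subring_sum[OF A(1)])
      fix i assume "i \<in> {..n}"
      then have i: "i < Suc n" by simp
      show "cfun (l (ev i)) * (\<lambda>v. v i) \<in> A" by (rule Aadd(2)[OF A(3) A(4)[OF i]])
    qed
  next
    case (add f g)
    have e: "(\<lambda>v. f v + g v) \<circ> tr = (f \<circ> tr) + (g \<circ> tr)" by (simp add: fun_eq_iff)
    show ?case unfolding e by (rule Aadd(1)[OF add.IH])
  next
    case (mult f g)
    have e: "(\<lambda>v. f v * g v) \<circ> tr = (f \<circ> tr) * (g \<circ> tr)" by (simp add: fun_eq_iff)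
    show ?case unfolding e by (rule Aadd(2)[OF mult.IH])
  qed
  have "f i \<circ> tr \<in> A" for i by (rule P) (use f in \<open>auto simp: forms_def\<close>)
  then obtain m where m: "f m \<circ> tr \<in> idl A ((\<lambda>i. f i \<circ> tr) ` {..<m})"
    using A(2)[unfolded noeth_def, rule_format, of "\<lambda>i. f i \<circ> tr"] by blast
  have "r (rp y) = 0" if "r \<in> idl A ((\<lambda>i. f i \<circ> tr) ` {..<m})" "y \<in> Y m" for r y
    using that(1)
  proof (induction rule: idl.induct)
    case (step a t r)
    then obtain i where i: "i < m" "t = f i \<circ> tr" by blast
    have "y \<in> Y (Suc i)" using dec[of "Suc i" m] i(1) that(2) by auto
    then have "f i (rp y) = 0" using f by blast
    moreover have "rp y \<in> E" using rp(3) YX that(2) by blast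
    ultimately show ?case using step i(2) by (simp add: trE)
  qed simp
  from this[OF m, of "x m"] f have "f m (tr (rp (x m))) = 0" by simp
  moreover have "rp (x m) \<in> E" using f YX rp(3) by blast
  ultimately show False using f trE by simp
qed

text \<open>By the descending chain condition an infinite closed set has a minimal infinite closed
  subset, which is irreducible. Between one of its points and X it would form a chain of length 2 on
  a space of dimension 1.\<close>

lemma finite_closed:
  assumes "closedin T Y" "Y \<noteq> X" shows "finite Y"
proof (rule ccontr)
  assume inf: "infinite Y"
  let ?r = "{(A, B). closedin T A \<and> closedin T B \<and> A \<subset> B}"
  have wf: "wf ?r"
    unfolding wf_iff_no_infinite_down_chain
  proof
    assume "\<exists>f. \<forall>i. (f (Suc i), f i) \<in> ?r"
    then obtain f where f: "\<And>i. (f (Suc i), f i) \<in> ?r" by blast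
    have "closedin T (f i)" "f (Suc i) \<subset> f i" for i using f[of i] by auto
    then show False using no_descending_chain[of f] by blast
  qed
  let ?Q = "{A. closedin T A \<and> infinite A \<and> A \<subseteq> Y}"
  have "Y \<in> ?Q" using assms inf by simp
  from wfE_min[OF wf this] obtain Z where Z: "Z \<in> ?Q" "\<And>A. (A, Z) \<in> ?r \<Longrightarrow> A \<notin> ?Q" by blast
  have YX: "Y \<subseteq> X" using closedin_subset[OF assms(1)] topspace_T by simp
  have "irreducible_closed T Z"
    unfolding irreducible_closed_def
  proof (intro conjI allI impI)
    show "closedin T Z" "Z \<noteq> {}" using Z(1) by auto
    fix A B assume AB: "closedin T A \<and> closedin T B \<and> Z \<subseteq> A \<union> B"
    have "Z = (Z \<inter> A) \<union> (Z \<inter> B)" using AB by blast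
    then have "infinite (Z \<inter> A) \<or> infinite (Z \<inter> B)" using Z(1) by (metis (no_types, lifting) finite_UnI mem_Collect_eq)
    moreover have "Z \<subseteq> C" if C: "closedin T C" "infinite (Z \<inter> C)" for C
    proof (rule ccontr)
      assume "\<not> Z \<subseteq> C"
      then have "Z \<inter> C \<subset> Z" by blast
      moreover have "closedin T (Z \<inter> C)" using C Z(1) by (simp add: closedin_Int)
      ultimately show False using Z(2)[of "Z \<inter> C"] Z(1) C(2) by auto
    qed
    ultimately show "Z \<subseteq> A \<or> Z \<subseteq> B" using AB by blast
  qed
  moreover obtain q where q: "q \<in> Z" using Z(1) by (metis (no_types, lifting) ex_in_conv finite.emptyI mem_Collect_eq)
  have qX: "q \<in> X" using q Z(1) YX by blast
  have "irreducible_closed T {q}"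
    unfolding irreducible_closed_def using closedin_point[OF qX] by blast
  moreover have "{q} \<subset> Z"
  proof -
    have "Z \<noteq> {q}" using Z(1) by auto
    then show ?thesis using q by blast
  qed
  moreover have "Z \<subset> X" using Z(1) YX assms(2) by blast
  moreover note irreducible_X
  ultimately have ch: "\<exists>C :: nat \<Rightarrow> (nat \<Rightarrow> 'k) set set. (\<forall>i\<le>2. irreducible_closed T (C i)) \<and> (\<forall>i<2. C i \<subset> C (Suc i))"
    by (intro exI[of _ "\<lambda>i. if i = 0 then {q} else if i = 1 then Z else X"])
      (auto simp: less_2_cases_iff)
  have "ereal (real 2) \<le> krull_dim T" unfolding krull_dim_def
    by (rule Sup_upper) (use ch in blast)
  then show False unfolding kd by simp
qed

end

text \<open>The product of all X - a, increased by 1, would have no root.\<close>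

lemma infinite_alg_closed: "infinite (UNIV :: 'k::alg_closed_field set)"
proof
  assume fin: "finite (UNIV :: 'k set)"
  let ?p = "(\<Prod>a\<in>(UNIV :: 'k set). [:- a, 1:]) + 1"
  have v: "poly ?p x = 1" for x :: 'k
    using fin by (auto simp: poly_prod prod_zero_iff)
  have "?p \<noteq> 0" using v[of 0] by (metis poly_0 zero_neq_one)
  have "degree (\<Prod>a\<in>(UNIV :: 'k set). [:- a, 1:]) = card (UNIV :: 'k set)"
    by (subst degree_prod_eq_sum_degree) auto
  moreover have "card (UNIV :: 'k set) > 0" using fin by (simp add: card_gt_0_iff)
  ultimately have "degree ?p > 0" by (subst degree_add_eq_left) auto
  then obtain x where "poly ?p x = 0" using alg_closed_imp_poly_has_root by blast
  then show False using v by simp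
qed

lemma poly_eq_infinite:
  fixes p q :: "'k::alg_closed_field poly"
  assumes "\<And>x. x \<notin> S \<Longrightarrow> poly p x = poly q x" "finite S" shows "p = q"
proof (rule ccontr)
  assume "p \<noteq> q"
  then have "finite {x. poly (p - q) x = 0}" by (intro poly_roots_finite) simp
  moreover have "UNIV \<subseteq> S \<union> {x. poly (p - q) x = 0}" using assms(1) by auto
  ultimately show False using infinite_alg_closed assms(2) finite_subset by blast
qed

text \<open>To a functional that works for S a multiple of one that is nonzero at v is added; each
  vector excludes at most one multiple, and the field is infinite.\<close>

lemma (in vector_space) ex_functional_nonzero_on:
  fixes S :: "'b set"
  assumes inf: "infinite (UNIV :: 'a set)" and S: "finite S" "0 \<notin> S"
  shows "\<exists>l. Vector_Spaces.linear scale (*) l \<and> (\<forall>v\<in>S. l v \<noteq> (0::'a))"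
  using S
proof (induction S rule: finite_induct)
  case empty
  have "Vector_Spaces.linear scale (*) (\<lambda>_. 0::'a)"
    by unfold_locales (auto simp: algebra_simps)
  then show ?case by blast
next
  case (insert v S)
  then obtain l where l: "Vector_Spaces.linear scale (*) l" "\<forall>v\<in>S. l v \<noteq> 0" by auto
  obtain m where m: "Vector_Spaces.linear scale (*) m" "m v = 1" using ex_functional_nonzero[of v] insert by auto
  let ?B = "insert (- l v) ((\<lambda>u. - l u / m u) ` S)"
  have "finite ?B" using insert by simp
  then obtain c where c: "c \<notin> ?B" using inf ex_new_if_finite by blast
  have lin: "Vector_Spaces.linear scale (*) (\<lambda>u. l u + c * m u)"
    using linear_functional_simps[OF l(1)] linear_functional_simps[OF m(1)]
    by (unfold_locales) (auto simp: algebra_simps)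
  have "l u + c * m u \<noteq> 0" if "u \<in> insert v S" for u
  proof
    assume e: "l u + c * m u = 0"
    show False
    proof (cases "u = v")
      case True
      then have "c = - l v" using e m(2) by (simp add: eq_neg_iff_add_eq_0 add.commute)
      then show False using c by blast
    next
      case False
      then have u: "u \<in> S" using that by blast
      have "m u \<noteq> 0" using e l(2) u by auto
      then have "c = - l u / m u" using e by (simp add: field_simps eq_neg_iff_add_eq_0 add.commute)
      then show False using c u by blast
    qed
  qed
  then show ?case using lin by blast
qed

text \<open>The hypothesis bounds the length of families in T independent modulo A; a longest one
  spans T modulo A. T itself need not be a subspace here.\<close>

lemma (in vector_space) finite_span_modulo:
  fixes N :: nat
  assumes A: "subspace A"
    and dep: "\<And>f. (\<And>j. j \<le> N \<Longrightarrow> f j \<in> T) \<Longrightarrow> \<exists>c. (\<exists>j\<le>N. c j \<noteq> 0) \<and> (\<Sum>j\<le>N. scale (c j) (f j)) \<in> A"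
  shows "\<exists>C. finite C \<and> C \<subseteq> T \<and> (\<forall>t\<in>T. \<exists>s\<in>span C. t - s \<in> A)"
proof -
  define P where "P m \<longleftrightarrow> (\<exists>f. (\<forall>j<m. f j \<in> T) \<and> (\<forall>c. (\<Sum>j<m. scale (c j) (f j)) \<in> A \<longrightarrow> (\<forall>j<m. c j = 0)))" for m :: nat
  have "\<exists>m. P m \<and> \<not> P (Suc m)"
  proof (rule ccontr)
    assume no: "\<nexists>m. P m \<and> \<not> P (Suc m)"
    have P0: "P 0" by (simp add: P_def)
    have "P m" for m
    proof (induction m)
      case (Suc m) then show ?case using no by blast
    qed (rule P0)
    then have "P (Suc N)" .
    then obtain f where f: "\<forall>j<Suc N. f j \<in> T" "\<forall>c. (\<Sum>j<Suc N. scale (c j) (f j)) \<in> A \<longrightarrow> (\<forall>j<Suc N. c j = 0)"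
      unfolding P_def by blast
    obtain c where "\<exists>j\<le>N. c j \<noteq> 0" "(\<Sum>j\<le>N. scale (c j) (f j)) \<in> A" using dep[of f] f(1) by auto
    then show False using f(2) by (auto simp: lessThan_Suc_atMost less_Suc_eq_le)
  qed
  then obtain m where m: "P m" "\<not> P (Suc m)" by blast
  obtain f where f: "\<forall>j<m. f j \<in> T" "\<forall>c. (\<Sum>j<m. scale (c j) (f j)) \<in> A \<longrightarrow> (\<forall>j<m. c j = 0)"
    using m(1) unfolding P_def by blast
  have "\<exists>s\<in>span (f ` {..<m}). t - s \<in> A" if t: "t \<in> T" for t
  proof -
    let ?f = "f(m := t)"
    have "\<not> ((\<forall>j<Suc m. ?f j \<in> T) \<and> (\<forall>c. (\<Sum>j<Suc m. scale (c j) (?f j)) \<in> A \<longrightarrow> (\<forall>j<Suc m. c j = 0)))"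
      using m(2) unfolding P_def by blast
    moreover have "\<forall>j<Suc m. ?f j \<in> T" using f(1) t by (auto simp: less_Suc_eq)
    ultimately obtain c where c: "(\<Sum>j<Suc m. scale (c j) (?f j)) \<in> A" "\<exists>j<Suc m. c j \<noteq> 0" by blast
    have e: "(\<Sum>j<Suc m. scale (c j) (?f j)) = (\<Sum>j<m. scale (c j) (f j)) + scale (c m) t"
      by simp
    have cm: "c m \<noteq> 0"
    proof
      assume z: "c m = 0"
      then have "(\<Sum>j<m. scale (c j) (f j)) \<in> A" using c(1) unfolding e by simp
      then show False using f(2) c(2) z by (auto simp: less_Suc_eq)
    qed
    let ?s = "- (\<Sum>j<m. scale (c j / c m) (f j))"
    have "scale (inverse (c m)) ((\<Sum>j<m. scale (c j) (f j)) + scale (c m) t) = t - ?s"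
      using cm by (simp add: scale_right_distrib scale_sum_right divide_inverse mult.commute)
    then have "t - ?s \<in> A" using subspace_scale[OF A c(1)] unfolding e by metis
    moreover have "?s \<in> span (f ` {..<m})" by (intro span_neg span_sum span_scale span_base) auto
    ultimately show ?thesis by blast
  qed
  then show ?thesis using f(1) by (intro exI[of _ "f ` {..<m}"]) auto
qed

section \<open>The homogeneous coordinate ring of a projective curve\<close>

context projective_curve
begin

text \<open>\<open>multi_points\<close> wants coordinates for every element of the type, so
  everything outside X is sent to a point of X.\<close>

definition \<rho> :: "(nat \<Rightarrow> 'k) set \<Rightarrow> (nat \<Rightarrow> 'k) set" where
  "\<rho> y = (if y \<in> X then y else (SOME x. x \<in> X))"

lemma \<rho>: "\<rho> y \<in> X" "y \<in> X \<Longrightarrow> \<rho> y = y"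
  using X_ne by (auto simp: \<rho>_def intro: someI)

definition w :: "(nat \<Rightarrow> 'k) set \<Rightarrow> nat \<Rightarrow> 'k" where "w y = rp (\<rho> y)"

lemma w_rp: "y \<in> X \<Longrightarrow> w y = rp y"
  by (simp add: w_def \<rho>)

sublocale mp: multi_points fscale "{()}" "\<lambda>_. E" "\<lambda>y _. w y"
proof unfold_locales
  show "finite {()}" by simp
  show "\<exists>B. finite B \<and> E = fsp.span B" using E_span by (intro exI[of _ "ev ` {..n}"]) simp
  show "w y \<in> E" "w y \<noteq> 0" for y using rp[OF \<rho>(1)] unfolding w_def by blast+
  fix f g :: "(unit \<Rightarrow> nat \<Rightarrow> 'k) \<Rightarrow> 'k" and d d' y y'
  assume f: "f \<in> multiforms fscale {()} d" "f (\<lambda>_. w y) \<noteq> 0"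
    and g: "g \<in> multiforms fscale {()} d'" "g (\<lambda>_. w y') \<noteq> 0"
  from irr_forms[OF multiforms_to_forms[OF f(1)] \<rho>(1)[of y] _ multiforms_to_forms[OF g(1)] \<rho>(1)[of y']] f(2) g(2)
  obtain z where "z \<in> X" "f (\<lambda>_. rp z) \<noteq> 0" "g (\<lambda>_. rp z) \<noteq> 0" unfolding w_def by blast
  then show "\<exists>z. f (\<lambda>_. w z) \<noteq> 0 \<and> g (\<lambda>_. w z) \<noteq> 0" using w_rp by metis
qed

lemma comp_form: "(\<lambda>v. f (v ())) \<circ> (\<lambda>y _. w y) = f \<circ> w"
  by (simp add: fun_eq_iff)

lemma N0_formI:
  assumes "f \<in> forms fscale d" "f (w y) \<noteq> 0" "\<And>y. f (w y) \<noteq> 0 \<Longrightarrow> h y = 0" shows "h \<in> mp.N0"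
  by (rule mp.N0I[OF forms_to_multiforms[OF assms(1)], of y]) (use assms in auto)

lemma N0_form_zero: "f \<in> forms fscale d \<Longrightarrow> f \<circ> w \<in> mp.N0 \<Longrightarrow> f (w y) = 0"
  using mp.N0_form[OF forms_to_multiforms, of f d y] unfolding comp_form by simp

lemma N0_form_cancel: "f \<in> forms fscale d \<Longrightarrow> f (w y) \<noteq> 0 \<Longrightarrow> (f \<circ> w) * h \<in> mp.N0 \<Longrightarrow> h \<in> mp.N0"
  using mp.N0_cancel[OF forms_to_multiforms, of f d y h] unfolding comp_form by simp

text \<open>X is closed in projective space: a point outside it has a form that separates it from
  all points of X.\<close>

lemma adherent_X:
  assumes "mp.adherent x" shows "\<exists>q\<in>X. \<exists>c. c \<noteq> 0 \<and> x () = fscale c (rp q)"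
proof -
  let ?v = "x ()" and ?P = "proj_n n"
  have v: "?v \<in> E" "?v \<noteq> 0" and van: "\<And>d f. f \<in> multiforms fscale {()} d \<Longrightarrow> (\<And>y. f (\<lambda>_. w y) = 0) \<Longrightarrow> f x = 0"
    using assms unfolding mp.adherent_def by auto
  define q where "q = fsp.span {?v}"
  have vq: "?v \<in> q" unfolding q_def by (simp add: fsp.span_base)
  have qP: "q \<in> ?P" unfolding proj_n_eq lines_def q_def using v by blast
  have "q \<in> X"
  proof (rule ccontr)
    assume qX: "q \<notin> X"
    have cl: "closedin (zar (proj_sub fscale ?P)) X" using Xirr unfolding irreducible_closed_def by simp
    have "openin (zar (proj_sub fscale ?P)) (?P - X)"
      using cl unfolding closedin_def fsp.topspace_proj_sub by simp
    then obtain d f where f: "f \<in> forms fscale d" "q \<in> nonvan (\<lambda>L. L - {0}) ?P f" "nonvan (\<lambda>L. L - {0}) ?P f \<subseteq> ?P - X"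
      using qX qP unfolding fsp.openin_proj_sub_iff by blast
    have "f ?v \<noteq> 0" using f(2) vq v(2) by (auto simp: nonvan_def)
    moreover have XP: "X \<subseteq> ?P" using X_sub proj_n_eq by blast
    have "f (w y) = 0" for y
      using nonvan_rp[OF f(1) \<rho>(1)[of y] XP] f(3) \<rho>(1)[of y] unfolding w_def by blast
    then have "f ?v = 0" using van[OF forms_to_multiforms[OF f(1)]] by simp
    ultimately show False by simp
  qed
  moreover have "q \<in> lines fscale E" using X_sub \<open>q \<in> X\<close> by blast
  from fsp.lines_memD[OF this rp(1,2)[OF \<open>q \<in> X\<close>] vq v(2)]
  have "\<exists>c. c \<noteq> 0 \<and> ?v = fscale c (rp q)" .
  ultimately show ?thesis by (rule bexI[rotated])
qed

text \<open>A linear form that is nonzero somewhere on the irreducible curve has finitely many zeros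
  there, and a second one can be chosen nonzero at all of them. The pair takes the place of a
  Noether normalization.\<close>

lemma ex_two_forms:
  "\<exists>l0 l1. Vector_Spaces.linear fscale (*) l0 \<and> Vector_Spaces.linear fscale (*) l1 \<and>
     (\<forall>x\<in>X. l0 (rp x) \<noteq> 0 \<or> l1 (rp x) \<noteq> 0) \<and> (\<exists>y. l0 (w y) \<noteq> (0::'k))"
proof -
  obtain x0 where x0: "x0 \<in> X" using X_ne by blast
  obtain l0 where l0: "Vector_Spaces.linear fscale (*) l0" "l0 (rp x0) = (1::'k)"
    using fsp.ex_functional_nonzero[OF rp(2)[OF x0]] by blast
  let ?Y = "{y \<in> X. l0 (rp y) = 0}"
  have "X - ?Y = {y \<in> X. l0 (rp y) \<noteq> 0}" by blast
  then have "closedin T ?Y" using openin_T_nonvan[OF forms_linear[OF l0(1)]] by (simp add: closedin_def topspace_T)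
  moreover have "x0 \<notin> ?Y" using l0(2) by simp
  then have "?Y \<noteq> X" using x0 by blast
  ultimately have "finite (rp ` ?Y)" using finite_closed by blast
  moreover have "0 \<notin> rp ` ?Y" using rp(2) by force
  ultimately obtain l1 where l1: "Vector_Spaces.linear fscale (*) l1" "\<forall>v\<in>rp ` ?Y. l1 v \<noteq> (0::'k)"
    using fsp.ex_functional_nonzero_on[OF infinite_alg_closed] by blast
  have "l0 (w x0) \<noteq> 0" using l0 x0 w_rp by simp
  moreover have "\<forall>x\<in>X. l0 (rp x) \<noteq> 0 \<or> l1 (rp x) \<noteq> 0" using l1(2) by blast
  ultimately show ?thesis using l0(1) l1(1) by blast
qed

definition hmon :: "nat \<Rightarrow> ((nat \<Rightarrow> 'k) \<Rightarrow> 'k) set" where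
  "hmon m = fsp.span {\<lambda>v. \<Prod>i\<le>n. v i ^ \<gamma> i | \<gamma>. sum \<gamma> {..n} = m}"

lemma hmon_mult: assumes "a \<in> hmon m" "b \<in> hmon m'" shows "a * b \<in> hmon (m + m')"
  unfolding hmon_def
proof (rule fspan_mult[OF assms[unfolded hmon_def]])
  fix s s' :: "(nat \<Rightarrow> 'k) \<Rightarrow> 'k"
  assume "s \<in> {\<lambda>v. \<Prod>i\<le>n. v i ^ \<gamma> i | \<gamma>. sum \<gamma> {..n} = m}" "s' \<in> {\<lambda>v. \<Prod>i\<le>n. v i ^ \<gamma> i | \<gamma>. sum \<gamma> {..n} = m'}"
  then obtain \<gamma> \<gamma>' where g: "s = (\<lambda>v. \<Prod>i\<le>n. v i ^ \<gamma> i)" "s' = (\<lambda>v. \<Prod>i\<le>n. v i ^ \<gamma>' i)" "sum \<gamma> {..n} = m" "sum \<gamma>' {..n} = m'"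
    by blast
  have "s * s' = (\<lambda>v. \<Prod>i\<le>n. v i ^ (\<gamma> i + \<gamma>' i))" unfolding g by (simp add: fun_eq_iff power_add prod.distrib)
  moreover have "(\<Sum>i\<le>n. \<gamma> i + \<gamma>' i) = m + m'" using g by (simp add: sum.distrib)
  ultimately show "s * s' \<in> fsp.span {\<lambda>v. \<Prod>i\<le>n. v i ^ \<gamma> i | \<gamma>. sum \<gamma> {..n} = m + m'}"
    by (intro fsp.span_base CollectI exI[of _ "\<lambda>i. \<gamma> i + \<gamma>' i"] conjI)
qed

lemma hmon_hom: assumes "a \<in> hmon m" shows "a (fscale c v) = c ^ m * a v"
  using assms unfolding hmon_def
proof (induction rule: fsp.span_induct_alt)
  case (step k x y)
  then obtain \<gamma> where g: "x = (\<lambda>v. \<Prod>i\<le>n. v i ^ \<gamma> i)" "sum \<gamma> {..n} = m" by blast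
  have "x (fscale c v) = c ^ m * x v"
    unfolding g(1) g(2)[symmetric] by (simp add: fscale_def power_mult_distrib prod.distrib power_sum)
  then show ?case using step by (simp add: fscale_def algebra_simps)
qed simp

lemma hmon_sum: "(\<And>i. i \<in> S \<Longrightarrow> f i \<in> hmon m) \<Longrightarrow> sum f S \<in> hmon m"
  unfolding hmon_def by (rule fsp.span_sum)

lemma hmon_const: "cfun c \<in> hmon 0"
proof -
  have "fscale c (\<lambda>v. \<Prod>i\<le>n. v i ^ (0::nat)) \<in> hmon 0"
    unfolding hmon_def by (intro fsp.span_scale fsp.span_base CollectI exI[of _ "\<lambda>_. 0"]) simp
  then show ?thesis by (simp add: fscale_def)
qed

lemma hmon_coord: assumes "i \<le> n" shows "(\<lambda>v. v i) \<in> hmon 1"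
proof -
  have "(\<Prod>j\<le>n. v j ^ (if j = i then 1 else 0)) = v i" for v :: "nat \<Rightarrow> 'k"
  proof -
    have "(\<Prod>j\<le>n. v j ^ (if j = i then 1 else 0)) = (\<Prod>j\<le>n. if j = i then v j else 1)"
      by (rule prod.cong) auto
    then show ?thesis using assms by simp
  qed
  moreover have "(\<Sum>j\<le>n. if j = i then 1 else 0) = (1::nat)" using assms by simp
  ultimately show ?thesis unfolding hmon_def
    by (intro fsp.span_base CollectI exI[of _ "\<lambda>j. if j = i then 1 else 0"]) simp
qed

lemma hmon_scale: "a \<in> hmon m \<Longrightarrow> cfun c * a \<in> hmon m"
  unfolding hmon_def by (rule fspan_cmult)

text \<open>The indeterminate of P only records degrees: its coefficients are the homogeneous
  components, and evaluation at 1 adds them up.\<close>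

lemma polyfun_decompose:
  assumes "f \<in> polyfun {l. Vector_Spaces.linear fscale (*) l}"
  shows "\<exists>P. (\<forall>m. coeff P m \<in> hmon m) \<and> (\<forall>v\<in>E. f v = poly P 1 v)"
  using assms
proof induction
  case (const c)
  have "coeff [:cfun c:] m \<in> hmon m" for m
    using hmon_const[of c] fsp.span_zero unfolding hmon_def by (cases m) auto
  moreover have "c = poly [:cfun c:] 1 v" for v :: "nat \<Rightarrow> 'k" by simp
  ultimately show ?case by blast
next
  case (gen l)
  then have l: "Vector_Spaces.linear fscale (*) l" by simp
  define L where "L = (\<Sum>i\<le>n. cfun (l (ev i)) * (\<lambda>v::nat \<Rightarrow> 'k. v i))"
  have "L \<in> hmon 1" unfolding L_def by (intro hmon_sum hmon_scale hmon_coord) simp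
  then have "coeff [:0, L:] m \<in> hmon m" for m
    using fsp.span_zero unfolding hmon_def by (cases m) (auto simp: coeff_pCons split: nat.split)
  moreover have "l v = poly [:0, L:] 1 v" if "v \<in> E" for v
  proof -
    have "l v = (\<Sum>i\<le>n. v i * l (ev i))"
      by (subst E_expand[OF that]) (simp add: fsp.linear_functional_simps[OF l])
    then show ?thesis by (simp add: L_def fun_sum_apply mult.commute)
  qed
  ultimately show ?case by blast
next
  case (add f g)
  then obtain P Q where P: "\<forall>m. coeff P m \<in> hmon m" "\<forall>v\<in>E. f v = poly P 1 v"
    and Q: "\<forall>m. coeff Q m \<in> hmon m" "\<forall>v\<in>E. g v = poly Q 1 v" by (elim exE conjE)
  have "coeff (P + Q) m \<in> hmon m" for m using P(1) Q(1) fsp.span_add unfolding hmon_def coeff_add by blast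
  moreover have "\<forall>v\<in>E. f v + g v = poly (P + Q) 1 v" using P(2) Q(2) by simp
  ultimately show ?case by blast
next
  case (mult f g)
  then obtain P Q where P: "\<forall>m. coeff P m \<in> hmon m" "\<forall>v\<in>E. f v = poly P 1 v"
    and Q: "\<forall>m. coeff Q m \<in> hmon m" "\<forall>v\<in>E. g v = poly Q 1 v" by (elim exE conjE)
  have "coeff (P * Q) m \<in> hmon m" for m
    unfolding coeff_mult
  proof (rule hmon_sum)
    fix i assume "i \<in> {..m}"
    then have "i + (m - i) = m" by simp
    then show "coeff P i * coeff Q (m - i) \<in> hmon m" using hmon_mult[OF P(1)[rule_format, of i] Q(1)[rule_format, of "m - i"]] by simp
  qed
  moreover have "\<forall>v\<in>E. f v * g v = poly (P * Q) 1 v" using P(2) Q(2) by simp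
  ultimately show ?case by blast
qed

text \<open>Along the multiples c v both sides are polynomials in c, and the field is infinite; so
  homogeneity singles out the component of degree D.\<close>

lemma form_hmon:
  assumes f: "f \<in> forms fscale D" shows "\<exists>a\<in>hmon D. \<forall>v\<in>E. f v = a v"
proof -
  obtain P where P: "\<forall>m. coeff P m \<in> hmon m" "\<forall>v\<in>E. f v = poly P 1 v"
    using polyfun_decompose[of f] f by (auto simp: forms_def)
  have "f v = coeff P D v" if v: "v \<in> E" for v
  proof -
    define R where "R = (\<Sum>m\<le>degree P. monom (coeff P m v) m)"
    have "poly R c = poly (monom (f v) D) c" for c
    proof -
      have cv: "fscale c v \<in> E" using v by (simp add: E_def fscale_def)
      have "poly R c = (\<Sum>m\<le>degree P. c ^ m * coeff P m v)" by (simp add: R_def poly_sum poly_monom mult.commute)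
      also have "\<dots> = (\<Sum>m\<le>degree P. coeff P m (fscale c v))"
        by (rule sum.cong[OF refl]) (simp only: hmon_hom[OF P(1)[rule_format]])
      also have "\<dots> = poly P 1 (fscale c v)" by (simp add: poly_altdef fun_sum_apply)
      also have "\<dots> = f (fscale c v)" using P(2) cv by simp
      finally show ?thesis by (simp add: forms_hom[OF f] poly_monom mult.commute)
    qed
    then have "R = monom (f v) D" using poly_eq_infinite[of "{}"] by blast
    then have "f v = coeff R D" by simp
    also have "\<dots> = coeff P D v"
      by (auto simp: R_def coeff_sum coeff_eq_0 intro: ccontr)
    finally show ?thesis .
  qed
  then show ?thesis using P(1) by blast
qed

end

section \<open>Linear growth of the coordinate ring, and sections of twists\<close>

context projective_curve
begin

text \<open>The coordinates are integral over two linear forms without common zero on the curve, and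
  \<open>monomial_bound\<close> with two generators gives growth of order D.\<close>

lemma form_span_bound:
  "\<exists>N. \<forall>D. \<exists>S. finite S \<and> card S \<le> N * (D + 1) \<and> (\<forall>A\<in>forms fscale D. A \<circ> w \<in> fsp.span S)"
proof -
  obtain l0 l1 where l: "Vector_Spaces.linear fscale (*) l0" "Vector_Spaces.linear fscale (*) l1"
    "\<forall>x\<in>X. l0 (rp x) \<noteq> 0 \<or> l1 (rp x) \<noteq> (0::'k)" using ex_two_forms by blast
  define F where "F = (\<lambda>i::nat. if i = 0 then (\<lambda>v::unit \<Rightarrow> nat \<Rightarrow> 'k. l0 (v ())) else (\<lambda>v. l1 (v ())))"
  define G where "G = (\<lambda>j (v::unit \<Rightarrow> nat \<Rightarrow> 'k). v () j)"
  \<comment> \<open>Coordinates that vanish on all of X are left out, because integrality was shown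
    for forms that are nonzero somewhere.\<close>
  define J where "J = {j\<in>{..n}. \<exists>y. w y j \<noteq> 0}"
  let ?T = "{0, 1::nat}"
  have F: "F i \<in> multiforms fscale {()} (\<lambda>_. 1)" for i
    unfolding F_def using forms_to_multiforms[OF forms_linear[OF l(1)]] forms_to_multiforms[OF forms_linear[OF l(2)]] by simp
  have co: "Vector_Spaces.linear fscale (*) (\<lambda>v::nat \<Rightarrow> 'k. v j)" for j
    by unfold_locales (auto simp: fscale_def algebra_simps)
  have G: "G j \<in> multiforms fscale {()} (\<lambda>_. 1)" for j
    unfolding G_def by (rule forms_to_multiforms[OF forms_linear[OF co]])
  have no: "\<exists>i\<in>?T. F i x \<noteq> 0" if x: "mp.adherent x" for x
  proof -
    obtain q c where q: "q \<in> X" "c \<noteq> 0" "x () = fscale c (rp q)" using adherent_X[OF x] by blast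
    have "l0 (x ()) = c * l0 (rp q)" "l1 (x ()) = c * l1 (rp q)"
      unfolding q(3) using fsp.linear_functional_simps(2) l by blast+
    then have "l0 (x ()) \<noteq> 0 \<or> l1 (x ()) \<noteq> 0" using l(3) q by auto
    then show ?thesis by (auto simp: F_def)
  qed
  define Fw where "Fw i = F i \<circ> (\<lambda>y _. w y)" for i
  define Gw where "Gw j = G j \<circ> (\<lambda>y _. w y)" for j
  have int: "\<exists>m. Gw j ^ m \<in> fsp.span (int_monos ?T Fw (Gw j) m)" if "j \<in> J" for j
  proof -
    obtain y where "G j (\<lambda>_. w y) \<noteq> 0" using \<open>j \<in> J\<close> unfolding J_def G_def by blast
    from mp.integral_over[of ?T F, OF _ F G this no] show ?thesis unfolding Fw_def Gw_def by simp
  qed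
  have "finite J" by (simp add: J_def)
  from monomial_bound[of ?T J Gw Fw, OF _ _ this int]
  obtain C where C: "\<forall>D. \<exists>S. finite S \<and> card S \<le> C * (D + 1) ^ (card ?T - 1) \<and>
     (\<forall>\<alpha> \<gamma>. sum \<alpha> ?T + sum \<gamma> J = D \<longrightarrow> monomial ?T Fw J Gw \<alpha> \<gamma> \<in> fsp.span S)" by auto
  have "\<exists>S. finite S \<and> card S \<le> C * (D + 1) \<and> (\<forall>A\<in>forms fscale D. A \<circ> w \<in> fsp.span S)" for D
  proof -
    obtain S where S: "finite S" "card S \<le> C * (D + 1) ^ (card ?T - 1)"
      "\<And>\<alpha> \<gamma>. sum \<alpha> ?T + sum \<gamma> J = D \<Longrightarrow> monomial ?T Fw J Gw \<alpha> \<gamma> \<in> fsp.span S" using C by blast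
    have hm: "a \<circ> w \<in> fsp.span S" if "a \<in> hmon D" for a
      using that unfolding hmon_def
    proof (induction rule: fsp.span_induct_alt)
      case base
      have "(0 :: (nat \<Rightarrow> 'k) \<Rightarrow> 'k) \<circ> w = 0" by (simp add: fun_eq_iff)
      then show ?case by (simp only: fsp.span_zero)
    next
      case (step c x y)
      then obtain \<gamma> where g: "x = (\<lambda>v. \<Prod>i\<le>n. v i ^ \<gamma> i)" "sum \<gamma> {..n} = D" by blast
      have xw: "x \<circ> w \<in> fsp.span S"
      proof (cases "\<forall>i\<in>{..n} - J. \<gamma> i = 0")
        case True
        have JN: "J \<subseteq> {..n}" by (auto simp: J_def)
        have s: "sum \<gamma> J = D" using g(2) sum.mono_neutral_left[OF _ JN, of \<gamma>] True by simp
        have p: "x \<circ> w = monomial ?T Fw J Gw (\<lambda>_. 0) \<gamma>"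
        proof
          fix y
          have pa: "(\<Prod>j\<in>B. Gw j ^ \<gamma> j) y = (\<Prod>j\<in>B. Gw j y ^ \<gamma> j)" for B
          proof -
            have "(Gw j ^ k) y = Gw j y ^ k" for j k by (induction k) auto
            then show ?thesis by (induction B rule: infinite_finite_induct) auto
          qed
          have Gwa: "Gw j y = w y j" for j by (simp add: Gw_def G_def)
          have "(\<Prod>i\<le>n. w y i ^ \<gamma> i) = (\<Prod>i\<in>J. w y i ^ \<gamma> i)"
            using prod.mono_neutral_right[OF _ JN, of "\<lambda>i. w y i ^ \<gamma> i"] True by simp
          then show "(x \<circ> w) y = monomial ?T Fw J Gw (\<lambda>_. 0) \<gamma> y"
            by (simp add: g(1) monomial_def pa Gwa)
        qed
        show ?thesis unfolding p by (rule S(3)) (simp add: s)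
      next
        case False
        then obtain i where i: "i \<le> n" "\<gamma> i \<noteq> 0" "i \<notin> J" by auto
        have "x \<circ> w = 0"
        proof
          fix y
          have "w y i = 0" using i by (auto simp: J_def)
          then have "\<exists>i\<in>{..n}. w y i ^ \<gamma> i = 0" using i by (auto simp: power_0_left)
          then show "(x \<circ> w) y = 0 y" unfolding g(1) by (simp add: prod_zero)
        qed
        then show ?thesis by (simp only: fsp.span_zero)
      qed
      have "(fscale c x + y) \<circ> w = fscale c (x \<circ> w) + (y \<circ> w)" by (simp add: fun_eq_iff fscale_def)
      moreover have "fscale c (x \<circ> w) + (y \<circ> w) \<in> fsp.span S"
        by (intro fsp.span_add fsp.span_scale xw step)
      ultimately show ?case by (simp only:)
    qed
    have "A \<circ> w \<in> fsp.span S" if A: "A \<in> forms fscale D" for A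
    proof -
      obtain a where a: "a \<in> hmon D" "\<forall>v\<in>E. A v = a v" using form_hmon[OF A] by blast
      have "w y \<in> E" for y using rp(3)[OF \<rho>(1)] by (simp add: w_def)
      then have "A \<circ> w = a \<circ> w" using a(2) by (simp add: fun_eq_iff)
      then show ?thesis using hm[OF a(1)] by (simp only:)
    qed
    then show ?thesis using S(1,2) by (intro exI[of _ S]) simp
  qed
  then show ?thesis by blast
qed

text \<open>Sections of the \<open>e\<close>-th twist of the structure sheaf, as functions of the chosen homogeneous
  coordinates, up to functions vanishing on a nonempty open set.\<close>

definition \<Gamma> :: "nat \<Rightarrow> ((nat \<Rightarrow> 'k) set \<Rightarrow> 'k) set" where
  "\<Gamma> e = {h. \<forall>q\<in>X. \<exists>d A B. A \<in> forms fscale (d + e) \<and> B \<in> forms fscale d \<and> B (rp q) \<noteq> 0 \<and>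
     h * (B \<circ> w) - (A \<circ> w) \<in> mp.N0}"

lemma \<Gamma>E:
  assumes "h \<in> \<Gamma> e" "q \<in> X"
  obtains d A B where "A \<in> forms fscale (d + e)" "B \<in> forms fscale d" "B (rp q) \<noteq> 0" "h * (B \<circ> w) - (A \<circ> w) \<in> mp.N0"
  using bspec[OF assms(1)[unfolded \<Gamma>_def mem_Collect_eq] assms(2)] by (elim exE conjE)

lemma comp_mult: "(\<lambda>v. f v * g v) \<circ> w = (f \<circ> w) * (g \<circ> w)"
  and comp_add: "(\<lambda>v. f v + g v) \<circ> w = (f \<circ> w) + (g \<circ> w)"
  and comp_cmult: "(\<lambda>v. c * g v) \<circ> w = cfun c * (g \<circ> w)"
  for f g :: "(nat \<Rightarrow> 'k) \<Rightarrow> 'k"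
  by (rule ext, simp)+

lemma \<Gamma>_form: assumes "f \<in> forms fscale e" shows "f \<circ> w \<in> \<Gamma> e"
  unfolding \<Gamma>_def
proof (intro CollectI ballI exI conjI)
  show "f \<in> forms fscale (0 + e)" using assms by simp
  show "(\<lambda>_. 1) \<in> forms fscale 0" by (rule forms_const)
  show "(f \<circ> w) * ((\<lambda>_. 1) \<circ> w) - (f \<circ> w) \<in> mp.N0"
  proof -
    have "(f \<circ> w) * ((\<lambda>_. 1) \<circ> w) - (f \<circ> w) = 0" by (simp add: fun_eq_iff)
    then show ?thesis by (simp only: mp.N0_zero)
  qed
qed simp

lemma \<Gamma>_mult: assumes "f \<in> \<Gamma> e" "g \<in> \<Gamma> e'" shows "f * g \<in> \<Gamma> (e + e')"
  unfolding \<Gamma>_def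
proof (intro CollectI ballI)
  fix q assume q: "q \<in> X"
  obtain d A B where f: "A \<in> forms fscale (d + e)" "B \<in> forms fscale d" "B (rp q) \<noteq> 0" "f * (B \<circ> w) - (A \<circ> w) \<in> mp.N0"
    using assms(1) q by (rule \<Gamma>E)
  obtain d' A' B' where g: "A' \<in> forms fscale (d' + e')" "B' \<in> forms fscale d'" "B' (rp q) \<noteq> 0" "g * (B' \<circ> w) - (A' \<circ> w) \<in> mp.N0"
    using assms(2) q by (rule \<Gamma>E)
  have e: "(f * g) * ((\<lambda>v. B v * B' v) \<circ> w) - ((\<lambda>v. A v * A' v) \<circ> w) =
      (g * (B' \<circ> w)) * (f * (B \<circ> w) - (A \<circ> w)) + (A \<circ> w) * (g * (B' \<circ> w) - (A' \<circ> w))"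
    unfolding comp_mult by (simp add: algebra_simps)
  have 1: "(f * g) * ((\<lambda>v. B v * B' v) \<circ> w) - ((\<lambda>v. A v * A' v) \<circ> w) \<in> mp.N0"
    unfolding e by (intro mp.N0_add mp.N0_mult f g)
  have "(\<lambda>v. A v * A' v) \<in> forms fscale ((d + d') + (e + e'))"
    using forms_mult[OF f(1) g(1)] by (simp add: ac_simps)
  with 1 show "\<exists>d A B. A \<in> forms fscale (d + (e + e')) \<and> B \<in> forms fscale d \<and> B (rp q) \<noteq> 0 \<and>
     (f * g) * (B \<circ> w) - (A \<circ> w) \<in> mp.N0"
    using forms_mult[OF f(2) g(2)] f(3) g(3)
    by (intro exI[of _ "d + d'"] exI[of _ "\<lambda>v. A v * A' v"] exI[of _ "\<lambda>v. B v * B' v"] conjI) simp_all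
qed

lemma \<Gamma>_add: assumes "f \<in> \<Gamma> e" "g \<in> \<Gamma> e" shows "f + g \<in> \<Gamma> e"
  unfolding \<Gamma>_def
proof (intro CollectI ballI)
  fix q assume q: "q \<in> X"
  obtain d A B where f: "A \<in> forms fscale (d + e)" "B \<in> forms fscale d" "B (rp q) \<noteq> 0" "f * (B \<circ> w) - (A \<circ> w) \<in> mp.N0"
    using assms(1) q by (rule \<Gamma>E)
  obtain d' A' B' where g: "A' \<in> forms fscale (d' + e)" "B' \<in> forms fscale d'" "B' (rp q) \<noteq> 0" "g * (B' \<circ> w) - (A' \<circ> w) \<in> mp.N0"
    using assms(2) q by (rule \<Gamma>E)
  let ?A = "\<lambda>v. A v * B' v + A' v * B v"
  have e: "(f + g) * ((\<lambda>v. B v * B' v) \<circ> w) - (?A \<circ> w) =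
      (B' \<circ> w) * (f * (B \<circ> w) - (A \<circ> w)) + (B \<circ> w) * (g * (B' \<circ> w) - (A' \<circ> w))"
    unfolding comp_mult comp_add by (simp add: algebra_simps)
  have 1: "(f + g) * ((\<lambda>v. B v * B' v) \<circ> w) - (?A \<circ> w) \<in> mp.N0"
    unfolding e by (intro mp.N0_add mp.N0_mult f g)
  have "?A \<in> forms fscale ((d + d') + e)"
    using forms_add[of "\<lambda>v. A v * B' v" fscale "(d + d') + e" "\<lambda>v. A' v * B v"]
      forms_mult[OF f(1) g(2)] forms_mult[OF g(1) f(2)] by (simp add: ac_simps)
  with 1 show "\<exists>d A B. A \<in> forms fscale (d + e) \<and> B \<in> forms fscale d \<and> B (rp q) \<noteq> 0 \<and>
     (f + g) * (B \<circ> w) - (A \<circ> w) \<in> mp.N0"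
    using forms_mult[OF f(2) g(2)] f(3) g(3)
    by (intro exI[of _ "d + d'"] exI[of _ ?A] exI[of _ "\<lambda>v. B v * B' v"] conjI) simp_all
qed

lemma \<Gamma>_scale: assumes "f \<in> \<Gamma> e" shows "fscale c f \<in> \<Gamma> e"
proof -
  have "(\<lambda>_. c) \<circ> w = cfun c" by (rule ext) simp
  then show ?thesis unfolding fscale_eq using \<Gamma>_mult[OF \<Gamma>_form[OF forms_const[of c]] assms] by (simp only: add_0)
qed

lemma \<Gamma>_zero: "0 \<in> \<Gamma> e"
proof -
  have "(\<lambda>v::nat \<Rightarrow> 'k. 0 :: 'k) \<circ> w = 0" by (rule ext) simp
  then show ?thesis using \<Gamma>_form[OF forms_zero[of fscale e]] by (simp only:)
qed

lemma \<Gamma>_sum: "(\<And>j. j \<in> S \<Longrightarrow> f j \<in> \<Gamma> e) \<Longrightarrow> sum f S \<in> \<Gamma> e"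
proof (induction S rule: infinite_finite_induct)
  case (insert x F)
  then have "f x + sum f F \<in> \<Gamma> e" by (intro \<Gamma>_add) auto
  then show ?case using insert(1,2) by (simp only: sum.insert not_False_eq_True)
qed (simp_all only: sum.infinite sum.empty \<Gamma>_zero not_False_eq_True)

text \<open>Up to \<open>N0\<close>, h - c is a quotient of forms, and its numerator is not
  identically zero. So h - c can be cancelled as a nonzero rational function.\<close>

lemma \<Gamma>0_factor:
  assumes h: "h \<in> \<Gamma> 0" and c: "h - cfun c \<notin> mp.N0"
  shows "\<exists>d A B y. A \<in> forms fscale d \<and> B \<in> forms fscale d \<and> A (w y) \<noteq> 0 \<and> (h - cfun c) * (B \<circ> w) - (A \<circ> w) \<in> mp.N0"
proof -
  obtain q where q: "q \<in> X" using X_ne by blast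
  obtain d A B where f: "A \<in> forms fscale (d + 0)" "B \<in> forms fscale d" "B (rp q) \<noteq> 0" "h * (B \<circ> w) - (A \<circ> w) \<in> mp.N0"
    using h q by (rule \<Gamma>E)
  let ?A = "\<lambda>v. A v - c * B v"
  have A: "?A \<in> forms fscale d" using f(1) by (intro forms_diff forms_scale f(2)) simp
  have e: "(h - cfun c) * (B \<circ> w) - (?A \<circ> w) = h * (B \<circ> w) - (A \<circ> w)"
    by (simp add: fun_eq_iff algebra_simps)
  have 1: "(h - cfun c) * (B \<circ> w) - (?A \<circ> w) \<in> mp.N0" unfolding e by (rule f(4))
  have "\<exists>y. ?A (w y) \<noteq> 0"
  proof (rule ccontr)
    assume no: "\<nexists>y. ?A (w y) \<noteq> 0"
    then have z: "?A \<circ> w = 0" by (auto simp: fun_eq_iff)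
    have 2: "(B \<circ> w) * (h - cfun c) \<in> mp.N0"
      using 1 unfolding z diff_0_right mult.commute[of "h - cfun c"] .
    have "B (w q) \<noteq> 0" using f(3) q w_rp by simp
    from N0_form_cancel[OF f(2) this 2] c show False by (rule notE[rotated])
  qed
  then show ?thesis using A f(2) 1 by blast
qed

lemma \<Gamma>0_cancel:
  assumes h: "h \<in> \<Gamma> 0" and c: "h - cfun c \<notin> mp.N0" and u: "(h - cfun c) * u \<in> mp.N0"
  shows "u \<in> mp.N0"
proof -
  obtain d A B y where f: "A \<in> forms fscale d" "B \<in> forms fscale d" "A (w y) \<noteq> 0" "(h - cfun c) * (B \<circ> w) - (A \<circ> w) \<in> mp.N0"
    using \<Gamma>0_factor[OF h c] by blast
  have e: "(A \<circ> w) * u = (B \<circ> w) * ((h - cfun c) * u) - u * ((h - cfun c) * (B \<circ> w) - (A \<circ> w))"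
    by (simp add: algebra_simps)
  have "(A \<circ> w) * u \<in> mp.N0" unfolding e by (intro mp.N0_diff mp.N0_mult u f)
  then show ?thesis by (rule N0_form_cancel[OF f(1,3)])
qed

end

section \<open>Finite dimension of the spaces of sections of twists\<close>

context projective_curve
begin

lemma form_limit:
  assumes M: "mp.fa.place M" "mp.N0 \<subseteq> M"
  shows "\<exists>\<tau> q x c. q \<in> X \<and> c \<noteq> 0 \<and> x = fscale c (rp q) \<and>
     (\<forall>d. \<forall>f\<in>forms fscale d. (\<lambda>y. \<tau> y ^ d) * (f \<circ> w) - cfun (f x) \<in> M)"
proof -
  obtain \<tau> x where x: "mp.adherent x"
    and lim: "\<forall>f\<in>polyfun {\<lambda>v. l (v i) | i l. i \<in> {()} \<and> Vector_Spaces.linear fscale (*) l}.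
        (\<lambda>y. f (\<lambda>i. fscale (\<tau> i y) (w y))) - cfun (f x) \<in> M"
    using mp.limit[OF M] by (elim exE conjE)
  obtain q c where q: "q \<in> X" "c \<noteq> 0" "x () = fscale c (rp q)" using adherent_X[OF x] by blast
  have "(\<lambda>y. \<tau> () y ^ d) * (f \<circ> w) - cfun (f (x ())) \<in> M" if f: "f \<in> forms fscale d" for d f
  proof -
    have m: "(\<lambda>v. f (v ())) \<in> multiforms fscale {()} (\<lambda>_. d)" by (rule forms_to_multiforms[OF f])
    then have "(\<lambda>v. f (v ())) \<in> polyfun {\<lambda>v. l (v i) | i l. i \<in> {()} \<and> Vector_Spaces.linear fscale (*) l}"
      by (simp add: multiforms_def)
    from bspec[OF lim this] have 1: "(\<lambda>y. f (fscale (\<tau> () y) (w y))) - cfun (f (x ())) \<in> M" .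
    have 2: "(\<lambda>y. f (fscale (\<tau> () y) (w y))) = (\<lambda>y. \<tau> () y ^ d) * (f \<circ> w)"
      by (rule ext) (simp add: forms_hom[OF f])
    show ?thesis using 1 unfolding 2 .
  qed
  then show ?thesis using q by (intro exI[of _ "\<tau> ()"] exI[of _ q] exI[of _ "x ()"] exI[of _ c]) simp
qed

text \<open>A nonconstant function h would be transcendental over k, so there is a place at which
  1/h vanishes. The limit of the points along this place is a point of X, where h is regular, so h
  would also be finite at the place.\<close>

lemma \<Gamma>0_const:
  assumes h: "h \<in> \<Gamma> 0" shows "\<exists>c. h - cfun c \<in> mp.N0"
proof (rule ccontr)
  assume "\<nexists>c. h - cfun c \<in> mp.N0"
  then have no: "\<And>c. h - cfun c \<notin> mp.N0" by blast
  define hh where "hh = mp.unitize h"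
  define g where "g = (\<lambda>y. inverse (hh y))"
  have ghh: "g * hh = 1" by (rule ext) (simp add: g_def hh_def mp.unitize_nz)
  have hhh: "hh - h \<in> mp.N0"
  proof (rule \<Gamma>0_cancel[OF h no[of 0]])
    have "(h - cfun 0) * (hh - h) = 0" by (rule ext) (simp add: hh_def mp.unitize_def)
    then show "(h - cfun 0) * (hh - h) \<in> mp.N0" by (simp only: mp.N0_zero)
  qed
  have canc: "u \<in> mp.N0" if "(hh - cfun c) * u \<in> mp.N0" for c u
  proof (rule \<Gamma>0_cancel[OF h no[of c]])
    have "(h - cfun c) * u = (hh - cfun c) * u - u * (hh - h)" by (simp add: algebra_simps)
    then show "(h - cfun c) * u \<in> mp.N0" using mp.N0_diff[OF that mp.N0_mult[OF hhh, of u]] by (simp only:)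
  qed
  \<comment> \<open>Transcendence of h modulo \<open>N0\<close>: over an algebraically closed field
    P splits into linear factors, each of which can be cancelled by \<open>canc\<close>.\<close>
  have noroot: "P \<noteq> 0 \<Longrightarrow> (\<lambda>y. poly P (hh y)) \<in> mp.N0 \<Longrightarrow> False" for P
  proof (induction "degree P" arbitrary: P)
    case 0
    then obtain c where c: "P = [:c:]" by (metis degree_0_id)
    then have "cfun (inverse c) * (\<lambda>y. poly P (hh y)) = 1" using 0 by (intro ext) simp
    then show False using mp.N0_mult[OF 0(3), of "cfun (inverse c)"] mp.N0_one by (simp only:)
  next
    case (Suc k)
    obtain c where "poly P c = 0" using alg_closed_imp_poly_has_root[of P] Suc by auto
    then obtain P' where P': "P = [:-c, 1:] * P'" using poly_eq_0_iff_dvd by blast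
    have "P' \<noteq> 0" using P' Suc.prems by auto
    then have "degree P = Suc (degree P')" unfolding P' by (subst degree_mult_eq) auto
    then have d: "k = degree P'" using Suc.hyps by simp
    have "(\<lambda>y. poly P (hh y)) = (hh - cfun c) * (\<lambda>y. poly P' (hh y))" unfolding P' by (rule ext) (simp add: algebra_simps)
    then have "(hh - cfun c) * (\<lambda>y. poly P' (hh y)) \<in> mp.N0" using Suc.prems(2) by (simp only:)
    then have "(\<lambda>y. poly P' (hh y)) \<in> mp.N0" by (rule canc)
    then show False by (rule Suc.hyps(1)[OF d \<open>P' \<noteq> 0\<close>])
  qed
  \<comment> \<open>Polynomials without constant term in g = 1/h, up to \<open>N0\<close>; a place
    over them is a pole of h.\<close>
  define M0 where "M0 = {nn + (\<lambda>y. g y * poly p (g y)) | nn p. nn \<in> mp.N0}"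
  have M0I: "a \<in> M0" if "nn \<in> mp.N0" "\<And>y. a y = nn y + g y * poly p (g y)" for a nn p
  proof -
    have "a = nn + (\<lambda>y. g y * poly p (g y))" by (rule ext) (simp add: that(2))
    then show ?thesis using that(1) unfolding M0_def by blast
  qed
  have M0E: "\<exists>nn p. nn \<in> mp.N0 \<and> (\<forall>y. a y = nn y + g y * poly p (g y))" if "a \<in> M0" for a
  proof -
    obtain nn p where "nn \<in> mp.N0" "a = nn + (\<lambda>y. g y * poly p (g y))" using \<open>a \<in> M0\<close> unfolding M0_def by blast
    then show ?thesis by (intro exI[of _ nn] exI[of _ p]) simp
  qed
  have "mp.fa.nonunital M0"
    unfolding mp.fa.nonunital_def
  proof (intro conjI ballI allI)
    show "0 \<in> M0" by (rule M0I[OF mp.N0_zero, of _ 0]) simp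
    show "1 \<notin> M0"
    proof
      assume "1 \<in> M0"
      from M0E[OF this] obtain nn p where p: "nn \<in> mp.N0" "\<forall>y. 1 y = nn y + g y * poly p (g y)" by blast
      define d where "d = degree p"
      \<comment> \<open>The equation 1 = g p(g) cleared of denominators by h^(d+1). The monic
        leading term shows that P is not zero.\<close>
      define P where "P = monom 1 (Suc d) - (\<Sum>i\<le>d. monom (coeff p i) (d - i))"
      have "coeff P (Suc d) = 1"
        by (auto simp: P_def coeff_sum intro!: sum.neutral)
      then have P0: "P \<noteq> 0" by auto
      have "poly P (hh y) = (hh ^ Suc d * nn) y" for y
      proof -
        let ?z = "hh y"
        have z: "?z \<noteq> 0" by (simp add: hh_def mp.unitize_nz)
        have gz: "g y = inverse ?z" by (simp add: g_def)
        have "?z ^ Suc d * (g y * poly p (g y)) = ?z ^ d * poly p (g y)" using z by (simp add: gz)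
        also have "\<dots> = (\<Sum>i\<le>d. coeff p i * (?z ^ d * g y ^ i))"
          by (simp add: poly_altdef d_def sum_distrib_left algebra_simps)
        also have "\<dots> = (\<Sum>i\<le>d. coeff p i * ?z ^ (d - i))"
          by (rule sum.cong) (use z in \<open>auto simp: gz power_diff field_simps\<close>)
        finally have 1: "?z ^ Suc d * (g y * poly p (g y)) = (\<Sum>i\<le>d. coeff p i * ?z ^ (d - i))" .
        have "1 = nn y + g y * poly p (g y)" using p(2) by simp
        then have "?z ^ Suc d = ?z ^ Suc d * nn y + ?z ^ Suc d * (g y * poly p (g y))"
          by (metis distrib_left mult.right_neutral)
        then have "?z ^ Suc d - (\<Sum>i\<le>d. coeff p i * ?z ^ (d - i)) = ?z ^ Suc d * nn y" unfolding 1 by (simp only: diff_eq_eq)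
        moreover have "poly P ?z = ?z ^ Suc d - (\<Sum>i\<le>d. coeff p i * ?z ^ (d - i))" by (simp add: P_def poly_sum poly_monom)
        ultimately have "poly P ?z = ?z ^ Suc d * nn y" by (simp only:)
        moreover have "(hh ^ k) y = ?z ^ k" for k by (induction k) auto
        ultimately show ?thesis by simp
      qed
      then have "(\<lambda>y. poly P (hh y)) = hh ^ Suc d * nn" by (rule ext)
      then have "(\<lambda>y. poly P (hh y)) \<in> mp.N0" using mp.N0_mult[OF p(1), of "hh ^ Suc d"] by (simp only:)
      then show False by (rule noroot[OF P0])
    qed
    fix c a assume "a \<in> M0"
    from M0E[OF this] obtain nn p where p: "nn \<in> mp.N0" "\<forall>y. a y = nn y + g y * poly p (g y)" by blast
    show "cfun c * a \<in> M0" by (rule M0I[OF mp.N0_mult[OF p(1), of "cfun c"], of _ "smult c p"])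
      (simp add: p(2)[rule_format] algebra_simps)
  next
    fix a b assume a: "a \<in> M0" and b: "b \<in> M0"
    from M0E[OF a] obtain nn p where p: "nn \<in> mp.N0" "\<forall>y. a y = nn y + g y * poly p (g y)" by blast
    from M0E[OF b] obtain mm q where q: "mm \<in> mp.N0" "\<forall>y. b y = mm y + g y * poly q (g y)" by blast
    show "a + b \<in> M0" by (rule M0I[OF mp.N0_add[OF p(1) q(1)], of _ "p + q"])
      (simp add: p(2)[rule_format] q(2)[rule_format] algebra_simps)
    have n: "b * nn + (\<lambda>y. g y * poly p (g y)) * mm \<in> mp.N0" by (intro mp.N0_add mp.N0_mult p q)
    show "a * b \<in> M0" by (rule M0I[OF n, of _ "[:0, 1:] * p * q"])
      (simp add: p(2)[rule_format] q(2)[rule_format] algebra_simps)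
  qed
  from mp.fa.exists_place[OF this] obtain M where M: "mp.fa.place M" "M0 \<subseteq> M" by blast
  interpret pl: place_of "cfun :: 'k \<Rightarrow> (nat \<Rightarrow> 'k) set \<Rightarrow> 'k" M
    by unfold_locales (rule M(1))
  have N0M: "mp.N0 \<subseteq> M"
  proof
    fix a assume "a \<in> mp.N0"
    then have "a \<in> M0" by (rule M0I[of _ _ 0]) simp
    then show "a \<in> M" using M by blast
  qed
  have "g \<in> M0" by (rule M0I[OF mp.N0_zero, of _ 1]) simp
  then have gM: "g \<in> M" using M by blast
  obtain \<tau> q x c where q: "q \<in> X" "c \<noteq> 0" "x = fscale c (rp q)"
    and lim: "\<forall>d. \<forall>f\<in>forms fscale d. (\<lambda>y. \<tau> y ^ d) * (f \<circ> w) - cfun (f x) \<in> M"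
    using form_limit[OF M(1) N0M] by (elim exE conjE)
  obtain d A B where f: "A \<in> forms fscale (d + 0)" "B \<in> forms fscale d" "B (rp q) \<noteq> 0" "h * (B \<circ> w) - (A \<circ> w) \<in> mp.N0"
    using h q(1) by (rule \<Gamma>E)
  let ?P = "\<lambda>y. \<tau> y ^ d"
  have Bx: "B x \<noteq> 0" unfolding q(3) forms_hom[OF f(2)] using q f by simp
  have A: "A \<in> forms fscale d" using f(1) by simp
  have AA: "?P * (A \<circ> w) \<in> pl.A" by (rule pl.AI[OF lim[rule_format, OF A]])
  have "?P * (h * (B \<circ> w) - (A \<circ> w)) \<in> pl.A" using mp.N0_mult[OF f(4)] N0M pl.M_A by blast
  from pl.A_add[OF AA this] have "(?P * (B \<circ> w)) * h \<in> pl.A" by (simp add: algebra_simps)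
  \<comment> \<open>The local denominator B does not vanish at the limit point, so it has nonzero
    residue at the place and can be divided out.\<close>
  from pl.A_unit[OF lim[rule_format, OF f(2)] Bx this] have "h \<in> pl.A" .
  moreover have "hh - h \<in> pl.A" using hhh N0M pl.M_A by blast
  ultimately have "h + (hh - h) \<in> pl.A" by (rule pl.A_add)
  then have "hh \<in> pl.A" by simp
  from pl.AM_mult[OF this gM] have "g * hh \<in> M" by (simp only: mult.commute)
  then show False unfolding ghh by simp
qed

lemma N0_functional:
  assumes "f \<in> forms fscale d" "f (w y) \<noteq> 0"
  shows "(f \<circ> w) * (\<lambda>y. u y / mp.unitize (f \<circ> w) y) - u \<in> mp.N0"
  by (rule N0_formI[OF assms]) (simp add: mp.unitize_def)

text \<open>Multiplication by \<open>l0\<close> from twist e to twist e + 1 has cokernel of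
  dimension at most N, the slope of the growth bound. The N + 1 given sections, multiplied by all
  monomials in l0 and l1 of large degree, exceed the available dimension. Dividing the resulting
  relation by its lowest power of \<open>l0\<close> leaves a combination of the sections that is
  divisible by \<open>l0\<close>.\<close>

lemma \<Gamma>_dependent:
  assumes l0: "Vector_Spaces.linear fscale (*) l0" and l1: "Vector_Spaces.linear fscale (*) l1"
    and l01: "\<forall>x\<in>X. l0 (rp x) \<noteq> 0 \<or> l1 (rp x) \<noteq> (0::'k)" and y0: "l0 (w y0) \<noteq> 0"
    and N: "\<forall>D. \<exists>S. finite S \<and> card S \<le> N * (D + 1) \<and> (\<forall>A\<in>forms fscale D. A \<circ> w \<in> fsp.span S)"
    and f: "\<And>j. j \<le> N \<Longrightarrow> f j \<in> \<Gamma> (Suc e)"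
  shows "\<exists>c. (\<exists>j\<le>N. c j \<noteq> 0) \<and> (\<exists>h\<in>\<Gamma> e. (\<Sum>j\<le>N. fscale (c j) (f j)) - (l0 \<circ> w) * h \<in> mp.N0)"
proof -
  obtain q0 where q0: "q0 \<in> X" using X_ne by blast
  have "\<forall>j. \<exists>d A B. j \<le> N \<longrightarrow> A \<in> forms fscale (d + Suc e) \<and> B \<in> forms fscale d \<and> B (rp q0) \<noteq> 0 \<and>
     f j * (B \<circ> w) - (A \<circ> w) \<in> mp.N0"
    using f q0 unfolding \<Gamma>_def by blast
  then obtain d A B where dAB: "\<And>j. j \<le> N \<Longrightarrow> A j \<in> forms fscale (d j + Suc e) \<and> B j \<in> forms fscale (d j) \<and> B j (rp q0) \<noteq> 0 \<and>
     f j * (B j \<circ> w) - (A j \<circ> w) \<in> mp.N0" by metis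
  define c where "c = sum d {..N}"
  \<comment> \<open>A common denominator turns all N + 1 sections into forms of one degree, to which
    the growth bound applies.\<close>
  define Q where "Q = (\<lambda>v. \<Prod>j\<le>N. B j v)"
  define R where "R j = (\<lambda>v. \<Prod>i\<in>{..N} - {j}. B i v)" for j
  define a where "a j = (\<lambda>v. A j v * R j v)" for j
  have Q: "Q \<in> forms fscale c" unfolding Q_def c_def by (rule forms_prod) (use dAB in auto)
  have Q0: "Q (w q0) \<noteq> 0" using dAB w_rp[OF q0] by (simp add: Q_def)
  have a: "a j \<in> forms fscale (c + Suc e)" if "j \<le> N" for j
  proof -
    have "R j \<in> forms fscale (sum d ({..N} - {j}))" unfolding R_def by (rule forms_prod) (use dAB in auto)
    from forms_mult[OF _ this, of "A j" "d j + Suc e"]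
    have "a j \<in> forms fscale (d j + Suc e + sum d ({..N} - {j}))" using dAB[OF that] unfolding a_def by blast
    moreover have "c = d j + sum d ({..N} - {j})" unfolding c_def by (rule sum.remove) (use that in auto)
    ultimately show ?thesis by (simp add: ac_simps)
  qed
  have Qf: "(Q \<circ> w) * f j - (a j \<circ> w) \<in> mp.N0" if "j \<le> N" for j
  proof -
    have "Q v = B j v * R j v" for v unfolding Q_def R_def by (rule prod.remove) (use that in auto)
    then have Qc: "Q \<circ> w = (B j \<circ> w) * (R j \<circ> w)" by (intro ext) simp
    have ac: "a j \<circ> w = (A j \<circ> w) * (R j \<circ> w)" unfolding a_def by (intro ext) simp
    have "(Q \<circ> w) * f j - (a j \<circ> w) = (R j \<circ> w) * (f j * (B j \<circ> w) - (A j \<circ> w))"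
      unfolding Qc ac by (simp add: algebra_simps)
    then show ?thesis using mp.N0_mult[of "f j * (B j \<circ> w) - (A j \<circ> w)" "R j \<circ> w"] dAB[OF that] by (simp only:)
  qed
  \<comment> \<open>With this D the number (N + 1)(D + 1) of products exceeds the bound N (D + c + e
    + 2) by exactly 1.\<close>
  define D where "D = N * (c + Suc e)"
  let ?L0 = "l0 \<circ> w" and ?L1 = "l1 \<circ> w"
  note fl0 = forms_linear[OF l0] and fl1 = forms_linear[OF l1]
  have pw: "(\<lambda>v. l v ^ k) \<circ> w = (l \<circ> w) ^ k" for l :: "(nat \<Rightarrow> 'k) \<Rightarrow> 'k" and k
    by (induction k) (auto simp: fun_eq_iff)
  define m where "m \<alpha> D = ?L0 ^ \<alpha> * ?L1 ^ (D - \<alpha>)" for \<alpha> D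
  have mform: "\<exists>F\<in>forms fscale D. F \<circ> w = m \<alpha> D" if "\<alpha> \<le> D" for \<alpha> D
  proof -
    have "(\<lambda>v. l0 v ^ \<alpha> * l1 v ^ (D - \<alpha>)) \<in> forms fscale (\<alpha> * 1 + (D - \<alpha>) * 1)"
      by (intro forms_mult forms_power fl0 fl1)
    then have "(\<lambda>v. l0 v ^ \<alpha> * l1 v ^ (D - \<alpha>)) \<in> forms fscale D" using that by simp
    moreover have "(\<lambda>v. l0 v ^ \<alpha> * l1 v ^ (D - \<alpha>)) \<circ> w = m \<alpha> D"
      unfolding m_def comp_mult pw ..
    ultimately show ?thesis by blast
  qed
  define v where "v = (\<lambda>(j, \<alpha>). m \<alpha> D * (a j \<circ> w))"
  let ?I = "{..N} \<times> {..D}"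
  obtain S where S: "finite S" "card S \<le> N * (D + (c + Suc e) + 1)"
    "\<forall>A\<in>forms fscale (D + (c + Suc e)). A \<circ> w \<in> fsp.span S" using N by blast
  have "card S < card ?I" using S(2) by (simp add: D_def card_cartesian_product algebra_simps)
  have vS: "v i \<in> fsp.span S" if iI: "i \<in> ?I" for i
  proof -
    obtain j \<alpha> where i: "i = (j, \<alpha>)" "j \<le> N" "\<alpha> \<le> D" using iI by blast
    obtain F where F: "F \<in> forms fscale D" "F \<circ> w = m \<alpha> D" using mform[OF i(3)] by blast
    have "v i = (\<lambda>v. F v * a j v) \<circ> w" unfolding comp_mult F(2) by (simp add: v_def i)
    then show ?thesis using bspec[OF S(3) forms_mult[OF F(1) a[OF i(2)]]] by (simp only:)
  qed
  have "\<exists>b. (\<exists>i\<in>?I. b i \<noteq> 0) \<and> (\<Sum>i\<in>?I. fscale (b i) (v i)) = 0"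
    by (rule fsp.ex_relation[OF _ S(1) \<open>card S < card ?I\<close> vS]) simp_all
  then obtain b where b: "\<exists>i\<in>?I. b i \<noteq> 0" "(\<Sum>i\<in>?I. fscale (b i) (v i)) = 0" by (elim exE conjE)
  define t where "t = (\<lambda>(j, \<alpha>). m \<alpha> D * f j)"
  have tN: "(\<Sum>i\<in>?I. fscale (b i) (t i)) \<in> mp.N0"
  proof (rule N0_form_cancel[OF Q Q0])
    have "(Q \<circ> w) * (\<Sum>i\<in>?I. fscale (b i) (t i)) =
       (\<Sum>i\<in>?I. fscale (b i) (v i)) + (\<Sum>i\<in>?I. cfun (b i) * (m (snd i) D * ((Q \<circ> w) * f (fst i) - (a (fst i) \<circ> w))))"
      unfolding sum_distrib_left sum.distrib[symmetric]
      by (rule sum.cong[OF refl]) (auto simp: t_def v_def fscale_eq algebra_simps)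
    also have "\<dots> \<in> mp.N0" unfolding b(2) add_0
    proof (rule mp.N0_sum)
      fix i assume "i \<in> ?I"
      then have "fst i \<le> N" by auto
      then show "cfun (b i) * (m (snd i) D * ((Q \<circ> w) * f (fst i) - (a (fst i) \<circ> w))) \<in> mp.N0"
        by (intro mp.N0_mult Qf)
    qed
    finally show "(Q \<circ> w) * (\<Sum>i\<in>?I. fscale (b i) (t i)) \<in> mp.N0" .
  qed
  define Z where "Z \<alpha> \<longleftrightarrow> (\<exists>j\<le>N. b (j, \<alpha>) \<noteq> 0) \<and> \<alpha> \<le> D" for \<alpha>
  have "\<exists>\<alpha>. Z \<alpha>" using b(1) unfolding Z_def by auto
  \<comment> \<open>The lowest power of \<open>l0\<close> in the relation; after division by it the
    terms free of \<open>l0\<close> have coefficients that are not all zero.\<close>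
  then obtain \<alpha>0 where \<alpha>0: "Z \<alpha>0" "\<And>\<alpha>. Z \<alpha> \<Longrightarrow> \<alpha>0 \<le> \<alpha>" by (metis LeastI Least_le)
  have le: "\<alpha>0 \<le> D" using \<alpha>0(1) by (simp add: Z_def)
  define D' where "D' = D - \<alpha>0"
  define p where "p j \<beta> = b (j, \<alpha>0 + \<beta>)" for j \<beta>
  define RR where "RR = (\<Sum>j\<le>N. \<Sum>\<beta>\<le>D'. fscale (p j \<beta>) (m \<beta> D' * f j))"
  have "(\<Sum>i\<in>?I. fscale (b i) (t i)) = (\<Sum>j\<le>N. \<Sum>\<alpha>\<le>D. fscale (b (j, \<alpha>)) (m \<alpha> D * f j))"
    unfolding sum.cartesian_product by (rule sum.cong) (auto simp: t_def)
  also have "\<dots> = (\<Sum>j\<le>N. \<Sum>\<beta>\<le>D'. fscale (p j \<beta>) (m (\<alpha>0 + \<beta>) D * f j))"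
  proof (rule sum.cong[OF refl])
    fix j assume j: "j \<in> {..N}"
    have "(\<Sum>\<alpha>\<le>D. fscale (b (j, \<alpha>)) (m \<alpha> D * f j)) = (\<Sum>\<alpha>\<in>{\<alpha>0..D}. fscale (b (j, \<alpha>)) (m \<alpha> D * f j))"
    proof (rule sum.mono_neutral_right)
      show "\<forall>\<alpha>\<in>{..D} - {\<alpha>0..D}. fscale (b (j, \<alpha>)) (m \<alpha> D * f j) = 0"
      proof
        fix \<alpha> assume al: "\<alpha> \<in> {..D} - {\<alpha>0..D}"
        then have "\<not> Z \<alpha>" using \<alpha>0(2)[of \<alpha>] by auto
        then have "b (j, \<alpha>) = 0" using j al by (auto simp: Z_def)
        then show "fscale (b (j, \<alpha>)) (m \<alpha> D * f j) = 0" by simp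
      qed
    qed auto
    also have "\<dots> = (\<Sum>\<beta>\<le>D'. fscale (p j \<beta>) (m (\<alpha>0 + \<beta>) D * f j))"
      unfolding p_def
      by (rule sum.reindex_bij_witness[of _ "\<lambda>\<beta>. \<alpha>0 + \<beta>" "\<lambda>\<alpha>. \<alpha> - \<alpha>0"]) (use le in \<open>auto simp: D'_def\<close>)
    finally show "(\<Sum>\<alpha>\<le>D. fscale (b (j, \<alpha>)) (m \<alpha> D * f j)) = (\<Sum>\<beta>\<le>D'. fscale (p j \<beta>) (m (\<alpha>0 + \<beta>) D * f j))" .
  qed
  also have "\<dots> = ?L0 ^ \<alpha>0 * RR"
    unfolding RR_def sum_distrib_left
  proof (intro sum.cong[OF refl])
    fix j \<beta> assume "\<beta> \<in> {..D'}"
    then have e: "D - (\<alpha>0 + \<beta>) = D' - \<beta>" by (simp add: D'_def)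
    show "fscale (p j \<beta>) (m (\<alpha>0 + \<beta>) D * f j) = ?L0 ^ \<alpha>0 * fscale (p j \<beta>) (m \<beta> D' * f j)"
      unfolding m_def e fscale_eq power_add by (simp only: ac_simps)
  qed
  finally have "((\<lambda>v. l0 v ^ \<alpha>0) \<circ> w) * RR \<in> mp.N0" using tN unfolding pw by (simp only:)
  moreover have "l0 (w y0) ^ \<alpha>0 \<noteq> 0" using y0 by simp
  ultimately have RN: "RR \<in> mp.N0" using N0_form_cancel[OF forms_power[OF fl0, of \<alpha>0], of y0 RR] by blast
  define g where "g = (\<Sum>j\<le>N. fscale (p j 0) (f j))"
  define G where "G = (\<Sum>j\<le>N. \<Sum>\<beta><D'. fscale (p j (Suc \<beta>)) (m \<beta> (D' - 1) * f j))"
  \<comment> \<open>Only the terms without \<open>l0\<close> enter g, so modulo \<open>l0\<close>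
    the relation says that l1^D' g vanishes.\<close>
  have "RR = ?L1 ^ D' * g + ?L0 * G"
    unfolding RR_def g_def G_def sum_distrib_left sum.distrib[symmetric]
  proof (rule sum.cong[OF refl])
    fix j
    have "(\<Sum>\<beta>\<le>D'. fscale (p j \<beta>) (m \<beta> D' * f j)) = fscale (p j 0) (m 0 D' * f j) + (\<Sum>\<beta><D'. fscale (p j (Suc \<beta>)) (m (Suc \<beta>) D' * f j))"
      by (rule sum.atMost_shift)
    also have "fscale (p j 0) (m 0 D' * f j) = ?L1 ^ D' * fscale (p j 0) (f j)"
      by (simp add: m_def fscale_eq algebra_simps)
    also have "(\<Sum>\<beta><D'. fscale (p j (Suc \<beta>)) (m (Suc \<beta>) D' * f j)) = (\<Sum>\<beta><D'. ?L0 * fscale (p j (Suc \<beta>)) (m \<beta> (D' - 1) * f j))"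
    proof (rule sum.cong[OF refl])
      fix \<beta> assume "\<beta> \<in> {..<D'}"
      then have e: "D' - Suc \<beta> = D' - 1 - \<beta>" by simp
      show "fscale (p j (Suc \<beta>)) (m (Suc \<beta>) D' * f j) = ?L0 * fscale (p j (Suc \<beta>)) (m \<beta> (D' - 1) * f j)"
        unfolding m_def e fscale_eq power_Suc by (simp only: ac_simps)
    qed
    finally show "(\<Sum>\<beta>\<le>D'. fscale (p j \<beta>) (m \<beta> D' * f j)) =
       ?L1 ^ D' * fscale (p j 0) (f j) + (\<Sum>\<beta><D'. ?L0 * fscale (p j (Suc \<beta>)) (m \<beta> (D' - 1) * f j))" .
  qed
  with RN have RN': "?L1 ^ D' * g + ?L0 * G \<in> mp.N0" by (simp only:)
  have g: "g \<in> \<Gamma> (Suc e)" unfolding g_def by (intro \<Gamma>_sum \<Gamma>_scale f) simp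
  have G: "G \<in> \<Gamma> (D' + e)" unfolding G_def
  proof (intro \<Gamma>_sum \<Gamma>_scale)
    fix j \<beta> assume j: "j \<in> {..N}" "\<beta> \<in> {..<D'}"
    obtain F where F: "F \<in> forms fscale (D' - 1)" "F \<circ> w = m \<beta> (D' - 1)"
    proof -
      have "\<beta> \<le> D' - 1" using j by auto
      from mform[OF this] show thesis using that by blast
    qed
    have "m \<beta> (D' - 1) * f j \<in> \<Gamma> (D' - 1 + Suc e)"
      unfolding F(2)[symmetric] by (intro \<Gamma>_mult \<Gamma>_form F f) (use j in simp)
    moreover have "D' - 1 + Suc e = D' + e" using j by simp
    ultimately show "m \<beta> (D' - 1) * f j \<in> \<Gamma> (D' + e)" by simp
  qed
  define h where "h = (\<lambda>y. g y / mp.unitize ?L0 y)"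
  have hg: "?L0 * h - g \<in> mp.N0" unfolding h_def by (rule N0_functional[OF fl0 y0])
  \<comment> \<open>The quotient h = g / l0 is regular where \<open>l0\<close> is nonzero. Elsewhere
    \<open>l1\<close> is nonzero, and the relation gives h = - G / l1^D'.\<close>
  have "h \<in> \<Gamma> e"
    unfolding \<Gamma>_def
  proof (intro CollectI ballI)
    fix q assume q: "q \<in> X"
    show "\<exists>d A B. A \<in> forms fscale (d + e) \<and> B \<in> forms fscale d \<and> B (rp q) \<noteq> 0 \<and> h * (B \<circ> w) - (A \<circ> w) \<in> mp.N0"
    proof (cases "l0 (rp q) = 0")
      case False
      obtain d A B where AB: "A \<in> forms fscale (d + Suc e)" "B \<in> forms fscale d" "B (rp q) \<noteq> 0" "g * (B \<circ> w) - (A \<circ> w) \<in> mp.N0"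
        using g q by (rule \<Gamma>E)
      have e: "h * ((\<lambda>v. l0 v * B v) \<circ> w) - (A \<circ> w) = (B \<circ> w) * (?L0 * h - g) + (g * (B \<circ> w) - (A \<circ> w))"
        unfolding comp_mult by (simp add: algebra_simps)
      have "h * ((\<lambda>v. l0 v * B v) \<circ> w) - (A \<circ> w) \<in> mp.N0" unfolding e by (intro mp.N0_add mp.N0_mult hg AB)
      then show ?thesis using forms_mult[OF fl0 AB(2)] AB(1,3) False
        by (intro exI[of _ "1 + d"] exI[of _ A] exI[of _ "\<lambda>v. l0 v * B v"] conjI) simp_all
    next
      case True
      then have l1q: "l1 (rp q) \<noteq> 0" using l01 q by blast
      obtain d A B where AB: "A \<in> forms fscale (d + (D' + e))" "B \<in> forms fscale d" "B (rp q) \<noteq> 0" "G * (B \<circ> w) - (A \<circ> w) \<in> mp.N0"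
        using G q by (rule \<Gamma>E)
      let ?B = "\<lambda>v. l1 v ^ D' * B v" and ?A = "\<lambda>v. - 1 * A v"
      have cA: "?A \<circ> w = - (A \<circ> w)" by (rule ext) simp
      have e: "?L0 * (h * (?B \<circ> w) - (?A \<circ> w)) = (?L1 ^ D' * (B \<circ> w)) * (?L0 * h - g) + (B \<circ> w) * (?L1 ^ D' * g + ?L0 * G)
          - ?L0 * (G * (B \<circ> w) - (A \<circ> w))"
        unfolding cA unfolding comp_mult pw by (simp add: algebra_simps)
      have "?L0 * (h * (?B \<circ> w) - (?A \<circ> w)) \<in> mp.N0"
        unfolding e by (intro mp.N0_add mp.N0_diff mp.N0_mult hg RN' AB)
      then have 1: "h * (?B \<circ> w) - (?A \<circ> w) \<in> mp.N0" by (rule N0_form_cancel[OF fl0 y0])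
      have "?B \<in> forms fscale (D' * 1 + d)" by (intro forms_mult forms_power fl1 AB)
      moreover have "?A \<in> forms fscale (D' + d + e)"
        using forms_scale[OF AB(1), of "-1"] by (simp add: ac_simps)
      ultimately show ?thesis using 1 AB(3) l1q
        by (intro exI[of _ "D' + d"] exI[of _ ?A] exI[of _ ?B] conjI) simp_all
    qed
  qed
  moreover have "g - ?L0 * h \<in> mp.N0" using mp.N0_neg[OF hg] by simp
  moreover have "\<exists>j\<le>N. p j 0 \<noteq> 0" using \<alpha>0(1) by (auto simp: Z_def p_def)
  ultimately show ?thesis unfolding g_def by (intro exI[of _ "\<lambda>j. p j 0"] conjI) blast+
qed

text \<open>Induction on the twist: constants for e = 0, then multiples of \<open>l0\<close> by
  sections of the previous twist together with finitely many representatives of the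
  cokernel.\<close>

lemma \<Gamma>_fd: "\<exists>C. finite C \<and> (\<forall>h\<in>\<Gamma> e. \<exists>s\<in>fsp.span C. h - s \<in> mp.N0)"
proof -
  obtain l0 l1 y0 where l: "Vector_Spaces.linear fscale (*) l0" "Vector_Spaces.linear fscale (*) l1"
    "\<forall>x\<in>X. l0 (rp x) \<noteq> 0 \<or> l1 (rp x) \<noteq> (0::'k)" "l0 (w y0) \<noteq> 0" using ex_two_forms by blast
  obtain N where N: "\<forall>D. \<exists>S. finite S \<and> card S \<le> N * (D + 1) \<and> (\<forall>A\<in>forms fscale D. A \<circ> w \<in> fsp.span S)"
    using form_span_bound by (elim exE)
  show ?thesis
  proof (induction e)
    case 0
    have fd: "\<exists>s\<in>fsp.span {1}. h - s \<in> mp.N0" if h: "h \<in> \<Gamma> 0" for h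
    proof -
      obtain c where c: "h - cfun c \<in> mp.N0" using \<Gamma>0_const[OF h] by (elim exE)
      have "fscale c 1 \<in> fsp.span {1 :: (nat \<Rightarrow> 'k) set \<Rightarrow> 'k}" by (intro fsp.span_scale fsp.span_base) simp
      moreover have "fscale c 1 = (cfun c :: (nat \<Rightarrow> 'k) set \<Rightarrow> 'k)" by (rule ext) (simp add: fscale_def)
      ultimately have "cfun c \<in> fsp.span {1 :: (nat \<Rightarrow> 'k) set \<Rightarrow> 'k}" by (simp only:)
      then show ?thesis using c by (intro bexI[of _ "cfun c"])
    qed
    show ?case by (intro exI[of _ "{1}"] conjI ballI finite.intros fd)
  next
    case (Suc e)
    then obtain C where C: "finite C" "\<forall>h\<in>\<Gamma> e. \<exists>s\<in>fsp.span C. h - s \<in> mp.N0" by (elim exE conjE)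
    define AA where "AA = {h. \<exists>g\<in>\<Gamma> e. h - (l0 \<circ> w) * g \<in> mp.N0}"
    have AAI: "h \<in> AA" if "g \<in> \<Gamma> e" "h - (l0 \<circ> w) * g \<in> mp.N0" for h g
      using that unfolding AA_def by blast
    have sub: "fsp.subspace AA"
      unfolding fsp.subspace_def
    proof (intro conjI ballI allI)
      show "0 \<in> AA" by (rule AAI[OF \<Gamma>_zero]) (simp only: mult_zero_right diff_self mp.N0_zero)
    next
      fix h h' assume "h \<in> AA" "h' \<in> AA"
      then obtain g g' where g: "g \<in> \<Gamma> e" "h - (l0 \<circ> w) * g \<in> mp.N0" "g' \<in> \<Gamma> e" "h' - (l0 \<circ> w) * g' \<in> mp.N0"
        unfolding AA_def by blast
      have "h + h' - (l0 \<circ> w) * (g + g') = (h - (l0 \<circ> w) * g) + (h' - (l0 \<circ> w) * g')" by (simp add: algebra_simps)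
      then have "h + h' - (l0 \<circ> w) * (g + g') \<in> mp.N0" using mp.N0_add[OF g(2,4)] by (simp only:)
      then show "h + h' \<in> AA" by (rule AAI[OF \<Gamma>_add[OF g(1,3)]])
    next
      fix c h assume "h \<in> AA"
      then obtain g where g: "g \<in> \<Gamma> e" "h - (l0 \<circ> w) * g \<in> mp.N0" unfolding AA_def by blast
      have "fscale c h - (l0 \<circ> w) * fscale c g = cfun c * (h - (l0 \<circ> w) * g)" by (simp add: fscale_eq algebra_simps)
      then have "fscale c h - (l0 \<circ> w) * fscale c g \<in> mp.N0" using mp.N0_mult[OF g(2), of "cfun c"] by (simp only:)
      then show "fscale c h \<in> AA" by (rule AAI[OF \<Gamma>_scale[OF g(1)]])
    qed
    have "\<exists>c. (\<exists>j\<le>N. c j \<noteq> 0) \<and> (\<Sum>j\<le>N. fscale (c j) (f j)) \<in> AA" if "\<And>j. j \<le> N \<Longrightarrow> f j \<in> \<Gamma> (Suc e)" for f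
      unfolding AA_def mem_Collect_eq by (rule \<Gamma>_dependent[OF l N that])
    from fsp.finite_span_modulo[OF sub, of N "\<Gamma> (Suc e)", OF this]
    obtain C' where C': "finite C'" "\<forall>t\<in>\<Gamma> (Suc e). \<exists>s\<in>fsp.span C'. t - s \<in> AA" by blast
    let ?C = "C' \<union> (\<lambda>s. (l0 \<circ> w) * s) ` C"
    have fd: "\<exists>s\<in>fsp.span ?C. h - s \<in> mp.N0" if h: "h \<in> \<Gamma> (Suc e)" for h
    proof -
      obtain s where s: "s \<in> fsp.span C'" "h - s \<in> AA" using C'(2) h by blast
      then obtain g where g: "g \<in> \<Gamma> e" "h - s - (l0 \<circ> w) * g \<in> mp.N0" unfolding AA_def by blast
      obtain s' where s': "s' \<in> fsp.span C" "g - s' \<in> mp.N0" using C(2) g(1) by blast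
      have "s \<in> fsp.span ?C" using s(1) fsp.span_mono[of C' ?C] by blast
      moreover have "(l0 \<circ> w) * s' \<in> fsp.span ?C"
        by (rule fspan_mult_left[OF s'(1)]) (intro fsp.span_base UnI2 imageI)
      ultimately have "s + (l0 \<circ> w) * s' \<in> fsp.span ?C" by (rule fsp.span_add)
      moreover have "h - (s + (l0 \<circ> w) * s') = (h - s - (l0 \<circ> w) * g) + (l0 \<circ> w) * (g - s')" by (simp add: algebra_simps)
      then have "h - (s + (l0 \<circ> w) * s') \<in> mp.N0" using mp.N0_add[OF g(2) mp.N0_mult[OF s'(2)]] by (simp only:)
      ultimately show ?thesis by (intro bexI[of _ "s + (l0 \<circ> w) * s'"])
    qed
    show ?case by (intro exI[of _ ?C] conjI ballI finite_UnI finite_imageI C(1) C'(1) fd)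
  qed
qed

end

section \<open>Global sections of line bundles\<close>

definition sscale :: "'k::field \<Rightarrow> ('a \<Rightarrow> 'p \<Rightarrow> 'k) \<Rightarrow> 'a \<Rightarrow> 'p \<Rightarrow> 'k" where
  "sscale c s = (\<lambda>a x. c * s a x)"

global_interpretation ssp: vector_space sscale
  by unfold_locales (auto simp: fun_eq_iff sscale_def algebra_simps)

lemma fun2_sum_apply: "sum f A a x = (\<Sum>i\<in>A. f i a x)"
  by (induction A rule: infinite_finite_induct) auto

context projective_curve
begin

abbreviation S :: "((nat \<Rightarrow> 'k) set, 'k) kspace" where "S \<equiv> proj_sub fscale X"

lemma reg_local:
  assumes h: "h \<in> reg S V" "q \<in> V" "q \<in> X"
  shows "\<exists>d A B. A \<in> forms fscale d \<and> B \<in> forms fscale d \<and> B (rp q) \<noteq> 0 \<and> h q = A (rp q) / B (rp q) \<and>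
     (h \<circ> \<rho>) * (B \<circ> w) - (A \<circ> w) \<in> mp.N0"
proof -
  have "\<exists>d F A B e. F \<in> forms fscale e \<and> A \<in> forms fscale d \<and> B \<in> forms fscale d \<and> F (rp q) \<noteq> 0 \<and> B (rp q) \<noteq> 0 \<and>
     (\<forall>y\<in>X. \<forall>u\<in>y. u \<noteq> 0 \<longrightarrow> F u \<noteq> 0 \<longrightarrow> y \<in> V \<and> B u \<noteq> 0 \<and> h y = A u / B u)"
    by (rule fsp.reg_proj_sub_local[OF h(1,2) X_sub rp(1,2)[OF h(3)]])
  then obtain d F A B e where f: "F \<in> forms fscale e" "A \<in> forms fscale d" "B \<in> forms fscale d" "F (rp q) \<noteq> 0" "B (rp q) \<noteq> 0"
    and loc: "\<forall>y\<in>X. \<forall>u\<in>y. u \<noteq> 0 \<longrightarrow> F u \<noteq> 0 \<longrightarrow> y \<in> V \<and> B u \<noteq> 0 \<and> h y = A u / B u"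
    by (elim exE conjE)
  have loc': "B (rp y) \<noteq> 0 \<and> h y = A (rp y) / B (rp y)" if "y \<in> X" "F (rp y) \<noteq> 0" for y
    using loc[rule_format, OF that(1) rp(1,2)[OF that(1)] that(2)] by simp
  have "(h \<circ> \<rho>) * (B \<circ> w) - (A \<circ> w) \<in> mp.N0"
  proof (rule N0_formI[OF f(1), of q])
    show "F (w q) \<noteq> 0" using f(4) w_rp[OF h(3)] by simp
    fix y assume "F (w y) \<noteq> 0"
    then show "((h \<circ> \<rho>) * (B \<circ> w) - (A \<circ> w)) y = 0"
      using loc'[OF \<rho>(1), of y] by (simp add: w_def)
  qed
  then show ?thesis using f loc'[OF h(3) f(4)] by blast
qed

lemma N0_openI:
  assumes "openin T W" "p \<in> W" "\<And>y. y \<in> W \<Longrightarrow> y \<in> X \<Longrightarrow> h y = 0" shows "h \<circ> \<rho> \<in> mp.N0"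
proof -
  obtain d f where f: "f \<in> forms fscale d" "f (rp p) \<noteq> 0" "\<forall>y\<in>X. f (rp y) \<noteq> 0 \<longrightarrow> y \<in> W"
    using openin_T_form[OF assms(1,2)] by blast
  have pX: "p \<in> X" using openin_subset[OF assms(1)] assms(2) topspace_T by auto
  show ?thesis
  proof (rule N0_formI[OF f(1), of p])
    show "f (w p) \<noteq> 0" using f(2) w_rp[OF pX] by simp
    fix y assume "f (w y) \<noteq> 0"
    then have "\<rho> y \<in> W" using f(3) \<rho>(1) by (simp add: w_def)
    then show "(h \<circ> \<rho>) y = 0" using assms(3) \<rho>(1) by simp
  qed
qed

lemma open_Int_nonempty:
  assumes "openin T W" "p \<in> W" "openin T W'" "p' \<in> W'" shows "\<exists>z\<in>X. z \<in> W \<and> z \<in> W'"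
proof -
  obtain d f where f: "f \<in> forms fscale d" "f (rp p) \<noteq> 0" "\<forall>y\<in>X. f (rp y) \<noteq> 0 \<longrightarrow> y \<in> W"
    using openin_T_form[OF assms(1,2)] by blast
  obtain d' f' where f': "f' \<in> forms fscale d'" "f' (rp p') \<noteq> 0" "\<forall>y\<in>X. f' (rp y) \<noteq> 0 \<longrightarrow> y \<in> W'"
    using openin_T_form[OF assms(3,4)] by blast
  have "p \<in> X" "p' \<in> X" using openin_subset[OF assms(1)] openin_subset[OF assms(3)] assms(2,4) topspace_T by auto
  from irr_forms[OF f(1) this(1) f(2) f'(1) this(2) f'(2)] f(3) f'(3) show ?thesis by blast
qed

lemma prod_form_nonzero:
  assumes "finite J" "\<And>j. j \<in> J \<Longrightarrow> Q j \<in> forms fscale (d j)" "\<And>j. j \<in> J \<Longrightarrow> \<exists>x\<in>X. Q j (rp x) \<noteq> 0"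
  shows "\<exists>x\<in>X. (\<Prod>j\<in>J. Q j (rp x)) \<noteq> 0"
  using assms
proof (induction J rule: finite_induct)
  case empty then show ?case using X_ne by auto
next
  case (insert j J)
  obtain x where x: "x \<in> X" "(\<Prod>j\<in>J. Q j (rp x)) \<noteq> 0" using insert by auto
  obtain x' where x': "x' \<in> X" "Q j (rp x') \<noteq> 0" using insert.prems(2)[of j] by auto
  have F: "(\<lambda>v. \<Prod>j\<in>J. Q j v) \<in> forms fscale (sum d J)" by (rule forms_prod) (use insert.prems(1) in auto)
  have "Q j \<in> forms fscale (d j)" using insert.prems(1) by blast
  from irr_forms[OF this x' F x] show ?case using insert(1,2) by simp
qed

context
  fixes U :: "'a \<Rightarrow> (nat \<Rightarrow> 'k) set set" and g :: "'a \<Rightarrow> 'a \<Rightarrow> (nat \<Rightarrow> 'k) set \<Rightarrow> 'k"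
  assumes lb: "line_bundle S U g"
begin

abbreviation H0L :: "('a \<Rightarrow> (nat \<Rightarrow> 'k) set \<Rightarrow> 'k) set" where "H0L \<equiv> tensor_power S U g 1 X"

lemma lbD:
  "openin T (U a)" "(\<Union>a. U a) = X" "g a b \<in> reg S (U a \<inter> U b)"
  using lb unfolding line_bundle_def topspace_T by auto

lemma H0LD:
  assumes "s \<in> H0L"
  shows "s a \<in> reg S (X \<inter> U a)" "x \<notin> X \<inter> U a \<Longrightarrow> s a x = 0"
    "x \<in> X \<inter> U a \<inter> U b \<Longrightarrow> s a x = g a b x * s b x"
  using assms unfolding tensor_power_def osec_def by auto

lemma transition_N0:
  assumes s: "s \<in> H0L" and p: "p \<in> U a" "p' \<in> U b"
  shows "(s a \<circ> \<rho>) - (g a b \<circ> \<rho>) * (s b \<circ> \<rho>) \<in> mp.N0"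
proof -
  obtain z where z: "z \<in> U a \<inter> U b" using open_Int_nonempty[OF lbD(1) p(1) lbD(1) p(2)] by blast
  have o: "openin T (U a \<inter> U b)" by (intro openin_Int lbD)
  have "(\<lambda>x. s a x - g a b x * s b x) \<circ> \<rho> \<in> mp.N0"
    by (rule N0_openI[OF o z]) (use H0LD(3)[OF s] in auto)
  moreover have "(\<lambda>x. s a x - g a b x * s b x) \<circ> \<rho> = (s a \<circ> \<rho>) - (g a b \<circ> \<rho>) * (s b \<circ> \<rho>)"
    by (rule ext) simp
  ultimately show ?thesis by (simp only:)
qed

text \<open>Transition functions carry generic vanishing to every chart, and the numerator of a
  local fraction, a form that vanishes generically, vanishes everywhere.\<close>

lemma section_zero:
  assumes s: "s \<in> H0L" and a: "p \<in> U a" "s a \<circ> \<rho> \<in> mp.N0" shows "s = 0"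
proof (intro ext)
  fix b y
  show "s b y = 0 b y"
  proof (cases "y \<in> X \<inter> U b")
    case True
    obtain d A B where AB: "A \<in> forms fscale d" "B \<in> forms fscale d" "B (rp y) \<noteq> 0" "s b y = A (rp y) / B (rp y)"
      "(s b \<circ> \<rho>) * (B \<circ> w) - (A \<circ> w) \<in> mp.N0"
      using reg_local[OF H0LD(1)[OF s] True] True by blast
    have "A \<circ> w = (B \<circ> w) * ((s b \<circ> \<rho>) - (g b a \<circ> \<rho>) * (s a \<circ> \<rho>)) + ((B \<circ> w) * (g b a \<circ> \<rho>)) * (s a \<circ> \<rho>) - ((s b \<circ> \<rho>) * (B \<circ> w) - (A \<circ> w))"
      by (simp add: algebra_simps)
    also have "\<dots> \<in> mp.N0"
      using True by (intro mp.N0_add mp.N0_diff mp.N0_mult transition_N0[OF s _ a(1)] a(2) AB(5)) auto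
    finally have "A (w y) = 0" by (rule N0_form_zero[OF AB(1)])
    then show ?thesis using AB(4) w_rp True by simp
  next
    case False then show ?thesis using H0LD(2)[OF s] by simp
  qed
qed

text \<open>One chart misses only finitely many points. Clearing the denominators of the transition
  functions at these points makes the component of every section in this chart a section of one
  fixed twist.\<close>

lemma section_embedding:
  "\<exists>e a p Q. p \<in> U a \<and> Q \<in> forms fscale e \<and> (\<exists>y. Q (w y) \<noteq> 0) \<and> (\<forall>s\<in>H0L. (Q \<circ> w) * (s a \<circ> \<rho>) \<in> \<Gamma> e)"
proof -
  obtain p a where p: "p \<in> U a" using lbD(2) X_ne by blast
  define Z where "Z = X - U a"
  have UX: "U a \<subseteq> X" using lbD(2) by blast
  have "closedin T Z" unfolding Z_def using lbD(1)[of a] by (metis closedin_def double_diff UX Diff_subset order_refl topspace_T)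
  moreover have "Z \<noteq> X" using p UX unfolding Z_def by blast
  ultimately have finZ: "finite Z" by (rule finite_closed)
  have "\<forall>q. \<exists>b d P Q. q \<in> Z \<longrightarrow> q \<in> U b \<and> P \<in> forms fscale d \<and> Q \<in> forms fscale d \<and> (\<exists>x\<in>X. Q (rp x) \<noteq> 0) \<and>
      (g a b \<circ> \<rho>) * (Q \<circ> w) - (P \<circ> w) \<in> mp.N0"
  proof (intro allI)
    fix q
    show "\<exists>b d P Q. q \<in> Z \<longrightarrow> q \<in> U b \<and> P \<in> forms fscale d \<and> Q \<in> forms fscale d \<and> (\<exists>x\<in>X. Q (rp x) \<noteq> 0) \<and>
      (g a b \<circ> \<rho>) * (Q \<circ> w) - (P \<circ> w) \<in> mp.N0"
    proof (cases "q \<in> Z")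
      case True
      then obtain b where b: "q \<in> U b" using lbD(2) unfolding Z_def by blast
      obtain z where z: "z \<in> X" "z \<in> U a" "z \<in> U b" using open_Int_nonempty[OF lbD(1) p lbD(1) b] by blast
      then have "z \<in> U a \<inter> U b" by blast
      from reg_local[OF lbD(3) this z(1)] obtain d A B where AB: "A \<in> forms fscale d" "B \<in> forms fscale d"
        "B (rp z) \<noteq> 0" "(g a b \<circ> \<rho>) * (B \<circ> w) - (A \<circ> w) \<in> mp.N0" by blast
      have "\<exists>x\<in>X. B (rp x) \<noteq> 0" using z(1) AB(3) by blast
      then show ?thesis using b AB by blast
    qed simp
  qed
  then obtain b d P Q where bPQ: "\<And>q. q \<in> Z \<Longrightarrow> q \<in> U (b q) \<and> P q \<in> forms fscale (d q) \<and> Q q \<in> forms fscale (d q) \<and>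
      (\<exists>x\<in>X. Q q (rp x) \<noteq> 0) \<and> (g a (b q) \<circ> \<rho>) * (Q q \<circ> w) - (P q \<circ> w) \<in> mp.N0"
    by metis
  define QQ where "QQ = (\<lambda>v. \<Prod>q\<in>Z. Q q v)"
  define e where "e = sum d Z"
  have QQ: "QQ \<in> forms fscale e" unfolding QQ_def e_def by (rule forms_prod) (use bPQ in blast)
  obtain x where x: "x \<in> X" "(\<Prod>q\<in>Z. Q q (rp x)) \<noteq> 0"
    using prod_form_nonzero[OF finZ, of Q d] bPQ by blast
  have x': "QQ (w x) \<noteq> 0" unfolding QQ_def w_rp[OF x(1)] by (rule x(2))
  have "(QQ \<circ> w) * (s a \<circ> \<rho>) \<in> \<Gamma> e" if s: "s \<in> H0L" for s
    unfolding \<Gamma>_def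
  proof (intro CollectI ballI)
    fix q assume q: "q \<in> X"
    let ?h = "(QQ \<circ> w) * (s a \<circ> \<rho>)"
    show "\<exists>d A B. A \<in> forms fscale (d + e) \<and> B \<in> forms fscale d \<and> B (rp q) \<noteq> 0 \<and> ?h * (B \<circ> w) - (A \<circ> w) \<in> mp.N0"
    proof (cases "q \<in> U a")
      case True
      then have "q \<in> X \<inter> U a" using q by blast
      from reg_local[OF H0LD(1)[OF s] this q] obtain d' A B where AB: "A \<in> forms fscale d'" "B \<in> forms fscale d'"
        "B (rp q) \<noteq> 0" "(s a \<circ> \<rho>) * (B \<circ> w) - (A \<circ> w) \<in> mp.N0" by blast
      have e: "?h * (B \<circ> w) - ((\<lambda>v. A v * QQ v) \<circ> w) = (QQ \<circ> w) * ((s a \<circ> \<rho>) * (B \<circ> w) - (A \<circ> w))"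
        unfolding comp_mult by (simp add: algebra_simps)
      have "?h * (B \<circ> w) - ((\<lambda>v. A v * QQ v) \<circ> w) \<in> mp.N0" unfolding e by (rule mp.N0_mult[OF AB(4)])
      then show ?thesis using forms_mult[OF AB(1) QQ] AB(2,3) by blast
    next
      case False
      then have qZ: "q \<in> Z" using q by (simp add: Z_def)
      note bq = bPQ[OF qZ]
      let ?b = "b q"
      have "q \<in> X \<inter> U ?b" using q bq by blast
      from reg_local[OF H0LD(1)[OF s] this q] obtain d' A B where AB: "A \<in> forms fscale d'" "B \<in> forms fscale d'"
        "B (rp q) \<noteq> 0" "(s ?b \<circ> \<rho>) * (B \<circ> w) - (A \<circ> w) \<in> mp.N0" by blast
      define R where "R = (\<lambda>v. \<Prod>q'\<in>Z - {q}. Q q' v)"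
      have R: "R \<in> forms fscale (sum d (Z - {q}))" unfolding R_def by (rule forms_prod) (use bPQ in blast)
      have "QQ v = Q q v * R v" for v unfolding QQ_def R_def by (rule prod.remove[OF finZ qZ])
      then have QR: "QQ \<circ> w = (Q q \<circ> w) * (R \<circ> w)" by (intro ext) simp
      have tr: "(s a \<circ> \<rho>) - (g a ?b \<circ> \<rho>) * (s ?b \<circ> \<rho>) \<in> mp.N0"
        by (rule transition_N0[OF s p]) (use bq in blast)
      \<comment> \<open>At a missing point q the component is rewritten in a chart around q. The
        factor \<open>Q q\<close> clears the transition function P q / Q q, and R is the product of
        the remaining factors.\<close>
      have e: "?h * (B \<circ> w) - ((\<lambda>v. (P q v * R v) * A v) \<circ> w) =
         ((Q q \<circ> w) * (R \<circ> w) * (B \<circ> w)) * ((s a \<circ> \<rho>) - (g a ?b \<circ> \<rho>) * (s ?b \<circ> \<rho>))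
         + ((R \<circ> w) * (B \<circ> w) * (s ?b \<circ> \<rho>)) * ((g a ?b \<circ> \<rho>) * (Q q \<circ> w) - (P q \<circ> w))
         + ((R \<circ> w) * (P q \<circ> w)) * ((s ?b \<circ> \<rho>) * (B \<circ> w) - (A \<circ> w))"
        unfolding comp_mult QR by (simp add: algebra_simps)
      have 1: "?h * (B \<circ> w) - ((\<lambda>v. (P q v * R v) * A v) \<circ> w) \<in> mp.N0"
        unfolding e by (intro mp.N0_add mp.N0_mult tr AB(4) bq[THEN conjunct2, THEN conjunct2, THEN conjunct2, THEN conjunct2])
      have "P q \<in> forms fscale (d q)" using bq by blast
      from forms_mult[OF forms_mult[OF this R] AB(1)]
      have "(\<lambda>v. (P q v * R v) * A v) \<in> forms fscale (d q + sum d (Z - {q}) + d')" .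
      moreover have "e = d q + sum d (Z - {q})" unfolding e_def by (rule sum.remove[OF finZ qZ])
      ultimately have "(\<lambda>v. (P q v * R v) * A v) \<in> forms fscale (d' + e)" by (simp only: add.commute)
      then show ?thesis using 1 AB(2,3) by blast
    qed
  qed
  then show ?thesis using p QQ x' by blast
qed

text \<open>The component in one chart, multiplied by Q, embeds the sections into a twist whose
  sections are finite-dimensional up to \<open>N0\<close>; the error does no harm because a section
  vanishing generically is zero.\<close>

lemma finite_dim_sections:
  assumes V: "V \<subseteq> H0L" "ssp.subspace V"
  shows "\<exists>C. finite C \<and> C \<subseteq> V \<and> V \<subseteq> ssp.span C"
proof -
  obtain e a p Q y where Q: "p \<in> U a" "Q \<in> forms fscale e" "Q (w y) \<noteq> 0" "\<forall>s\<in>H0L. (Q \<circ> w) * (s a \<circ> \<rho>) \<in> \<Gamma> e"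
    using section_embedding by (elim exE conjE)
  note y = Q(3)
  obtain C where C: "finite C" "\<forall>h\<in>\<Gamma> e. \<exists>s\<in>fsp.span C. h - s \<in> mp.N0" using \<Gamma>_fd[of e] by (elim exE conjE)
  define \<psi> where "\<psi> s = (Q \<circ> w) * (s a \<circ> \<rho>)" for s :: "'a \<Rightarrow> (nat \<Rightarrow> 'k) set \<Rightarrow> 'k"
  have dep: "\<exists>c. (\<exists>j\<le>card C. c j \<noteq> 0) \<and> (\<Sum>j\<le>card C. sscale (c j) (f j)) \<in> {0}"
    if f: "\<And>j. j \<le> card C \<Longrightarrow> f j \<in> V" for f
  proof -
    have "\<forall>j. \<exists>t. j \<le> card C \<longrightarrow> t \<in> fsp.span C \<and> \<psi> (f j) - t \<in> mp.N0"
      using C(2) Q(4) f V(1) unfolding \<psi>_def by blast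
    then obtain t where t: "\<And>j. j \<le> card C \<Longrightarrow> t j \<in> fsp.span C \<and> \<psi> (f j) - t j \<in> mp.N0" by metis
    have "\<exists>c. (\<exists>j\<in>{..card C}. c j \<noteq> 0) \<and> (\<Sum>j\<in>{..card C}. fscale (c j) (t j)) = 0"
      by (rule fsp.ex_relation[OF _ C(1)]) (use t in auto)
    then obtain c where c: "\<exists>j\<in>{..card C}. c j \<noteq> 0" "(\<Sum>j\<le>card C. fscale (c j) (t j)) = 0" by (elim exE conjE)
    let ?s = "\<Sum>j\<le>card C. sscale (c j) (f j)"
    have sV: "?s \<in> V" by (intro ssp.subspace_sum[OF V(2)] ssp.subspace_scale[OF V(2)] f) simp
    have "\<psi> ?s = (\<Sum>j\<le>card C. fscale (c j) (\<psi> (f j)))"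
      by (rule ext) (simp add: \<psi>_def fun_sum_apply fun2_sum_apply sscale_def fscale_def sum_distrib_left algebra_simps)
    also have "\<dots> = (\<Sum>j\<le>card C. fscale (c j) (t j)) + (\<Sum>j\<le>card C. cfun (c j) * (\<psi> (f j) - t j))"
      unfolding sum.distrib[symmetric] by (rule sum.cong[OF refl]) (simp add: fscale_eq algebra_simps)
    also have "\<dots> \<in> mp.N0" unfolding c(2) add_0 by (intro mp.N0_sum mp.N0_mult) (use t in auto)
    finally have "?s a \<circ> \<rho> \<in> mp.N0" unfolding \<psi>_def by (rule N0_form_cancel[OF Q(2) y])
    then have "?s = 0" by (rule section_zero[OF subsetD[OF V(1) sV] Q(1)])
    then show ?thesis using c(1) by (intro exI[of _ c]) auto
  qed
  have "\<exists>C'. finite C' \<and> C' \<subseteq> V \<and> (\<forall>t\<in>V. \<exists>s\<in>ssp.span C'. t - s \<in> {0})"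
    by (rule ssp.finite_span_modulo[OF ssp.subspace_single_0 dep])
  then show ?thesis by auto
qed

end

end

section \<open>Independence of vectors depending polynomially on parameters\<close>

text \<open>Independence of a family, not of a set: a repeated vector makes it fail.\<close>

definition ind :: "('a::field \<Rightarrow> 'b::ab_group_add \<Rightarrow> 'b) \<Rightarrow> nat \<Rightarrow> (nat \<Rightarrow> 'b) \<Rightarrow> bool" where
  "ind sc s u \<longleftrightarrow> (\<forall>c. (\<Sum>b<s. sc (c b) (u b)) = 0 \<longrightarrow> (\<forall>b<s. c b = 0))"

text \<open>A multihomogeneous polynomial map with vector values; testing it by functionals
  dispenses with a basis of the possibly infinite-dimensional target.\<close>

definition vform :: "('a::field \<Rightarrow> 'b::ab_group_add \<Rightarrow> 'b) \<Rightarrow> 'i set \<Rightarrow> ('i \<Rightarrow> nat) \<Rightarrow> (('i \<Rightarrow> 'b) \<Rightarrow> 'b) \<Rightarrow> bool" where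
  "vform sc I d u \<longleftrightarrow> (\<forall>l. Vector_Spaces.linear sc (*) l \<longrightarrow> (\<lambda>v. l (u v)) \<in> multiforms sc I d)"

context vector_space
begin

lemma vform_diff_scale:
  fixes a b :: "('i \<Rightarrow> 'b) \<Rightarrow> 'b" and l :: "'b \<Rightarrow> 'a"
  assumes a: "vform scale I d a" and b: "vform scale I d' b" and l: "Vector_Spaces.linear scale (*) l"
  shows "vform scale I (\<lambda>i. d i + d' i) (\<lambda>v. scale (l (a v)) (b v) - scale (l (b v)) (a v))"
  unfolding vform_def
proof (intro allI impI)
  fix m :: "'b \<Rightarrow> 'a" assume m: "Vector_Spaces.linear scale (*) m"
  have "(\<lambda>v. l (a v) * m (b v)) \<in> multiforms scale I (\<lambda>i. d i + d' i)"
    by (rule multiforms_mult) (use a b l m in \<open>auto simp: vform_def\<close>)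
  moreover have "(\<lambda>v. m (a v) * l (b v)) \<in> multiforms scale I (\<lambda>i. d i + d' i)"
    by (rule multiforms_mult) (use a b l m in \<open>auto simp: vform_def\<close>)
  ultimately show "(\<lambda>v. m (scale (l (a v)) (b v) - scale (l (b v)) (a v))) \<in> multiforms scale I (\<lambda>i. d i + d' i)"
    using multiforms_diff by (simp add: linear_functional_simps[OF m] mult.commute)
qed

text \<open>Elimination without division: a functional l that is nonzero on the first vector removes
  it from the others. The form D is the product of the pivots and takes the role of a nonvanishing
  minor.\<close>

lemma ind_open:
  fixes u :: "nat \<Rightarrow> ('i \<Rightarrow> 'b) \<Rightarrow> 'b" and I :: "'i set"
  assumes "\<And>b. b < s \<Longrightarrow> \<exists>d. vform scale I d (u b)" "ind scale s (\<lambda>b. u b x)"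
  shows "\<exists>d. \<exists>D\<in>multiforms scale I d. D x \<noteq> 0 \<and> (\<forall>v. D v \<noteq> 0 \<longrightarrow> ind scale s (\<lambda>b. u b v))"
  using assms
proof (induction s arbitrary: u)
  case 0
  show ?case using multiforms_const[of 1 scale I]
    by (intro exI[of _ "\<lambda>_. 0"] bexI[of _ "\<lambda>_. 1"]) (simp_all add: ind_def)
next
  case (Suc s)
  have u0: "u 0 x \<noteq> 0"
  proof
    assume z: "u 0 x = 0"
    define c :: "nat \<Rightarrow> 'a" where "c b = (if b = 0 then 1 else 0)" for b
    have "(\<Sum>b<Suc s. scale (c b) (u b x)) = 0"
      by (rule sum.neutral) (auto simp: c_def z)
    then have "c 0 = 0" using Suc.prems(2) unfolding ind_def by blast
    then show False by (simp add: c_def)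
  qed
  then obtain l where l: "Vector_Spaces.linear scale (*) l" "l (u 0 x) = (1::'a)" using ex_functional_nonzero by blast
  note ls = linear_functional_simps[OF l(1)]
  \<comment> \<open>Cross-multiplied elimination: l vanishes on \<open>u' b v\<close>, and
    multihomogeneity is preserved.\<close>
  define u' where "u' b v = scale (l (u 0 v)) (u (Suc b) v) - scale (l (u (Suc b) v)) (u 0 v)" for b v
  obtain d0 where d0: "vform scale I d0 (u 0)" using Suc.prems(1)[of 0] by auto
  have vf: "\<exists>d. vform scale I d (u' b)" if b: "b < s" for b
  proof -
    obtain d where "vform scale I d (u (Suc b))" using Suc.prems(1)[of "Suc b"] b by auto
    from vform_diff_scale[OF d0 this l(1)] show ?thesis unfolding u'_def by blast
  qed
  have key: "(\<Sum>b<s. scale (c b) (u' b v)) = scale (l (u 0 v)) (\<Sum>b<s. scale (c b) (u (Suc b) v))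
      - scale (\<Sum>b<s. c b * l (u (Suc b) v)) (u 0 v)" for c v
    by (simp add: u'_def scale_right_diff_distrib sum_subtractf scale_sum_left scale_sum_right mult.commute)
  have "ind scale s (\<lambda>b. u' b x)"
    unfolding ind_def
  proof (intro allI impI)
    fix c b assume c: "(\<Sum>b<s. scale (c b) (u' b x)) = 0" and b: "b < s"
    define c' where "c' b = (case b of 0 \<Rightarrow> - (\<Sum>b<s. c b * l (u (Suc b) x)) | Suc b \<Rightarrow> c b)" for b
    have "(\<Sum>b<Suc s. scale (c' b) (u b x)) = 0"
      using c unfolding key l(2) sum.lessThan_Suc_shift by (simp add: c'_def)
    then have "\<forall>b<Suc s. c' b = 0" using Suc.prems(2) unfolding ind_def by blast
    then have "c' (Suc b) = 0" using b by blast
    then show "c b = 0" by (simp add: c'_def)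
  qed
  from Suc.IH[of u', OF vf this] obtain d D where D: "D \<in> multiforms scale I d" "D x \<noteq> 0"
    "\<forall>v. D v \<noteq> 0 \<longrightarrow> ind scale s (\<lambda>b. u' b v)" by blast
  have "(\<lambda>v. l (u 0 v)) \<in> multiforms scale I d0" using d0 l(1) by (simp add: vform_def)
  from multiforms_mult[OF this D(1)] have m: "(\<lambda>v. l (u 0 v) * D v) \<in> multiforms scale I (\<lambda>i. d0 i + d i)" .
  have "ind scale (Suc s) (\<lambda>b. u b v)" if v: "l (u 0 v) * D v \<noteq> 0" for v
    unfolding ind_def
  proof (intro allI impI)
    fix c b assume c: "(\<Sum>b<Suc s. scale (c b) (u b v)) = 0" and b: "b < Suc s"
    have c1: "scale (c 0) (u 0 v) + (\<Sum>b<s. scale (c (Suc b)) (u (Suc b) v)) = 0"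
      using c unfolding sum.lessThan_Suc_shift .
    then have "l (scale (c 0) (u 0 v) + (\<Sum>b<s. scale (c (Suc b)) (u (Suc b) v))) = 0" using ls(3) by simp
    then have c2: "(\<Sum>b<s. c (Suc b) * l (u (Suc b) v)) = - (c 0 * l (u 0 v))"
      by (simp add: ls add_eq_0_iff)
    have c3: "(\<Sum>b<s. scale (c (Suc b)) (u (Suc b) v)) = - scale (c 0) (u 0 v)"
      using c1 by (simp add: add_eq_0_iff)
    have "(\<Sum>b<s. scale (c (Suc b)) (u' b v)) = 0"
      unfolding key[of "\<lambda>b. c (Suc b)"] c2 c3 by (simp add: mult.commute)
    moreover have "ind scale s (\<lambda>b. u' b v)" using D(3) v by auto
    ultimately have cs: "\<forall>b<s. c (Suc b) = 0"
      using spec[of _ "\<lambda>b. c (Suc b)", OF \<open>ind scale s (\<lambda>b. u' b v)\<close>[unfolded ind_def]] by blast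
    then have "c 0 * l (u 0 v) = 0" using c2 by simp
    then have "c 0 = 0" using v by simp
    then show "c b = 0" using cs b by (cases b) auto
  qed
  moreover have "l (u 0 x) * D x \<noteq> 0" using l(2) D(2) by simp
  ultimately show ?case
    by (intro exI[of _ "\<lambda>i. d0 i + d i"] bexI[OF _ m] conjI allI impI) simp_all
qed

text \<open>E_l contains every later vector but not e_l, so in a relation the coefficients vanish
  one after the other. The last vector only has to be nonzero.\<close>

lemma ind_triangular:
  assumes E: "\<And>l. l < t \<Longrightarrow> subspace (E l)" "\<And>l. l < t \<Longrightarrow> e l \<notin> E l"
    "\<And>l l'. l < l' \<Longrightarrow> l' \<le> t \<Longrightarrow> e l' \<in> E l" and e: "e t \<noteq> 0"
  shows "ind scale (Suc t) e"
  unfolding ind_def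
proof (intro allI impI)
  fix c b assume c: "(\<Sum>b<Suc t. scale (c b) (e b)) = 0" and b: "b < Suc t"
  show "c b = 0" using b
  proof (induction b rule: less_induct)
    case (less l)
    have split: "{..<Suc t} = {..<l} \<union> {l} \<union> {l<..t}" using less.prems by auto
    have "(\<Sum>b<Suc t. scale (c b) (e b)) = (\<Sum>b<l. scale (c b) (e b)) + scale (c l) (e l) + (\<Sum>b\<in>{l<..t}. scale (c b) (e b))"
      unfolding split by (subst sum.union_disjoint; (subst sum.union_disjoint)?) auto
    also have "(\<Sum>b<l. scale (c b) (e b)) = 0" by (rule sum.neutral) (use less in auto)
    finally have z: "scale (c l) (e l) = - (\<Sum>b\<in>{l<..t}. scale (c b) (e b))"
      using c by (simp add: add_eq_0_iff2)
    show "c l = 0"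
    proof (rule ccontr)
      assume cl: "c l \<noteq> 0"
      show False
      proof (cases "l = t")
        case True
        then show False using z cl e by simp
      next
        case False
        then have lt: "l < t" using less.prems by simp
        have "scale (c l) (e l) \<in> E l" unfolding z
          by (intro subspace_neg[OF E(1)[OF lt]] subspace_sum[OF E(1)[OF lt]] subspace_scale[OF E(1)[OF lt]] E(3)) auto
        then have "scale (inverse (c l)) (scale (c l) (e l)) \<in> E l" by (rule subspace_scale[OF E(1)[OF lt]])
        then show False using cl E(2)[OF lt] by simp
      qed
    qed
  qed
qed

end

section \<open>Products of linear systems in a field\<close>

locale field_systems = vector_space sc
  for sc :: "'k::alg_closed_field \<Rightarrow> 'K::field \<Rightarrow> 'K" +
  fixes I :: "'i set" and V :: "'i \<Rightarrow> 'K set"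
  assumes sc_mult: "sc c (a * b) = sc c a * b"
    and finI: "finite I"
    and fdV: "i \<in> I \<Longrightarrow> \<exists>B. finite B \<and> V i = span B"
begin

definition \<kappa> :: "'k \<Rightarrow> 'K" where "\<kappa> c = sc c 1"

lemma sc_\<kappa>: "sc c z = \<kappa> c * z"
  using sc_mult[of c 1 z] by (simp add: \<kappa>_def)

sublocale ka: algebra_over \<kappa>
proof
  show "\<kappa> (a + b) = \<kappa> a + \<kappa> b" for a b by (simp add: \<kappa>_def scale_left_distrib)
  show "\<kappa> (a * b) = \<kappa> a * \<kappa> b" for a b using scale_scale[of a b 1] sc_\<kappa>[of a "sc b 1"] by (simp add: \<kappa>_def)
  show "\<kappa> 1 = 1" by (simp add: \<kappa>_def)
qed

definition Bs :: "'i \<Rightarrow> 'K set" where "Bs i = (SOME B. finite B \<and> independent B \<and> V i = span B)"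

lemma Bs:
  assumes "i \<in> I" shows "finite (Bs i)" "independent (Bs i)" "V i = span (Bs i)"
proof -
  obtain B0 where B0: "finite B0" "V i = span B0" using fdV assms by blast
  obtain B where "B \<subseteq> B0" "independent B" "span B = span B0"
    using maximal_independent_subset[of B0] span_mono span_span subset_antisym
    by (metis span_minimal subspace_span)
  then have "\<exists>B. finite B \<and> independent B \<and> V i = span B" using B0 finite_subset by blast
  then have "finite (Bs i) \<and> independent (Bs i) \<and> V i = span (Bs i)" unfolding Bs_def by (rule someI_ex)
  then show "finite (Bs i)" "independent (Bs i)" "V i = span (Bs i)" by auto
qed

lemma subspace_V: "i \<in> I \<Longrightarrow> subspace (V i)"
  using Bs(3) subspace_span by metis

definition dual :: "'i \<Rightarrow> 'K \<Rightarrow> 'K \<Rightarrow> 'k" where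
  "dual i = (SOME l. (\<forall>b. Vector_Spaces.linear sc (*) (l b)) \<and> (\<forall>b\<in>Bs i. \<forall>b'\<in>Bs i. l b b' = (if b' = b then 1 else 0)))"

lemma dual:
  assumes "i \<in> I"
  shows "\<forall>b. Vector_Spaces.linear sc (*) (dual i b)" "\<forall>b\<in>Bs i. \<forall>b'\<in>Bs i. dual i b b' = (if b' = b then 1 else 0)"
proof -
  have "(\<forall>b. Vector_Spaces.linear sc (*) (dual i b)) \<and> (\<forall>b\<in>Bs i. \<forall>b'\<in>Bs i. dual i b b' = (if b' = b then 1 else 0))"
    unfolding dual_def by (rule someI_ex[OF ex_dual_basis[OF Bs(2)[OF assms]]])
  then show "\<forall>b. Vector_Spaces.linear sc (*) (dual i b)" "\<forall>b\<in>Bs i. \<forall>b'\<in>Bs i. dual i b b' = (if b' = b then 1 else 0)" by auto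
qed

lemma V_expand: "i \<in> I \<Longrightarrow> z \<in> V i \<Longrightarrow> z = (\<Sum>b\<in>Bs i. sc (dual i b z) b)"
  using span_dual_expand[OF Bs(1) _ dual(1,2), of i z] Bs(3) by blast

text \<open>Forms are polynomials in functionals on all of \<open>'K\<close>, where the product is
  not polynomial. Each factor is therefore first projected to the finite-dimensional V_j, which
  changes nothing for vectors of V_j.\<close>

definition mprod :: "'i set \<Rightarrow> 'K \<Rightarrow> ('i \<Rightarrow> 'K) \<Rightarrow> 'K" where
  "mprod S a v = a * (\<Prod>j\<in>S. \<Sum>b\<in>Bs j. sc (dual j b (v j)) b)"

lemma mprod_eq: "S \<subseteq> I \<Longrightarrow> (\<And>j. j \<in> S \<Longrightarrow> v j \<in> V j) \<Longrightarrow> mprod S a v = a * (\<Prod>j\<in>S. v j)"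
  unfolding mprod_def using V_expand by (intro arg_cong2[where f = "(*)"] prod.cong) auto

lemma \<kappa>_prod: "\<kappa> (prod f S) = (\<Prod>j\<in>S. \<kappa> (f j))"
  by (induction S rule: infinite_finite_induct) (auto simp: ka.kmult ka.kone)

lemma vform_mprod:
  assumes S: "S \<subseteq> I" shows "vform sc I (\<lambda>j. if j \<in> S then 1 else 0) (mprod S a)"
  unfolding vform_def
proof (intro allI impI)
  fix l :: "'K \<Rightarrow> 'k" assume l: "Vector_Spaces.linear sc (*) l"
  have fS: "finite S" using S finI finite_subset by blast
  have "l (mprod S a v) = (\<Sum>\<beta>\<in>PiE S Bs. l (a * (\<Prod>j\<in>S. \<beta> j)) * (\<Prod>j\<in>S. dual j (\<beta> j) (v j)))" for v
  proof -
    have "mprod S a v = a * (\<Sum>\<beta>\<in>PiE S Bs. \<Prod>j\<in>S. sc (dual j (\<beta> j) (v j)) (\<beta> j))"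
      unfolding mprod_def by (subst prod_sum_PiE[OF fS]) (use S Bs(1) in auto)
    also have "\<dots> = (\<Sum>\<beta>\<in>PiE S Bs. sc (\<Prod>j\<in>S. dual j (\<beta> j) (v j)) (a * (\<Prod>j\<in>S. \<beta> j)))"
      unfolding sum_distrib_left
      by (rule sum.cong[OF refl]) (simp add: sc_\<kappa> \<kappa>_prod prod.distrib)
    finally show ?thesis by (simp add: linear_functional_simps[OF l] mult.commute)
  qed
  then have e: "(\<lambda>v. l (mprod S a v)) = (\<lambda>v. \<Sum>\<beta>\<in>PiE S Bs. l (a * (\<Prod>j\<in>S. \<beta> j)) * (\<Prod>j\<in>S. dual j (\<beta> j) (v j)))"
    by (rule ext)
  have d: "multiforms sc I (\<lambda>j. if j \<in> S then 1 else 0) = multiforms sc I (\<lambda>i. \<Sum>j\<in>S. if i = j then 1 else 0)"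
    by (rule multiforms_cong) (use fS in simp)
  show "(\<lambda>v. l (mprod S a v)) \<in> multiforms sc I (\<lambda>j. if j \<in> S then 1 else 0)"
    unfolding e d
  proof (intro multiforms_sum multiforms_scale multiforms_prod)
    fix \<beta> j assume "j \<in> S"
    then have j: "j \<in> I" using S by blast
    show "(\<lambda>v. dual j (\<beta> j) (v j)) \<in> multiforms sc I (\<lambda>i. if i = j then 1 else 0)"
      by (rule multiforms_linear[OF j finI]) (use dual(1)[OF j] in blast)
  qed
qed

definition pr :: "('i \<Rightarrow> 'K) \<Rightarrow> 'K" where "pr v = (\<Prod>j\<in>I. v j)"

text \<open>The derivative of \<open>pr\<close> at v in the direction u of the factor i.\<close>

definition qv :: "'i \<Rightarrow> 'K \<Rightarrow> ('i \<Rightarrow> 'K) \<Rightarrow> 'K" where "qv i u v = u * (\<Prod>j\<in>I - {i}. v j)"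

text \<open>\<open>pr v\<close> together with some vectors \<open>qv i u v\<close> forms an independent family of length \<open>t + 1\<close>: the
  differential of the product map at \<open>v\<close> has rank at least \<open>t\<close>.\<close>

definition rank_ge :: "nat \<Rightarrow> ('i \<Rightarrow> 'K) \<Rightarrow> bool" where
  "rank_ge t v \<longleftrightarrow> (\<exists>i u. (\<forall>l<t. i l \<in> I \<and> u l \<in> V (i l)) \<and>
     ind sc (Suc t) (\<lambda>b. if b < t then qv (i b) (u b) v else pr v))"

text \<open>Lower semicontinuity of the rank: the finitely many vectors in question are
  multihomogeneous in v, so \<open>ind_open\<close> provides a form that certifies their
  independence.\<close>

lemma rank_ge_open:
  assumes x: "\<And>i. i \<in> I \<Longrightarrow> x i \<in> V i" and r: "rank_ge t x"
  shows "\<exists>d. \<exists>D\<in>multiforms sc I d. D x \<noteq> 0 \<and> (\<forall>v. (\<forall>i\<in>I. v i \<in> V i) \<longrightarrow> D v \<noteq> 0 \<longrightarrow> rank_ge t v)"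
proof -
  obtain i u where iu: "\<forall>l<t. i l \<in> I \<and> u l \<in> V (i l)"
    "ind sc (Suc t) (\<lambda>b. if b < t then qv (i b) (u b) x else pr x)" using r unfolding rank_ge_def by blast
  define W where "W b v = (if b < t then mprod (I - {i b}) (u b) v else mprod I 1 v)" for b v
  have W: "W b v = (if b < t then qv (i b) (u b) v else pr v)" if "\<forall>i\<in>I. v i \<in> V i" for b v
    using that mprod_eq[of I v 1] by (auto simp: W_def qv_def pr_def intro!: mprod_eq)
  have "\<exists>d. vform sc I d (W b)" for b
    using vform_mprod[of "I - {i b}" "u b"] vform_mprod[of I 1] unfolding W_def by (cases "b < t") auto
  moreover have "ind sc (Suc t) (\<lambda>b. W b x)" using iu(2) W[of x] x by simp
  ultimately obtain d D where D: "D \<in> multiforms sc I d" "D x \<noteq> 0" "\<forall>v. D v \<noteq> 0 \<longrightarrow> ind sc (Suc t) (\<lambda>b. W b v)"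
    using ind_open[of "Suc t" I W x] by blast
  have "rank_ge t v" if v: "\<forall>i\<in>I. v i \<in> V i" "D v \<noteq> 0" for v
    unfolding rank_ge_def using iu(1) D(3) v(2) W[OF v(1)] by (intro exI[of _ i] exI[of _ u]) auto
  then show ?thesis using D(1,2) by blast
qed

end

lemma (in place_of) M_unit: assumes "a - \<kappa> c \<in> M" "c \<noteq> 0" "a * r \<in> M" shows "r \<in> M"
proof -
  have "r \<in> A" by (rule A_unit[OF assms(1,2) M_A[OF assms(3)]])
  from AE[OF this] obtain d where d: "r - \<kappa> d \<in> M" by (elim exE)
  have 1: "a * r - \<kappa> (c * d) \<in> M" by (rule res_mult[OF assms(1) d])
  have 2: "a * r - \<kappa> 0 \<in> M" using assms(3) by simp
  have "c * d = 0" by (rule res_unique[OF 1 2])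
  then have "d = 0" using assms(2) by simp
  then show ?thesis using d by simp
qed

section \<open>Residue functionals and places in general position\<close>

context field_systems
begin

text \<open>The residue is determined by its values on a basis of V_i; the dual functionals extend
  it to all of \<open>'K\<close>, as forms require.\<close>

lemma residue_functional:
  assumes M: "ka.place M" and i: "i \<in> I" "V i \<subseteq> ka.vring M"
  shows "\<exists>l. Vector_Spaces.linear sc (*) l \<and> (\<forall>z\<in>V i. z - \<kappa> (l z) \<in> M)"
proof -
  interpret pl: place_of \<kappa> M by unfold_locales (rule M)
  have "\<exists>c. b - \<kappa> c \<in> M" if "b \<in> Bs i" for b
  proof (rule pl.AE, rule subsetD[OF i(2)])
    show "b \<in> V i" using that Bs(3)[OF i(1)] span_base by simp
  qed
  then have "\<forall>b. \<exists>c. b \<in> Bs i \<longrightarrow> b - \<kappa> c \<in> M" by blast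
  from choice[OF this] obtain r where r: "\<forall>b. b \<in> Bs i \<longrightarrow> b - \<kappa> (r b) \<in> M" ..
  define l where "l z = (\<Sum>b\<in>Bs i. dual i b z * r b)" for z
  have dl: "dual i b (x + y) = dual i b x + dual i b y" "dual i b (sc c x) = c * dual i b x" for b x y c
    using linear_functional_simps(1,2) dual(1)[OF i(1)] by blast+
  have "Vector_Spaces.linear sc (*) l"
    unfolding l_def
    by unfold_locales (auto simp: algebra_simps dl sum.distrib sum_distrib_left)
  moreover have "z - \<kappa> (l z) \<in> M" if "z \<in> V i" for z
  proof -
    have "z - \<kappa> (l z) = (\<Sum>b\<in>Bs i. \<kappa> (dual i b z) * (b - \<kappa> (r b)))"
      by (subst V_expand[OF i(1) that])
        (simp add: l_def sc_\<kappa> pl.ksum ka.kmult sum_subtractf algebra_simps)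
    also have "\<dots> \<in> M" by (intro pl.Msum pl.Mk) (use r in blast)
    finally show ?thesis .
  qed
  ultimately show ?thesis by blast
qed

text \<open>Each place is generic with respect to the preceding ones: its residue functionals do not
  vanish on any nonzero intersection of kernels of earlier ones.\<close>

definition adapted :: "nat \<Rightarrow> (nat \<Rightarrow> 'K set) \<Rightarrow> (nat \<Rightarrow> 'i \<Rightarrow> 'K \<Rightarrow> 'k) \<Rightarrow> bool" where
  "adapted t M r \<longleftrightarrow> (\<forall>l<t. ka.place (M l) \<and> (\<forall>i\<in>I. V i \<subseteq> ka.vring (M l) \<and> Vector_Spaces.linear sc (*) (r l i) \<and>
     (\<forall>z\<in>V i. z - \<kappa> (r l i z) \<in> M l) \<and>
     (\<forall>J\<subseteq>{..<l}. (\<exists>u\<in>V i. u \<noteq> 0 \<and> (\<forall>s\<in>J. r s i u = 0)) \<longrightarrow> (\<exists>u\<in>V i. r l i u \<noteq> 0 \<and> (\<forall>s\<in>J. r s i u = 0)))))"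

text \<open>Genericity at the next step concerns finitely many pairs (i, J) only, so one witness
  from each nonzero intersection of kernels gives a finite set that the next place has to
  avoid.\<close>

lemma ex_adapted:
  assumes ev: "\<And>Q. finite Q \<Longrightarrow> Q \<subseteq> (\<Union>i\<in>I. V i) - {0} \<Longrightarrow>
     \<exists>M. ka.place M \<and> (\<forall>i\<in>I. V i \<subseteq> ka.vring M) \<and> Q \<inter> M = {}"
  shows "\<exists>M r. adapted t M r"
proof (induction t)
  case 0 show ?case by (simp add: adapted_def)
next
  case (Suc t)
  then obtain M r where ad: "adapted t M r" by blast
  define P where "P i J u \<longleftrightarrow> u \<in> V i \<and> u \<noteq> 0 \<and> (\<forall>s\<in>J. r s i u = 0)" for i J u
  define pick where "pick i J = (SOME u. P i J u)" for i J
  \<comment> \<open>One nonzero element for each nonzero intersection of kernels of earlier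
    functionals.\<close>
  define Q where "Q = {pick i J | i J. i \<in> I \<and> J \<subseteq> {..<t} \<and> (\<exists>u. P i J u)}"
  have Pp: "P i J (pick i J)" if "\<exists>u. P i J u" for i J unfolding pick_def using someI_ex[OF that] .
  have "Q \<subseteq> (\<lambda>(i, J). pick i J) ` (I \<times> Pow {..<t})" unfolding Q_def by auto
  then have "finite Q" by (rule finite_subset) (use finI in auto)
  moreover have "Q \<subseteq> (\<Union>i\<in>I. V i) - {0}"
  proof
    fix u assume "u \<in> Q"
    then obtain i J where "u = pick i J" "i \<in> I" "\<exists>u. P i J u" unfolding Q_def by blast
    then show "u \<in> (\<Union>i\<in>I. V i) - {0}" using Pp[of i J] by (auto simp: P_def)
  qed
  ultimately have "\<exists>M. ka.place M \<and> (\<forall>i\<in>I. V i \<subseteq> ka.vring M) \<and> Q \<inter> M = {}" by (rule ev)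
  then obtain M' where M': "ka.place M'" "\<forall>i\<in>I. V i \<subseteq> ka.vring M'" "Q \<inter> M' = {}" by (elim exE conjE)
  interpret pl: place_of \<kappa> M' by unfold_locales (rule M'(1))
  have "\<forall>i. \<exists>l. i \<in> I \<longrightarrow> Vector_Spaces.linear sc (*) l \<and> (\<forall>z\<in>V i. z - \<kappa> (l z) \<in> M')"
    using residue_functional[OF M'(1)] M'(2) by blast
  from choice[OF this] obtain r' where r': "\<forall>i. i \<in> I \<longrightarrow> Vector_Spaces.linear sc (*) (r' i) \<and> (\<forall>z\<in>V i. z - \<kappa> (r' i z) \<in> M')" ..
  let ?r = "r(t := r')" and ?M = "M(t := M')"
  have new: "\<exists>u\<in>V i. r' i u \<noteq> 0 \<and> (\<forall>s\<in>J. ?r s i u = 0)"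
    if i: "i \<in> I" "J \<subseteq> {..<t}" "\<exists>u\<in>V i. u \<noteq> 0 \<and> (\<forall>s\<in>J. ?r s i u = 0)" for i J
  proof -
    have J: "?r s i u = r s i u" if "s \<in> J" for s u using that i(2) by auto
    have "\<exists>u. P i J u" using i(3) J unfolding P_def by auto
    then have p: "P i J (pick i J)" "pick i J \<in> Q" using Pp i(1,2) unfolding Q_def by blast+
    let ?u = "pick i J"
    have uV: "?u \<in> V i" using p(1) by (simp add: P_def)
    have "r' i ?u \<noteq> 0"
    proof
      assume "r' i ?u = 0"
      then have "?u - \<kappa> 0 \<in> M'" using r' i(1) uV by metis
      then show False using p(2) M'(3) by auto
    qed
    then show ?thesis using p(1) J by (intro bexI[of _ ?u]) (auto simp: P_def)
  qed
  have "adapted (Suc t) ?M ?r"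
    unfolding adapted_def
  proof (intro allI impI)
    fix l assume l: "l < Suc t"
    let ?C = "\<lambda>M r l. ka.place (M l) \<and> (\<forall>i\<in>I. V i \<subseteq> ka.vring (M l) \<and> Vector_Spaces.linear sc (*) (r l i) \<and>
     (\<forall>z\<in>V i. z - \<kappa> (r l i z) \<in> M l) \<and>
     (\<forall>J\<subseteq>{..<l}. (\<exists>u\<in>V i. u \<noteq> 0 \<and> (\<forall>s\<in>J. r s i u = 0)) \<longrightarrow> (\<exists>u\<in>V i. r l i u \<noteq> 0 \<and> (\<forall>s\<in>J. r s i u = 0))))"
    show "?C ?M ?r l"
    proof (cases "l = t")
      case True
      show ?thesis unfolding True
      proof (intro conjI ballI allI impI)
        show "ka.place (?M t)" using M'(1) by simp
        fix i assume i: "i \<in> I"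
        have ri: "Vector_Spaces.linear sc (*) (r' i)" "\<forall>z\<in>V i. z - \<kappa> (r' i z) \<in> M'" using r' i by blast+
        show "V i \<subseteq> ka.vring (?M t)" using M'(2) i by simp
        show "Vector_Spaces.linear sc (*) (?r t i)" using ri(1) by (simp only: fun_upd_same)
        show "z - \<kappa> (?r t i z) \<in> ?M t" if "z \<in> V i" for z using ri(2) that by (simp only: fun_upd_same)
        fix J assume "J \<subseteq> {..<t}" "\<exists>u\<in>V i. u \<noteq> 0 \<and> (\<forall>s\<in>J. ?r s i u = 0)"
        from new[OF i this] show "\<exists>u\<in>V i. ?r t i u \<noteq> 0 \<and> (\<forall>s\<in>J. ?r s i u = 0)" by (simp only: fun_upd_same)
      qed
    next
      case False
      then have lt: "l < t" using l by simp
      have c: "?C M r l" by (rule mp[OF spec[OF ad[unfolded adapted_def]] lt])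
      have Ml: "?M l = M l" and rl: "?r l = r l" using False by simp_all
      show ?thesis unfolding Ml rl
      proof (intro conjI ballI allI impI)
        show "ka.place (M l)" by (rule conjunct1[OF c])
        fix i assume i: "i \<in> I"
        note ci = bspec[OF conjunct2[OF c] i]
        show "V i \<subseteq> ka.vring (M l)" by (rule conjunct1[OF ci])
        show "Vector_Spaces.linear sc (*) (r l i)" by (rule conjunct1[OF conjunct2[OF ci]])
        show "z - \<kappa> (r l i z) \<in> M l" if "z \<in> V i" for z
          by (rule bspec[OF conjunct1[OF conjunct2[OF conjunct2[OF ci]]] that])
        fix K assume K: "K \<subseteq> {..<l}" and ex: "\<exists>u\<in>V i. u \<noteq> 0 \<and> (\<forall>s\<in>K. ?r s i u = 0)"
        have tK: "t \<notin> K" using K lt by auto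
        have e: "(\<forall>s\<in>K. ?r s i u = 0) \<longleftrightarrow> (\<forall>s\<in>K. r s i u = 0)" for u
          by (rule ball_cong[OF refl]) (use tK in auto)
        show "\<exists>u\<in>V i. r l i u \<noteq> 0 \<and> (\<forall>s\<in>K. ?r s i u = 0)" unfolding e
          by (rule mp[OF mp[OF spec[OF conjunct2[OF conjunct2[OF conjunct2[OF ci]]]] K] ex[unfolded e]])
      qed
    qed
  qed
  then show ?case by blast
qed

text \<open>The poles of the quotients \<open>u / v i\<close> at the successive places make them independent.\<close>

lemma adapted_rank:
  assumes ad: "adapted t M r"
    and v: "\<And>i. i \<in> I \<Longrightarrow> v i \<in> V i" "\<And>i. i \<in> I \<Longrightarrow> v i \<noteq> 0"
    and z: "\<And>l. l < t \<Longrightarrow> \<exists>i\<in>I. r l i (v i) = 0"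
  shows "rank_ge t v"
proof -
  \<comment> \<open>For u in \<open>W l i\<close> the quotient u / v_i has at the place l at worst a
    pole less deep than that of 1 / v_i. The span \<open>E l\<close> collects all derivatives along
    such directions.\<close>
  define W where "W l i = {u\<in>V i. \<forall>s\<le>l. r s i (v i) = 0 \<longrightarrow> r s i u = 0}" for l i
  define E where "E l = span {qv i u v | i u. i \<in> I \<and> u \<in> W l i}" for l
  define p where "p = pr v"
  have p0: "p \<noteq> 0" using v(2) finI by (simp add: p_def pr_def)
  have qv_p: "qv i u v = u * p / v i" if "i \<in> I" for i u
    using v(2)[OF that] prod.remove[OF finI that, of v] by (simp add: qv_def p_def pr_def)
  have step: "\<exists>i u. i \<in> I \<and> u \<in> V i \<and> (\<forall>s<l. r s i (v i) = 0 \<longrightarrow> r s i u = 0) \<and> qv i u v \<notin> E l" if l: "l < t" for l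
  proof -
    have c: "ka.place (M l)" and ci: "\<And>i. i \<in> I \<Longrightarrow> V i \<subseteq> ka.vring (M l)"
      and cr: "\<And>i z. i \<in> I \<Longrightarrow> z \<in> V i \<Longrightarrow> z - \<kappa> (r l i z) \<in> M l"
      and cu: "\<And>i J. i \<in> I \<Longrightarrow> J \<subseteq> {..<l} \<Longrightarrow> \<exists>u\<in>V i. u \<noteq> 0 \<and> (\<forall>s\<in>J. r s i u = 0) \<Longrightarrow>
          \<exists>u\<in>V i. r l i u \<noteq> 0 \<and> (\<forall>s\<in>J. r s i u = 0)"
      using ad l unfolding adapted_def by blast+
    interpret pl: place_of \<kappa> "M l" by unfold_locales (rule c)
    define J where "J = {i\<in>I. r l i (v i) = 0}"
    have J: "finite J" "J \<noteq> {}" using finI z[OF l] by (auto simp: J_def)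
    have vM: "v j \<in> M l" if "j \<in> J" for j
      using cr[of j "v j"] v(1)[of j] that by (simp add: J_def)
    \<comment> \<open>Among the factors that vanish at this place, \<open>j0\<close> has the deepest
      zero.\<close>
    have "\<exists>j0\<in>J. \<forall>j\<in>J. inverse (v j) * v j0 \<in> pl.A"
      by (rule pl.ex_min_valuation[OF J]) (use v(2) in \<open>simp add: J_def\<close>)
    then obtain j0 where j0: "j0 \<in> J" "\<And>j. j \<in> J \<Longrightarrow> inverse (v j) * v j0 \<in> pl.A" by blast
    have j0I: "j0 \<in> I" using j0(1) by (simp add: J_def)
    \<comment> \<open>The vector \<open>v j0\<close> is itself a nonzero member of the intersection
      of earlier kernels, so genericity supplies a member with nonzero residue at the present
      place.\<close>
    obtain u where u: "u \<in> V j0" "r l j0 u \<noteq> 0" "\<forall>s\<in>{s\<in>{..<l}. r s j0 (v j0) = 0}. r s j0 u = 0"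
      using cu[OF j0I, of "{s\<in>{..<l}. r s j0 (v j0) = 0}"] v[OF j0I] by blast
    \<comment> \<open>Vectors whose quotient by p has at this place a pole strictly less deep than 1
      / v_j0. It contains \<open>E l\<close> but not the new derivative, whose quotient by p is u /
      v_j0.\<close>
    define Y where "Y = {y. v j0 * y / p \<in> M l}"
    have subY: "subspace Y"
      unfolding subspace_def
    proof (intro conjI ballI allI)
      show "0 \<in> Y" by (simp add: Y_def)
      show "a + b \<in> Y" if "a \<in> Y" "b \<in> Y" for a b
        using pl.Madd[of "v j0 * a / p" "v j0 * b / p"] that by (simp add: Y_def distrib_left add_divide_distrib)
      show "sc k a \<in> Y" if "a \<in> Y" for k a
        using pl.Mk[of "v j0 * a / p" k] that by (simp add: Y_def sc_\<kappa> mult.left_commute)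
    qed
    have "E l \<subseteq> Y"
      unfolding E_def
    proof (rule span_minimal[OF _ subY], rule subsetI)
      fix y assume "y \<in> {qv i u v | i u. i \<in> I \<and> u \<in> W l i}"
      then obtain i u' where y: "y = qv i u' v" "i \<in> I" "u' \<in> W l i" by blast
      have u'V: "u' \<in> V i" using y(3) by (simp add: W_def)
      have u'A: "u' \<in> pl.A" using ci[OF y(2)] u'V by blast
      have e: "v j0 * y / p = v j0 * u' / v i" using p0 unfolding y(1) qv_p[OF y(2)] by simp
      \<comment> \<open>If v_i vanishes at the place, u' vanishes as well and v_j0 / v_i is finite.
        Otherwise v_i acts as a unit and v_j0 vanishes.\<close>
      have "v j0 * u' / v i \<in> M l"
      proof (cases "r l i (v i) = 0")
        case True
        then have "r l i u' = 0" using y(3) by (simp add: W_def)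
        then have "u' \<in> M l" using cr[OF y(2) u'V] by simp
        moreover have "inverse (v i) * v j0 \<in> pl.A" using True y(2) by (intro j0(2)) (simp add: J_def)
        ultimately have "(inverse (v i) * v j0) * u' \<in> M l" using pl.AM_mult by blast
        then show ?thesis by (simp add: field_simps)
      next
        case False
        have "u' * v j0 \<in> M l" by (rule pl.AM_mult[OF u'A vM[OF j0(1)]])
        then have "v i * (v j0 * u' / v i) \<in> M l" using v(2)[OF y(2)] by (simp add: mult.commute)
        then show ?thesis by (rule pl.M_unit[OF cr[OF y(2) v(1)[OF y(2)]] False])
      qed
      then show "y \<in> Y" unfolding Y_def e[symmetric] by simp
    qed
    moreover have "qv j0 u v \<notin> Y"
    proof
      assume "qv j0 u v \<in> Y"
      then have "u \<in> M l" using p0 v(2)[OF j0I] unfolding Y_def qv_p[OF j0I] by simp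
      then have "u - (u - \<kappa> (r l j0 u)) \<in> M l" by (rule pl.Mdiff[OF _ cr[OF j0I u(1)]])
      then have "\<kappa> (r l j0 u) \<in> M l" by simp
      then show False using u(2) by (simp only: pl.Mk_iff)
    qed
    ultimately have "qv j0 u v \<notin> E l" by blast
    then show ?thesis using j0I u by (intro exI[of _ j0] exI[of _ u]) auto
  qed
  then have "\<forall>l. \<exists>i u. l < t \<longrightarrow> i \<in> I \<and> u \<in> V i \<and> (\<forall>s<l. r s i (v i) = 0 \<longrightarrow> r s i u = 0) \<and> qv i u v \<notin> E l" by blast
  then obtain i u where iu: "\<And>l. l < t \<Longrightarrow> i l \<in> I \<and> u l \<in> V (i l) \<and>
     (\<forall>s<l. r s (i l) (v (i l)) = 0 \<longrightarrow> r s (i l) (u l) = 0) \<and> qv (i l) (u l) v \<notin> E l" by metis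
  define e where "e b = (if b < t then qv (i b) (u b) v else p)" for b
  have "ind sc (Suc t) e"
  proof (rule ind_triangular)
    show "subspace (E l)" for l by (simp add: E_def)
    show "e l \<notin> E l" if "l < t" for l using iu[OF that] that by (simp add: e_def)
    show "e t \<noteq> 0" using p0 by (simp add: e_def)
    fix l l' assume l: "l < l'" "l' \<le> t"
    show "e l' \<in> E l"
    proof (cases "l' < t")
      case True
      \<comment> \<open>The vector chosen at step l' vanishes with v at all places before l', in
        particular at those up to l; hence the strict bound in \<open>step\<close> and the weak one
        in \<open>W\<close>.\<close>
      have "u l' \<in> W l (i l')" using iu[OF True] l(1) by (auto simp: W_def)
      then have "qv (i l') (u l') v \<in> E l" unfolding E_def using iu[OF True] by (intro span_base) blast
      then show ?thesis using True by (simp add: e_def)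
    next
      case False
      obtain j where j: "j \<in> I" using z[of l] l by auto
      \<comment> \<open>Euler's relation: the product itself is the derivative in the direction of
        v_j, and \<open>v j\<close> trivially lies in \<open>W l j\<close>.\<close>
      have "p = qv j (v j) v" using qv_p[OF j, of "v j"] v(2)[OF j] by simp
      moreover have "v j \<in> W l j" using v(1)[OF j] by (simp add: W_def)
      ultimately have "p \<in> E l" unfolding E_def using j by (intro span_base) blast
      then show ?thesis using False by (simp add: e_def)
    qed
  qed
  then show ?thesis unfolding rank_ge_def e_def p_def using iu by (intro exI[of _ i] exI[of _ u]) simp
qed

end

section \<open>Derivatives of rational functions along a line\<close>

text \<open>A formal derivative at 0, with the quotient rule cleared of denominators, so that it is
  meaningful in every characteristic. Values of \<phi> at zeros of q are left arbitrary.\<close>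

definition ratd :: "('k::field \<Rightarrow> 'k) \<Rightarrow> 'k \<Rightarrow> bool" where
  "ratd \<phi> \<delta> \<longleftrightarrow> (\<exists>p q. coeff q 0 \<noteq> 0 \<and> (\<forall>e. poly q e \<noteq> 0 \<longrightarrow> \<phi> e = poly p e / poly q e) \<and>
     \<delta> * (coeff q 0)\<^sup>2 = coeff p 1 * coeff q 0 - coeff p 0 * coeff q 1)"

lemma coeff_mult_01:
  "coeff (p * q) 0 = coeff p 0 * coeff q 0" "coeff (p * q) 1 = coeff p 0 * coeff q 1 + coeff p 1 * coeff q 0"
  for p q :: "'k::field poly"
  by (simp_all add: coeff_mult)

lemma ratdI:
  assumes "coeff q 0 \<noteq> 0" "\<And>e. poly q e \<noteq> 0 \<Longrightarrow> \<phi> e = poly p e / poly q e"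
    "\<delta> * (coeff q 0)\<^sup>2 = coeff p 1 * coeff q 0 - coeff p 0 * coeff q 1"
  shows "ratd \<phi> \<delta>"
  using assms unfolding ratd_def by blast

text \<open>Two representations agree off finitely many points of an infinite field, hence as
  fractions of polynomials.\<close>

lemma ratd_unique:
  fixes \<delta> :: "'k::alg_closed_field"
  assumes "ratd \<phi> \<delta>" "ratd \<phi> \<delta>'" shows "\<delta> = \<delta>'"
proof -
  obtain p q where p: "coeff q 0 \<noteq> 0" "\<And>e. poly q e \<noteq> 0 \<Longrightarrow> \<phi> e = poly p e / poly q e"
    "\<delta> * (coeff q 0)\<^sup>2 = coeff p 1 * coeff q 0 - coeff p 0 * coeff q 1" using assms(1) unfolding ratd_def by blast
  obtain p' q' where p': "coeff q' 0 \<noteq> 0" "\<And>e. poly q' e \<noteq> 0 \<Longrightarrow> \<phi> e = poly p' e / poly q' e"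
    "\<delta>' * (coeff q' 0)\<^sup>2 = coeff p' 1 * coeff q' 0 - coeff p' 0 * coeff q' 1" using assms(2) unfolding ratd_def by blast
  have q0: "q * q' \<noteq> 0" using p(1) p'(1) by auto
  have "p * q' = p' * q"
  proof (rule poly_eq_infinite)
    show "finite {e. poly (q * q') e = 0}" by (rule poly_roots_finite[OF q0])
    fix e assume "e \<notin> {e. poly (q * q') e = 0}"
    then have nz: "poly q e \<noteq> 0" "poly q' e \<noteq> 0" by auto
    then have "poly p e / poly q e = poly p' e / poly q' e" using p(2) p'(2) by metis
    then show "poly (p * q') e = poly (p' * q) e" using nz by (simp add: field_simps)
  qed
  then have "coeff (p * q') 0 = coeff (p' * q) 0" "coeff (p * q') 1 = coeff (p' * q) 1" by simp_all
  then have e: "coeff p 0 * coeff q' 0 = coeff p' 0 * coeff q 0"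
    "coeff p 0 * coeff q' 1 + coeff p 1 * coeff q' 0 = coeff p' 0 * coeff q 1 + coeff p' 1 * coeff q 0"
    unfolding coeff_mult_01 .
  have "\<delta> * ((coeff q 0)\<^sup>2 * (coeff q' 0)\<^sup>2) = \<delta>' * ((coeff q 0)\<^sup>2 * (coeff q' 0)\<^sup>2)"
    using p(3) p'(3) e by algebra
  then show ?thesis using p(1) p'(1) by simp
qed

lemma ratd_add:
  fixes \<phi> :: "'k::field \<Rightarrow> 'k"
  assumes "ratd \<phi> \<delta>" "ratd \<psi> \<delta>'" shows "ratd (\<lambda>e. \<phi> e + \<psi> e) (\<delta> + \<delta>')"
proof -
  obtain p q where p: "coeff q 0 \<noteq> 0" "\<And>e. poly q e \<noteq> 0 \<Longrightarrow> \<phi> e = poly p e / poly q e"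
    "\<delta> * (coeff q 0)\<^sup>2 = coeff p 1 * coeff q 0 - coeff p 0 * coeff q 1" using assms(1) unfolding ratd_def by blast
  obtain p' q' where p': "coeff q' 0 \<noteq> 0" "\<And>e. poly q' e \<noteq> 0 \<Longrightarrow> \<psi> e = poly p' e / poly q' e"
    "\<delta>' * (coeff q' 0)\<^sup>2 = coeff p' 1 * coeff q' 0 - coeff p' 0 * coeff q' 1" using assms(2) unfolding ratd_def by blast
  show ?thesis
  proof (rule ratdI[of "q * q'" _ "p * q' + p' * q"])
    show "coeff (q * q') 0 \<noteq> 0" using p(1) p'(1) by (simp add: coeff_mult_01)
    show "\<phi> e + \<psi> e = poly (p * q' + p' * q) e / poly (q * q') e" if "poly (q * q') e \<noteq> 0" for e
      using that p(2)[of e] p'(2)[of e] by (simp add: field_simps)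
    show "(\<delta> + \<delta>') * (coeff (q * q') 0)\<^sup>2 = coeff (p * q' + p' * q) 1 * coeff (q * q') 0 - coeff (p * q' + p' * q) 0 * coeff (q * q') 1"
      unfolding coeff_add coeff_mult_01 using p(3) p'(3) by algebra
  qed
qed

lemma ratd_mult:
  fixes \<phi> :: "'k::field \<Rightarrow> 'k"
  assumes "ratd \<phi> \<delta>" "ratd \<psi> \<delta>'" shows "ratd (\<lambda>e. \<phi> e * \<psi> e) (\<phi> 0 * \<delta>' + \<psi> 0 * \<delta>)"
proof -
  obtain p q where p: "coeff q 0 \<noteq> 0" "\<And>e. poly q e \<noteq> 0 \<Longrightarrow> \<phi> e = poly p e / poly q e"
    "\<delta> * (coeff q 0)\<^sup>2 = coeff p 1 * coeff q 0 - coeff p 0 * coeff q 1" using assms(1) unfolding ratd_def by blast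
  obtain p' q' where p': "coeff q' 0 \<noteq> 0" "\<And>e. poly q' e \<noteq> 0 \<Longrightarrow> \<psi> e = poly p' e / poly q' e"
    "\<delta>' * (coeff q' 0)\<^sup>2 = coeff p' 1 * coeff q' 0 - coeff p' 0 * coeff q' 1" using assms(2) unfolding ratd_def by blast
  have v: "\<phi> 0 * coeff q 0 = coeff p 0" "\<psi> 0 * coeff q' 0 = coeff p' 0"
    using p(1,2) p'(1,2) by (simp_all add: poly_0_coeff_0)
  show ?thesis
  proof (rule ratdI[of "q * q'" _ "p * p'"])
    show "coeff (q * q') 0 \<noteq> 0" using p(1) p'(1) by (simp add: coeff_mult_01)
    show "\<phi> e * \<psi> e = poly (p * p') e / poly (q * q') e" if "poly (q * q') e \<noteq> 0" for e
      using that p(2)[of e] p'(2)[of e] by simp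
    show "(\<phi> 0 * \<delta>' + \<psi> 0 * \<delta>) * (coeff (q * q') 0)\<^sup>2 = coeff (p * p') 1 * coeff (q * q') 0 - coeff (p * p') 0 * coeff (q * q') 1"
      unfolding coeff_mult_01 using p(3) p'(3) v by algebra
  qed
qed

lemma ratd_const: "ratd (\<lambda>_. c) (0::'k::field)"
  by (rule ratdI[of 1 _ "[:c:]"]) (simp_all add: coeff_1)

text \<open>Multiplying numerator and denominator by s confines the representation to the points
  where both functions agree.\<close>

lemma ratd_cong:
  fixes \<phi> :: "'k::field \<Rightarrow> 'k"
  assumes "ratd \<phi> \<delta>" "coeff s 0 \<noteq> 0" "\<And>e. poly s e \<noteq> 0 \<Longrightarrow> \<phi> e = \<psi> e" shows "ratd \<psi> \<delta>"
proof -
  obtain p q where p: "coeff q 0 \<noteq> 0" "\<And>e. poly q e \<noteq> 0 \<Longrightarrow> \<phi> e = poly p e / poly q e"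
    "\<delta> * (coeff q 0)\<^sup>2 = coeff p 1 * coeff q 0 - coeff p 0 * coeff q 1" using assms(1) unfolding ratd_def by blast
  show ?thesis
  proof (rule ratdI[of "q * s" _ "p * s"])
    show "coeff (q * s) 0 \<noteq> 0" using p(1) assms(2) by (simp add: coeff_mult_01)
    show "\<psi> e = poly (p * s) e / poly (q * s) e" if "poly (q * s) e \<noteq> 0" for e
      using that p(2)[of e] assms(3)[of e] by simp
    show "\<delta> * (coeff (q * s) 0)\<^sup>2 = coeff (p * s) 1 * coeff (q * s) 0 - coeff (p * s) 0 * coeff (q * s) 1"
      unfolding coeff_mult_01 using p(3) by algebra
  qed
qed

section \<open>Tangent spaces of cones\<close>

lemma subspace_tangent_space: "fsp.subspace (tangent_space S x)"
  unfolding fsp.subspace_def tangent_space_def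
  by (auto simp: fscale_def algebra_simps)

text \<open>Each evaluation cuts the dimension by at most one, and the subspace on which all of them
  vanish is zero.\<close>

lemma finite_span_determined:
  assumes "finite J" "fsp.subspace W" "\<And>D. D \<in> W \<Longrightarrow> (\<And>j. j \<in> J \<Longrightarrow> D j = 0) \<Longrightarrow> D = 0"
  shows "\<exists>C. finite C \<and> W \<subseteq> fsp.span C"
  using assms
proof (induction J arbitrary: W rule: finite_induct)
  case empty
  have "W \<subseteq> fsp.span {}"
  proof
    fix D assume "D \<in> W"
    then have "D = 0" by (rule empty.prems(2)) simp
    then show "D \<in> fsp.span {}" by (simp only: fsp.span_zero)
  qed
  then show ?case by blast
next
  case (insert j J)
  let ?W = "{D \<in> W. D j = 0}"
  have sW: "fsp.subspace ?W" using insert.prems(1) unfolding fsp.subspace_def by (auto simp: fscale_def)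
  have "\<exists>C. finite C \<and> ?W \<subseteq> fsp.span C"
    by (rule insert.IH[OF sW]) (use insert.prems(2) in auto)
  then obtain C where C: "finite C" "?W \<subseteq> fsp.span C" by (elim exE conjE)
  show ?case
  proof (cases "W \<subseteq> ?W")
    case True then show ?thesis using C by blast
  next
    case False
    then obtain D0 where D0: "D0 \<in> W" "D0 j \<noteq> 0" by blast
    have "D \<in> fsp.span (insert D0 C)" if D: "D \<in> W" for D
    proof -
      let ?c = "D j / D0 j"
      have 1: "D - fscale ?c D0 \<in> W"
        by (rule fsp.subspace_diff[OF insert.prems(1) D fsp.subspace_scale[OF insert.prems(1) D0(1)]])
      have 2: "(D - fscale ?c D0) j = 0" using D0(2) by (simp add: fscale_def)
      have "D - fscale ?c D0 \<in> ?W" using 1 2 by blast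
      then have "D - fscale ?c D0 \<in> fsp.span (insert D0 C)" using C(2) fsp.span_mono[of C "insert D0 C"] by blast
      moreover have "fscale ?c D0 \<in> fsp.span (insert D0 C)" by (intro fsp.span_scale fsp.span_base) simp
      ultimately have "(D - fscale ?c D0) + fscale ?c D0 \<in> fsp.span (insert D0 C)" by (rule fsp.span_add)
      then show ?thesis by simp
    qed
    then show ?thesis using C(1) by (intro exI[of _ "insert D0 C"]) auto
  qed
qed

lemma tangent_map_linear:
  "tangent_map T \<phi> x (D + D') = tangent_map T \<phi> x D + tangent_map T \<phi> x D'"
  "tangent_map T \<phi> x (fscale c D) = fscale c (tangent_map T \<phi> x D)"
  by (auto simp: tangent_map_def fscale_def fun_eq_iff)

lemma tangent_map_span:
  assumes "W \<subseteq> fsp.span C"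
  shows "tangent_map T \<phi> x ` W \<subseteq> fsp.span (tangent_map T \<phi> x ` C)"
proof
  fix E assume "E \<in> tangent_map T \<phi> x ` W"
  then obtain D where D: "D \<in> fsp.span C" "E = tangent_map T \<phi> x D" using assms by blast
  have "tangent_map T \<phi> x D \<in> fsp.span (tangent_map T \<phi> x ` C)"
    using D(1)
  proof (induction rule: fsp.span_induct_alt)
    case base
    have "tangent_map T \<phi> x 0 = 0" using tangent_map_linear(2)[of T \<phi> x 0 0] by simp
    then show ?case by (simp only: fsp.span_zero)
  next
    case (step c a b)
    show ?case unfolding tangent_map_linear by (rule fsp.span_add[OF fsp.span_scale[OF fsp.span_base[OF imageI[OF step(1)]]] step(2)])
  qed
  then show "E \<in> fsp.span (tangent_map T \<phi> x ` C)" unfolding D(2) .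
qed

section \<open>Germs of regular functions on a cone\<close>

context
  fixes rep :: "'p \<Rightarrow> 'v set" and H :: "'d \<Rightarrow> ('v \<Rightarrow> 'k::field) set" and X :: "'p set"
    and pl :: "'d \<Rightarrow> 'd \<Rightarrow> 'd"
  assumes Hadd: "\<And>d f g. f \<in> H d \<Longrightarrow> g \<in> H d \<Longrightarrow> (\<lambda>v. f v + g v) \<in> H d"
    and Hmult: "\<And>d d' f g. f \<in> H d \<Longrightarrow> g \<in> H d' \<Longrightarrow> (\<lambda>v. f v * g v) \<in> H (pl d d')"
begin

lemma cone_regular_alg:
  assumes f: "f \<in> cone_regular rep H X U" and g: "g \<in> cone_regular rep H X U'"
  shows "(\<lambda>y. f y + g y) \<in> cone_regular rep H X (U \<inter> U')"
    "(\<lambda>y. f y * g y) \<in> cone_regular rep H X (U \<inter> U')"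
proof -
  have loc: "\<exists>N d a b c. openin (cone_zariski rep H X) N \<and> x \<in> N \<and> N \<subseteq> U \<inter> U' \<and> a \<in> H d \<and> b \<in> H d \<and> c \<in> H d \<and>
     (\<forall>y\<in>N. \<forall>v\<in>rep y. c v \<noteq> 0 \<and> f y + g y = a v / c v \<and> f y * g y = b v / c v)" if x: "x \<in> U \<inter> U'" for x
  proof -
    obtain N d a b where 1: "openin (cone_zariski rep H X) N" "x \<in> N" "N \<subseteq> U" "a \<in> H d" "b \<in> H d"
      "\<forall>y\<in>N. \<forall>v\<in>rep y. b v \<noteq> 0 \<and> f y = a v / b v"
      using f x unfolding cone_regular_def by blast
    obtain N' d' a' b' where 2: "openin (cone_zariski rep H X) N'" "x \<in> N'" "N' \<subseteq> U'" "a' \<in> H d'" "b' \<in> H d'"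
      "\<forall>y\<in>N'. \<forall>v\<in>rep y. b' v \<noteq> 0 \<and> g y = a' v / b' v"
      using g x unfolding cone_regular_def by blast
    have A: "(\<lambda>v. a v * b' v + b v * a' v) \<in> H (pl d d')" by (rule Hadd[OF Hmult[OF 1(4) 2(5)] Hmult[OF 1(5) 2(4)]])
    have B: "(\<lambda>v. a v * a' v) \<in> H (pl d d')" by (rule Hmult[OF 1(4) 2(4)])
    have C: "(\<lambda>v. b v * b' v) \<in> H (pl d d')" by (rule Hmult[OF 1(5) 2(5)])
    have O: "openin (cone_zariski rep H X) (N \<inter> N')" using 1(1) 2(1) by (rule openin_Int)
    have V: "\<forall>y\<in>N \<inter> N'. \<forall>v\<in>rep y. b v * b' v \<noteq> 0 \<and> f y + g y = (a v * b' v + b v * a' v) / (b v * b' v) \<and>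
        f y * g y = (a v * a' v) / (b v * b' v)"
    proof (intro ballI)
      fix y v assume y: "y \<in> N \<inter> N'" "v \<in> rep y"
      then have "b v \<noteq> 0 \<and> f y = a v / b v" "b' v \<noteq> 0 \<and> g y = a' v / b' v" using 1(6) 2(6) by blast+
      then show "b v * b' v \<noteq> 0 \<and> f y + g y = (a v * b' v + b v * a' v) / (b v * b' v) \<and>
        f y * g y = (a v * a' v) / (b v * b' v)" by (simp add: field_simps)
    qed
    have "x \<in> N \<inter> N'" "N \<inter> N' \<subseteq> U \<inter> U'" using 1(2,3) 2(2,3) by blast+
    then show ?thesis using O A B C V
      by (intro exI[of _ "N \<inter> N'"] exI[of _ "pl d d'"] exI[of _ "\<lambda>v. a v * b' v + b v * a' v"]
        exI[of _ "\<lambda>v. a v * a' v"] exI[of _ "\<lambda>v. b v * b' v"] conjI)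
  qed
  show "(\<lambda>y. f y + g y) \<in> cone_regular rep H X (U \<inter> U')"
    unfolding cone_regular_def
  proof (intro CollectI ballI)
    fix x assume "x \<in> U \<inter> U'"
    from loc[OF this] show "\<exists>N d a c. openin (cone_zariski rep H X) N \<and> x \<in> N \<and> N \<subseteq> U \<inter> U' \<and> a \<in> H d \<and> c \<in> H d \<and>
     (\<forall>y\<in>N. \<forall>v\<in>rep y. c v \<noteq> 0 \<and> f y + g y = a v / c v)" by blast
  qed
  show "(\<lambda>y. f y * g y) \<in> cone_regular rep H X (U \<inter> U')"
    unfolding cone_regular_def
  proof (intro CollectI ballI)
    fix x assume "x \<in> U \<inter> U'"
    from loc[OF this] show "\<exists>N d a c. openin (cone_zariski rep H X) N \<and> x \<in> N \<and> N \<subseteq> U \<inter> U' \<and> a \<in> H d \<and> c \<in> H d \<and>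
     (\<forall>y\<in>N. \<forall>v\<in>rep y. c v \<noteq> 0 \<and> f y * g y = a v / c v)" by blast
  qed
qed

lemma germs_alg:
  assumes "f \<in> germs (cone_space rep H X) x" "g \<in> germs (cone_space rep H X) x"
  shows "(\<lambda>y. f y + g y) \<in> germs (cone_space rep H X) x" "(\<lambda>y. f y * g y) \<in> germs (cone_space rep H X) x"
proof -
  obtain U U' where U: "openin (cone_zariski rep H X) U" "x \<in> U" "f \<in> cone_regular rep H X U"
    "openin (cone_zariski rep H X) U'" "x \<in> U'" "g \<in> cone_regular rep H X U'"
    using assms unfolding germs_def cone_space_def by auto
  have "openin (cone_zariski rep H X) (U \<inter> U')" "x \<in> U \<inter> U'" using U by auto
  then show "(\<lambda>y. f y + g y) \<in> germs (cone_space rep H X) x" "(\<lambda>y. f y * g y) \<in> germs (cone_space rep H X) x"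
    using cone_regular_alg[OF U(3,6)] unfolding germs_def cone_space_def by auto
qed

end

lemma cone_regular_quotient:
  assumes "a \<in> H d" "b \<in> H d" "\<And>y v. y \<in> nonvan rep X b \<Longrightarrow> v \<in> rep y \<Longrightarrow> h y = a v / b v" "x \<in> nonvan rep X b"
  shows "h \<in> germs (cone_space rep H X) x"
proof -
  have o: "openin (cone_zariski rep H X) (nonvan rep X b)" by (rule openin_nonvan[where H = H and d = d, OF assms(2)])
  have "h \<in> cone_regular rep H X (nonvan rep X b)"
    unfolding cone_regular_def
  proof (intro CollectI ballI exI conjI)
    fix x y v assume "y \<in> nonvan rep X b" "v \<in> rep y"
    then show "b v \<noteq> 0" "h y = a v / b v" using assms(3) by (auto simp: nonvan_def)
  qed (use o assms in auto)
  then show ?thesis using o assms(4) unfolding germs_def cone_space_def by auto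
qed

lemma (in vector_space) ind_dual:
  assumes "ind scale s u"
  shows "\<exists>l. \<forall>b<s. Vector_Spaces.linear scale (*) (l b) \<and> (\<forall>b'<s. l b (u b') = (if b' = b then 1 else (0::'a)))"
proof -
  have nz: "c b = 0" if "(\<Sum>b<s. scale (c b) (u b)) = 0" "b < s" for c b
    using assms that unfolding ind_def by blast
  have inj: "inj_on u {..<s}"
  proof (rule inj_onI, rule ccontr)
    fix a b assume ab: "a \<in> {..<s}" "b \<in> {..<s}" "u a = u b" "a \<noteq> b"
    define c :: "nat \<Rightarrow> 'a" where "c x = (if x = a then 1 else if x = b then - 1 else 0)" for x
    have "(\<Sum>x<s. scale (c x) (u x)) = (\<Sum>x\<in>{a, b}. scale (c x) (u x))"
      by (rule sum.mono_neutral_right) (use ab in \<open>auto simp: c_def\<close>)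
    also have "\<dots> = 0" using ab by (simp add: c_def)
    finally show False using nz[of c a] ab(1) by (simp add: c_def)
  qed
  have "independent (u ` {..<s})"
  proof
    assume "dependent (u ` {..<s})"
    then obtain d where d: "\<exists>x\<in>u ` {..<s}. d x \<noteq> 0" "(\<Sum>x\<in>u ` {..<s}. scale (d x) x) = 0"
      using dependent_finite[of "u ` {..<s}"] by auto
    have "(\<Sum>b<s. scale (d (u b)) (u b)) = 0" using d(2) by (simp add: sum.reindex[OF inj])
    then show False using nz[of "\<lambda>b. d (u b)"] d(1) by auto
  qed
  from ex_dual_basis[OF this] obtain l where l: "\<forall>b. Vector_Spaces.linear scale (*) (l b)"
    "\<forall>b\<in>u ` {..<s}. \<forall>b'\<in>u ` {..<s}. l b b' = (if b' = b then 1 else 0)" by (elim exE conjE)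
  have "l (u b) (u b') = (if b' = b then 1 else 0)" if "b < s" "b' < s" for b b'
    using l(2) that inj_on_eq_iff[OF inj, of b' b] by auto
  then show ?thesis using l(1) by (intro exI[of _ "\<lambda>b. l (u b)"]) auto
qed

lemma polyfun_multi_cong:
  assumes "f \<in> polyfun {\<lambda>v. l (v i) | i l. i \<in> I \<and> Vector_Spaces.linear sc (*) l}" "\<And>i. i \<in> I \<Longrightarrow> v i = v' i"
  shows "f v = f v'"
  using assms(1) by induction (use assms(2) in auto)

section \<open>Rays and the tangent vectors they define on the product\<close>

context field_systems
begin

definition rep :: "('i \<Rightarrow> 'K set) \<Rightarrow> ('i \<Rightarrow> 'K) set" where "rep x = (\<Pi>\<^sub>E i\<in>I. x i - {0})"

definition P :: "('i \<Rightarrow> 'K set) set" where "P = (\<Pi>\<^sub>E i\<in>I. lines sc (V i))"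

definition pt :: "('i \<Rightarrow> 'K) \<Rightarrow> 'i \<Rightarrow> 'K set" where "pt v = (\<lambda>i\<in>I. span {v i})"

abbreviation mf :: "('i \<Rightarrow> nat) \<Rightarrow> (('i \<Rightarrow> 'K) \<Rightarrow> 'k) set" where "mf \<equiv> multiforms sc I"

abbreviation Pr :: "('i \<Rightarrow> 'K set, 'k) kspace" where "Pr \<equiv> cone_space rep mf P"

lemma proj_prod_eq: "proj_prod sc I V = Pr"
  unfolding proj_prod_def rep_def P_def ..

lemma repD: assumes "x \<in> P" "v \<in> rep x" "i \<in> I" shows "v i \<in> V i" "v i \<noteq> 0" "v i \<in> x i" "x i = span {v i}"
proof -
  show 1: "v i \<noteq> 0" "v i \<in> x i" using assms unfolding rep_def by auto
  have L: "x i \<in> lines sc (V i)" using assms unfolding P_def by auto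
  show "v i \<in> V i" by (rule lines_subspace_mem[OF L subspace_V[OF assms(3)] 1(2)])
  show "x i = span {v i}" by (rule lines_span_eq[OF L 1(2,1)])
qed

lemma pt_rep: assumes "x \<in> P" "v \<in> rep x" shows "pt v = x"
proof
  fix i show "pt v i = x i"
    using repD(4)[OF assms, of i] assms(1) by (cases "i \<in> I") (auto simp: pt_def P_def PiE_def extensional_def)
qed

lemma ptI:
  assumes "\<And>i. i \<in> I \<Longrightarrow> v i \<in> V i" "\<And>i. i \<in> I \<Longrightarrow> v i \<noteq> 0"
  shows "pt v \<in> P" "restrict v I \<in> rep (pt v)"
  using assms unfolding pt_def P_def rep_def lines_def by (auto intro!: span_base)

lemma rep_ex: "x \<in> P \<Longrightarrow> \<exists>v. v \<in> rep x"
proof -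
  assume x: "x \<in> P"
  have "\<forall>i. \<exists>z. i \<in> I \<longrightarrow> z \<in> x i \<and> z \<noteq> 0" using x lines_ex_nonzero unfolding P_def by blast
  from choice[OF this] obtain v where "\<forall>i. i \<in> I \<longrightarrow> v i \<in> x i \<and> v i \<noteq> 0" ..
  then have "restrict v I \<in> rep x" unfolding rep_def by auto
  then show ?thesis by blast
qed

text \<open>Points of \<open>rep\<close> are extensional functions while the constructions on
  vectors are not; forms do not see the difference.\<close>

lemma mf_restrict: "f \<in> mf d \<Longrightarrow> f (restrict v I) = f v"
  by (rule polyfun_multi_cong[of f I sc]) (auto simp: multiforms_def)

lemma mf_cong: "f \<in> mf d \<Longrightarrow> (\<And>i. i \<in> I \<Longrightarrow> v i = v' i) \<Longrightarrow> f v = f v'"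
  by (rule polyfun_multi_cong[of f I sc]) (auto simp: multiforms_def)

lemma mf_rep':
  assumes "x \<in> P" "v \<in> rep x" "u \<in> rep x"
  obtains c where "\<And>i. i \<in> I \<Longrightarrow> c i \<noteq> 0" "\<And>d f. f \<in> mf d \<Longrightarrow> f u = (\<Prod>i\<in>I. c i ^ d i) * f v"
proof -
  have "\<forall>i. \<exists>c. i \<in> I \<longrightarrow> c \<noteq> 0 \<and> u i = sc c (v i)"
    using lines_memD repD[OF assms(1,2)] repD[OF assms(1,3)] assms(1) unfolding P_def by (metis PiE_mem)
  from choice[OF this] obtain c where c: "\<forall>i. i \<in> I \<longrightarrow> c i \<noteq> 0 \<and> u i = sc (c i) (v i)" ..
  have "f u = (\<Prod>i\<in>I. c i ^ d i) * f v" if f: "f \<in> mf d" for f d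
  proof -
    have "f u = f (\<lambda>i. sc (c i) (v i))" by (rule mf_cong[OF f]) (use c in simp)
    then show ?thesis using multiforms_hom[OF f] by simp
  qed
  then show thesis using that c by blast
qed

lemma nonvan_mf:
  assumes f: "f \<in> mf d" and x: "x \<in> P" "v \<in> rep x" shows "x \<in> nonvan rep P f \<longleftrightarrow> f v \<noteq> 0"
proof
  assume "x \<in> nonvan rep P f" then show "f v \<noteq> 0" using x by (auto simp: nonvan_def)
next
  assume fv: "f v \<noteq> 0"
  have "f u \<noteq> 0" if u: "u \<in> rep x" for u
  proof -
    obtain c where c: "\<And>i. i \<in> I \<Longrightarrow> c i \<noteq> 0" "\<And>d f. f \<in> mf d \<Longrightarrow> f u = (\<Prod>i\<in>I. c i ^ d i) * f v"
      using mf_rep'[OF x u] by blast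
    show ?thesis using c(1) c(2)[OF f] fv finI by simp
  qed
  then show "x \<in> nonvan rep P f" using x by (auto simp: nonvan_def)
qed

lemma openin_Pr_iff:
  "openin (zar Pr) U \<longleftrightarrow> (\<forall>x\<in>U. \<exists>d. \<exists>f\<in>mf d. x \<in> nonvan rep P f \<and> nonvan rep P f \<subseteq> U)"
  unfolding cone_space_def kspace.simps
  by (rule openin_cone_zariski_iff) (rule exI, rule multiforms_mult)

lemma topspace_Pr: "topspace (zar Pr) = P"
  unfolding cone_space_def kspace.simps by (rule topspace_cone_zariski[where H = mf, OF multiforms_const[of 1]]) simp

lemma germs_Pr_local:
  assumes h: "h \<in> germs Pr x" and x: "x \<in> P" "v \<in> rep x"
  shows "\<exists>d d' F A B. F \<in> mf d' \<and> A \<in> mf d \<and> B \<in> mf d \<and> F v \<noteq> 0 \<and> B v \<noteq> 0 \<and>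
     (\<forall>y\<in>P. \<forall>u\<in>rep y. F u \<noteq> 0 \<longrightarrow> B u \<noteq> 0 \<and> h y = A u / B u)"
proof -
  obtain U where U: "openin (zar Pr) U" "x \<in> U" "h \<in> cone_regular rep mf P U"
    using h unfolding germs_def by (auto simp: cone_space_def)
  obtain N d A B where N: "openin (cone_zariski rep mf P) N" "x \<in> N" "A \<in> mf d" "B \<in> mf d"
    "\<forall>y\<in>N. \<forall>v\<in>rep y. B v \<noteq> 0 \<and> h y = A v / B v" using U(2,3) unfolding cone_regular_def by blast
  have "openin (zar Pr) N" using N(1) by (simp add: cone_space_def)
  then obtain d' F where F: "F \<in> mf d'" "x \<in> nonvan rep P F" "nonvan rep P F \<subseteq> N" using N(2) unfolding openin_Pr_iff by blast
  have "F v \<noteq> 0" "B v \<noteq> 0" using nonvan_mf[OF F(1) x] F(2) N(2,5) x(2) by blast+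
  moreover have "\<forall>y\<in>P. \<forall>u\<in>rep y. F u \<noteq> 0 \<longrightarrow> B u \<noteq> 0 \<and> h y = A u / B u"
    using nonvan_mf[OF F(1)] F(3) N(5) by blast
  ultimately show ?thesis using F(1) N(3,4) by blast
qed

definition ray :: "('i \<Rightarrow> 'K) \<Rightarrow> 'i \<Rightarrow> 'K \<Rightarrow> 'k \<Rightarrow> 'i \<Rightarrow> 'K" where
  "ray v i u e = v(i := v i + sc e u)"

lemma ray_poly:
  assumes "f \<in> mf d" shows "\<exists>p. \<forall>e. f (ray v i u e) = poly p e"
proof -
  have "f \<in> polyfun {\<lambda>v. l (v i) | i l. i \<in> I \<and> Vector_Spaces.linear sc (*) l}" using assms by (simp add: multiforms_def)
  then show ?thesis
  proof induction
    case (const c) show ?case by (intro exI[of _ "[:c:]"]) simp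
  next
    case (gen f)
    then obtain j l where l: "Vector_Spaces.linear sc (*) l" "f = (\<lambda>v. l (v j))" by blast
    show ?case
      by (intro exI[of _ "if j = i then [:l (v i), l u:] else [:l (v j):]"])
        (simp add: ray_def l(2) linear_functional_simps[OF l(1)])
  next
    case (add f g)
    then obtain p q where "\<forall>e. f (ray v i u e) = poly p e" "\<forall>e. g (ray v i u e) = poly q e" by (elim exE)
    then show ?case by (intro exI[of _ "p + q"]) simp
  next
    case (mult f g)
    then obtain p q where "\<forall>e. f (ray v i u e) = poly p e" "\<forall>e. g (ray v i u e) = poly q e" by (elim exE)
    then show ?case by (intro exI[of _ "p * q"]) simp
  qed
qed

lemma const_germ: assumes x: "x \<in> P" shows "(\<lambda>y. c) \<in> germs Pr x"
proof (rule cone_regular_quotient[where H = mf and d = "\<lambda>_. 0"])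
  show "(\<lambda>v. c) \<in> mf (\<lambda>_. 0)" "(\<lambda>v. 1) \<in> mf (\<lambda>_. 0)" by (rule multiforms_const)+
qed (use x in \<open>auto simp: nonvan_def\<close>)

lemma Pr_germs_alg:
  assumes "f \<in> germs Pr x" "g \<in> germs Pr x"
  shows "(\<lambda>y. f y + g y) \<in> germs Pr x" "(\<lambda>y. f y * g y) \<in> germs Pr x"
proof -
  note r = germs_alg[where H = mf and pl = "\<lambda>d d' i. d i + d' i" and rep = rep and X = P and f = f and g = g and x = x]
  show "(\<lambda>y. f y + g y) \<in> germs Pr x" by (rule r(1)) (erule (1) multiforms_add multiforms_mult | rule assms)+
  show "(\<lambda>y. f y * g y) \<in> germs Pr x" by (rule r(2)) (erule (1) multiforms_add multiforms_mult | rule assms)+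
qed

context
  fixes x v i u
  assumes x: "x \<in> P" "v \<in> rep x" and i: "i \<in> I" and u: "u \<in> V i"
begin

lemma ray_zero: "ray v i u 0 = v" by (simp add: ray_def)

lemma ex_ray_poly: "\<exists>m. coeff m 0 \<noteq> 0 \<and> (\<forall>e. poly m e \<noteq> 0 \<longrightarrow> pt (ray v i u e) \<in> P \<and> restrict (ray v i u e) I \<in> rep (pt (ray v i u e))
     \<and> (\<forall>j\<in>I. ray v i u e j \<noteq> 0 \<and> ray v i u e j \<in> V j))"
proof -
  obtain l where l: "Vector_Spaces.linear sc (*) l" "l (v i) = (1::'k)" using ex_functional_nonzero repD(2)[OF x i] by blast
  note ls = linear_functional_simps[OF l(1)]
  \<comment> \<open>Along the ray the functional l with value 1 at \<open>v i\<close> becomes the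
    polynomial 1 + l(u) e; where that is nonzero the moved factor is still a nonzero vector.\<close>
  have *: "ray v i u e j \<noteq> 0 \<and> ray v i u e j \<in> V j" if e: "poly [:1, l u:] e \<noteq> 0" and j: "j \<in> I" for e j
  proof (cases "j = i")
    case True
    have "l (v i + sc e u) = poly [:1, l u:] e" by (simp add: ls l(2))
    then have "v i + sc e u \<noteq> 0" using e ls(3) by auto
    moreover have "v i + sc e u \<in> V i"
      using subspace_V[OF i] repD(1)[OF x i] u by (intro subspace_add subspace_scale)
    ultimately show ?thesis using True by (simp add: ray_def)
  next
    case False then show ?thesis using repD(1,2)[OF x j] by (simp add: ray_def)
  qed
  then have "pt (ray v i u e) \<in> P \<and> restrict (ray v i u e) I \<in> rep (pt (ray v i u e))" if e: "poly [:1, l u:] e \<noteq> 0" for e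
    using ptI[of "ray v i u e"] e by blast
  then show ?thesis using * by (intro exI[of _ "[:1, l u:]"]) auto
qed

lemma ratd_ex: assumes h: "h \<in> germs Pr x" shows "\<exists>\<delta>. ratd (\<lambda>e. h (pt (ray v i u e))) \<delta>"
proof -
  obtain d d' F A B where F: "F \<in> mf d'" "A \<in> mf d" "B \<in> mf d" "F v \<noteq> 0" "B v \<noteq> 0"
    and loc: "\<forall>y\<in>P. \<forall>u\<in>rep y. F u \<noteq> 0 \<longrightarrow> B u \<noteq> 0 \<and> h y = A u / B u" using germs_Pr_local[OF h x] by (elim exE conjE)
  obtain m where m: "coeff m 0 \<noteq> 0" "\<And>e. poly m e \<noteq> 0 \<Longrightarrow> pt (ray v i u e) \<in> P \<and> restrict (ray v i u e) I \<in> rep (pt (ray v i u e))"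
    using ex_ray_poly by blast
  obtain pF pA pB where p: "\<forall>e. F (ray v i u e) = poly pF e" "\<forall>e. A (ray v i u e) = poly pA e" "\<forall>e. B (ray v i u e) = poly pB e"
    using ray_poly[OF F(1)] ray_poly[OF F(2)] ray_poly[OF F(3)] by blast
  have c0: "coeff pF 0 \<noteq> 0" "coeff pB 0 \<noteq> 0" using F(4,5) p(1,3)[rule_format, of 0] by (simp_all add: ray_zero poly_0_coeff_0)
  \<comment> \<open>\<open>ratd\<close> demands the quotient formula wherever the denominator is
    nonzero. The conditions F nonzero and ray inside the product are therefore multiplied into both
    parts.\<close>
  let ?q = "pB * (pF * m)" and ?p = "pA * (pF * m)"
  have q0: "coeff ?q 0 \<noteq> 0" using c0 m(1) by (simp only: coeff_mult_01 mult_eq_0_iff simp_thms)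
  have "h (pt (ray v i u e)) = poly ?p e / poly ?q e" if "poly ?q e \<noteq> 0" for e
  proof -
    let ?r = "restrict (ray v i u e) I"
    have nz: "poly m e \<noteq> 0" "poly pF e \<noteq> 0" using that by auto
    have "F ?r \<noteq> 0" using nz(2) p(1) mf_restrict[OF F(1)] by simp
    then have "h (pt (ray v i u e)) = A ?r / B ?r" using loc m(2)[OF nz(1)] by blast
    then show ?thesis using mf_restrict[OF F(2)] mf_restrict[OF F(3)] p nz by simp
  qed
  then show ?thesis
    by (intro exI[of _ "(coeff ?p 1 * coeff ?q 0 - coeff ?p 0 * coeff ?q 1) / (coeff ?q 0)\<^sup>2"] ratdI[OF q0]) (use q0 in simp_all)
qed

text \<open>The derivative in the direction of the ray, as an element of the tangent space; the
  value 0 on non-germs is the convention of \<open>tangent_space\<close>.\<close>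

definition Dray :: "(('i \<Rightarrow> 'K set) \<Rightarrow> 'k) \<Rightarrow> 'k" where
  "Dray h = (if h \<in> germs Pr x then (THE \<delta>. ratd (\<lambda>e. h (pt (ray v i u e))) \<delta>) else 0)"

lemma Dray_eqI:
  assumes "h \<in> germs Pr x" "ratd (\<lambda>e. h (pt (ray v i u e))) \<delta>" shows "Dray h = \<delta>"
proof -
  have "(THE \<delta>. ratd (\<lambda>e. h (pt (ray v i u e))) \<delta>) = \<delta>"
    by (rule the_equality[where P = "\<lambda>d. ratd (\<lambda>e. h (pt (ray v i u e))) d" and a = \<delta>, OF assms(2)])
      (rule ratd_unique[OF _ assms(2)])
  then show ?thesis using assms(1) by (simp add: Dray_def)
qed

lemma Dray: assumes "h \<in> germs Pr x" shows "ratd (\<lambda>e. h (pt (ray v i u e))) (Dray h)"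
proof -
  obtain \<delta> where "ratd (\<lambda>e. h (pt (ray v i u e))) \<delta>" using ratd_ex[OF assms] by (elim exE)
  then show ?thesis using Dray_eqI[OF assms] by simp
qed

lemma Dray_tangent: "Dray \<in> tangent_space Pr x"
  unfolding tangent_space_def
proof (intro CollectI conjI ballI allI impI)
  have p0: "pt (ray v i u 0) = x" using pt_rep[OF x] by (simp add: ray_zero)
  fix f g assume f: "f \<in> germs Pr x" and g: "g \<in> germs Pr x"
  have ga: "(\<lambda>y. f y + g y) \<in> germs Pr x" "(\<lambda>y. f y * g y) \<in> germs Pr x"
    by (rule Pr_germs_alg[OF f g])+
  show "Dray (\<lambda>y. f y + g y) = Dray f + Dray g"
    by (rule Dray_eqI[OF ga(1) ratd_add[OF Dray[OF f] Dray[OF g]]])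
  show "Dray (\<lambda>y. f y * g y) = f x * Dray g + g x * Dray f"
    using Dray_eqI[OF ga(2) ratd_mult[OF Dray[OF f] Dray[OF g]]] by (simp only: p0)
  assume "germ_eq Pr x f g"
  then obtain U where U: "openin (zar Pr) U" "x \<in> U" "\<forall>y\<in>U. f y = g y" unfolding germ_eq_def by blast
  obtain d F where F: "F \<in> mf d" "x \<in> nonvan rep P F" "nonvan rep P F \<subseteq> U" using U(1,2) unfolding openin_Pr_iff by blast
  have Fv: "F v \<noteq> 0" using nonvan_mf[OF F(1) x] F(2) by blast
  obtain m where m: "coeff m 0 \<noteq> 0" "\<And>e. poly m e \<noteq> 0 \<Longrightarrow> pt (ray v i u e) \<in> P \<and> restrict (ray v i u e) I \<in> rep (pt (ray v i u e))"
    using ex_ray_poly by blast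
  obtain pF where p: "\<forall>e. F (ray v i u e) = poly pF e" using ray_poly[OF F(1)] by blast
  have c0: "coeff (pF * m) 0 \<noteq> 0" using Fv p[rule_format, of 0] m(1) by (simp add: ray_zero poly_0_coeff_0 coeff_mult_01)
  have "f (pt (ray v i u e)) = g (pt (ray v i u e))" if "poly (pF * m) e \<noteq> 0" for e
  proof -
    have nz: "poly m e \<noteq> 0" "poly pF e \<noteq> 0" using that by auto
    have "F (restrict (ray v i u e) I) \<noteq> 0" using nz(2) p mf_restrict[OF F(1)] by simp
    then have "pt (ray v i u e) \<in> nonvan rep P F" using nonvan_mf[OF F(1)] m(2)[OF nz(1)] by blast
    then show ?thesis using F(3) U(3) by blast
  qed
  from ratd_cong[OF Dray[OF f] c0 this] have "ratd (\<lambda>e. g (pt (ray v i u e))) (Dray f)" .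
  then show "Dray f = Dray g" using Dray_eqI[OF g] by simp
next
  fix f c assume f: "f \<in> germs Pr x"
  have ga: "(\<lambda>y. c + f y) \<in> germs Pr x" "(\<lambda>y. c * f y) \<in> germs Pr x"
    by (rule Pr_germs_alg[OF const_germ[OF x(1)] f])+
  show "Dray (\<lambda>y. c * f y) = c * Dray f"
    using Dray_eqI[OF ga(2) ratd_mult[OF ratd_const[of c] Dray[OF f]]] by simp
next
  fix f assume "f \<notin> germs Pr x" then show "Dray f = 0" by (simp add: Dray_def)
qed

end

end

section \<open>Finite dimension of the tangent spaces of the product\<close>

context field_systems
begin

lemma tangent_spaceD:
  assumes "D \<in> tangent_space S x"
  shows "f \<in> germs S x \<Longrightarrow> g \<in> germs S x \<Longrightarrow> germ_eq S x f g \<Longrightarrow> D f = D g"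
    "f \<in> germs S x \<Longrightarrow> g \<in> germs S x \<Longrightarrow> D (\<lambda>y. f y + g y) = D f + D g"
    "f \<in> germs S x \<Longrightarrow> D (\<lambda>y. c * f y) = c * D f"
    "f \<in> germs S x \<Longrightarrow> g \<in> germs S x \<Longrightarrow> D (\<lambda>y. f y * g y) = f x * D g + g x * D f"
    "h \<notin> germs S x \<Longrightarrow> D h = 0"
  using assms unfolding tangent_space_def by blast+

definition rps :: "('i \<Rightarrow> 'K set) \<Rightarrow> 'i \<Rightarrow> 'K" where "rps y = (SOME v. v \<in> rep y)"

lemma rps: "y \<in> P \<Longrightarrow> rps y \<in> rep y"
  unfolding rps_def by (rule someI_ex[OF rep_ex])

context
  fixes x v m
  assumes x: "x \<in> P" "v \<in> rep x"
    and m: "\<And>j. j \<in> I \<Longrightarrow> Vector_Spaces.linear sc (*) (m j)" "\<And>j. j \<in> I \<Longrightarrow> m j (v j) = (1::'k)"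
begin

text \<open>Affine coordinates on the chart where all \<open>m j\<close> are nonzero; as quotients
  of linear forms they do not depend on the chosen representative.\<close>

definition quot :: "'i \<Rightarrow> ('K \<Rightarrow> 'k) \<Rightarrow> ('i \<Rightarrow> 'K set) \<Rightarrow> 'k" where
  "quot j l y = l (rps y j) / m j (rps y j)"

lemma quot_germ: assumes j: "j \<in> I" and l: "Vector_Spaces.linear sc (*) l" shows "quot j l \<in> germs Pr x"
proof (rule cone_regular_quotient[where H = mf and d = "\<lambda>i. if i = j then 1 else 0"])
  show a: "(\<lambda>v. l (v j)) \<in> mf (\<lambda>i. if i = j then 1 else 0)" by (rule multiforms_linear[OF j finI l])
  show b: "(\<lambda>v. m j (v j)) \<in> mf (\<lambda>i. if i = j then 1 else 0)" by (rule multiforms_linear[OF j finI m(1)[OF j]])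
  show "x \<in> nonvan rep P (\<lambda>v. m j (v j))" using nonvan_mf[OF b x] m(2)[OF j] by simp
  fix y u assume y: "y \<in> nonvan rep P (\<lambda>v. m j (v j))" "u \<in> rep y"
  then have yP: "y \<in> P" by (simp add: nonvan_def)
  obtain c where c: "\<And>i. i \<in> I \<Longrightarrow> c i \<noteq> 0" "\<And>d f. f \<in> mf d \<Longrightarrow> f (rps y) = (\<Prod>i\<in>I. c i ^ d i) * f u"
    using mf_rep'[OF yP y(2) rps[OF yP]] by blast
  have "(\<Prod>i\<in>I. c i ^ (if i = j then 1 else 0)) \<noteq> 0" using c(1) finI by auto
  then show "quot j l y = l (u j) / m j (u j)"
    unfolding quot_def using c(2)[OF a] c(2)[OF b] by simp
qed

text \<open>The representative on which every \<open>m j\<close> is 1. A form evaluated at it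
  becomes a polynomial in affine coordinates.\<close>

definition nrm :: "('i \<Rightarrow> 'K set) \<Rightarrow> 'i \<Rightarrow> 'K" where
  "nrm y = (\<lambda>j. sc (inverse (m j (rps y j))) (rps y j))"

lemma Pr_germs_const: "(\<lambda>y. c) \<in> germs Pr x"
  by (rule const_germ[OF x(1)])

lemma germs_sum:
  assumes "\<And>b. b \<in> S \<Longrightarrow> f b \<in> germs Pr x" shows "(\<lambda>y. \<Sum>b\<in>S. c b * f b y) \<in> germs Pr x"
  using assms
proof (induction S rule: infinite_finite_induct)
  case (insert b S)
  have "(\<lambda>y. c b * f b y) \<in> germs Pr x" by (rule Pr_germs_alg(2)[OF Pr_germs_const]) (use insert in simp)
  moreover have "(\<lambda>y. \<Sum>b\<in>S. c b * f b y) \<in> germs Pr x" using insert by simp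
  ultimately show ?case using insert(1,2) Pr_germs_alg(1) by simp
qed (use Pr_germs_const in simp_all)

lemma derivation_sum:
  assumes D: "D \<in> tangent_space Pr x" and "\<And>b. b \<in> S \<Longrightarrow> f b \<in> germs Pr x" "\<And>b. b \<in> S \<Longrightarrow> D (f b) = 0" "finite S"
  shows "D (\<lambda>y. \<Sum>b\<in>S. c b * f b y) = 0"
  using assms(4,2,3)
proof (induction S rule: finite_induct)
  case empty
  have "D (\<lambda>y. 0 * (0::'k)) = 0 * D (\<lambda>y. 0)" by (rule tangent_spaceD(3)[OF D Pr_germs_const])
  then show ?case by simp
next
  case (insert b S)
  have fb: "f b \<in> germs Pr x" using insert by simp
  have 1: "(\<lambda>y. c b * f b y) \<in> germs Pr x" by (rule Pr_germs_alg(2)[OF Pr_germs_const fb])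
  have 2: "(\<lambda>y. \<Sum>b\<in>S. c b * f b y) \<in> germs Pr x" by (rule germs_sum) (use insert in simp)
  have "D (\<lambda>y. c b * f b y + (\<Sum>b\<in>S. c b * f b y)) = D (\<lambda>y. c b * f b y) + D (\<lambda>y. \<Sum>b\<in>S. c b * f b y)"
    by (rule tangent_spaceD(2)[OF D 1 2])
  also have "\<dots> = 0" using insert tangent_spaceD(3)[OF D fb, of "c b"] by simp
  finally show ?case using insert(1,2) by simp
qed

lemma germ_eqI:
  assumes "\<And>y. y \<in> P \<Longrightarrow> y \<in> nonvan rep P F \<Longrightarrow> f y = g y" "F \<in> mf d" "F v \<noteq> 0"
  shows "germ_eq Pr x f g"
proof -
  have "openin (zar Pr) (nonvan rep P F)"
    unfolding cone_space_def kspace.simps by (rule openin_nonvan[where H = mf and d = d, OF assms(2)])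
  moreover have "x \<in> nonvan rep P F" using nonvan_mf[OF assms(2) x] assms(3) by simp
  moreover have "\<forall>y\<in>nonvan rep P F. f y = g y" using assms(1) by (simp add: nonvan_def)
  ultimately show ?thesis unfolding germ_eq_def by blast
qed

text \<open>A derivation that kills the affine coordinates kills all polynomials in them, and then
  their quotients.\<close>

lemma tangent_zero:
  assumes D: "D \<in> tangent_space Pr x" and z: "\<And>j b. j \<in> I \<Longrightarrow> b \<in> Bs j \<Longrightarrow> D (quot j (dual j b)) = 0"
  shows "D = 0"
proof
  fix h
  show "D h = 0 h"
  proof (cases "h \<in> germs Pr x")
    case False then show ?thesis using tangent_spaceD(5)[OF D] by simp
  next
    case True
    have Dc: "D (\<lambda>y. c) = 0" for c
    proof -
      have "D (\<lambda>y. 1 * 1) = 1 * D (\<lambda>y. 1) + 1 * D (\<lambda>y. 1)" by (rule tangent_spaceD(4)[OF D Pr_germs_const Pr_germs_const])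
      then have "D (\<lambda>y. 1) = D (\<lambda>y. 1) + D (\<lambda>y. 1)" by (simp only: mult_1_left)
      then have "D (\<lambda>y. 1) = 0" by (simp only: add_cancel_right_right)
      moreover have "D (\<lambda>y. c * 1) = c * D (\<lambda>y. 1)" by (rule tangent_spaceD(3)[OF D Pr_germs_const])
      ultimately show ?thesis by simp
    qed
    have nz: "(\<lambda>y. f (nrm y)) \<in> germs Pr x \<and> D (\<lambda>y. f (nrm y)) = 0"
      if "f \<in> polyfun {\<lambda>v. l (v i) | i l. i \<in> I \<and> Vector_Spaces.linear sc (*) l}" for f
      using that
    proof induction
      case (const c) show ?case using Pr_germs_const Dc by simp
    next
      case (gen f)
      then obtain j l where l: "j \<in> I" "Vector_Spaces.linear sc (*) l" "f = (\<lambda>v. l (v j))" by blast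
      have e: "(\<lambda>y. f (nrm y)) = quot j l"
        by (rule ext) (simp add: l(3) nrm_def quot_def linear_functional_simps[OF l(2)] divide_inverse mult.commute)
      have dl: "Vector_Spaces.linear sc (*) (dual j b)" for b using dual(1)[OF l(1)] by blast
      let ?s = "\<lambda>y. \<Sum>b\<in>Bs j. l b * quot j (dual j b) y"
      have g: "?s \<in> germs Pr x" by (intro germs_sum quot_germ l(1) dl)
      have "germ_eq Pr x (quot j l) ?s"
      proof (rule germ_eqI[OF _ multiforms_const[of 1]])
        fix y assume y: "y \<in> P"
        have "rps y j \<in> V j" by (rule repD(1)[OF y rps[OF y] l(1)])
        then have "l (rps y j) = (\<Sum>b\<in>Bs j. dual j b (rps y j) * l b)"
          by (subst V_expand[OF l(1)]) (simp_all add: linear_functional_simps[OF l(2)])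
        then show "quot j l y = ?s y" by (simp add: quot_def sum_divide_distrib mult.commute)
      qed simp
      then have "D (quot j l) = D ?s" by (rule tangent_spaceD(1)[OF D quot_germ[OF l(1,2)] g])
      also have "\<dots> = 0" by (rule derivation_sum[OF D]) (use quot_germ[OF l(1) dl] z[OF l(1)] Bs(1)[OF l(1)] in auto)
      finally show ?case unfolding e using quot_germ[OF l(1,2)] by simp
    next
      case (add f g)
      then show ?case using Pr_germs_alg(1) tangent_spaceD(2)[OF D] by simp
    next
      case (mult f g)
      then show ?case using Pr_germs_alg(2) tangent_spaceD(4)[OF D] by simp
    qed
    obtain d d' F A B where F: "F \<in> mf d'" "A \<in> mf d" "B \<in> mf d" "F v \<noteq> 0" "B v \<noteq> 0"
      and loc: "\<forall>y\<in>P. \<forall>u\<in>rep y. F u \<noteq> 0 \<longrightarrow> B u \<noteq> 0 \<and> h y = A u / B u" using germs_Pr_local[OF True x] by (elim exE conjE)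
    have A: "(\<lambda>y. A (nrm y)) \<in> germs Pr x" "D (\<lambda>y. A (nrm y)) = 0"
      and B: "(\<lambda>y. B (nrm y)) \<in> germs Pr x" "D (\<lambda>y. B (nrm y)) = 0"
      using nz[of A] nz[of B] F(2,3) by (auto simp: multiforms_def)
    have hom: "f (nrm y) = (\<Prod>i\<in>I. inverse (m i (rps y i)) ^ d i) * f (rps y)" if "f \<in> mf d" for f d y
      unfolding nrm_def by (rule multiforms_hom[OF that])
    \<comment> \<open>Locally h = A / B also on normalized representatives, since A and B have the
      same multidegree. Leibniz applied to A = h B isolates D h, multiplied by the nonzero value of
      B.\<close>
    have "germ_eq Pr x (\<lambda>y. A (nrm y)) (\<lambda>y. h y * B (nrm y))"
    proof (rule germ_eqI[OF _ F(1,4)])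
      fix y assume y: "y \<in> P" "y \<in> nonvan rep P F"
      have "F (rps y) \<noteq> 0" using nonvan_mf[OF F(1) y(1) rps[OF y(1)]] y(2) by blast
      then have "B (rps y) \<noteq> 0 \<and> h y = A (rps y) / B (rps y)" using loc y(1) rps[OF y(1)] by blast
      then show "A (nrm y) = h y * B (nrm y)" unfolding hom[OF F(2)] hom[OF F(3)] by simp
    qed
    then have "D (\<lambda>y. A (nrm y)) = D (\<lambda>y. h y * B (nrm y))"
      by (rule tangent_spaceD(1)[OF D A(1) Pr_germs_alg(2)[OF True B(1)]])
    also have "\<dots> = h x * D (\<lambda>y. B (nrm y)) + B (nrm x) * D h" by (rule tangent_spaceD(4)[OF D True B(1)])
    finally have "B (nrm x) * D h = 0" using A(2) B(2) by simp
    moreover have "B (nrm x) \<noteq> 0"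
    proof -
      obtain c where c: "\<And>i. i \<in> I \<Longrightarrow> c i \<noteq> 0" "\<And>d f. f \<in> mf d \<Longrightarrow> f (rps x) = (\<Prod>i\<in>I. c i ^ d i) * f v"
        using mf_rep'[OF x rps[OF x(1)]] by blast
      have "B (rps x) \<noteq> 0" using c(2)[OF F(3)] c(1) F(5) finI by simp
      moreover have "m i (rps x i) \<noteq> 0" if i: "i \<in> I" for i
      proof -
        have "(\<Prod>j\<in>I. c j ^ (if j = i then 1 else 0)) \<noteq> 0" using c(1) finI by auto
        then show ?thesis using c(2)[OF multiforms_linear[OF i finI m(1)[OF i]]] m(2)[OF i] by simp
      qed
      ultimately show ?thesis unfolding hom[OF F(3)] using finI by simp
    qed
    ultimately show ?thesis by simp
  qed
qed

lemma tangent_fd': "\<exists>C. finite C \<and> tangent_space Pr x \<subseteq> fsp.span C"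
proof (rule finite_span_determined)
  show "finite (\<Union>j\<in>I. (\<lambda>b. quot j (dual j b)) ` Bs j)" using finI Bs(1) by auto
  show "fsp.subspace (tangent_space Pr x)" by (rule subspace_tangent_space)
  show "D = 0" if "D \<in> tangent_space Pr x" "\<And>j. j \<in> (\<Union>j\<in>I. (\<lambda>b. quot j (dual j b)) ` Bs j) \<Longrightarrow> D j = 0" for D
    by (rule tangent_zero[OF that(1)]) (use that(2) in blast)
qed

end

text \<open>\<open>dim\<close> is the \<open>card\<close> of a basis and would be 0 for an infinite
  one; only with this bound does it measure the rank of the differential.\<close>

lemma tangent_fd:
  assumes x: "x \<in> P" "v \<in> rep x" shows "\<exists>C. finite C \<and> tangent_space Pr x \<subseteq> fsp.span C"
proof -
  have "\<forall>j. \<exists>l. j \<in> I \<longrightarrow> Vector_Spaces.linear sc (*) l \<and> l (v j) = (1::'k)"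
    using ex_functional_nonzero repD(2)[OF x] by blast
  from choice[OF this] obtain m where m: "\<forall>j. j \<in> I \<longrightarrow> Vector_Spaces.linear sc (*) (m j) \<and> m j (v j) = (1::'k)" ..
  show ?thesis by (rule tangent_fd'[OF x, of m]) (use m in auto)
qed

section \<open>The rank of the differential of the product map\<close>

abbreviation TK :: "('K set, 'k) kspace" where "TK \<equiv> ind_proj sc UNIV"

text \<open>The rational function l / l0 on the projective space of \<open>'K\<close>; these
  functions detect tangent vectors of the ind-scheme.\<close>

definition lq :: "('K \<Rightarrow> 'k) \<Rightarrow> ('K \<Rightarrow> 'k) \<Rightarrow> 'K set \<Rightarrow> 'k" where
  "lq l l0 L = (let z = (SOME z. z \<in> L \<and> z \<noteq> 0) in l z / l0 z)"

lemma lq_line: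
  assumes l: "Vector_Spaces.linear sc (*) l" "Vector_Spaces.linear sc (*) l0" and L: "L \<in> lines sc W" "z \<in> L" "z \<noteq> 0"
  shows "lq l l0 L = l z / l0 z"
proof -
  let ?z = "SOME z. z \<in> L \<and> z \<noteq> 0"
  have "?z \<in> L \<and> ?z \<noteq> 0" by (rule someI_ex) (use L in blast)
  then obtain c where "c \<noteq> 0" "?z = sc c z" using lines_memD[OF L] by blast
  then show ?thesis unfolding lq_def Let_def by (simp add: linear_functional_simps[OF l(1)] linear_functional_simps[OF l(2)])
qed

lemma lines_mono: "W \<subseteq> W' \<Longrightarrow> lines sc W \<subseteq> lines sc W'"
  unfolding lines_def by blast

lemma lq_germ:
  assumes l: "Vector_Spaces.linear sc (*) l" "Vector_Spaces.linear sc (*) l0" and z: "l0 z \<noteq> 0"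
  shows "lq l l0 \<in> germs TK (span {z})"
proof -
  define N where "N = nonvan (\<lambda>L. L - {0}) (lines sc UNIV) l0"
  have f: "l \<in> forms sc 1" "l0 \<in> forms sc 1" using forms_linear l by blast+
  \<comment> \<open>The functionals live on all of \<open>'K\<close>, so one open set and one
    quotient restrict to every finite-dimensional subspace, as the inductive limit requires.\<close>
  have NW: "N \<inter> lines sc W = nonvan (\<lambda>L. L - {0}) (lines sc W) l0" for W
    using lines_mono[of W UNIV] by (auto simp: N_def nonvan_def)
  have op: "openin (cone_zariski (\<lambda>L. L - {0}) (forms sc) (lines sc W)) (N \<inter> lines sc W)" for W
    unfolding NW by (rule openin_nonvan[where H = "forms sc" and d = 1, OF f(2)])
  have "openin (zar TK) N"
    unfolding openin_ind_proj using op by (auto simp: N_def nonvan_def proj_sub_def cone_space_def)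
  moreover have "span {z} \<in> N"
  proof -
    have z0: "z \<noteq> 0" using z linear_functional_simps(3)[OF l(2)] by auto
    have L: "span {z} \<in> lines sc UNIV" unfolding lines_def using z0 by blast
    show ?thesis unfolding N_def using nonvan_forms_iff[OF f(2) L _ z0 L] z by (simp add: span_base)
  qed
  moreover have "lq l l0 \<in> reg TK N"
  proof -
    have "lq l l0 \<in> cone_regular (\<lambda>L. L - {0}) (forms sc) (lines sc W) (N \<inter> lines sc W)" for W
      unfolding cone_regular_def
    proof (intro CollectI ballI exI conjI)
      fix L y v assume y: "y \<in> N \<inter> lines sc W" "v \<in> y - {0}"
      show "l0 v \<noteq> 0" using y by (auto simp: N_def nonvan_def)
      show "lq l l0 y = l v / l0 v" by (rule lq_line[OF l, of y W]) (use y in auto)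
    qed (use op f in auto)
    then show ?thesis by (simp add: ind_proj_def proj_sub_def cone_space_def)
  qed
  ultimately show ?thesis unfolding germs_def by blast
qed

lemma product_map_pt:
  assumes "y \<in> P" "u \<in> rep y" shows "product_map sc I y = span {pr u}"
proof -
  have "\<exists>c. (\<Prod>i\<in>I. w i) = sc c (pr u)" if w: "w \<in> (\<Pi>\<^sub>E i\<in>I. y i)" for w
  proof -
    have "\<forall>i. \<exists>c. i \<in> I \<longrightarrow> w i = \<kappa> c * u i"
    proof (intro allI)
      fix i show "\<exists>c. i \<in> I \<longrightarrow> w i = \<kappa> c * u i"
      proof (cases "i \<in> I")
        case True
        then have "w i \<in> span {u i}" using w repD(4)[OF assms True] by auto
        then show ?thesis by (auto simp: span_singleton sc_\<kappa>)
      qed simp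
    qed
    from choice[OF this] obtain c where "\<forall>i. i \<in> I \<longrightarrow> w i = \<kappa> (c i) * u i" ..
    then have "(\<Prod>i\<in>I. w i) = \<kappa> (\<Prod>i\<in>I. c i) * pr u" by (simp add: pr_def \<kappa>_prod prod.distrib)
    then show ?thesis using sc_\<kappa> by metis
  qed
  note ex = this
  have "{\<Prod>i\<in>I. v i | v. v \<in> (\<Pi>\<^sub>E i\<in>I. y i)} \<subseteq> span {pr u}"
  proof (rule subsetI)
    fix z assume "z \<in> {\<Prod>i\<in>I. v i | v. v \<in> (\<Pi>\<^sub>E i\<in>I. y i)}"
    then obtain w c where "z = (\<Prod>i\<in>I. w i)" "(\<Prod>i\<in>I. w i) = sc c (pr u)"
      using ex by blast
    then show "z \<in> span {pr u}" by (simp add: span_scale span_base)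
  qed
  then have "product_map sc I y \<subseteq> span {pr u}" unfolding product_map_def
    by (intro span_minimal) simp_all
  moreover have "u \<in> (\<Pi>\<^sub>E i\<in>I. y i)" using assms(2) unfolding rep_def by (auto simp: PiE_def Pi_def)
  then have "pr u \<in> {\<Prod>i\<in>I. v i | v. v \<in> (\<Pi>\<^sub>E i\<in>I. y i)}" unfolding pr_def by blast
  then have "span {pr u} \<subseteq> product_map sc I y" unfolding product_map_def
    by (intro span_minimal) (auto intro: span_base)
  ultimately show ?thesis by blast
qed

lemma pr_nz: "y \<in> P \<Longrightarrow> u \<in> rep y \<Longrightarrow> pr u \<noteq> 0"
  using repD(2) finI by (simp add: pr_def)

lemma lq_product:
  assumes l: "Vector_Spaces.linear sc (*) l" "Vector_Spaces.linear sc (*) l0" and y: "y \<in> P" "u \<in> rep y"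
  shows "(lq l l0 \<circ> product_map sc I) y = l (pr u) / l0 (pr u)"
proof -
  have "span {pr u} \<in> lines sc UNIV" unfolding lines_def using pr_nz[OF y] by blast
  from lq_line[OF l this span_base pr_nz[OF y]] show ?thesis by (simp add: product_map_pt[OF y])
qed

lemma lq_product_germ:
  assumes l: "Vector_Spaces.linear sc (*) l" "Vector_Spaces.linear sc (*) l0" and x: "x \<in> P" "v \<in> rep x" and nz: "l0 (pr v) \<noteq> 0"
  shows "lq l l0 \<circ> product_map sc I \<in> germs Pr x"
proof -
  let ?d = "\<lambda>j. if j \<in> I then 1 else 0"
  have mp: "mprod I 1 u = pr u" if "y \<in> P" "u \<in> rep y" for y u
    using mprod_eq[of I u 1] repD(1)[OF that] by (simp add: pr_def)
  have f: "(\<lambda>v. l (mprod I 1 v)) \<in> mf ?d" "(\<lambda>v. l0 (mprod I 1 v)) \<in> mf ?d"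
    using vform_mprod[of I 1] l unfolding vform_def by auto
  show ?thesis
  proof (rule cone_regular_quotient[where H = mf and d = ?d, OF f])
    show "x \<in> nonvan rep P (\<lambda>v. l0 (mprod I 1 v))" using nonvan_mf[OF f(2) x] mp[OF x] nz by simp
    fix y u assume y: "y \<in> nonvan rep P (\<lambda>v. l0 (mprod I 1 v))" "u \<in> rep y"
    then have yP: "y \<in> P" by (simp add: nonvan_def)
    show "(lq l l0 \<circ> product_map sc I) y = l (mprod I 1 u) / l0 (mprod I 1 u)"
      unfolding mp[OF yP y(2)] by (rule lq_product[OF l yP y(2)])
  qed
qed

text \<open>The functionals dual to the r + 1 derivatives, divided by the one dual to
  \<open>pr v\<close>, are functions near the image point. Their derivatives along the corresponding
  rays form the identity matrix, so the rank would be at least r + 1.\<close>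

lemma rank_bound:
  assumes x: "x \<in> P" "v \<in> rep x"
    and r: "fsp.dim (tangent_map TK (product_map sc I) x ` tangent_space Pr x) = r"
  shows "\<not> rank_ge (Suc r) v"
proof
  assume "rank_ge (Suc r) v"
  then obtain i u where iu: "\<forall>l<Suc r. i l \<in> I \<and> u l \<in> V (i l)"
    and ind: "ind sc (Suc (Suc r)) (\<lambda>b. if b < Suc r then qv (i b) (u b) v else pr v)" unfolding rank_ge_def by blast
  let ?t = "Suc r"
  obtain l where l': "\<forall>b<Suc ?t. Vector_Spaces.linear sc (*) (l b) \<and>
     (\<forall>b'<Suc ?t. l b (if b' < ?t then qv (i b') (u b') v else pr v) = (if b' = b then 1 else (0::'k)))"
    using ind_dual[OF ind] ..
  have lin: "Vector_Spaces.linear sc (*) (l b)" if "b \<le> ?t" for b using l' that by auto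
  have lp: "l b (pr v) = (if b = ?t then 1 else 0)" if "b \<le> ?t" for b
    using l'[rule_format, of b] that by (auto dest: spec[of _ ?t])
  have lv: "l b (qv (i b') (u b') v) = (if b' = b then 1 else 0)" if "b \<le> ?t" "b' < ?t" for b b'
  proof -
    have "b < Suc ?t" "b' < Suc ?t" using that by auto
    then show ?thesis using l' that(2) by (metis (mono_tags, lifting))
  qed
  note lint = lin[of ?t, simplified]
  define g where "g b = lq (l b) (l ?t)" for b
  have l0: "l ?t (pr v) \<noteq> 0" using lp[of ?t] by simp
  have gg: "g b \<in> germs TK (product_map sc I x)" if "b < ?t" for b
    unfolding g_def product_map_pt[OF x] by (rule lq_germ) (use that lin lint l0 in auto)
  have gP: "g b \<circ> product_map sc I \<in> germs Pr x" if "b < ?t" for b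
    unfolding g_def by (rule lq_product_germ) (use that lin lint l0 x in auto)
  define D where "D b = Dray x v (i b) (u b)" for b
  have DT: "D b \<in> tangent_space Pr x" if "b < ?t" for b
    unfolding D_def by (rule Dray_tangent[OF x]) (use iu that in auto)
  have Dg: "D b' (g b \<circ> product_map sc I) = (if b' = b then 1 else 0)" if b: "b < ?t" "b' < ?t" for b b'
    unfolding D_def
  proof (rule Dray_eqI[OF x _ _ gP[OF b(1)]])
    show ib: "i b' \<in> I" and ub: "u b' \<in> V (i b')" using iu b(2) by auto
    let ?ray = "ray v (i b') (u b')" and ?q = "qv (i b') (u b') v"
    obtain m where m: "coeff m 0 \<noteq> 0" "\<And>e. poly m e \<noteq> 0 \<Longrightarrow> pt (?ray e) \<in> P \<and> restrict (?ray e) I \<in> rep (pt (?ray e))"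
      using ex_ray_poly[OF x ib ub] by blast
    \<comment> \<open>Only one factor moves, so the product is affine in the parameter of the
      ray.\<close>
    have prr: "pr (restrict (?ray e) I) = pr v + sc e ?q" for e
    proof -
      have "pr (restrict (?ray e) I) = (\<Prod>j\<in>I. ?ray e j)" unfolding pr_def by (rule prod.cong) auto
      also have "\<dots> = ?ray e (i b') * (\<Prod>j\<in>I - {i b'}. ?ray e j)" by (rule prod.remove[OF finI ib])
      also have "(\<Prod>j\<in>I - {i b'}. ?ray e j) = (\<Prod>j\<in>I - {i b'}. v j)" by (rule prod.cong) (auto simp: ray_def)
      also have "?ray e (i b') * \<dots> = v (i b') * (\<Prod>j\<in>I - {i b'}. v j) + sc e ?q"
        by (simp add: ray_def distrib_right qv_def sc_\<kappa> mult.assoc)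
      also have "v (i b') * (\<Prod>j\<in>I - {i b'}. v j) = pr v" unfolding pr_def by (rule prod.remove[OF finI ib, symmetric])
      finally show ?thesis .
    qed
    have le: "b \<le> ?t" using b by simp
    show "ratd (\<lambda>e. (g b \<circ> product_map sc I) (pt (?ray e))) (if b' = b then 1 else 0)"
    proof (rule ratdI[of m _ "[:0, if b' = b then 1 else 0:] * m"])
      show "coeff m 0 \<noteq> 0" by (rule m(1))
      fix e assume e: "poly m e \<noteq> 0"
      have "(g b \<circ> product_map sc I) (pt (?ray e)) = l b (pr v + sc e ?q) / l ?t (pr v + sc e ?q)"
        unfolding g_def prr[symmetric] by (rule lq_product[OF lin[OF le] lint]) (use m(2)[OF e] in auto)
      also have "l b (pr v + sc e ?q) = e * (if b' = b then 1 else 0)"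
        using b by (simp add: linear_functional_simps[OF lin[OF le]] lp[OF le] lv[OF le b(2)])
      \<comment> \<open>By duality the denominator is constant along the ray, and the quotient is
        exactly the parameter e or 0.\<close>
      also have "l ?t (pr v + sc e ?q) = 1"
        using b by (simp add: linear_functional_simps[OF lint] lp lv)
      finally show "(g b \<circ> product_map sc I) (pt (?ray e)) = poly ([:0, if b' = b then 1 else 0:] * m) e / poly m e"
        using e by simp
    next
      show "(if b' = b then 1 else 0) * (coeff m 0)\<^sup>2 = coeff ([:0, if b' = b then 1 else 0:] * m) 1 * coeff m 0
         - coeff ([:0, if b' = b then 1 else 0:] * m) 0 * coeff m 1"
        unfolding coeff_mult_01 by (simp add: power2_eq_square)
    qed
  qed
  let ?tm = "tangent_map TK (product_map sc I) x"
  define \<tau> where "\<tau> b = ?tm (D b)" for b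
  have tg: "\<tau> b' (g b) = (if b' = b then 1 else 0)" if "b < ?t" "b' < ?t" for b b'
    using Dg[OF that] gg[OF that(1)] by (simp add: \<tau>_def tangent_map_def)
  have inj: "inj_on \<tau> {..<?t}"
  proof (rule inj_onI, rule ccontr)
    fix a b assume ab: "a \<in> {..<?t}" "b \<in> {..<?t}" "\<tau> a = \<tau> b" "a \<noteq> b"
    have "\<tau> a (g a) = 1" "\<tau> b (g a) = 0" using tg[of a a] tg[of a b] ab by auto
    then show False using ab(3) by simp
  qed
  have indt: "fsp.independent (\<tau> ` {..<?t})"
  proof
    assume "fsp.dependent (\<tau> ` {..<?t})"
    then obtain c where c: "\<exists>y\<in>\<tau> ` {..<?t}. c y \<noteq> 0" "(\<Sum>y\<in>\<tau> ` {..<?t}. fscale (c y) y) = 0"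
      using fsp.dependent_finite[of "\<tau> ` {..<?t}"] by auto
    have s: "(\<Sum>b<?t. fscale (c (\<tau> b)) (\<tau> b)) = 0" using c(2) by (simp only: sum.reindex[OF inj] comp_def)
    have "c (\<tau> a) = 0" if a: "a < ?t" for a
    proof -
      have "(\<Sum>b<?t. fscale (c (\<tau> b)) (\<tau> b)) (g a) = (\<Sum>b<?t. if b = a then c (\<tau> b) else 0)"
        unfolding fun_sum_apply fscale_def by (rule sum.cong[OF refl]) (use tg[OF a] in auto)
      also have "\<dots> = c (\<tau> a)" using a by simp
      finally show ?thesis unfolding s by simp
    qed
    then show False using c(1) by auto
  qed
  \<comment> \<open>Without finiteness an infinite basis of the image could have \<open>card\<close>
    equal to r.\<close>
  obtain C where C: "finite C" "tangent_space Pr x \<subseteq> fsp.span C" using tangent_fd[OF x] by (elim exE conjE)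
  let ?W = "?tm ` tangent_space Pr x"
  have Wsub: "?W \<subseteq> fsp.span (?tm ` C)" by (rule tangent_map_span[OF C(2)])
  obtain B where B: "B \<subseteq> ?W" "fsp.independent B" "?W \<subseteq> fsp.span B" "card B = fsp.dim ?W"
    using fsp.basis_exists[of ?W] by blast
  have "finite B" using fsp.independent_span_bound[OF finite_imageI[OF C(1)] B(2)] B(1) Wsub by blast
  moreover have "\<tau> ` {..<?t} \<subseteq> fsp.span B"
  proof -
    have "\<tau> ` {..<?t} \<subseteq> ?W" unfolding \<tau>_def using DT by auto
    then show ?thesis using B(3) by blast
  qed
  ultimately have "card (\<tau> ` {..<?t}) \<le> card B" using fsp.independent_span_bound[OF _ indt] by blast
  then show False using B(4) r by (simp add: card_image[OF inj])
qed

end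

section \<open>The dimension bound for chains in the strata\<close>

context field_systems
begin

text \<open>In each factor the missing degree is supplied by powers of a linear form that is nonzero
  at \<open>v j\<close>; the zeros of f are kept.\<close>

lemma uniform_form:
  assumes f: "f \<in> mf d" and v: "\<And>j. j \<in> I \<Longrightarrow> v j \<noteq> 0" "f v \<noteq> 0" and e: "\<And>i. i \<in> I \<Longrightarrow> d i \<le> e"
  shows "\<exists>g\<in>mf (\<lambda>_. e). g v \<noteq> 0 \<and> (\<forall>u. f u = 0 \<longrightarrow> g u = 0)"
proof -
  have "\<forall>j. \<exists>l. j \<in> I \<longrightarrow> Vector_Spaces.linear sc (*) l \<and> l (v j) = (1::'k)"
    using ex_functional_nonzero v(1) by blast
  from choice[OF this] obtain m where m: "\<forall>j. j \<in> I \<longrightarrow> Vector_Spaces.linear sc (*) (m j) \<and> m j (v j) = (1::'k)" ..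
  define g where "g u = f u * (\<Prod>j\<in>I. m j (u j) ^ (e - d j))" for u
  have "(\<lambda>u. \<Prod>j\<in>I. m j (u j) ^ (e - d j)) \<in> mf (\<lambda>i. \<Sum>j\<in>I. (e - d j) * (if i = j then 1 else 0))"
    by (intro multiforms_prod multiforms_power multiforms_linear finI) (use m in auto)
  from multiforms_mult[OF f this] have "g \<in> mf (\<lambda>i. d i + (\<Sum>j\<in>I. (e - d j) * (if i = j then 1 else 0)))"
    unfolding g_def .
  also have "mf (\<lambda>i. d i + (\<Sum>j\<in>I. (e - d j) * (if i = j then 1 else 0))) = mf (\<lambda>_. e)"
  proof (rule multiforms_cong)
    fix i assume i: "i \<in> I"
    have "(\<Sum>j\<in>I. (e - d j) * (if i = j then 1 else 0)) = (\<Sum>j\<in>I. if i = j then e - d j else 0)"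
      by (rule sum.cong) auto
    also have "\<dots> = e - d i" using i finI by simp
    finally show "d i + (\<Sum>j\<in>I. (e - d j) * (if i = j then 1 else 0)) = e" using e[OF i] by simp
  qed
  finally have "g \<in> mf (\<lambda>_. e)" .
  moreover have "g v \<noteq> 0" using v(2) m by (simp add: g_def)
  ultimately show ?thesis by (intro bexI[of _ g]) (auto simp: g_def)
qed

lemma rps_props:
  assumes "y \<in> P" "i \<in> I" shows "rps y i \<in> V i" "rps y i \<noteq> 0"
  using repD(1,2)[OF assms(1) rps[OF assms(1)] assms(2)] by auto

lemma closed_sub_nonvan:
  assumes "f \<in> mf d" "Y \<subseteq> P" shows "closedin (subtopology (zar Pr) Y) {y\<in>Y. f (rps y) = 0}"
proof -
  have "openin (zar Pr) (nonvan rep P f)"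
    unfolding cone_space_def kspace.simps by (rule openin_nonvan[where H = mf and d = d, OF assms(1)])
  then have "closedin (zar Pr) (P - nonvan rep P f)" using topspace_Pr by (metis openin_closedin_eq Diff_Diff_Int openin_subset inf.absorb2 closedin_def Diff_subset)
  moreover have "{y\<in>Y. f (rps y) = 0} = (P - nonvan rep P f) \<inter> Y"
    using nonvan_mf[OF assms(1) _ rps] assms(2) by blast
  ultimately show ?thesis unfolding closedin_subtopology by blast
qed

text \<open>Zero sets of forms are closed in the stratum, so an irreducible Z on which fg vanishes
  lies in one of them.\<close>

lemma irreducible_mf:
  assumes Z: "irreducible_closed (subtopology (zar Pr) Y) Z" and Y: "Y \<subseteq> P"
    and f: "f \<in> mf d" "\<exists>y\<in>Z. f (rps y) \<noteq> 0" and g: "g \<in> mf d'" "\<exists>y\<in>Z. g (rps y) \<noteq> 0"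
  shows "\<exists>y\<in>Z. f (rps y) \<noteq> 0 \<and> g (rps y) \<noteq> 0"
proof (rule ccontr)
  assume n: "\<not> ?thesis"
  have ZY: "Z \<subseteq> Y" using Z closedin_subset unfolding irreducible_closed_def by fastforce
  then have "Z \<subseteq> {y\<in>Y. f (rps y) = 0} \<union> {y\<in>Y. g (rps y) = 0}" using n by blast
  then have "Z \<subseteq> {y\<in>Y. f (rps y) = 0} \<or> Z \<subseteq> {y\<in>Y. g (rps y) = 0}"
    using Z closed_sub_nonvan[OF f(1) Y] closed_sub_nonvan[OF g(1) Y] unfolding irreducible_closed_def by meson
  then show False using f(2) g(2) by blast
qed

lemma separating_mf:
  assumes Z: "closedin (subtopology (zar Pr) Y) Z" and Y: "Y \<subseteq> P" and x: "x \<in> Y" "x \<notin> Z"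
  shows "\<exists>d. \<exists>f\<in>mf d. f (rps x) \<noteq> 0 \<and> (\<forall>y\<in>Z. f (rps y) = 0)"
proof -
  obtain C where C: "closedin (zar Pr) C" "Z = C \<inter> Y" using Z unfolding closedin_subtopology by blast
  then have "openin (zar Pr) (P - C)" using topspace_Pr by (metis openin_diff openin_topspace)
  moreover have xP: "x \<in> P" "x \<in> P - C" using x Y C(2) by auto
  ultimately obtain d f where f: "f \<in> mf d" "x \<in> nonvan rep P f" "nonvan rep P f \<subseteq> P - C"
    unfolding openin_Pr_iff by blast
  have "f (rps x) \<noteq> 0" using nonvan_mf[OF f(1) xP(1) rps[OF xP(1)]] f(2) by blast
  moreover have "f (rps y) = 0" if "y \<in> Z" for y
    using nonvan_mf[OF f(1) _ rps] that f(3) C(2) Y by blast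
  ultimately show ?thesis using f(1) by blast
qed

text \<open>Stated for any set of points where the rank stays below t, so that tangent spaces have
  disappeared and only the vectors of \<open>rank_ge\<close> are left.\<close>

lemma chain_length_bound:
  assumes ad: "\<And>t. \<exists>M r. adapted t M r"
    and Y: "Y \<subseteq> P" and nr: "\<And>y. y \<in> Y \<Longrightarrow> \<not> rank_ge t (rps y)" and t: "t \<ge> 1"
    and Z: "\<And>k. k \<le> t \<Longrightarrow> irreducible_closed (subtopology (zar Pr) Y) (Z k)" "\<And>k. k < t \<Longrightarrow> Z k \<subset> Z (Suc k)"
  shows False
proof -
  obtain M r where a: "adapted t M r" using ad[of t] by (elim exE)
  have rl: "Vector_Spaces.linear sc (*) (r l i)" if "l < t" "i \<in> I" for l i
    using a that unfolding adapted_def by blast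
  have ZY: "Z k \<subseteq> Y" if "k \<le> t" for k
    using Z(1)[OF that] closedin_subset unfolding irreducible_closed_def by fastforce
  have ZP: "y \<in> P" if "k \<le> t" "y \<in> Z k" for k y using ZY Y that by blast
  have Zmono: "Z k \<subseteq> Z t" if "k \<le> t" for k
    using that by (induction k rule: inc_induct) (use Z(2) in auto)
  \<comment> \<open>For each member of the chain a multidegree, a form and a point: the form
    vanishes on the previous member but not at the point. The first member takes the constant form
    1.\<close>
  have "\<forall>j. \<exists>p. j \<le> t \<longrightarrow> snd (snd p) \<in> Z j \<and> fst (snd p) \<in> mf (fst p) \<and> fst (snd p) (rps (snd (snd p))) \<noteq> 0 \<and>
      (\<forall>k y. j = Suc k \<longrightarrow> y \<in> Z k \<longrightarrow> fst (snd p) (rps y) = 0)"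
  proof
    fix j
    show "\<exists>p. j \<le> t \<longrightarrow> snd (snd p) \<in> Z j \<and> fst (snd p) \<in> mf (fst p) \<and> fst (snd p) (rps (snd (snd p))) \<noteq> 0 \<and>
      (\<forall>k y. j = Suc k \<longrightarrow> y \<in> Z k \<longrightarrow> fst (snd p) (rps y) = 0)"
    proof (cases j)
      case 0
      obtain x where "x \<in> Z 0" using Z(1)[of 0] unfolding irreducible_closed_def by auto
      then show ?thesis using multiforms_const[of 1] 0 by (intro exI[of _ "(\<lambda>_. 0, (\<lambda>_. 1), x)"]) simp
    next
      case (Suc k)
      show ?thesis
      proof (cases "j \<le> t")
        case True
        then obtain x where x: "x \<in> Z j" "x \<notin> Z k" using Z(2)[of k] Suc by auto
        have "closedin (subtopology (zar Pr) Y) (Z k)" using Z(1)[of k] True Suc unfolding irreducible_closed_def by simp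
        then obtain d f where f: "f \<in> mf d" "f (rps x) \<noteq> 0" "\<forall>y\<in>Z k. f (rps y) = 0"
          using separating_mf[OF _ Y _ x(2)] x(1) ZY[OF True] by blast
        then show ?thesis using x(1) Suc by (intro exI[of _ "(d, f, x)"]) simp
      qed simp
    qed
  qed
  from choice[OF this] obtain p where p: "\<forall>j. j \<le> t \<longrightarrow> snd (snd (p j)) \<in> Z j \<and> fst (snd (p j)) \<in> mf (fst (p j)) \<and>
      fst (snd (p j)) (rps (snd (snd (p j)))) \<noteq> 0 \<and> (\<forall>k y. j = Suc k \<longrightarrow> y \<in> Z k \<longrightarrow> fst (snd (p j)) (rps y) = 0)" ..
  define d where "d j = fst (p j)" for j
  define f where "f j = fst (snd (p j))" for j
  define z where "z j = snd (snd (p j))" for j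
  have f: "f j \<in> mf (d j)" "z j \<in> Z j" "f j (rps (z j)) \<noteq> 0" "\<And>k y. j = Suc k \<Longrightarrow> y \<in> Z k \<Longrightarrow> f j (rps y) = 0" if "j \<le> t" for j
    using p that unfolding f_def d_def z_def by blast+
  \<comment> \<open>Any bound for all the multidegrees serves; the sum is convenient.\<close>
  define e where "e = Suc (\<Sum>j\<le>t. \<Sum>i\<in>I. d j i)"
  have de: "d j i \<le> e" if "j \<le> t" "i \<in> I" for j i
  proof -
    have "d j i \<le> (\<Sum>i\<in>I. d j i)" by (rule member_le_sum) (use that finI in auto)
    also have "\<dots> \<le> (\<Sum>j\<le>t. \<Sum>i\<in>I. d j i)" by (rule member_le_sum[of j]) (use that in auto)
    finally show ?thesis by (simp add: e_def)
  qed
  have "\<forall>j. \<exists>g. j \<le> t \<longrightarrow> g \<in> mf (\<lambda>_. e) \<and> g (rps (z j)) \<noteq> 0 \<and> (\<forall>u. f j u = 0 \<longrightarrow> g u = 0)"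
  proof
    fix j
    show "\<exists>g. j \<le> t \<longrightarrow> g \<in> mf (\<lambda>_. e) \<and> g (rps (z j)) \<noteq> 0 \<and> (\<forall>u. f j u = 0 \<longrightarrow> g u = 0)"
    proof (cases "j \<le> t")
      case True
      have "\<exists>g\<in>mf (\<lambda>_. e). g (rps (z j)) \<noteq> 0 \<and> (\<forall>u. f j u = 0 \<longrightarrow> g u = 0)"
        by (rule uniform_form[OF f(1)[OF True] rps_props(2)[OF ZP[OF True f(2)[OF True]]] f(3)[OF True] de[OF True]])
      then show ?thesis by blast
    qed simp
  qed
  from choice[OF this] obtain G where G: "\<forall>j. j \<le> t \<longrightarrow> G j \<in> mf (\<lambda>_. e) \<and> G j (rps (z j)) \<noteq> 0 \<and> (\<forall>u. f j u = 0 \<longrightarrow> G j u = 0)" ..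
  \<comment> \<open>The points are those of the largest member of the chain, padded by one of them
    so that the whole type is covered.\<close>
  define w where "w y = rps (if y \<in> Z t then y else z t)" for y
  have zt: "z t \<in> Z t" using f(2) by blast
  have wZ: "\<exists>x\<in>Z t. w y = rps x" for y using zt by (auto simp: w_def)
  have Zw: "w x = rps x" if "x \<in> Z t" for x using that by (simp add: w_def)
  interpret mp: multi_points sc I V w
  proof
    show "finite I" by (rule finI)
    show "\<exists>B. finite B \<and> V i = span B" if "i \<in> I" for i using fdV[OF that] .
    fix i y assume i: "i \<in> I"
    obtain x where x: "x \<in> Z t" "w y = rps x" using wZ[of y] by blast
    show "w y i \<in> V i" "w y i \<noteq> 0" unfolding x(2) by (rule rps_props[OF ZP[OF order_refl x(1)] i])+
  next
    fix f g d d' y y' assume f: "f \<in> mf d" "f (w y) \<noteq> 0" and g: "g \<in> mf d'" "g (w y') \<noteq> 0"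
    obtain x x' where x: "x \<in> Z t" "w y = rps x" "x' \<in> Z t" "w y' = rps x'" using wZ[of y] wZ[of y'] by blast
    have "\<exists>y\<in>Z t. f (rps y) \<noteq> 0 \<and> g (rps y) \<noteq> 0"
    proof (rule irreducible_mf[OF Z(1)[OF order_refl] Y f(1) _ g(1)])
      show "\<exists>y\<in>Z t. f (rps y) \<noteq> 0" by (rule bexI[OF _ x(1)]) (use f(2) x(2) in simp)
      show "\<exists>y\<in>Z t. g (rps y) \<noteq> 0" by (rule bexI[OF _ x(3)]) (use g(2) x(4) in simp)
    qed
    then show "\<exists>z. f (w z) \<noteq> 0 \<and> g (w z) \<noteq> 0" using Zw by metis
  qed
  \<comment> \<open>The forms attached to the t places, in the same multidegree as the G's so that
    integrality is homogeneous.\<close>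
  define F where "F l v = (\<Prod>i\<in>I. r l i (v i) ^ e)" for l v
  have F: "F l \<in> mf (\<lambda>_. e)" if l: "l \<in> {..<t}" for l
  proof -
    have "F l \<in> mf (\<lambda>i. \<Sum>j\<in>I. e * (if i = j then 1 else 0))"
      unfolding F_def by (intro multiforms_prod multiforms_power multiforms_linear finI) (use rl l in auto)
    also have "mf (\<lambda>i. \<Sum>j\<in>I. e * (if i = j then 1 else 0)) = mf (\<lambda>_. e)"
    proof (rule multiforms_cong)
      fix i assume i: "i \<in> I"
      have "(\<Sum>j\<in>I. e * (if i = j then 1 else 0)) = (\<Sum>j\<in>I. if i = j then e else 0)" by (rule sum.cong) auto
      then show "(\<Sum>j\<in>I. e * (if i = j then 1 else 0)) = e" using i finI by simp
    qed
    finally show ?thesis .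
  qed
  have no: "\<exists>l\<in>{..<t}. F l x \<noteq> 0" if x: "mp.adherent x" for x
  proof (rule ccontr)
    assume n: "\<not> ?thesis"
    have xV: "x i \<in> V i" "x i \<noteq> 0" if "i \<in> I" for i using x that unfolding mp.adherent_def by auto
    have "\<exists>i\<in>I. r l i (x i) = 0" if "l < t" for l
    proof -
      have "(\<Prod>i\<in>I. r l i (x i) ^ e) = 0" using n that unfolding F_def by simp
      then show ?thesis using finI by simp
    qed
    \<comment> \<open>The common zero x lies in the closure only, where nothing is assumed about the
      rank. The form certifying the rank at x is nonzero at some point of \<open>Z t\<close> and
      contradicts the bound there.\<close>
    from adapted_rank[OF a xV this] have "rank_ge t x" by simp
    from rank_ge_open[OF xV(1) this] obtain d D where D: "D \<in> mf d" "D x \<noteq> 0"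
      "\<forall>v. (\<forall>i\<in>I. v i \<in> V i) \<longrightarrow> D v \<noteq> 0 \<longrightarrow> rank_ge t v" by blast
    obtain y where y: "D (w y) \<noteq> 0" using x D(1,2) unfolding mp.adherent_def by blast
    have "rank_ge t (w y)" using D(3) y mp.wV by blast
    moreover obtain x' where "x' \<in> Z t" "w y = rps x'" using wZ by blast
    ultimately show False using nr ZY by auto
  qed
  show False
  \<comment> \<open>There are t + 1 independent forms, one for each of Z_0, ..., Z_t, but only t
    forms F_l: the chain is one step too long.\<close>
  proof (rule growth_contradiction[of "{..<t}" t "\<lambda>j. G j \<circ> w" "\<lambda>l. F l \<circ> w"])
    fix j assume j: "j \<le> t"
    have "G j (w (z j)) \<noteq> 0" using G j Zw Zmono[OF j] f(2)[OF j] by fastforce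
    then show "\<exists>m. (G j \<circ> w) ^ m \<in> fsp.span (int_monos {..<t} (\<lambda>l. F l \<circ> w) (G j \<circ> w) m)"
    proof (rule mp.integral_over[where e = e, rotated 3])
      show "finite {..<t}" by simp
      show "F l \<in> mf (\<lambda>_. e)" if "l \<in> {..<t}" for l by (rule F[OF that])
      show "G j \<in> mf (\<lambda>_. e)" using G j by blast
      show "\<exists>l\<in>{..<t}. F l x \<noteq> 0" if "mp.adherent x" for x by (rule no[OF that])
    qed
  next
    fix D c assume s: "\<forall>y. (\<Sum>\<beta>\<in>exps t D. c \<beta> * (\<Prod>j\<le>t. (G j \<circ> w) y ^ \<beta> j)) = 0"
    show "\<forall>\<beta>\<in>exps t D. c \<beta> = 0"
    proof (rule chain_monomials_independent[where n = t and sc = sc and I = I and Y = "\<lambda>k. rps ` Z k" and G = G and e = e and k = t and D = D and c = c])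
      fix k f g d d' assume "k \<le> t" "f \<in> mf d" "g \<in> mf d'" "\<exists>y\<in>rps ` Z k. f y \<noteq> 0" "\<exists>y\<in>rps ` Z k. g y \<noteq> 0"
      then show "\<exists>y\<in>rps ` Z k. f y \<noteq> 0 \<and> g y \<noteq> 0" using irreducible_mf[OF Z(1) Y, of k f d g d'] by simp
    next
      fix k assume "k < t" then show "rps ` Z k \<subseteq> rps ` Z (Suc k)" using Z(2) by blast
    next
      fix j assume "j \<le> t" then show "G j \<in> mf (\<lambda>_. e)" using G by blast
    next
      fix j assume "j \<le> t" then show "\<exists>y\<in>rps ` Z j. G j y \<noteq> 0" using G f(2) by blast
    next
      fix j y assume "j < t" "y \<in> rps ` Z j" then show "G (Suc j) y = 0" using G f(4)[of "Suc j"] by fastforce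
    next
      show "\<forall>y\<in>rps ` Z t. (\<Sum>\<beta>\<in>exps t D. c \<beta> * (\<Prod>j\<le>t. G j y ^ \<beta> j)) = 0"
      proof (rule ballI)
        fix y assume "y \<in> rps ` Z t"
        then obtain x where "x \<in> Z t" "y = rps x" by blast
        then show "(\<Sum>\<beta>\<in>exps t D. c \<beta> * (\<Prod>j\<le>t. G j y ^ \<beta> j)) = 0" using s[rule_format, of x] Zw by (simp add: comp_def)
      qed
    qed simp
  qed (use t in auto)
qed

lemma krull_dim_thom_boardman:
  assumes ev: "\<And>Q. finite Q \<Longrightarrow> Q \<subseteq> (\<Union>i\<in>I. V i) - {0} \<Longrightarrow>
     \<exists>M. ka.place M \<and> (\<forall>i\<in>I. V i \<subseteq> ka.vring M) \<and> Q \<inter> M = {}"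
  shows "krull_dim (subtopology (zar (proj_prod sc I V))
       (thom_boardman (proj_prod sc I V) (ind_proj sc UNIV) (product_map sc I) r)) \<le> ereal (real r)"
proof -
  let ?Y = "thom_boardman Pr TK (product_map sc I) r"
  have Y: "?Y \<subseteq> P" unfolding thom_boardman_def topspace_Pr by blast
  have nr: "\<not> rank_ge (Suc r) (rps y)" if "y \<in> ?Y" for y
  proof (rule rank_bound)
    show yP: "y \<in> P" using that Y by blast
    show "rps y \<in> rep y" by (rule rps[OF yP])
    show "fsp.dim (tangent_map TK (product_map sc I) y ` tangent_space Pr y) = r"
      using that unfolding thom_boardman_def fscale_alt by blast
  qed
  show ?thesis unfolding proj_prod_eq krull_dim_def
  proof (rule Sup_least, elim CollectE exE conjE)
    fix x n Z assume x: "x = ereal (real n)" and Z: "\<forall>i\<le>n. irreducible_closed (subtopology (zar Pr) ?Y) (Z i)" "\<forall>i<n. Z i \<subset> Z (Suc i)"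
    have "n \<le> r"
    proof (rule ccontr)
      assume "\<not> n \<le> r"
      then have le: "Suc r \<le> n" by simp
      \<comment> \<open>Only the first r + 2 members of the chain are used, that is, t = r +
        1.\<close>
      show False by (rule chain_length_bound[OF ex_adapted[OF ev] Y nr, of Z]) (use Z le in auto)
    qed
    then show "x \<le> ereal (real r)" using x by simp
  qed
qed

end

section \<open>Evaluation of sections\<close>

lemma reg_proj_sub_alg:
  assumes "f \<in> reg (proj_sub sc X) U" "g \<in> reg (proj_sub sc X) U"
  shows "(\<lambda>y. f y + g y) \<in> reg (proj_sub sc X) U" "(\<lambda>y. f y * g y) \<in> reg (proj_sub sc X) U"
proof -
  have fg: "f \<in> cone_regular (\<lambda>L. L - {0}) (forms sc) X U" "g \<in> cone_regular (\<lambda>L. L - {0}) (forms sc) X U"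
    using assms by (simp_all add: proj_sub_def cone_space_def)
  note r = cone_regular_alg[where H = "forms sc" and pl = "(+)", OF _ _ fg, simplified Int_absorb]
  show "(\<lambda>y. f y + g y) \<in> reg (proj_sub sc X) U"
    unfolding proj_sub_def cone_space_def kspace.simps by (rule r(1)) (erule (1) forms_add forms_mult)+
  show "(\<lambda>y. f y * g y) \<in> reg (proj_sub sc X) U"
    unfolding proj_sub_def cone_space_def kspace.simps by (rule r(2)) (erule (1) forms_add forms_mult)+
qed

lemma reg_proj_sub_const:
  assumes "openin (zar (proj_sub sc X)) U" "\<And>y. y \<in> U \<Longrightarrow> f y = c"
  shows "f \<in> reg (proj_sub sc X) U"
  unfolding proj_sub_def cone_space_def kspace.simps cone_regular_def
proof (intro CollectI ballI)
  fix x assume x: "x \<in> U"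
  have "openin (cone_zariski (\<lambda>L. L - {0}) (forms sc) X) U" using assms(1) by (simp add: proj_sub_def cone_space_def)
  then show "\<exists>N d f' g. openin (cone_zariski (\<lambda>L. L - {0}) (forms sc) X) N \<and> x \<in> N \<and> N \<subseteq> U \<and> f' \<in> forms sc d \<and> g \<in> forms sc d \<and>
     (\<forall>y\<in>N. \<forall>v\<in>y - {0}. g v \<noteq> 0 \<and> f y = f' v / g v)"
    using x assms(2) by (intro exI[of _ U] exI[of _ "0::nat"] exI[of _ "\<lambda>_. c"] exI[of _ "\<lambda>_. 1"]) (auto intro: forms_const)
qed

abbreviation const0 :: "('a \<Rightarrow> 'p set) \<Rightarrow> 'k::field \<Rightarrow> nat \<Rightarrow> 'a \<Rightarrow> 'p \<Rightarrow> 'k" where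
  "const0 U c \<equiv> in_degree 0 (const_section U c)"

context projective_curve
begin

context
  fixes U :: "'a \<Rightarrow> (nat \<Rightarrow> 'k) set set" and g :: "'a \<Rightarrow> 'a \<Rightarrow> (nat \<Rightarrow> 'k) set \<Rightarrow> 'k"
    and \<iota> :: "(nat \<Rightarrow> 'a \<Rightarrow> (nat \<Rightarrow> 'k) set \<Rightarrow> 'k) \<Rightarrow> 'K::field"
  assumes lb: "line_bundle S U g" and ff: "is_fraction_field S U g \<iota>"
begin

abbreviation SA :: "(nat \<Rightarrow> 'a \<Rightarrow> (nat \<Rightarrow> 'k) set \<Rightarrow> 'k) set" where "SA \<equiv> section_algebra S U g"

lemma openU: "openin T (X \<inter> U a)" using lbD(1)[OF lb, of a] openin_topspace[of T] by (simp add: topspace_T openin_Int)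

lemma osec_const: "openin T W \<Longrightarrow> (\<lambda>y. if y \<in> W then c else 0) \<in> osec S W"
  unfolding osec_def using reg_proj_sub_const[of fscale X W "\<lambda>y. if y \<in> W then c else 0" c] by auto

lemma osec_zero: "(\<lambda>_. 0) \<in> osec S (X \<inter> U a)"
  using osec_const[OF openU, where c = 0] by simp

lemma osec_alg:
  assumes "f \<in> osec S W" "h \<in> osec S W" shows "(\<lambda>y. f y + h y) \<in> osec S W" "(\<lambda>y. f y * h y) \<in> osec S W"
  using assms reg_proj_sub_alg[of f fscale X W h] unfolding osec_def by auto

lemma osec_sum:
  assumes "openin T W" "\<And>j. j \<in> J \<Longrightarrow> f j \<in> osec S W" shows "(\<lambda>y. \<Sum>j\<in>J. f j y) \<in> osec S W"
  using assms(2)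
proof (induction J rule: infinite_finite_induct)
  case (insert j J)
  then have "f j \<in> osec S W" "(\<lambda>y. \<Sum>j\<in>J. f j y) \<in> osec S W" by auto
  from osec_alg(1)[OF this] show ?case using insert(1,2) by simp
qed (use osec_const[OF assms(1), of 0] in simp_all)

lemma SA_iff: "F \<in> SA \<longleftrightarrow> (\<forall>m a. F m a \<in> osec S (X \<inter> U a)) \<and>
    (\<forall>m a b. \<forall>x\<in>X \<inter> U a \<inter> U b. F m a x = g a b x ^ m * F m b x)"
  unfolding section_algebra_def tensor_power_def topspace_T by blast

lemma SA_add: assumes "F \<in> SA" "G \<in> SA" shows "F + G \<in> SA"
  unfolding SA_iff
proof (intro conjI allI ballI)
  fix m a
  have "(\<lambda>y. F m a y + G m a y) \<in> osec S (X \<inter> U a)" by (rule osec_alg) (use assms in \<open>auto simp: SA_iff\<close>)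
  moreover have "(F + G) m a = (\<lambda>y. F m a y + G m a y)" by (rule ext) simp
  ultimately show "(F + G) m a \<in> osec S (X \<inter> U a)" by simp
  fix b x assume "x \<in> X \<inter> U a \<inter> U b"
  then have "F m a x = g a b x ^ m * F m b x" "G m a x = g a b x ^ m * G m b x" using assms unfolding SA_iff by blast+
  then show "(F + G) m a x = g a b x ^ m * (F + G) m b x" by (simp add: distrib_left)
qed

lemma SA_mult: assumes "F \<in> SA" "G \<in> SA" shows "section_mult F G \<in> SA"
  unfolding SA_iff
proof (intro conjI allI ballI)
  fix m a
  show "section_mult F G m a \<in> osec S (X \<inter> U a)"
    unfolding section_mult_def by (rule osec_sum[OF openU osec_alg(2)]) (use assms in \<open>auto simp: SA_iff\<close>)
  fix b x assume x: "x \<in> X \<inter> U a \<inter> U b"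
  have F: "F i a x = g a b x ^ i * F i b x" for i using assms(1) x unfolding SA_iff by blast
  have G: "G i a x = g a b x ^ i * G i b x" for i using assms(2) x unfolding SA_iff by blast
  have "F i a x * G (m - i) a x = g a b x ^ m * (F i b x * G (m - i) b x)" if "i \<le> m" for i
  proof -
    have "g a b x ^ m = g a b x ^ i * g a b x ^ (m - i)" using that by (simp flip: power_add)
    then show ?thesis using F[of i] G[of "m - i"] by (simp add: mult_ac)
  qed
  then show "section_mult F G m a x = g a b x ^ m * section_mult F G m b x"
    unfolding section_mult_def sum_distrib_left by (intro sum.cong) auto
qed

lemma SA_const: "const0 U c \<in> SA"
  unfolding SA_iff
proof (intro conjI allI ballI)
  fix m a
  have "U a \<subseteq> X" using lbD(2)[OF lb] by blast
  then have "const_section U c a = (\<lambda>y. if y \<in> X \<inter> U a then c else 0)"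
    by (intro ext) (auto simp: const_section_def)
  then have c: "const_section U c a \<in> osec S (X \<inter> U a)" using osec_const[OF openU, where c = c] by simp
  show "const0 U c m a \<in> osec S (X \<inter> U a)"
  proof (cases "m = 0")
    case True then show ?thesis using c by (simp only: in_degree_def simp_thms if_True)
  next
    case False
    then have "const0 U c m a = (\<lambda>_. 0)" by (intro ext) (simp add: in_degree_def)
    then show ?thesis using osec_zero by (simp only:)
  qed
  fix b x assume "x \<in> X \<inter> U a \<inter> U b"
  then show "const0 U c m a x = g a b x ^ m * const0 U c m b x"
    by (cases "m = 0") (simp_all add: in_degree_def const_section_def)
qed

lemma SA_deg1: assumes "s \<in> H0L U g" shows "in_degree 1 s \<in> SA"
  unfolding SA_iff
proof (intro conjI allI ballI)
  fix m a
  have s: "s a \<in> osec S (X \<inter> U a)" using assms unfolding tensor_power_def by blast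
  show "in_degree 1 s m a \<in> osec S (X \<inter> U a)"
  proof (cases "m = 1")
    case True then show ?thesis using s by (simp only: in_degree_def simp_thms if_True)
  next
    case False
    then have "in_degree 1 s m a = (\<lambda>_. 0)" by (intro ext) (simp add: in_degree_def)
    then show ?thesis using osec_zero by (simp only:)
  qed
  fix b x assume x: "x \<in> X \<inter> U a \<inter> U b"
  show "in_degree 1 s m a x = g a b x ^ m * in_degree 1 s m b x"
  proof (cases "m = 1")
    case True then show ?thesis unfolding in_degree_def using H0LD(3)[OF lb assms x] by (simp only: simp_thms if_True power_one_right)
  next
    case False then show ?thesis by (simp add: in_degree_def)
  qed
qed

lemma \<iota>: "F \<in> SA \<Longrightarrow> G \<in> SA \<Longrightarrow> \<iota> (F + G) = \<iota> F + \<iota> G" "F \<in> SA \<Longrightarrow> G \<in> SA \<Longrightarrow> \<iota> (section_mult F G) = \<iota> F * \<iota> G"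
  "\<iota> (const0 U 1) = 1" "inj_on \<iota> SA"
  using ff unfolding is_fraction_field_def Let_def by blast+

lemma const0_add: "const0 U (c + d) = const0 U c + const0 U d"
  by (intro ext) (simp add: in_degree_def const_section_def)

lemma section_mult_const: "section_mult (const0 U c) F m a x = (if x \<in> U a then c * F m a x else 0)"
proof -
  have "section_mult (const0 U c) F m a x = (\<Sum>i\<le>m. if i = 0 then const_section U c a x * F m a x else 0)"
    unfolding section_mult_def by (rule sum.cong) (auto simp: in_degree_def)
  then show ?thesis by (simp add: const_section_def)
qed

lemma const0_mult: "const0 U (c * d) = section_mult (const0 U c) (const0 U d)"
  by (intro ext) (simp add: section_mult_const, simp add: in_degree_def const_section_def)

lemma \<iota>_const0: "\<iota> (const0 U (c + d)) = \<iota> (const0 U c) + \<iota> (const0 U d)" "\<iota> (const0 U (c * d)) = \<iota> (const0 U c) * \<iota> (const0 U d)"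
  "\<iota> (const0 U 0) = 0"
proof -
  show a: "\<iota> (const0 U (c + d)) = \<iota> (const0 U c) + \<iota> (const0 U d)" for c d unfolding const0_add by (rule \<iota>(1)[OF SA_const SA_const])
  show "\<iota> (const0 U (c * d)) = \<iota> (const0 U c) * \<iota> (const0 U d)" unfolding const0_mult by (rule \<iota>(2)[OF SA_const SA_const])
  show "\<iota> (const0 U 0) = 0" using a[of 0 0] by (simp only: add_0 add_cancel_right_right)
qed

lemma vector_space_K_scale: "vector_space (K_scale U \<iota>)"
  by unfold_locales (simp_all add: K_scale_def \<iota>_const0 \<iota>(3) algebra_simps)

lemma deg1_add: "s \<in> H0L U g \<Longrightarrow> s' \<in> H0L U g \<Longrightarrow> \<iota> (in_degree 1 (s + s')) = \<iota> (in_degree 1 s) + \<iota> (in_degree 1 s')"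
proof -
  assume s: "s \<in> H0L U g" "s' \<in> H0L U g"
  have "in_degree 1 (s + s') = in_degree 1 s + in_degree 1 s'" by (intro ext) (simp add: in_degree_def)
  then show ?thesis using \<iota>(1)[OF SA_deg1[OF s(1)] SA_deg1[OF s(2)]] by simp
qed

lemma deg1_scale: "s \<in> H0L U g \<Longrightarrow> \<iota> (in_degree 1 (sscale c s)) = K_scale U \<iota> c (\<iota> (in_degree 1 s))"
proof -
  assume s: "s \<in> H0L U g"
  have "in_degree 1 (sscale c s) = section_mult (const0 U c) (in_degree 1 s)"
  proof (intro ext)
    fix m a x
    show "in_degree 1 (sscale c s) m a x = section_mult (const0 U c) (in_degree 1 s) m a x"
      unfolding section_mult_const using H0LD(2)[OF lb s, of x a] by (auto simp: in_degree_def sscale_def)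
  qed
  then show ?thesis using \<iota>(2)[OF SA_const SA_deg1[OF s]] by (simp add: K_scale_def)
qed

lemma \<iota>_zero: "\<iota> (in_degree 1 0) = 0"
proof -
  have "in_degree 1 0 = (const0 U 0 :: nat \<Rightarrow> 'a \<Rightarrow> (nat \<Rightarrow> 'k) set \<Rightarrow> 'k)"
    by (intro ext) (simp add: in_degree_def const_section_def)
  then show ?thesis using \<iota>_const0(3) by simp
qed

text \<open>The image of a finite-dimensional space under the linear map from sections to degree 1
  of the fraction field; linearity holds only on sections, hence the detour through
  subspaces.\<close>

lemma sections_span:
  assumes W: "W \<subseteq> H0L U g" "ssp.subspace W"
  shows "\<exists>B. finite B \<and> {\<iota> (in_degree 1 s) | s. s \<in> W} = module.span (K_scale U \<iota>) B"
proof -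
  interpret k: vector_space "K_scale U \<iota>" by (rule vector_space_K_scale)
  obtain C where C: "finite C" "C \<subseteq> W" "W \<subseteq> ssp.span C" using finite_dim_sections[OF lb W] by (elim exE conjE)
  let ?L = "\<lambda>s. \<iota> (in_degree 1 s)"
  have sub: "k.subspace {\<iota> (in_degree 1 s) | s. s \<in> W}"
  proof (rule k.subspaceI)
    show "0 \<in> {\<iota> (in_degree 1 s) | s. s \<in> W}" using \<iota>_zero ssp.subspace_0[OF W(2)] by force
  next
    fix x y assume "x \<in> {\<iota> (in_degree 1 s) | s. s \<in> W}" "y \<in> {\<iota> (in_degree 1 s) | s. s \<in> W}"
    then obtain s s' where s: "s \<in> W" "x = ?L s" "s' \<in> W" "y = ?L s'" by blast
    have "x + y = ?L (s + s')" using deg1_add s W(1) by (simp add: subset_iff)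
    then show "x + y \<in> {\<iota> (in_degree 1 s) | s. s \<in> W}" using ssp.subspace_add[OF W(2) s(1,3)] by blast
  next
    fix c x assume "x \<in> {\<iota> (in_degree 1 s) | s. s \<in> W}"
    then obtain s where s: "s \<in> W" "x = ?L s" by blast
    have "K_scale U \<iota> c x = ?L (sscale c s)" using deg1_scale s W(1) by (simp add: subset_iff)
    then show "K_scale U \<iota> c x \<in> {\<iota> (in_degree 1 s) | s. s \<in> W}" using ssp.subspace_scale[OF W(2) s(1)] by blast
  qed
  have "ssp.subspace {s\<in>W. ?L s \<in> k.span (?L ` C)}"
  proof (rule ssp.subspaceI)
    show "0 \<in> {s\<in>W. ?L s \<in> k.span (?L ` C)}" using \<iota>_zero ssp.subspace_0[OF W(2)] k.span_zero by simp
  next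
    fix s s' assume s: "s \<in> {s\<in>W. ?L s \<in> k.span (?L ` C)}" "s' \<in> {s\<in>W. ?L s \<in> k.span (?L ` C)}"
    then have "?L (s + s') = ?L s + ?L s'" using deg1_add W(1) by blast
    then show "s + s' \<in> {s\<in>W. ?L s \<in> k.span (?L ` C)}" using s ssp.subspace_add[OF W(2)] k.span_add by simp
  next
    fix c s assume s: "s \<in> {s\<in>W. ?L s \<in> k.span (?L ` C)}"
    then have "?L (sscale c s) = K_scale U \<iota> c (?L s)" using deg1_scale W(1) by blast
    then show "sscale c s \<in> {s\<in>W. ?L s \<in> k.span (?L ` C)}" using s ssp.subspace_scale[OF W(2)] k.span_scale by simp
  qed
  moreover have "C \<subseteq> {s\<in>W. ?L s \<in> k.span (?L ` C)}"
    by (intro subsetI CollectI conjI subsetD[OF C(2)] k.span_base imageI)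
  ultimately have CW: "ssp.span C \<subseteq> {s\<in>W. ?L s \<in> k.span (?L ` C)}" by (rule ssp.span_minimal[rotated])
  have "{\<iota> (in_degree 1 s) | s. s \<in> W} = k.span (?L ` C)"
  proof (rule subset_antisym)
    show "k.span (?L ` C) \<subseteq> {\<iota> (in_degree 1 s) | s. s \<in> W}"
    proof (rule k.span_minimal[OF _ sub], rule image_subsetI)
      fix s assume "s \<in> C"
      then have "s \<in> W" by (rule subsetD[OF C(2)])
      then show "?L s \<in> {\<iota> (in_degree 1 s) | s. s \<in> W}" by (intro CollectI exI[of _ s] conjI refl)
    qed
    show "{\<iota> (in_degree 1 s) | s. s \<in> W} \<subseteq> k.span (?L ` C)"
    proof (rule subsetI)
      fix z assume "z \<in> {\<iota> (in_degree 1 s) | s. s \<in> W}"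
      then obtain s where s: "z = ?L s" "s \<in> W" by (elim CollectE exE conjE)
      from subsetD[OF CW subsetD[OF C(3) s(2)]] have "?L s \<in> k.span (?L ` C)" by (simp only: mem_Collect_eq)
      then show "z \<in> k.span (?L ` C)" unfolding s(1) .
    qed
  qed
  then show ?thesis by (intro exI[of _ "?L ` C"] conjI finite_imageI C(1))
qed

text \<open>Adding the constants amounts to adding the vector 1 to the spanning set.\<close>

lemma sections_span_const:
  assumes W: "W \<subseteq> H0L U g" "ssp.subspace W"
  shows "\<exists>B. finite B \<and> {\<iota> (const0 U c) + \<iota> (in_degree 1 s) | c s. s \<in> W} = module.span (K_scale U \<iota>) B"
proof -
  interpret k: vector_space "K_scale U \<iota>" by (rule vector_space_K_scale)
  from sections_span[OF W] obtain B where B': "finite B \<and> {\<iota> (in_degree 1 s) | s. s \<in> W} = k.span B" ..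
  note B = B'[THEN conjunct1] B'[THEN conjunct2]
  have "{\<iota> (const0 U c) + \<iota> (in_degree 1 s) | c s. s \<in> W} = k.span (insert 1 B)"
  proof (intro subset_antisym subsetI)
    fix x assume "x \<in> {\<iota> (const0 U c) + \<iota> (in_degree 1 s) | c s. s \<in> W}"
    then obtain c s where "s \<in> W" "x = \<iota> (const0 U c) + \<iota> (in_degree 1 s)" by blast
    then have "x - K_scale U \<iota> c 1 \<in> k.span B" unfolding B(2)[symmetric] K_scale_def by auto
    then show "x \<in> k.span (insert 1 B)" unfolding k.span_insert by blast
  next
    fix x assume "x \<in> k.span (insert 1 B)"
    then obtain c where "x - K_scale U \<iota> c 1 \<in> k.span B" unfolding k.span_insert by blast
    then obtain s where "s \<in> W" "x - K_scale U \<iota> c 1 = \<iota> (in_degree 1 s)" unfolding B(2)[symmetric] by blast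
    then have "x = \<iota> (const0 U c) + \<iota> (in_degree 1 s)" "s \<in> W" unfolding K_scale_def by (auto simp: algebra_simps)
    then show "x \<in> {\<iota> (const0 U c) + \<iota> (in_degree 1 s) | c s. s \<in> W}" by blast
  qed
  then show ?thesis using B(1) by (intro exI[of _ "insert 1 B"]) simp
qed

text \<open>A nonzero section is not generically zero in the chart. Near a point where it is nonzero
  it is a fraction, whose numerator times the form of the neighbourhood has the required
  property.\<close>

lemma nonvanishing_form:
  assumes p: "p \<in> U a" and s: "s \<in> H0L U g" "s \<noteq> 0"
  shows "\<exists>d. \<exists>H\<in>forms fscale d. (\<exists>x\<in>X. H (rp x) \<noteq> 0) \<and> (\<forall>y\<in>X. H (rp y) \<noteq> 0 \<longrightarrow> s a y \<noteq> 0)"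
proof -
  have "\<exists>q\<in>U a \<inter> X. s a q \<noteq> 0"
  proof (rule ccontr)
    assume n: "\<not> ?thesis"
    have "s a \<circ> \<rho> \<in> mp.N0" by (rule N0_openI[OF lbD(1)[OF lb] p]) (use n in blast)
    then show False using section_zero[OF lb s(1) p] s(2) by simp
  qed
  then obtain q where q: "q \<in> X \<inter> U a" "s a q \<noteq> 0" by blast
  then have qX: "q \<in> X" by simp
  have "\<exists>d F A B e. F \<in> forms fscale e \<and> A \<in> forms fscale d \<and> B \<in> forms fscale d \<and> F (rp q) \<noteq> 0 \<and> B (rp q) \<noteq> 0 \<and>
     (\<forall>y\<in>X. \<forall>u\<in>y. u \<noteq> 0 \<longrightarrow> F u \<noteq> 0 \<longrightarrow> y \<in> X \<inter> U a \<and> B u \<noteq> 0 \<and> s a y = A u / B u)"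
    by (rule fsp.reg_proj_sub_local[OF H0LD(1)[OF lb s(1)] q(1) X_sub rp(1,2)[OF qX]])
  then obtain d F A B e where f: "F \<in> forms fscale e" "A \<in> forms fscale d" "F (rp q) \<noteq> 0" "B (rp q) \<noteq> 0"
    and loc: "\<forall>y\<in>X. \<forall>u\<in>y. u \<noteq> 0 \<longrightarrow> F u \<noteq> 0 \<longrightarrow> y \<in> X \<inter> U a \<and> B u \<noteq> 0 \<and> s a y = A u / B u"
    by (elim exE conjE)
  have loc': "B (rp y) \<noteq> 0 \<and> s a y = A (rp y) / B (rp y)" if "y \<in> X" "F (rp y) \<noteq> 0" for y
    using loc[rule_format, OF that(1) rp(1,2)[OF that(1)] that(2)] by simp
  show ?thesis
  proof (rule exI[of _ "e + d"], rule bexI[of _ "\<lambda>v. F v * A v"], intro conjI ballI impI)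
    show "(\<lambda>v. F v * A v) \<in> forms fscale (e + d)" by (rule forms_mult[OF f(1,2)])
    show "\<exists>x\<in>X. F (rp x) * A (rp x) \<noteq> 0" by (rule bexI[OF _ qX]) (use f(3) q(2) loc'[OF qX f(3)] in auto)
    fix y assume "y \<in> X" "F (rp y) * A (rp y) \<noteq> 0"
    then show "s a y \<noteq> 0" using loc'[of y] by auto
  qed
qed

text \<open>The forms that witness the single sections are multiplied, and irreducibility keeps the
  product nonzero.\<close>

lemma common_nonzero:
  assumes p: "p \<in> U a" and J: "finite J" "\<And>s. s \<in> J \<Longrightarrow> s \<in> H0L U g \<and> s \<noteq> 0"
  shows "\<exists>y\<in>X. y \<in> U a \<and> (\<forall>s\<in>J. s a y \<noteq> 0)"
proof -
  have "\<exists>d. \<exists>H\<in>forms fscale d. (\<exists>x\<in>X. H (rp x) \<noteq> 0) \<and> (\<forall>y\<in>X. H (rp y) \<noteq> 0 \<longrightarrow> y \<in> U a \<and> (\<forall>s\<in>J. s a y \<noteq> 0))"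
    using J
  proof (induction J rule: finite_induct)
    case empty
    have "p \<in> X" using p lbD(2)[OF lb] by blast
    then show ?case using openin_T_form[OF lbD(1)[OF lb] p] by blast
  next
    case (insert s J)
    obtain d H x where H: "H \<in> forms fscale d" "x \<in> X" "H (rp x) \<noteq> 0" "\<forall>y\<in>X. H (rp y) \<noteq> 0 \<longrightarrow> y \<in> U a \<and> (\<forall>s\<in>J. s a y \<noteq> 0)"
      using insert by blast
    obtain d' H' x' where H': "H' \<in> forms fscale d'" "x' \<in> X" "H' (rp x') \<noteq> 0" "\<forall>y\<in>X. H' (rp y) \<noteq> 0 \<longrightarrow> s a y \<noteq> 0"
      using nonvanishing_form[OF p, of s] insert.prems[of s] by blast
    show ?case
    proof (rule exI[of _ "d + d'"], rule bexI[of _ "\<lambda>v. H v * H' v"], intro conjI)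
      show "(\<lambda>v. H v * H' v) \<in> forms fscale (d + d')" by (rule forms_mult[OF H(1) H'(1)])
      show "\<exists>x\<in>X. H (rp x) * H' (rp x) \<noteq> 0" using irr_forms[OF H(1-3) H'(1-3)] by simp
      show "\<forall>y\<in>X. H (rp y) * H' (rp y) \<noteq> 0 \<longrightarrow> y \<in> U a \<and> (\<forall>s\<in>insert s J. s a y \<noteq> 0)"
        using H(4) H'(4) by simp
    qed
  qed
  then show ?thesis by blast
qed

text \<open>Evaluation at a point y of the curve turns elements of the section algebra into power
  series in the grading variable; putting this variable equal to t sends c + s to c + s(y) t. For
  suitable y and t finitely many given nonzero elements have nonzero values, and a place extends
  this evaluation.\<close>

lemma ex_evaluation_place:
  fixes V :: "'i \<Rightarrow> 'K set"
  assumes fs: "field_systems (K_scale U \<iota>) I V"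
    and V: "\<And>i z. i \<in> I \<Longrightarrow> z \<in> V i \<Longrightarrow> \<exists>c s. s \<in> H0L U g \<and> z = \<iota> (const0 U c) + \<iota> (in_degree 1 s)"
    and Q: "finite Q" "Q \<subseteq> (\<Union>i\<in>I. V i) - {0}"
  shows "\<exists>M. algebra_over.place (field_systems.\<kappa> (K_scale U \<iota>)) M \<and>
     (\<forall>i\<in>I. V i \<subseteq> algebra_over.vring (field_systems.\<kappa> (K_scale U \<iota>)) M) \<and> Q \<inter> M = {}"
proof -
  interpret fs: field_systems "K_scale U \<iota>" I V by (rule fs)
  have \<kappa>: "fs.\<kappa> c = \<iota> (const0 U c)" for c unfolding fs.\<kappa>_def K_scale_def by simp
  have "\<forall>z. \<exists>cs. z \<in> Q \<longrightarrow> snd cs \<in> H0L U g \<and> z = \<iota> (const0 U (fst cs)) + \<iota> (in_degree 1 (snd cs))"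
  proof
    fix z
    show "\<exists>cs. z \<in> Q \<longrightarrow> snd cs \<in> H0L U g \<and> z = \<iota> (const0 U (fst cs)) + \<iota> (in_degree 1 (snd cs))"
    proof (cases "z \<in> Q")
      case True
      then obtain i where "i \<in> I" "z \<in> V i" using Q(2) by blast
      from V[OF this] obtain c s where "s \<in> H0L U g" "z = \<iota> (const0 U c) + \<iota> (in_degree 1 s)" by (elim exE conjE)
      then show ?thesis by (intro exI[of _ "(c, s)"]) simp
    qed simp
  qed
  from choice[OF this] obtain cs where cs: "\<forall>z. z \<in> Q \<longrightarrow> snd (cs z) \<in> H0L U g \<and> z = \<iota> (const0 U (fst (cs z))) + \<iota> (in_degree 1 (snd (cs z)))" ..
  obtain p a where p: "p \<in> U a" using X_ne lbD(2)[OF lb] by blast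
  have "\<exists>y\<in>X. y \<in> U a \<and> (\<forall>s\<in>(\<lambda>z. snd (cs z)) ` Q - {0}. s a y \<noteq> 0)"
    by (rule common_nonzero[OF p]) (use Q(1) cs in auto)
  then obtain y where y: "y \<in> U a" "\<And>z. z \<in> Q \<Longrightarrow> snd (cs z) \<noteq> 0 \<Longrightarrow> snd (cs z) a y \<noteq> 0" by blast
  \<comment> \<open>The value of z at y as a polynomial in the grading variable; t has to avoid the
    roots of finitely many of these.\<close>
  define q where "q z = [:fst (cs z), snd (cs z) a y:]" for z
  have q0: "q z \<noteq> 0" if z: "z \<in> Q" for z
  proof
    assume "q z = 0"
    then have "fst (cs z) = 0" "snd (cs z) = 0" using y(2)[OF z] unfolding q_def by auto
    then have "z = 0" using cs z \<iota>_const0(3) \<iota>_zero by fastforce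
    then show False using z Q(2) by blast
  qed
  have "prod q Q \<noteq> 0" using q0 Q(1) by simp
  then have "finite {t. poly (prod q Q) t = 0}" by (rule poly_roots_finite)
  then obtain t where "poly (prod q Q) t \<noteq> 0" using infinite_alg_closed[where 'k = 'k] by (metis (mono_tags, lifting) ex_new_if_finite mem_Collect_eq)
  then have t: "poly (q z) t \<noteq> 0" if "z \<in> Q" for z using that Q(1) by (simp add: poly_prod)
  define M0 where "M0 = {\<iota> F | F r. F \<in> SA \<and> (\<forall>m. coeff r m = F m a y) \<and> poly r t = 0}"
  have M0I: "\<iota> F \<in> M0" if "F \<in> SA" "\<And>m. coeff r m = F m a y" "poly r t = 0" for F r
    using that unfolding M0_def by blast
  have c0: "coeff [:c:] m = const0 U c m a y" for c m
    using y(1) by (simp add: in_degree_def const_section_def coeff_pCons split: nat.split)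
  have "fs.ka.nonunital M0"
    unfolding fs.ka.nonunital_def
  proof (intro conjI ballI allI)
    show "0 \<in> M0" unfolding \<iota>_const0(3)[symmetric] by (rule M0I[OF SA_const, of "[:0:]"]) (simp_all only: c0, simp)
  next
    fix x z assume "x \<in> M0" "z \<in> M0"
    then obtain F r F' r' where F: "x = \<iota> F" "F \<in> SA" "\<forall>m. coeff r m = F m a y" "poly r t = 0"
      and F': "z = \<iota> F'" "F' \<in> SA" "\<forall>m. coeff r' m = F' m a y" "poly r' t = 0" unfolding M0_def by blast
    show "x + z \<in> M0" unfolding F(1) F'(1) \<iota>(1)[OF F(2) F'(2), symmetric]
      by (rule M0I[OF SA_add[OF F(2) F'(2)], of "r + r'"]) (use F F' in simp_all)
    show "x * z \<in> M0" unfolding F(1) F'(1) \<iota>(2)[OF F(2) F'(2), symmetric]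
      by (rule M0I[OF SA_mult[OF F(2) F'(2)], of "r * r'"]) (use F F' in \<open>simp_all add: coeff_mult section_mult_def\<close>)
  next
    fix c x assume "x \<in> M0"
    then obtain F r where F: "x = \<iota> F" "F \<in> SA" "\<forall>m. coeff r m = F m a y" "poly r t = 0" unfolding M0_def by blast
    show "fs.\<kappa> c * x \<in> M0" unfolding \<kappa> F(1) \<iota>(2)[OF SA_const F(2), symmetric]
      by (rule M0I[OF SA_mult[OF SA_const F(2)], of "smult c r"]) (use F y(1) in \<open>simp_all add: section_mult_const\<close>)
  next
    show "1 \<notin> M0"
    proof
      assume "1 \<in> M0"
      then obtain F r where F: "1 = \<iota> F" "F \<in> SA" "\<forall>m. coeff r m = F m a y" "poly r t = 0" unfolding M0_def by blast
      \<comment> \<open>An element of the field determines its F by injectivity of \<iota>, so for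
        the element 1 the polynomial is 1, which has no root.\<close>
      have "F = const0 U 1" by (rule inj_onD[OF \<iota>(4) _ F(2) SA_const]) (simp add: \<iota>(3) F(1)[symmetric])
      then have "r = [:1:]" by (intro poly_eqI) (simp only: F(3) c0)
      then show False using F(4) by simp
    qed
  qed
  then obtain M where M: "fs.ka.place M" "M0 \<subseteq> M" using fs.ka.exists_place by blast
  interpret pl: place_of fs.\<kappa> M by unfold_locales (rule M(1))
  \<comment> \<open>The difference belongs to the polynomial s(y) (X - t), which vanishes at t, so
    it lies in \<open>M0\<close>.\<close>
  have ev: "\<iota> (const0 U c) + \<iota> (in_degree 1 s) - fs.\<kappa> (c + s a y * t) \<in> M" if s: "s \<in> H0L U g" for c s
  proof -
    let ?e = "c + s a y * t"
    have neg: "\<iota> (const0 U (- ?e)) = - \<iota> (const0 U ?e)"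
      using \<iota>_const0(1)[of "- ?e" ?e] \<iota>_const0(3) by (simp add: eq_neg_iff_add_eq_0)
    note m = SA_const SA_deg1[OF s]
    have "\<iota> (const0 U c + in_degree 1 s + const0 U (- ?e)) = \<iota> (const0 U c) + \<iota> (in_degree 1 s) - fs.\<kappa> ?e"
      using \<iota>(1)[OF SA_add[OF m] SA_const] \<iota>(1)[OF m] neg by (simp add: \<kappa>)
    moreover have "\<iota> (const0 U c + in_degree 1 s + const0 U (- ?e)) \<in> M0"
      by (rule M0I[OF SA_add[OF SA_add[OF m] SA_const], of "[:c - ?e, s a y:]"])
        (use y(1) in \<open>simp_all add: in_degree_def const_section_def coeff_pCons split: nat.split\<close>)
    ultimately show ?thesis using M(2) by auto
  qed
  show ?thesis
  proof (intro exI conjI ballI)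
    show "fs.ka.place M" by (rule M(1))
    show "V i \<subseteq> fs.ka.vring M" if i: "i \<in> I" for i
    proof
      fix z assume "z \<in> V i"
      from V[OF i this] obtain c s where "s \<in> H0L U g" "z = \<iota> (const0 U c) + \<iota> (in_degree 1 s)" by (elim exE conjE)
      then show "z \<in> fs.ka.vring M" using pl.AI[OF ev[of s c]] by simp
    qed
    have "z \<notin> M" if z: "z \<in> Q" for z
    proof
      assume zM: "z \<in> M"
      let ?e = "fst (cs z) + snd (cs z) a y * t"
      have e0: "?e \<noteq> 0" using t[OF z] by (simp add: q_def mult.commute)
      have "z - fs.\<kappa> ?e \<in> M" using ev[of "snd (cs z)" "fst (cs z)"] cs z by simp
      from pl.Mdiff[OF zM this] have "fs.\<kappa> ?e \<in> M" by simp
      then show False using pl.Mk_iff e0 by simp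
    qed
    then show "Q \<inter> M = {}" by blast
  qed
qed

end

end

lemma subsheaf_global_sections:
  assumes "projective_curve n X" and lb: "line_bundle (proj_sub fscale X) U g"
    and M: "subsheaf_of_modules (proj_sub fscale X) M (line_sheaf (proj_sub fscale X) U g)"
  shows "M (topspace (zar (proj_sub fscale X))) \<subseteq> tensor_power (proj_sub fscale X) U g 1 X"
    "ssp.subspace (M (topspace (zar (proj_sub fscale X))))"
proof -
  interpret projective_curve n X by fact
  have o: "openin T X" using openin_topspace[of T] by (simp add: topspace_T)
  note m = M[unfolded subsheaf_of_modules_def, rule_format, OF o]
  note m4 = m[THEN conjunct2, THEN conjunct2, THEN conjunct2, THEN conjunct1, rule_format]
  have 2: "M X \<subseteq> H0L U g" by (rule m[THEN conjunct1])
  then show "M (topspace T) \<subseteq> H0L U g" by (simp only: topspace_T)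
  have "ssp.subspace (M X)"
  proof (rule ssp.subspaceI)
    show "0 \<in> M X" by (rule m[THEN conjunct2, THEN conjunct1])
    show "s + s' \<in> M X" if s: "s \<in> M X" "s' \<in> M X" for s s'
      by (rule m[THEN conjunct2, THEN conjunct2, THEN conjunct1, rule_format, OF s])
    fix c s assume s: "s \<in> M X"
    have "(\<lambda>y. if y \<in> X then c else 0) \<in> osec S X"
      unfolding osec_def using reg_proj_sub_const[OF o, of "\<lambda>y. if y \<in> X then c else 0" c] by simp
    then have "smul (\<lambda>y. if y \<in> X then c else 0) s \<in> M X" by (rule m4[OF _ s])
    \<comment> \<open>Scalars act through the constant function cut off outside X; sections are zero
      there, so the cut-off is harmless.\<close>
    moreover have "smul (\<lambda>y. if y \<in> X then c else 0) s = sscale c s"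
    proof -
      have sH: "s \<in> H0L U g" by (rule subsetD[OF 2 s])
      show ?thesis
      proof (intro ext)
        fix a x show "smul (\<lambda>y. if y \<in> X then c else 0) s a x = sscale c s a x"
          using H0LD(2)[OF lb sH, of x a] by (simp add: smul_def sscale_def)
      qed
    qed
    ultimately show "sscale c s \<in> M X" by (simp only:)
  qed
  then show "ssp.subspace (M (topspace T))" by (simp only: topspace_T)
qed

theorem mainTheorem4:
  fixes n :: nat
    and X :: "(nat \<Rightarrow> 'k::alg_closed_field) set set"
    and U :: "'a \<Rightarrow> (nat \<Rightarrow> 'k) set set"
    and g :: "'a \<Rightarrow> 'a \<Rightarrow> (nat \<Rightarrow> 'k) set \<Rightarrow> 'k"
    and I :: "'i set"
    and M :: "'i \<Rightarrow> (nat \<Rightarrow> 'k) set set \<Rightarrow> ('a \<Rightarrow> (nat \<Rightarrow> 'k) set \<Rightarrow> 'k) set"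
    and \<iota> :: "(nat \<Rightarrow> 'a \<Rightarrow> (nat \<Rightarrow> 'k) set \<Rightarrow> 'k) \<Rightarrow> 'K::field"
    and V :: "'i \<Rightarrow> 'K set"
  defines "S \<equiv> proj_variety X"
  defines "H0 \<equiv> \<lambda>i. global_sections S (M i)"
  defines "sc \<equiv> K_scale U \<iota>"
  assumes "smooth_projective_curve n X"
    and "line_bundle S U g"
    and "finite I"
    and "\<And>i. i \<in> I \<Longrightarrow> subsheaf_of_modules S (M i) (line_sheaf S U g)"
    and "\<And>i. i \<in> I \<Longrightarrow> coherent S (M i)"
    and "is_fraction_field S U g \<iota>"
    and "\<And>i. i \<in> I \<Longrightarrow>
           V i = {\<iota> (in_degree 0 (const_section U c)) + \<iota> (in_degree 1 s) | c s. s \<in> H0 i} \<or>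
           V i = {\<iota> (in_degree 1 s) | s. s \<in> H0 i}"
  shows "\<forall>r. krull_dim (subtopology (zar (proj_prod sc I V))
               (thom_boardman (proj_prod sc I V) (ind_proj sc UNIV) (product_map sc I) r))
             \<le> ereal (real r)"
proof (rule allI)
  fix r
  have S: "S = proj_sub fscale X" by (simp only: S_def fscale_alt)
  have pc: "projective_curve n X"
    using assms(4) unfolding smooth_projective_curve_def projective_curve_def fscale_alt by blast
  interpret projective_curve n X by (rule pc)
  note lb = assms(5)[unfolded S]
  note ff = assms(9)[unfolded S]
  have W: "H0 i \<subseteq> tensor_power (proj_sub fscale X) U g 1 X" "ssp.subspace (H0 i)" if "i \<in> I" for i
    unfolding H0_def S by (rule subsheaf_global_sections[OF pc lb assms(7)[OF that, unfolded S]])+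
  have fs: "field_systems sc I V"
  proof (rule field_systems.intro[OF _ field_systems_axioms.intro])
    show "vector_space sc" unfolding sc_def by (rule vector_space_K_scale[OF lb ff])
    show "sc c (a * b) = sc c a * b" for c a b by (simp add: sc_def K_scale_def mult.assoc)
    show "finite I" by (rule assms(6))
    show "\<exists>B. finite B \<and> V i = module.span sc B" if i: "i \<in> I" for i
    proof (rule disjE[OF assms(10)[OF i]])
      assume V: "V i = {\<iota> (in_degree 0 (const_section U c)) + \<iota> (in_degree 1 s) | c s. s \<in> H0 i}"
      show ?thesis unfolding V sc_def by (rule sections_span_const[OF lb ff W[OF i]])
    next
      assume V: "V i = {\<iota> (in_degree 1 s) | s. s \<in> H0 i}"
      show ?thesis unfolding V sc_def by (rule sections_span[OF lb ff W[OF i]])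
    qed
  qed
  have V: "\<exists>c s. s \<in> tensor_power (proj_sub fscale X) U g 1 X \<and> z = \<iota> (in_degree 0 (const_section U c)) + \<iota> (in_degree 1 s)"
    if i: "i \<in> I" and z: "z \<in> V i" for i z
  proof (rule disjE[OF assms(10)[OF i]])
    assume "V i = {\<iota> (in_degree 0 (const_section U c)) + \<iota> (in_degree 1 s) | c s. s \<in> H0 i}"
    then obtain c s where "s \<in> H0 i" "z = \<iota> (in_degree 0 (const_section U c)) + \<iota> (in_degree 1 s)" using z by blast
    then show ?thesis using W(1)[OF i] by blast
  next
    assume "V i = {\<iota> (in_degree 1 s) | s. s \<in> H0 i}"
    then obtain s where s: "s \<in> H0 i" "z = \<iota> (in_degree 1 s)" using z by blast
    \<comment> \<open>The second shape of V_i is treated as the first with constant 0, so one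
      evaluation lemma serves both.\<close>
    have "z = \<iota> (in_degree 0 (const_section U 0)) + \<iota> (in_degree 1 s)" using s(2) \<iota>_const0(3)[OF lb ff] by simp
    then show ?thesis using W(1)[OF i] s(1) by blast
  qed
  show "krull_dim (subtopology (zar (proj_prod sc I V))
               (thom_boardman (proj_prod sc I V) (ind_proj sc UNIV) (product_map sc I) r))
             \<le> ereal (real r)"
    by (rule field_systems.krull_dim_thom_boardman[OF fs])
      (unfold sc_def, rule ex_evaluation_place[OF lb ff fs[unfolded sc_def] V])
qed

end
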